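(* Let $n<p<\infty$, let $\alpha=(p-n)/(p-1)$, let $\Omega\subset\mathbf{R}^n$ be a domain satisfying condition $(A_\alpha)$, and let $\eta\ge 41$. A function $f:(\partial\Omega)_\alpha\to\mathbf{R}$ is the trace to $(\partial\Omega)_\alpha$ of a continuous function $F\in L^1_p(\Omega)$ if and only if $f$ is continuous with respect to $d_{\alpha,\overline{\Omega}}$ and there exists a constant $\lambda>0$ such that for every finite family $\{Q_i:i=1,\dots,m\}$ of pairwise disjoint cubes in $\Omega$ and every choice of $Q_i$-visible points $x_i,y_i\in(\eta Q_i)\cap(\partial\Omega)_\alpha$ the inequality $$\sum_{i=1}^m\frac{|f(x_i)-f(y_i)|^p}{(\operatorname{diam}Q_i)^{p-n}}\le\lambda$$ holds. Moreover, $\|f\|_{\operatorname{tr}(L^1_p(\Omega))}\sim\inf\lambda^{1/p}$ (infimum over all such $\lambda$), with constants of equivalence depending only on $n$, $p$ and $\eta$.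
   Context: Conventions. $\mathbf{R}^n$ carries the uniform norm $\|x\|=\max_i|x_i|$; distances, diameters and arc length are taken with respect to it. A cube is a closed cube $Q=Q(x,r)=\{y:\|y-x\|\le r\}$, $r>0$, and $\lambda Q(x,r)=Q(x,\lambda r)$. $\Omega\subset\mathbf{R}^n$ is a domain (nonempty open connected set) with $\Omega\ne\mathbf{R}^n$. $X\sim Y$ means $X/C\le Y\le CX$ for a constant $C\ge1$. Metrics. For $\alpha\in(0,1]$ and $x,y\in\Omega$, $d_{\alpha,\Omega}(x,y)=\inf_\gamma\int_\gamma\operatorname{dist}(z,\partial\Omega)^{\alpha-1}ds(z)$, the infimum being over rectifiable curves $\gamma\subset\Omega$ joining $x$ to $y$; $\rho_{\alpha,\Omega}(x,y)=d_{\alpha,\Omega}(x,y)+\|x-y\|^\alpha$. Completion. $\Omega^{*,\alpha}$ is the Cauchy completion of $(\Omega,\rho_{\alpha,\Omega})$, i.e. the set of equivalence classes $\omega=[(x_i)]_\alpha$ of $\rho_{\alpha,\Omega}$-Cauchy sequences in $\Omega$, where $(x_i)\stackrel{\alpha}{\sim}(y_i)$ iff $\rho_{\alpha,\Omega}(x_i,y_i)\to0$; $\Omega$ is viewed as a subset via constant sequences. For $\omega\in\Omega^{*,\alpha}$, all sequences in $\omega$ converge in $\|\cdot\|$ to a common point $\ell(\omega)\in\overline{\Omega}$. $\rho_{\alpha,\overline\Omega}$ is the completion metric, and $d_{\alpha,\overline\Omega}(\omega_1,\omega_2)=\lim_i d_{\alpha,\Omega}(x_i,y_i)$ for $(x_i)\in\omega_1$,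 $(y_i)\in\omega_2$. The $\alpha$-boundary is $(\partial\Omega)_\alpha=\Omega^{*,\alpha}\setminus\Omega$; one has $\ell(\omega)\in\partial\Omega$ for $\omega\in(\partial\Omega)_\alpha$. Condition $(A_\alpha)$. $I_\alpha(\Omega)$ is the set of $x\in\partial\Omega$ for which there is no $\omega\in\Omega^{*,\alpha}$ with $\ell(\omega)=x$ (inaccessible points). $\Omega$ satisfies $(A_\alpha)$ if for every $x\in\partial\Omega\setminus I_\alpha(\Omega)$ there is a unique $\omega\in\Omega^{*,\alpha}$ with $\ell(\omega)=x$. In this case $(\partial\Omega)_\alpha$ is identified with $\partial\Omega\setminus I_\alpha(\Omega)$ via $\ell$, and $d_{\alpha,\overline\Omega}$ is regarded as a function on pairs of points of $\overline\Omega\setminus I_\alpha(\Omega)$. Visibility. For a cube $Q\subset\Omega$, a point $x\in\overline\Omega$ is $Q$-visible (in $\Omega$) if for each $y\in Q$ the semi-open segment $(x,y]$ lies in $\Omega$. Sobolev spaces and traces. $L^1_p(\Omega)$ is the homogeneous Sobolev space with seminorm $\|F\|_{L^1_p(\Omega)}=\|\nabla F\|_{L_p(\Omega)}$. For $p>n$ each element is identified with its continuous representative; with $\alpha=(p-n)/(p-1)$ this representative is uniformly continuous with respect to $\rho_{\alpha,\Omega}$, so it extends uniquely to a continuous function on $\Omega^{*,\alpha}$, and its trace $\operatorname{tr}_{(\partial\Omega)_\alpha}F$ is the restriction of this extension to $(\partial\Omega)_\alpha$; i.e. $\operatorname{tr}_{(\partial\Omega)_\alpha}F(\omega)=\lim_iF(y_i)$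 for any $(y_i)\in\omega$. $\|f\|_{\operatorname{tr}(L^1_p(\Omega))}=\inf\{\|F\|_{L^1_p(\Omega)}:F\in L^1_p(\Omega)\text{ continuous},\ \operatorname{tr}_{(\partial\Omega)_\alpha}F=f\}$. *)

theory Defs
  imports "HOL-Analysis.Analysis"
begin

text \<open>
  \<open>real ^ 'n\<close> carries the uniform norm, which is \<open>infnorm\<close> in the library; the library's
  \<open>norm\<close>, \<open>dist\<close>, \<open>infdist\<close>, \<open>cball\<close> and \<open>diameter\<close> are Euclidean and are therefore not used.
  Purely topological notions (open sets, frontier, closure, limits, continuity) and Lebesgue
  measure do not depend on this choice.
\<close>

section \<open>Uniform geometry\<close>

definition udist :: "real ^ 'n \<Rightarrow> (real ^ 'n) set \<Rightarrow> real" where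
  "udist z S = (INF w\<in>S. infnorm (z - w))"

definition udiam :: "(real ^ 'n) set \<Rightarrow> real" where
  "udiam S = Sup {infnorm (x - y) | x y. x \<in> S \<and> y \<in> S}"

definition cube :: "real ^ 'n \<Rightarrow> real \<Rightarrow> (real ^ 'n) set" where
  "cube c r = {y. infnorm (y - c) \<le> r}"

definition variation_sums :: "(real \<Rightarrow> real ^ 'n) \<Rightarrow> real \<Rightarrow> real set" where
  "variation_sums g s =
     {\<Sum>i<k. infnorm (g (t (Suc i)) - g (t i)) | (k :: nat) t.
        t 0 = 0 \<and> t k = s \<and> (\<forall>i<k. t i \<le> t (Suc i))}"

definition rectifiable :: "(real \<Rightarrow> real ^ 'n) \<Rightarrow> bool" where
  "rectifiable g \<longleftrightarrow> path g \<and> bdd_above (variation_sums g 1)"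

text \<open>The length of \<open>g\<close> restricted to \<open>[0, s]\<close>, for \<open>0 \<le> s \<le> 1\<close>.\<close>

definition curve_length :: "(real \<Rightarrow> real ^ 'n) \<Rightarrow> real \<Rightarrow> real" where
  "curve_length g s = Sup (variation_sums g s)"

text \<open>
  The integral of \<open>w\<close> along \<open>g\<close> with respect to arc length: the Lebesgue-Stieltjes integral of
  \<open>w \<circ> g\<close> against the length function, which is extended to the real line by constants (for a
  rectifiable path it is continuous and nondecreasing, as \<open>interval_measure\<close> requires).
\<close>

definition curve_integral :: "(real \<Rightarrow> real ^ 'n) \<Rightarrow> (real ^ 'n \<Rightarrow> real) \<Rightarrow> ennreal" where
  "curve_integral g w =
     (\<integral>\<^sup>+ t\<in>{0..1}. ennreal (w (g t)) \<partial>interval_measure (\<lambda>s. curve_length g (max 0 (min 1 s))))"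

section \<open>The metrics, the completion and the boundary\<close>

text \<open>For \<open>x, y\<close> in a domain the infimum is finite, so \<open>enn2real\<close> loses nothing.\<close>

definition d_metric :: "real \<Rightarrow> (real ^ 'n) set \<Rightarrow> real ^ 'n \<Rightarrow> real ^ 'n \<Rightarrow> real" where
  "d_metric \<alpha> \<Omega> x y = enn2real
     (INF g \<in> {g. rectifiable g \<and> path_image g \<subseteq> \<Omega> \<and> pathstart g = x \<and> pathfinish g = y}.
        curve_integral g (\<lambda>z. udist z (frontier \<Omega>) powr (\<alpha> - 1)))"

definition rho_metric :: "real \<Rightarrow> (real ^ 'n) set \<Rightarrow> real ^ 'n \<Rightarrow> real ^ 'n \<Rightarrow> real" where
  "rho_metric \<alpha> \<Omega> x y = d_metric \<alpha> \<Omega> x y + infnorm (x - y) powr \<alpha>"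

definition rho_Cauchy :: "real \<Rightarrow> (real ^ 'n) set \<Rightarrow> (nat \<Rightarrow> real ^ 'n) set" where
  "rho_Cauchy \<alpha> \<Omega> = {x. range x \<subseteq> \<Omega> \<and>
     (\<forall>e>0. \<exists>N. \<forall>i\<ge>N. \<forall>j\<ge>N. rho_metric \<alpha> \<Omega> (x i) (x j) < e)}"

definition rho_equiv :: "real \<Rightarrow> (real ^ 'n) set \<Rightarrow> ((nat \<Rightarrow> real ^ 'n) \<times> (nat \<Rightarrow> real ^ 'n)) set" where
  "rho_equiv \<alpha> \<Omega> = {(x, y). x \<in> rho_Cauchy \<alpha> \<Omega> \<and> y \<in> rho_Cauchy \<alpha> \<Omega> \<and>
     (\<lambda>i. rho_metric \<alpha> \<Omega> (x i) (y i)) \<longlonglongrightarrow> 0}"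

definition completion :: "real \<Rightarrow> (real ^ 'n) set \<Rightarrow> (nat \<Rightarrow> real ^ 'n) set set" where
  "completion \<alpha> \<Omega> = rho_Cauchy \<alpha> \<Omega> // rho_equiv \<alpha> \<Omega>"

text \<open>A point \<open>x\<close> of \<open>\<Omega>\<close> is identified with the class of the constant sequence \<open>x\<close>.\<close>

definition alpha_boundary :: "real \<Rightarrow> (real ^ 'n) set \<Rightarrow> (nat \<Rightarrow> real ^ 'n) set set" where
  "alpha_boundary \<alpha> \<Omega> = completion \<alpha> \<Omega> - (\<lambda>x. rho_equiv \<alpha> \<Omega> `` {\<lambda>_. x}) ` \<Omega>"

definition ell :: "(nat \<Rightarrow> real ^ 'n) set \<Rightarrow> real ^ 'n" where
  "ell \<omega> = (THE z. \<forall>x\<in>\<omega>. x \<longlonglongrightarrow> z)"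

definition d_completion ::
  "real \<Rightarrow> (real ^ 'n) set \<Rightarrow> (nat \<Rightarrow> real ^ 'n) set \<Rightarrow> (nat \<Rightarrow> real ^ 'n) set \<Rightarrow> real" where
  "d_completion \<alpha> \<Omega> \<omega>\<^sub>1 \<omega>\<^sub>2 =
     (THE L. \<forall>x\<in>\<omega>\<^sub>1. \<forall>y\<in>\<omega>\<^sub>2. (\<lambda>i. d_metric \<alpha> \<Omega> (x i) (y i)) \<longlonglongrightarrow> L)"

definition inaccessible :: "real \<Rightarrow> (real ^ 'n) set \<Rightarrow> (real ^ 'n) set" where
  "inaccessible \<alpha> \<Omega> = {x \<in> frontier \<Omega>. \<not> (\<exists>\<omega>\<in>completion \<alpha> \<Omega>. ell \<omega> = x)}"

definition condition_A :: "real \<Rightarrow> (real ^ 'n) set \<Rightarrow> bool" where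
  "condition_A \<alpha> \<Omega> \<longleftrightarrow>
     (\<forall>x \<in> frontier \<Omega> - inaccessible \<alpha> \<Omega>. \<exists>!\<omega>. \<omega> \<in> completion \<alpha> \<Omega> \<and> ell \<omega> = x)"

section \<open>Sobolev functions and traces\<close>

definition partial_deriv :: "'n \<Rightarrow> (real ^ 'n \<Rightarrow> real) \<Rightarrow> real ^ 'n \<Rightarrow> real" where
  "partial_deriv i f x = frechet_derivative f (at x) (axis i 1)"

primrec C_class :: "nat \<Rightarrow> (real ^ 'n \<Rightarrow> real) \<Rightarrow> bool" where
  "C_class 0 f \<longleftrightarrow> continuous_on UNIV f"
| "C_class (Suc k) f \<longleftrightarrow>
     (\<forall>x. f differentiable (at x)) \<and> (\<forall>i. C_class k (partial_deriv i f))"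

definition test_function :: "(real ^ 'n) set \<Rightarrow> (real ^ 'n \<Rightarrow> real) \<Rightarrow> bool" where
  "test_function \<Omega> \<phi> \<longleftrightarrow> (\<forall>k. C_class k \<phi>) \<and>
     (\<exists>K. compact K \<and> K \<subseteq> \<Omega> \<and> (\<forall>x. x \<notin> K \<longrightarrow> \<phi> x = 0))"

definition weak_gradient ::
  "(real ^ 'n) set \<Rightarrow> (real ^ 'n \<Rightarrow> real) \<Rightarrow> (real ^ 'n \<Rightarrow> real ^ 'n) \<Rightarrow> bool" where
  "weak_gradient \<Omega> F G \<longleftrightarrow>
     (\<forall>K. compact K \<and> K \<subseteq> \<Omega> \<longrightarrow> set_integrable lebesgue K F \<and> set_integrable lebesgue K G) \<and>
     (\<forall>\<phi> i. test_function \<Omega> \<phi> \<longrightarrow>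
        (LINT x:\<Omega>|lebesgue. F x * partial_deriv i \<phi> x) = - (LINT x:\<Omega>|lebesgue. G x $ i * \<phi> x))"

definition L1p :: "real \<Rightarrow> (real ^ 'n) set \<Rightarrow> (real ^ 'n \<Rightarrow> real) set" where
  "L1p p \<Omega> = {F. \<exists>G. weak_gradient \<Omega> F G \<and>
     set_integrable lebesgue \<Omega> (\<lambda>x. infnorm (G x) powr p)}"

text \<open>The weak gradient is unique up to null sets, so the choice of \<open>G\<close> is immaterial.\<close>

definition L1p_norm :: "real \<Rightarrow> (real ^ 'n) set \<Rightarrow> (real ^ 'n \<Rightarrow> real) \<Rightarrow> real" where
  "L1p_norm p \<Omega> F =
     (LINT x:\<Omega>|lebesgue. infnorm ((SOME G. weak_gradient \<Omega> F G) x) powr p) powr (1 / p)"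

text \<open>
  Functions on the \<open>\<alpha>\<close>-boundary are functions of equivalence classes; their values outside
  \<open>alpha_boundary \<alpha> \<Omega>\<close> are never used.
\<close>

definition has_trace ::
  "real \<Rightarrow> (real ^ 'n) set \<Rightarrow> (real ^ 'n \<Rightarrow> real) \<Rightarrow> ((nat \<Rightarrow> real ^ 'n) set \<Rightarrow> real) \<Rightarrow> bool" where
  "has_trace \<alpha> \<Omega> F f \<longleftrightarrow>
     (\<forall>\<omega> \<in> alpha_boundary \<alpha> \<Omega>. \<forall>y\<in>\<omega>. (\<lambda>i. F (y i)) \<longlonglongrightarrow> f \<omega>)"

definition trace_extensions ::
  "real \<Rightarrow> real \<Rightarrow> (real ^ 'n) set \<Rightarrow> ((nat \<Rightarrow> real ^ 'n) set \<Rightarrow> real) \<Rightarrow> (real ^ 'n \<Rightarrow> real) set" where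
  "trace_extensions p \<alpha> \<Omega> f = {F \<in> L1p p \<Omega>. continuous_on \<Omega> F \<and> has_trace \<alpha> \<Omega> F f}"

definition trace_norm ::
  "real \<Rightarrow> real \<Rightarrow> (real ^ 'n) set \<Rightarrow> ((nat \<Rightarrow> real ^ 'n) set \<Rightarrow> real) \<Rightarrow> real" where
  "trace_norm p \<alpha> \<Omega> f = (INF F \<in> trace_extensions p \<alpha> \<Omega> f. L1p_norm p \<Omega> F)"

section \<open>The criterion\<close>

definition d_continuous ::
  "real \<Rightarrow> (real ^ 'n) set \<Rightarrow> ((nat \<Rightarrow> real ^ 'n) set \<Rightarrow> real) \<Rightarrow> bool" where
  "d_continuous \<alpha> \<Omega> f \<longleftrightarrow>
     (\<forall>\<omega> \<in> alpha_boundary \<alpha> \<Omega>. \<forall>e>0. \<exists>\<delta>>0. \<forall>\<omega>' \<in> alpha_boundary \<alpha> \<Omega>.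
        d_completion \<alpha> \<Omega> \<omega> \<omega>' < \<delta> \<longrightarrow> \<bar>f \<omega>' - f \<omega>\<bar> < e)"

definition visible :: "(real ^ 'n) set \<Rightarrow> (real ^ 'n) set \<Rightarrow> real ^ 'n \<Rightarrow> bool" where
  "visible \<Omega> Q x \<longleftrightarrow>
     x \<in> closure \<Omega> \<and> (\<forall>y\<in>Q. insert y (open_segment x y) \<subseteq> \<Omega>)"

text \<open>
  Under \<open>condition_A\<close> the \<open>\<alpha>\<close>-boundary is identified via \<open>ell\<close> with the accessible part of
  the frontier; a boundary element is visible, or lies in a cube, when its image under \<open>ell\<close> does.
  The cubes are \<open>cube (c i) (r i)\<close> for \<open>i = 1, \<dots>, m\<close>.
\<close>

definition visible_bound ::
  "real \<Rightarrow> real \<Rightarrow> real \<Rightarrow> (real ^ 'n) set \<Rightarrow> ((nat \<Rightarrow> real ^ 'n) set \<Rightarrow> real) \<Rightarrow> real \<Rightarrow> bool" where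
  "visible_bound p \<alpha> \<eta> \<Omega> f L \<longleftrightarrow>
     (\<forall>(m :: nat) c r x y.
        (\<forall>i\<in>{1..m}. r i > 0 \<and> cube (c i) (r i) \<subseteq> \<Omega>) \<and>
        disjoint_family_on (\<lambda>i. cube (c i) (r i)) {1..m} \<and>
        (\<forall>i\<in>{1..m}. \<forall>\<omega> \<in> {x i, y i}.
           \<omega> \<in> alpha_boundary \<alpha> \<Omega> \<and>
           ell \<omega> \<in> cube (c i) (\<eta> * r i) \<and>
           visible \<Omega> (cube (c i) (r i)) (ell \<omega>))
        \<longrightarrow> (\<Sum>i=1..m. \<bar>f (x i) - f (y i)\<bar> powr p /
                 udiam (cube (c i) (r i)) powr (p - real CARD('n))) \<le> L)"

end

theory Submission
  imports Defs
begin

text \<open>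
  \<^bold>\<open>Why traces satisfy the inequality.\<close>  Let \<open>F\<close> be continuous with weak gradient \<open>G\<close> in \<open>L\<^sub>p\<close>, and let
  \<open>x\<close> be visible from the cube \<open>Q\<close> with centre \<open>c\<close> and radius \<open>r\<close>. Then the cubes with centre
  \<open>x + (c - x) / s\<close> and radius \<open>r / s\<close>, \<open>s \<ge> 1\<close>, lie in \<open>\<Omega>\<close>. Let \<open>F\<close> be averaged with
  a smooth bump over the concentric cubes of half the radius, called slices below. Then the derivative of the mean with respect to \<open>s\<close> is the integral of \<open>F\<close> against a
  divergence (\<open>bump_scaling_derivative\<close>), hence by the definition of the weak gradient an integral of
  \<open>G\<close> against an explicit vector field; \<open>F\<close> itself is never smoothed. Integration over \<open>s\<close> gives an
  estimate of Morrey's type for the difference between the value at the vertex \<open>x\<close> and the mean over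
  \<open>Q\<close>, namely a multiple of \<open>r powr (1 - n / p) * E powr (1 / p)\<close> (\<open>wmean_variation\<close>). Here \<open>E\<close> need not
  bound the energy \<open>\<integral> |G|\<^sup>p\<close> on all slices: the slice at scale \<open>1 / s\<close> may have energy \<open>s powr \<kappa> * E\<close>,
  as long as \<open>\<kappa> < p - n\<close>. For a visible boundary point the slice at scale \<open>1 / s\<close> has distance at
  least \<open>r / (2 * s)\<close> to the boundary, so \<open>E\<close> may be the integral of \<open>|G|\<^sup>p (2 R / r)\<^sup>\<kappa>\<close>, \<open>R\<close> being the
  distance to the boundary, over a set that depends on \<open>Q\<close> alone (\<open>visible_estimate\<close>). These sets
  overlap without bound for disjoint cubes, but the weights compensate: among the disjoint cubes whose
  sets contain a given \<open>z\<close>, boundedly many have radius of a given dyadic order, and all radii are at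
  least \<open>R z / (\<eta> + 1)\<close>; thus the weights at \<open>z\<close> are dominated by a geometric series
  (\<open>sum_powr_disjoint_cubes_le\<close>). Summation over the cubes gives \<open>visible_sum_bound\<close>.

  \<^bold>\<open>Why traces are continuous.\<close>  Along a curve, take a shortest chain of cubes with centre \<open>z\<close> on the
  curve and radius \<open>R z / 4\<close> that leads from one end to the other. The cubes at even positions are
  disjoint, and so are those at odd positions. On each of them Morrey's estimate and Young's
  inequality with the exponents \<open>p\<close> and \<open>p / (p - 1)\<close> bound the oscillation of \<open>F\<close> by a multiple of
  \<open>l powr (p / (p - 1)) * R z powr \<alpha> + l powr (- p) * \<integral> |G|\<^sup>p\<close>, because
  \<open>(1 - n / p) * (p / (p - 1)) = \<alpha>\<close>. The sum of the \<open>R z powr \<alpha>\<close> is controlled by the weighted length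
  of the curve, since leaving such a cube is expensive. The result is \<open>curve_estimate\<close>.

  \<^bold>\<open>Why the conditions suffice.\<close>  Choose a maximal set of centres \<open>c\<close> in \<open>\<Omega>\<close> for which the cubes of
  radius \<open>R c / 20\<close> are disjoint, and give \<open>c\<close> the value of \<open>f\<close> at a point of the boundary nearest to
  \<open>c\<close>. This point is visible from every cube inside the open cube with centre \<open>c\<close> and radius \<open>R c\<close>
  (\<open>nearest_visible\<close>), in particular from the small cubes of neighbouring centres. The extension is the
  quotient of two sums of bumps around the centres. Near \<open>j\<close> its gradient is bounded by the largest
  difference between the value of \<open>j\<close> and those of its neighbours, divided by \<open>R j\<close>, and the assumed
  inequality for the cubes around the centres bounds the energy (\<open>ext_gradient_bound\<close>,
  \<open>ext_energy\<close>). Since in the metric a point is close to the nearest boundary points of the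
  centres around it, continuity of \<open>f\<close> makes \<open>f\<close> the trace of the extension (\<open>extension\<close>).

  All estimates are quantitative, with constants that depend on \<open>n\<close>, \<open>p\<close> and \<open>\<eta>\<close> only. As the weak
  gradient is unique up to null sets (\<open>weak_gradient_unique\<close>), they are estimates for the seminorm, and
  the equivalence of the norms follows.
\<close>

section \<open>Cubes and the distance to the boundary\<close>

lemma infnorm_le_iff: "infnorm (x :: real ^ 'n) \<le> r \<longleftrightarrow> (\<forall>i. \<bar>x $ i\<bar> \<le> r)"
proof
  assume "\<forall>i. \<bar>x $ i\<bar> \<le> r"
  then show "infnorm x \<le> r"
    unfolding infnorm_cart by (intro cSup_least) auto
qed (meson component_le_infnorm_cart order_trans)

lemma infnorm_less_iff: "infnorm (x :: real ^ 'n) < r \<longleftrightarrow> (\<forall>i. \<bar>x $ i\<bar> < r)"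
proof
  assume *: "\<forall>i. \<bar>x $ i\<bar> < r"
  have "infnorm x = Max ((\<lambda>i. \<bar>x $ i\<bar>) ` UNIV)"
    unfolding infnorm_cart by (subst cSup_eq_Max) (auto simp: full_SetCompr_eq)
  also have "\<dots> < r" using * by (subst Max_less_iff) auto
  finally show "infnorm x < r" .
qed (meson component_le_infnorm_cart order.strict_trans1)

lemma infnorm_triangle_diff: "infnorm (x - z) \<le> infnorm (x - y) + infnorm (y - z)"
  using infnorm_triangle[of "x - y" "y - z"] by simp

lemma infnorm_axis_1 [simp]: "infnorm (axis i (1::real) :: real ^ 'n) = 1"
proof (rule antisym)
  show "infnorm (axis i (1::real) :: real ^ 'n) \<le> 1"
    by (auto simp: infnorm_le_iff axis_def)
  show "1 \<le> infnorm (axis i (1::real) :: real ^ 'n)"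
    using component_le_infnorm_cart[of "axis i (1::real) :: real ^ 'n" i] by (simp add: axis_def)
qed

lemma mem_cube: "y \<in> cube c r \<longleftrightarrow> infnorm (y - c) \<le> r"
  by (simp add: cube_def)

lemma cube_eq_cbox: "cube c r = cbox (c - vec r) (c + vec r)"
proof -
  have "(\<bar>a - b\<bar> \<le> r) = (b - r \<le> a \<and> a \<le> b + r)" for a b :: real by arith
  then show ?thesis by (auto simp: mem_cube infnorm_le_iff mem_box_cart)
qed

lemma compact_cube: "compact (cube c r)"
  and closed_cube: "closed (cube c r)"
  and convex_cube: "convex (cube c r)"
  and sets_cube [measurable]: "cube c r \<in> sets borel"
  by (auto simp: cube_eq_cbox closed_cbox convex_box)

lemma measure_cube:
  fixes c :: "real ^ 'n"
  assumes "r \<ge> 0"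
  shows "measure lborel (cube c r) = (2 * r) ^ CARD('n)"
proof -
  have "c \<in> cube c r" using assms by (simp add: mem_cube infnorm_0)
  then show ?thesis
    unfolding cube_eq_cbox by (subst content_cbox_cart) auto
qed

lemma emeasure_cube_finite [simp]: "emeasure lborel (cube c r) < top" "emeasure lborel (cube c r) \<noteq> top"
  using emeasure_lborel_cbox_finite[of "c - vec r" "c + vec r"]
  unfolding cube_eq_cbox infinity_ennreal_def by auto

lemma center_in_cube: "r \<ge> 0 \<Longrightarrow> c \<in> cube c r"
  by (simp add: mem_cube infnorm_0)

lemma udiam_cube:
  fixes c :: "real ^ 'n"
  assumes "r > 0"
  shows "udiam (cube c r) = 2 * r"
  unfolding udiam_def
proof (rule cSup_eq_maximum)
  fix i :: 'n
  let ?x = "c + r *\<^sub>R axis i 1" and ?y = "c - r *\<^sub>R axis i 1"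
  have "?x - ?y = (2 * r) *\<^sub>R axis i 1" by (simp add: scaleR_2 [symmetric])
  then have "infnorm (?x - ?y) = 2 * r"
    using assms by (simp add: infnorm_mul)
  moreover have "?x \<in> cube c r" "?y \<in> cube c r"
    using assms by (auto simp: mem_cube infnorm_mul infnorm_neg)
  ultimately show "2 * r \<in> {infnorm (x - y) |x y. x \<in> cube c r \<and> y \<in> cube c r}"
    by (metis (mono_tags, lifting) mem_Collect_eq)
next
  fix d assume "d \<in> {infnorm (x - y) |x y. x \<in> cube c r \<and> y \<in> cube c r}"
  then obtain x y where "d = infnorm (x - y)" "infnorm (x - c) \<le> r" "infnorm (y - c) \<le> r"
    by (auto simp: mem_cube)
  then show "d \<le> 2 * r" using infnorm_triangle_diff[of x y c] infnorm_sub[of c y] by simp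
qed

text \<open>Disjoint cubes that are not too small cannot crowd into a bounded region: compare volumes.\<close>

lemma card_disjoint_cubes_le:
  fixes c :: "'i \<Rightarrow> real ^ 'n"
  assumes fin: "finite I" and disj: "disjoint_family_on (\<lambda>i. cube (c i) (r i)) I"
    and a: "a > 0" "\<And>i. i \<in> I \<Longrightarrow> a \<le> r i"
    and b: "b \<ge> 0" "\<And>i. i \<in> I \<Longrightarrow> cube (c i) (r i) \<subseteq> cube z b"
  shows "real (card I) \<le> (b / a) ^ CARD('n)"
proof -
  have "real (card I) * (2 * a) ^ CARD('n) = (\<Sum>i\<in>I. (2 * a) ^ CARD('n))" by simp
  also have "\<dots> \<le> (\<Sum>i\<in>I. measure lborel (cube (c i) (r i)))"
  proof (rule sum_mono)
    fix i assume "i \<in> I"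
    then have "0 < a" "a \<le> r i" using a by auto
    then show "(2 * a) ^ CARD('n) \<le> measure lborel (cube (c i) (r i))"
      by (simp add: measure_cube power_mono)
  qed
  also have "\<dots> = measure lborel (\<Union>i\<in>I. cube (c i) (r i))"
    by (rule measure_finite_Union[symmetric])
       (use fin disj in \<open>simp_all add: image_subset_iff disjoint_family_on_def\<close>)
  also have "\<dots> \<le> measure lborel (cube z b)"
    by (rule measure_mono_fmeasurable)
       (use b fin in \<open>simp_all add: cube_eq_cbox UN_subset_iff sets.finite_UN\<close>)
  also have "\<dots> = (2 * b) ^ CARD('n)" by (rule measure_cube[OF b(1)])
  finally have "real (card I) \<le> (2 * b) ^ CARD('n) / (2 * a) ^ CARD('n)"
    using a by (simp add: pos_le_divide_eq)
  also have "\<dots> = (b / a) ^ CARD('n)" using a by (simp add: power_divide[symmetric])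
  finally show ?thesis .
qed

lemma udist_le: "w \<in> S \<Longrightarrow> udist z S \<le> infnorm (z - w)"
  unfolding udist_def by (rule cINF_lower) (auto intro!: bdd_belowI[of _ 0] infnorm_pos_le)

lemma udist_greatest: "S \<noteq> {} \<Longrightarrow> (\<And>w. w \<in> S \<Longrightarrow> d \<le> infnorm (z - w)) \<Longrightarrow> d \<le> udist z S"
  unfolding udist_def by (rule cINF_greatest)

lemma udist_Lipschitz:
  assumes "S \<noteq> {}"
  shows "\<bar>udist y S - udist z S\<bar> \<le> infnorm (y - z)"
proof -
  have "udist y S \<le> udist z S + infnorm (y - z)" for y z
  proof -
    have "udist y S - infnorm (y - z) \<le> udist z S"
    proof (rule udist_greatest[OF assms])
      fix w assume "w \<in> S"
      then show "udist y S - infnorm (y - z) \<le> infnorm (z - w)"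
        using udist_le[of w S y] infnorm_triangle_diff[of y w z] by simp
    qed
    then show ?thesis by simp
  qed
  from this[of y z] this[of z y] show ?thesis by (simp add: infnorm_sub[of z y] abs_le_iff)
qed

lemma continuous_on_udist: "S \<noteq> {} \<Longrightarrow> continuous_on A (\<lambda>z. udist z S)"
proof (rule continuous_onI)
  fix x e assume *: "S \<noteq> {}" "(e::real) > 0"
  have "dist (udist y S) (udist x S) \<le> dist y x" for y
    using udist_Lipschitz[OF *(1), of y x] infnorm_le_norm[of "y - x"]
    by (simp add: dist_norm)
  then show "\<exists>d>0. \<forall>x'\<in>A. dist x' x < d \<longrightarrow> dist (udist x' S) (udist x S) \<le> e"
    using *(2) by (meson less_imp_le order_trans)
qed

lemma udist_attained:
  fixes S :: "(real ^ 'n) set"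
  assumes "closed S" "S \<noteq> {}"
  obtains w where "w \<in> S" "udist z S = infnorm (z - w)"
proof -
  from assms(2) obtain s where s: "s \<in> S" by blast
  define K where "K = S \<inter> cube z (infnorm (z - s))"
  have "compact K" unfolding K_def using assms(1) compact_cube by (rule closed_Int_compact)
  moreover have "s \<in> K" using s by (simp add: K_def mem_cube infnorm_sub)
  moreover have "continuous_on K (\<lambda>w. infnorm (z - w))" by (intro continuous_intros)
  ultimately obtain w where w: "w \<in> K" "\<forall>y\<in>K. infnorm (z - w) \<le> infnorm (z - y)"
    using continuous_attains_inf[of K "\<lambda>w. infnorm (z - w)"] by blast
  have "infnorm (z - w) \<le> udist z S"
  proof (rule udist_greatest[OF assms(2)])
    fix y assume y: "y \<in> S"
    show "infnorm (z - w) \<le> infnorm (z - y)"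
    proof (cases "y \<in> K")
      case False
      then have "infnorm (z - s) < infnorm (z - y)" using y by (auto simp: K_def mem_cube infnorm_sub[of y z])
      then show ?thesis using w(2) \<open>s \<in> K\<close> by fastforce
    qed (use w in blast)
  qed
  then show ?thesis using that[of w] w(1) udist_le[of w S z] by (auto simp: K_def)
qed

locale proper_domain =
  fixes \<Omega> :: "(real ^ 'n) set"
  assumes op: "open \<Omega>" and conn: "connected \<Omega>" and nonempty: "\<Omega> \<noteq> {}" and proper: "\<Omega> \<noteq> UNIV"
begin

abbreviation R :: "real ^ 'n \<Rightarrow> real" where "R z \<equiv> udist z (frontier \<Omega>)"

lemma frontier_nonempty: "frontier \<Omega> \<noteq> {}"
  using frontier_eq_empty nonempty proper by blast

lemma frontier_disjoint: "frontier \<Omega> \<inter> \<Omega> = {}"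
  using op frontier_disjoint_eq by blast

lemma R_Lipschitz: "\<bar>R y - R z\<bar> \<le> infnorm (y - z)"
  by (rule udist_Lipschitz[OF frontier_nonempty])

lemma R_nonneg: "R z \<ge> 0"
  by (rule udist_greatest[OF frontier_nonempty]) (rule infnorm_pos_le)

lemma R_attained: obtains a where "a \<in> frontier \<Omega>" "R z = infnorm (z - a)"
  using udist_attained[OF frontier_closed frontier_nonempty] by metis

lemma R_pos: "z \<in> \<Omega> \<Longrightarrow> R z > 0"
  by (metis R_attained disjoint_iff frontier_disjoint infnorm_pos_lt right_minus_eq)

lemma continuous_on_R: "continuous_on A R"
  by (rule continuous_on_udist[OF frontier_nonempty])

lemma open_cube_subset:
  assumes "z \<in> \<Omega>" "infnorm (y - z) < R z"
  shows "y \<in> \<Omega>"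
proof (rule ccontr)
  assume "y \<notin> \<Omega>"
  then obtain w where w: "w \<in> closed_segment z y" "w \<in> frontier \<Omega>"
    using connected_Int_frontier[OF connected_segment(1)[of z y], of \<Omega>] assms(1)
    by fastforce
  from w(1) obtain u where u: "0 \<le> u" "u \<le> 1" "w = (1 - u) *\<^sub>R z + u *\<^sub>R y"
    by (auto simp: in_segment)
  have "z - w = u *\<^sub>R (z - y)" by (simp add: u(3) algebra_simps)
  then have "infnorm (z - w) \<le> infnorm (y - z)"
    using u by (simp add: infnorm_mul infnorm_sub[of z y] mult_left_le_one_le infnorm_pos_le)
  with udist_le[OF w(2), of z] assms(2) show False by simp
qed

lemma cube_subset: "z \<in> \<Omega> \<Longrightarrow> r < R z \<Longrightarrow> cube z r \<subseteq> \<Omega>"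
  by (auto simp: mem_cube intro: open_cube_subset)

lemma R_ge_of_cube:
  assumes "cube z r \<subseteq> \<Omega>"
  shows "r \<le> R z"
proof -
  obtain a where a: "a \<in> frontier \<Omega>" "R z = infnorm (z - a)" by (rule R_attained)
  then have "a \<notin> cube z r" using assms frontier_disjoint by blast
  then show ?thesis using a(2) by (simp add: mem_cube infnorm_sub[of a z])
qed

end

section \<open>Smooth bump functions\<close>

text \<open>For \<open>P = 1\<close> this is the smooth function \<open>exp (- 1 / t)\<close>, continued by \<open>0\<close>. The polynomial factor makes
  the family closed under differentiation.\<close>

definition flat :: "real poly \<Rightarrow> real \<Rightarrow> real" where
  "flat P t = (if t > 0 then poly P (1 / t) * exp (- 1 / t) else 0)"

text \<open>The derivative of \<open>P(1/t) exp(-1/t)\<close> is \<open>(1/t)\<^sup>2 (P - P')(1/t) exp(-1/t)\<close>.\<close>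

definition dflat :: "real poly \<Rightarrow> real poly" where
  "dflat P = [:0, 0, 1:] * (P - pderiv P)"

lemma poly_div_exp_tendsto_0: "((\<lambda>u. poly Q u * exp (- u)) \<longlongrightarrow> (0::real)) at_top"
proof -
  have "((\<lambda>u. \<Sum>i\<le>degree Q. coeff Q i * (u ^ i / exp u)) \<longlongrightarrow> (\<Sum>i\<le>degree Q. coeff Q i * 0)) at_top"
    by (intro tendsto_sum tendsto_mult tendsto_const tendsto_power_div_exp_0)
  moreover have "(\<Sum>i\<le>degree Q. coeff Q i * (u ^ i / exp u)) = poly Q u * exp (- u)" for u
    by (simp add: poly_altdef sum_distrib_right exp_minus divide_inverse mult.assoc)
  ultimately show ?thesis by simp
qed

text \<open>Only \<open>t = 0\<close> needs an argument: there the exponential beats every polynomial in \<open>1 / t\<close>.\<close>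

lemma flat_has_derivative: "(flat P has_real_derivative flat (dflat P) t) (at t)"
proof -
  consider "t > 0" | "t < 0" | "t = 0" by linarith
  then show ?thesis
  proof cases
    case 1
    have 2: "((\<lambda>t. poly P (1 / t)) has_real_derivative poly (pderiv P) (1 / t) * (- 1 / t\<^sup>2)) (at t)"
      by (rule DERIV_chain2[OF poly_DERIV])
         (use 1 in \<open>auto intro!: derivative_eq_intros simp: power2_eq_square\<close>)
    have 3: "((\<lambda>t. exp (- 1 / t)) has_real_derivative exp (- 1 / t) * (1 / t\<^sup>2)) (at t)"
      by (rule DERIV_chain2[OF DERIV_exp])
         (use 1 in \<open>auto intro!: derivative_eq_intros simp: power2_eq_square\<close>)
    have "((\<lambda>t. poly P (1 / t) * exp (- 1 / t)) has_real_derivative flat (dflat P) t) (at t)"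
      using DERIV_mult[OF 2 3] 1 by (simp add: flat_def dflat_def field_simps power2_eq_square)
    then show ?thesis
      by (rule has_field_derivative_transform_within_open[where S = "{0<..}"])
         (use 1 in \<open>auto simp: flat_def\<close>)
  next
    case 2
    have "((\<lambda>t. 0) has_real_derivative flat (dflat P) t) (at t)"
      using 2 by (simp add: flat_def)
    then show ?thesis
      by (rule has_field_derivative_transform_within_open[where S = "{..<0}"])
         (use 2 in \<open>auto simp: flat_def\<close>)
  next
    case 3
    have "((\<lambda>h. flat P h / h) \<longlongrightarrow> 0) (at_right 0)"
    proof (rule Lim_transform_eventually)
      show "((\<lambda>h. poly (pCons 0 P) (inverse h) * exp (- inverse h)) \<longlongrightarrow> 0) (at_right 0)"
        by (rule filterlim_compose[OF poly_div_exp_tendsto_0 filterlim_inverse_at_top_right])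
      show "\<forall>\<^sub>F h in at_right 0. poly (pCons 0 P) (inverse h) * exp (- inverse h) = flat P h / h"
        using eventually_at_right_less[of 0]
        by eventually_elim (simp add: flat_def field_simps)
    qed
    moreover have "((\<lambda>h. flat P h / h) \<longlongrightarrow> 0) (at_left 0)"
    proof (rule Lim_transform_eventually[OF tendsto_const])
      show "\<forall>\<^sub>F h in at_left 0. 0 = flat P h / h"
        unfolding eventually_at_filter by (auto simp: flat_def)
    qed
    ultimately have "((\<lambda>h. flat P h / h) \<longlongrightarrow> 0) (at 0)"
      using filterlim_split_at by blast
    then show ?thesis using 3 by (simp add: has_field_derivative_iff flat_def)
  qed
qed

lemma flat_1_bounds: "0 \<le> flat 1 t" "flat 1 t \<le> 1"
  by (auto simp: flat_def)

lemma flat_1_mono: "s \<le> t \<Longrightarrow> flat 1 s \<le> flat 1 t"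
  by (auto simp: flat_def frac_le)

lemma flat_1_pos_iff: "flat 1 t > 0 \<longleftrightarrow> t > 0"
  by (auto simp: flat_def)

text \<open>An explicit class of functions that is closed under partial derivatives, so that membership implies
  all the conditions \<open>C_class k\<close> at once.\<close>

inductive smooth :: "(real ^ 'n \<Rightarrow> real) \<Rightarrow> bool" where
  smooth_const: "smooth (\<lambda>x. c)"
| smooth_coord: "smooth (\<lambda>x. x $ i)"
| smooth_add: "smooth f \<Longrightarrow> smooth g \<Longrightarrow> smooth (\<lambda>x. f x + g x)"
| smooth_mult: "smooth f \<Longrightarrow> smooth g \<Longrightarrow> smooth (\<lambda>x. f x * g x)"
| smooth_flat: "smooth f \<Longrightarrow> smooth (\<lambda>x. flat P (f x))"

lemma partial_deriv_eq: "(f has_derivative D) (at x) \<Longrightarrow> partial_deriv i f x = D (axis i 1)"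
  unfolding partial_deriv_def using frechet_derivative_at by metis

lemma has_derivative_partial_deriv:
  fixes f :: "real ^ 'n \<Rightarrow> real"
  assumes "f differentiable (at x)"
  shows "(f has_derivative (\<lambda>h. \<Sum>i\<in>UNIV. h $ i * partial_deriv i f x)) (at x)"
proof -
  obtain D where D: "(f has_derivative D) (at x)" using assms by (auto simp: differentiable_def)
  then interpret D: bounded_linear D by (rule has_derivative_bounded_linear)
  have "D h = (\<Sum>i\<in>UNIV. h $ i * partial_deriv i f x)" for h
  proof -
    have "D h = D (\<Sum>i\<in>UNIV. (h $ i) *\<^sub>R axis i 1)"
      using basis_expansion[of h] by (simp add: scalar_mult_eq_scaleR)
    then show ?thesis by (simp add: D.sum D.scaleR partial_deriv_eq[OF D])
  qed
  then show ?thesis using D by presburger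
qed

lemma smooth_differentiable: "smooth f \<Longrightarrow> f differentiable (at x)"
proof (induction rule: smooth.induct)
  case (smooth_flat f P)
  then show ?case
    using differentiable_chain_at[of f x "flat P"] flat_has_derivative[of P "f x"]
    by (auto simp: o_def real_differentiable_def)
qed (auto intro: differentiable_add differentiable_mult simp: bounded_linear_imp_differentiable bounded_linear_vec_nth)

lemma smooth_partial_deriv: "smooth f \<Longrightarrow> smooth (partial_deriv i f)"
proof (induction rule: smooth.induct)
  case (smooth_const c)
  have "partial_deriv i (\<lambda>x. c) = (\<lambda>x :: real ^ 'a. 0)"
    by (rule ext, rule partial_deriv_eq) (rule has_derivative_const)
  then show ?case by (simp add: smooth.smooth_const)
next
  case (smooth_coord j)
  have "partial_deriv i (\<lambda>x. x $ j) = (\<lambda>x :: real ^ 'a. axis i 1 $ j)"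
    by (rule ext, rule partial_deriv_eq) (rule bounded_linear_imp_has_derivative[OF bounded_linear_vec_nth])
  then show ?case by (simp add: smooth.smooth_const)
next
  case (smooth_add f g)
  have "partial_deriv i (\<lambda>x. f x + g x) = (\<lambda>x. partial_deriv i f x + partial_deriv i g x)"
  proof
    fix x
    note d = smooth_differentiable[OF smooth_add(1), of x, unfolded frechet_derivative_works]
      smooth_differentiable[OF smooth_add(2), of x, unfolded frechet_derivative_works]
    show "partial_deriv i (\<lambda>x. f x + g x) x = partial_deriv i f x + partial_deriv i g x"
      using partial_deriv_eq[OF has_derivative_add[OF d]] by (simp add: partial_deriv_def)
  qed
  with smooth_add show ?case by (simp add: smooth.smooth_add)
next
  case (smooth_mult f g)
  have "partial_deriv i (\<lambda>x. f x * g x) = (\<lambda>x. f x * partial_deriv i g x + partial_deriv i f x * g x)"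
  proof
    fix x
    note d = smooth_differentiable[OF smooth_mult(1), of x, unfolded frechet_derivative_works]
      smooth_differentiable[OF smooth_mult(2), of x, unfolded frechet_derivative_works]
    show "partial_deriv i (\<lambda>x. f x * g x) x = f x * partial_deriv i g x + partial_deriv i f x * g x"
      using partial_deriv_eq[OF has_derivative_mult[OF d]] by (simp add: partial_deriv_def)
  qed
  with smooth_mult show ?case by (simp add: smooth.smooth_add smooth.smooth_mult)
next
  case (smooth_flat f P)
  have "partial_deriv i (\<lambda>x. flat P (f x)) = (\<lambda>x. flat (dflat P) (f x) * partial_deriv i f x)"
  proof
    fix x
    note d = smooth_differentiable[OF smooth_flat(1), of x, unfolded frechet_derivative_works]
    have "((\<lambda>x. flat P (f x)) has_derivative (\<lambda>h. flat (dflat P) (f x) * frechet_derivative f (at x) h)) (at x)"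
      using has_derivative_compose[OF d, of "flat P" "(*) (flat (dflat P) (f x))"] flat_has_derivative[of P "f x"]
      by (simp add: has_field_derivative_def)
    then show "partial_deriv i (\<lambda>x. flat P (f x)) x = flat (dflat P) (f x) * partial_deriv i f x"
      using partial_deriv_eq by (fastforce simp: partial_deriv_def)
  qed
  with smooth_flat show ?case by (simp add: smooth.smooth_mult smooth.smooth_flat)
qed

lemma smooth_continuous: "smooth f \<Longrightarrow> continuous_on A f"
  by (meson continuous_at_imp_continuous_on differentiable_imp_continuous_within smooth_differentiable)

lemma smooth_C_class: "smooth f \<Longrightarrow> C_class k f"
  by (induction k arbitrary: f) (auto intro: smooth_continuous smooth_differentiable smooth_partial_deriv)

lemma smooth_diff: "smooth f \<Longrightarrow> smooth g \<Longrightarrow> smooth (\<lambda>x. f x - g x)"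
  using smooth_add[OF _ smooth_mult[OF smooth_const[of "-1"]], of f g] by simp

lemma smooth_divide_const: "smooth f \<Longrightarrow> smooth (\<lambda>x. f x / s)"
  using smooth_mult[OF _ smooth_const[of "1 / s"], of f] by simp

lemma smooth_prod: "finite I \<Longrightarrow> (\<And>i. i \<in> I \<Longrightarrow> smooth (f i)) \<Longrightarrow> smooth (\<lambda>x. \<Prod>i\<in>I. f i x)"
  by (induction I rule: finite_induct) (auto intro: smooth_const smooth_mult)

lemmas smooth_intros = smooth_const smooth_coord smooth_add smooth_mult smooth_flat smooth_diff
  smooth_divide_const smooth_prod

lemma test_function_smooth:
  assumes "smooth \<phi>" "compact K" "K \<subseteq> \<Omega>" "\<And>x. x \<notin> K \<Longrightarrow> \<phi> x = 0"
  shows "test_function \<Omega> \<phi>"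
  unfolding test_function_def using assms smooth_C_class by blast

text \<open>A product over the coordinates, rather than a function of a norm, is smooth everywhere and still has
  a cube as its support.\<close>

definition bump :: "real ^ 'n \<Rightarrow> real \<Rightarrow> real ^ 'n \<Rightarrow> real" where
  "bump a s z = (\<Prod>i\<in>UNIV. flat 1 (1 - (z $ i - a $ i) / s) * flat 1 (1 + (z $ i - a $ i) / s))"

lemma smooth_bump: "smooth (bump a s)"
  unfolding bump_def[abs_def] by (intro smooth_intros finite_class.finite_UNIV)

lemma bump_nonneg: "bump a s z \<ge> 0"
  unfolding bump_def by (intro prod_nonneg mult_nonneg_nonneg flat_1_bounds)

lemma bump_le_1: "bump a s z \<le> 1"
  unfolding bump_def by (intro prod_le_1 conjI mult_nonneg_nonneg mult_le_one flat_1_bounds)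

lemma bump_eq_0:
  assumes "s > 0" "infnorm (z - a) \<ge> s"
  shows "bump a s z = 0"
proof -
  obtain i where "\<bar>(z - a) $ i\<bar> \<ge> s"
    using assms(2) infnorm_less_iff[of "z - a" s] not_le by blast
  then have "1 - (z $ i - a $ i) / s \<le> 0 \<or> 1 + (z $ i - a $ i) / s \<le> 0"
    using assms(1) by (auto simp: field_simps abs_if split: if_splits)
  then have "flat 1 (1 - (z $ i - a $ i) / s) * flat 1 (1 + (z $ i - a $ i) / s) = 0"
    by (auto simp: flat_def)
  then show ?thesis unfolding bump_def by (intro prod_zero) auto
qed

text \<open>On the concentric smaller cube every factor is at least \<open>flat 1 (1 - \<theta>)\<close>.\<close>

lemma bump_lower:
  fixes a :: "real ^ 'n"
  assumes "s > 0" "infnorm (z - a) \<le> \<theta> * s"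
  shows "flat 1 (1 - \<theta>) ^ (2 * CARD('n)) \<le> bump a s z"
proof -
  have "flat 1 (1 - \<theta>) * flat 1 (1 - \<theta>) \<le> flat 1 (1 - (z $ i - a $ i) / s) * flat 1 (1 + (z $ i - a $ i) / s)" for i
  proof (intro mult_mono flat_1_mono flat_1_bounds)
    have "\<bar>z $ i - a $ i\<bar> \<le> \<theta> * s" using assms(2) by (simp add: infnorm_le_iff)
    then show "1 - \<theta> \<le> 1 - (z $ i - a $ i) / s" "1 - \<theta> \<le> 1 + (z $ i - a $ i) / s"
      using assms(1) by (auto simp: field_simps abs_le_iff)
  qed
  then have "(\<Prod>i\<in>(UNIV :: 'n set). flat 1 (1 - \<theta>) * flat 1 (1 - \<theta>)) \<le> bump a s z"
    unfolding bump_def by (intro prod_mono) (auto intro: flat_1_bounds)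
  then show ?thesis by (simp add: power2_eq_square[symmetric] power_mult)
qed

lemma bump_scale: "s \<noteq> 0 \<Longrightarrow> bump a s z = bump 0 1 ((1 / s) *\<^sub>R (z - a))"
  by (simp add: bump_def diff_divide_distrib)

lemma bump_partial_deriv_eq_0:
  assumes "infnorm z > 1"
  shows "partial_deriv i (bump 0 1) z = 0"
proof -
  have "((\<lambda>z. 0) has_derivative (\<lambda>h. 0)) (at z)" by simp
  moreover have "open {z :: real ^ 'a. infnorm z > 1}"
    by (intro open_Collect_less continuous_intros)
  ultimately have "(bump 0 1 has_derivative (\<lambda>h. 0)) (at z)"
    by (rule has_derivative_transform_within_open) (use assms bump_eq_0[of 1 _ "0 :: real ^ 'a"] in \<open>auto simp: less_imp_le\<close>)
  then show ?thesis by (rule partial_deriv_eq)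
qed

lemma bump_partial_deriv_bounded:
  obtains M where "M \<ge> 0" "\<And>i z. \<bar>partial_deriv i (bump 0 1) (z :: real ^ 'n)\<bar> \<le> M"
proof -
  have "\<exists>M. \<forall>z :: real ^ 'n. \<bar>partial_deriv i (bump 0 1) z\<bar> \<le> M" for i
  proof -
    have "compact (partial_deriv i (bump 0 1) ` cube (0 :: real ^ 'n) 1)"
      by (intro compact_continuous_image smooth_continuous smooth_partial_deriv smooth_bump compact_cube)
    then obtain M where M: "\<forall>z\<in>cube (0 :: real ^ 'n) 1. \<bar>partial_deriv i (bump 0 1) z\<bar> \<le> M"
      by (auto simp: bounded_iff dest!: compact_imp_bounded)
    have "\<bar>partial_deriv i (bump 0 1) z\<bar> \<le> max M 0" for z :: "real ^ 'n"
      using M bump_partial_deriv_eq_0[of z i] by (cases "infnorm z \<le> 1") (auto simp: mem_cube max.coboundedI1)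
    then show ?thesis by blast
  qed
  then obtain M where M: "\<And>i (z :: real ^ 'n). \<bar>partial_deriv i (bump 0 1) z\<bar> \<le> M i" by metis
  have "\<bar>partial_deriv i (bump 0 1) z\<bar> \<le> (\<Sum>i\<in>UNIV. \<bar>M i\<bar>)" for i and z :: "real ^ 'n"
    using M[of i z] member_le_sum[of i UNIV "\<lambda>i. \<bar>M i\<bar>"] by auto
  then show ?thesis by (intro that[of "\<Sum>i\<in>UNIV. \<bar>M i\<bar>"]) (auto intro: sum_nonneg)
qed

lemma bump_has_derivative:
  assumes "s \<noteq> 0"
  shows "(bump a s has_derivative (\<lambda>h. \<Sum>i\<in>UNIV. (h $ i / s) * partial_deriv i (bump 0 1) ((1 / s) *\<^sub>R (z - a)))) (at z)"
proof -
  have "((\<lambda>z. (1 / s) *\<^sub>R (z - a)) has_derivative (\<lambda>h. (1 / s) *\<^sub>R h)) (at z)"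
    by (auto intro!: derivative_eq_intros)
  from has_derivative_compose[OF this has_derivative_partial_deriv[OF smooth_differentiable[OF smooth_bump]]]
  have "((\<lambda>z. bump 0 1 ((1 / s) *\<^sub>R (z - a))) has_derivative
      (\<lambda>h. \<Sum>i\<in>UNIV. ((1 / s) *\<^sub>R h) $ i * partial_deriv i (bump 0 1) ((1 / s) *\<^sub>R (z - a)))) (at z)" .
  then show ?thesis using assms by (simp add: bump_scale[symmetric])
qed

lemma partial_deriv_bump:
  assumes "s \<noteq> 0"
  shows "partial_deriv i (bump a s) z = partial_deriv i (bump 0 1) ((1 / s) *\<^sub>R (z - a)) / s"
proof -
  have "(axis i 1 $ j / s) * q = (if j = i then q / s else 0)" for j q
    by (auto simp: axis_def)
  then show ?thesis by (simp add: partial_deriv_eq[OF bump_has_derivative[OF assms]])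
qed

lemma borel_measurable_bump [measurable]: "bump a s \<in> borel_measurable borel"
  by (intro borel_measurable_continuous_onI smooth_continuous smooth_bump)

lemma integrable_bump: "s > 0 \<Longrightarrow> integrable lborel (bump (a :: real ^ 'n) s)"
proof (rule Bochner_Integration.integrable_bound)
  show "integrable lborel (indicator (cube a s) :: real ^ 'n \<Rightarrow> real)"
    by (intro integrable_real_indicator) auto
qed (auto simp: indicator_def mem_cube bump_nonneg bump_le_1 bump_eq_0)

definition bump_mass :: "('n :: finite) itself \<Rightarrow> real" where
  "bump_mass _ = (LINT z|lborel. bump (0 :: real ^ 'n) 1 z)"

lemma integral_bump:
  assumes "s > 0"
  shows "(LINT z|lborel. bump (a :: real ^ 'n) s z) = s ^ CARD('n) * bump_mass TYPE('n)"
proof -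
  have "(LINT z|lborel. bump a s z)
      = (LINT z|density (distr lborel borel (\<lambda>x. a + s *\<^sub>R x)) (\<lambda>_. \<bar>s\<bar> ^ DIM(real ^ 'n)). bump a s z)"
    using lborel_affine[of s a] assms by simp
  also have "\<dots> = s ^ CARD('n) * (LINT z|lborel. bump a s (a + s *\<^sub>R z))"
    using assms by (subst integral_density) (auto simp: integral_distr)
  also have "(\<lambda>z. bump a s (a + s *\<^sub>R z)) = bump 0 1"
    using assms by (auto simp: bump_scale[of s])
  finally show ?thesis by (simp add: bump_mass_def)
qed

lemma bump_mass_pos: "bump_mass TYPE('n::finite) > 0"
proof -
  let ?e = "flat 1 (1 / 2) ^ (2 * CARD('n))"
  have "0 < ?e * measure lborel (cube (0 :: real ^ 'n) (1 / 2))"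
    by (simp add: measure_cube flat_1_pos_iff)
  also have "\<dots> = (LINT z|lborel. ?e * indicator (cube (0 :: real ^ 'n) (1 / 2)) z)"
    by simp
  also have "\<dots> \<le> (LINT z|lborel. bump (0 :: real ^ 'n) 1 z)"
  proof (rule integral_mono)
    show "integrable lborel (\<lambda>z :: real ^ 'n. ?e * indicator (cube 0 (1 / 2)) z)"
      by (intro integrable_mult_right integrable_real_indicator) auto
    show "integrable lborel (bump (0 :: real ^ 'n) 1)" by (simp add: integrable_bump)
    show "?e * indicator (cube 0 (1 / 2)) z \<le> bump 0 1 z" for z :: "real ^ 'n"
      using bump_lower[of 1 z 0 "1 / 2"] bump_nonneg[of 0 1 z] by (auto simp: indicator_def mem_cube)
  qed
  finally show ?thesis by (simp add: bump_mass_def)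
qed

section \<open>Uniqueness of the weak gradient\<close>

text \<open>The boxes form a generator of the Borel sets that is stable under intersection, hence the integrals
  over all measurable subsets vanish, in particular those over the sets where \<open>u\<close> is positive or negative.\<close>

lemma AE_zero_of_integral_boxes:
  fixes u :: "real ^ 'n \<Rightarrow> real"
  assumes int: "set_integrable lebesgue (box a b) u"
    and zero: "\<And>c d. box c d \<subseteq> box a b \<Longrightarrow> (LINT x:box c d|lebesgue. u x) = 0"
  shows "AE x in lebesgue. x \<in> box a b \<longrightarrow> u x = 0"
proof -
  define v where "v x = indicator (box a b) x *\<^sub>R u x" for x
  have v: "integrable lebesgue v" using int by (simp add: v_def[abs_def] set_integrable_def)
  have vs: "set_integrable lebesgue A v" if "A \<in> sets lebesgue" for A
    using v that unfolding set_integrable_def by (intro integrable_mult_indicator)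
  have sb: "sets borel = sigma_sets UNIV (range (\<lambda>(a :: real ^ 'n, b). box a b))"
    by (subst borel_eq_box) simp
  have "(LINT x:A|lebesgue. v x) = 0" if "A \<in> sets borel" for A
  proof -
    have "Int_stable (range (\<lambda>(a :: real ^ 'n, b). box a b))"
      by (auto simp: Int_stable_def Int_interval box_Int_box)
    moreover have "range (\<lambda>(a :: real ^ 'n, b). box a b) \<subseteq> Pow UNIV" by simp
    moreover from that have "A \<in> sigma_sets UNIV (range (\<lambda>(a, b). box a b))"
      by (simp add: borel_eq_box)
    ultimately show ?thesis
    proof (induction rule: sigma_sets_induct_disjoint[consumes 3])
      case (basic A)
      then obtain c d where A: "A = box c d" by auto
      have "(LINT x:A|lebesgue. v x) = (LINT x:box c d \<inter> box a b|lebesgue. u x)"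
        unfolding A set_lebesgue_integral_def v_def
        by (rule Bochner_Integration.integral_cong) (auto simp: indicator_def)
      moreover obtain c' d' where "box c d \<inter> box a b = box c' d'" using box_Int_box by blast
      ultimately show ?case using zero[of c' d'] by (metis inf.cobounded2)
    next
      case (compl A)
      have A: "A \<in> sets lebesgue"
        using compl(1) unfolding sb[symmetric] by (intro sets_completionI_sets) simp
      have "(LINT x:UNIV|lebesgue. v x) = (LINT x:box a b|lebesgue. u x)"
        unfolding set_lebesgue_integral_def v_def
        by (rule Bochner_Integration.integral_cong) auto
      then have "(LINT x:UNIV|lebesgue. v x) = 0" by (simp add: zero)
      moreover have "(LINT x:A \<union> (UNIV - A)|lebesgue. v x)
          = (LINT x:A|lebesgue. v x) + (LINT x:UNIV - A|lebesgue. v x)"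
        using A by (intro set_integral_Un vs) auto
      ultimately show ?case using compl by simp
    next
      case (union A)
      have A: "A i \<in> sets lebesgue" for i
        using union(2) unfolding sb[symmetric] by (intro sets_completionI_sets) auto
      have "(LINT x:(\<Union>i. A i)|lebesgue. v x) = (\<Sum>i. (LINT x:A i|lebesgue. v x))"
        by (rule lebesgue_integral_countable_add) (use union A in \<open>auto simp: disjoint_family_on_def intro!: vs\<close>)
      then show ?case using union by simp
    qed (simp add: set_lebesgue_integral_def)
  qed
  then have *: "(LINT x:A|lebesgue. v x) = 0" if "A \<in> sets lebesgue" for A
  proof -
    obtain S N N' where A: "A = S \<union> N" "N \<subseteq> N'" "N' \<in> null_sets lborel" "S \<in> sets lborel"
      using \<open>A \<in> sets lebesgue\<close> by (rule sets_completionE)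
    have "(LINT x:A|lebesgue. v x) = (LINT x:S|lebesgue. v x)"
    proof (rule set_integral_cong_set)
      have "AE x in lebesgue. x \<notin> N'"
        using A(3) AE_not_in null_sets_completionI by blast
      then show "AE x in lebesgue. (x \<in> S) = (x \<in> A)" by eventually_elim (use A in auto)
      show "set_borel_measurable lebesgue A v" "set_borel_measurable lebesgue S v"
        using vs[OF that] vs[of S] A(4) by (auto simp: set_borel_measurable_def set_integrable_def sets_completionI_sets)
    qed
    then show ?thesis using \<open>\<And>A. A \<in> sets borel \<Longrightarrow> (LINT x:A|lebesgue. v x) = 0\<close> A(4) by simp
  qed
  have [measurable]: "v \<in> borel_measurable lebesgue" using v by simp
  have pos: "{x. v x > 0} \<in> null_sets lebesgue"
  proof (rule null_if_pos_func_has_zero_int[of _ v])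
    have "{x \<in> space lebesgue. v x > 0} \<in> sets lebesgue" by measurable
    then show "{x. v x > 0} \<in> sets lebesgue" by simp
    then show "(LINT x:{x. v x > 0}|lebesgue. v x) = 0" by (rule *)
  qed (use v in auto)
  have neg: "{x. - v x > 0} \<in> null_sets lebesgue"
  proof (rule null_if_pos_func_has_zero_int[of _ "\<lambda>x. - v x"])
    have "{x \<in> space lebesgue. - v x > 0} \<in> sets lebesgue" by measurable
    then show 1: "{x. - v x > 0} \<in> sets lebesgue" by simp
    show "(LINT x:{x. - v x > 0}|lebesgue. - v x) = 0"
      using set_integral_uminus[OF vs[OF 1]] *[OF 1] by simp
  qed (use v in auto)
  have "AE x in lebesgue. v x = 0"
    by (rule eventually_mono[OF eventually_conj[OF AE_not_in[OF pos] AE_not_in[OF neg]]]) auto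
  then show ?thesis by (rule eventually_mono) (auto simp: v_def)
qed

lemma set_integrable_component:
  fixes G :: "'a \<Rightarrow> real ^ 'n"
  shows "set_integrable M A G \<Longrightarrow> set_integrable M A (\<lambda>x. G x $ i)"
  unfolding set_integrable_def
  using integrable_bounded_linear[OF bounded_linear_vec_nth[of i], of M "\<lambda>x. indicator A x *\<^sub>R G x"]
  by simp

lemma smooth_measurable: "smooth f \<Longrightarrow> f \<in> borel_measurable lebesgue"
  by (intro measurable_completion) (simp add: borel_measurable_continuous_onI smooth_continuous)

text \<open>The factors \<open>flat 1 (k t)\<close> tend to \<open>1\<close> for \<open>t > 0\<close> and vanish for \<open>t \<le> 0\<close>.\<close>

lemma smooth_approx_indicator_box:
  fixes c d :: "real ^ 'n"
  defines "\<phi> k x \<equiv> (\<Prod>j\<in>UNIV. flat 1 (real k * (x $ j - c $ j)) * flat 1 (real k * (d $ j - x $ j)))"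
  shows "smooth (\<phi> k)" "\<And>x. 0 \<le> \<phi> k x" "\<And>x. \<phi> k x \<le> 1" "\<And>x. x \<notin> box c d \<Longrightarrow> \<phi> k x = 0"
    "\<And>x. (\<lambda>k. \<phi> k x) \<longlonglongrightarrow> indicator (box c d) x"
proof -
  show "smooth (\<phi> k)" unfolding \<phi>_def[abs_def] by (intro smooth_intros finite_class.finite_UNIV)
  show "0 \<le> \<phi> k x" "\<phi> k x \<le> 1" for x
    unfolding \<phi>_def by (intro prod_nonneg prod_le_1 conjI mult_nonneg_nonneg mult_le_one flat_1_bounds)+
  show 0: "\<phi> k x = 0" if outside: "x \<notin> box c d" for k x
  proof -
    obtain j where "\<not> (c $ j < x $ j \<and> x $ j < d $ j)" using outside unfolding mem_box_cart by blast
    then have "flat 1 (real k * (x $ j - c $ j)) * flat 1 (real k * (d $ j - x $ j)) = 0"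
      by (auto simp: flat_def zero_less_mult_iff)
    then show ?thesis unfolding \<phi>_def by (intro prod_zero) auto
  qed
  have flat_lim: "(\<lambda>k. flat 1 (real k * t)) \<longlonglongrightarrow> 1" if "t > 0" for t
  proof -
    have "(\<lambda>k. exp (- (inverse (real (Suc k)) / t))) \<longlonglongrightarrow> exp (- (0 / t))"
      by (intro tendsto_intros LIMSEQ_inverse_real_of_nat) (use that in simp)
    then have "(\<lambda>k. flat 1 (real (Suc k) * t)) \<longlonglongrightarrow> 1"
      using that by (simp add: flat_def zero_less_mult_iff field_simps del: of_nat_Suc)
    then show ?thesis by (rule LIMSEQ_imp_Suc)
  qed
  show "(\<lambda>k. \<phi> k x) \<longlonglongrightarrow> indicator (box c d) x" for x
  proof (cases "x \<in> box c d")
    case True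
    then have "(\<lambda>k. \<phi> k x) \<longlonglongrightarrow> (\<Prod>j\<in>(UNIV :: 'n set). 1 * 1)"
      unfolding \<phi>_def by (intro tendsto_prod tendsto_mult flat_lim) (auto simp: mem_box_cart)
    then show ?thesis using True by simp
  qed (simp add: 0)
qed

text \<open>Test functions that increase to the indicator of a box show that the difference of the two gradients
  has vanishing integrals over boxes; and \<open>\<Omega>\<close> is a countable union of boxes.\<close>

lemma weak_gradient_unique:
  fixes G H :: "real ^ 'n \<Rightarrow> real ^ 'n"
  assumes op: "open \<Omega>" and G: "weak_gradient \<Omega> F G" and H: "weak_gradient \<Omega> F H"
  shows "AE x in lebesgue. x \<in> \<Omega> \<longrightarrow> G x = H x"
proof -
  have box: "AE x in lebesgue. x \<in> box a b \<longrightarrow> G x $ i - H x $ i = 0" if ab: "cbox a b \<subseteq> \<Omega>" for a b i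
  proof (rule AE_zero_of_integral_boxes)
    have int: "set_integrable lebesgue K (\<lambda>x. G x $ i - H x $ i)"
        "set_integrable lebesgue K (\<lambda>x. G x $ i)" "set_integrable lebesgue K (\<lambda>x. H x $ i)"
      if "compact K" "K \<subseteq> \<Omega>" for K
      using G H that unfolding weak_gradient_def
      by (auto intro!: set_integral_diff set_integrable_component)
    have "set_integrable lebesgue (cbox a b) (\<lambda>x. G x $ i - H x $ i)"
      using int[OF compact_cbox ab] by simp
    then show "set_integrable lebesgue (box a b) (\<lambda>x. G x $ i - H x $ i)"
      by (rule set_integrable_subset) (auto simp: box_subset_cbox)
    fix c d assume cd: "box c d \<subseteq> box a b"
    show "(LINT x:box c d|lebesgue. G x $ i - H x $ i) = 0"
    proof (cases "box c d = {}")
      case False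
      then have "closure (box c d) \<subseteq> closure (cbox a b)"
        using cd box_subset_cbox by (intro closure_mono) blast
      then have sub: "cbox c d \<subseteq> \<Omega>" using False ab by (simp add: closure_box)
      define \<phi> where "\<phi> k x = (\<Prod>j\<in>UNIV. flat 1 (real k * (x $ j - c $ j)) * flat 1 (real k * (d $ j - x $ j)))"
        for k :: nat and x :: "real ^ 'n"
      note \<phi> = smooth_approx_indicator_box[where c = c and d = d, folded \<phi>_def]
      define u where "u x = indicator (cbox c d) x *\<^sub>R (G x $ i - H x $ i)" for x
      have u: "integrable lebesgue u" using int(1)[OF compact_cbox sub] by (simp add: u_def[abs_def] set_integrable_def)
      have [measurable]: "u \<in> borel_measurable lebesgue" "box c d \<in> sets lebesgue"
        using u by auto
      have [measurable]: "\<phi> k \<in> borel_measurable lebesgue" for k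
        by (rule smooth_measurable[OF \<phi>(1)])
      have zero: "(LINT x|lebesgue. \<phi> k x * u x) = 0" for k
      proof -
        have "test_function \<Omega> (\<phi> k)"
          by (rule test_function_smooth[OF \<phi>(1) compact_cbox sub]) (use \<phi>(4) box_subset_cbox in blast)
        then have "(LINT x:\<Omega>|lebesgue. F x * partial_deriv i (\<phi> k) x) = - (LINT x:\<Omega>|lebesgue. G x $ i * \<phi> k x)"
            "(LINT x:\<Omega>|lebesgue. F x * partial_deriv i (\<phi> k) x) = - (LINT x:\<Omega>|lebesgue. H x $ i * \<phi> k x)"
          using G H unfolding weak_gradient_def by blast+
        then have eq: "(LINT x:\<Omega>|lebesgue. G x $ i * \<phi> k x) = (LINT x:\<Omega>|lebesgue. H x $ i * \<phi> k x)"
          by simp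
        have red: "(LINT x:\<Omega>|lebesgue. J x $ i * \<phi> k x)
            = (LINT x|lebesgue. \<phi> k x * (indicator (cbox c d) x *\<^sub>R J x $ i))" for J :: "real ^ 'n \<Rightarrow> real ^ 'n"
          unfolding set_lebesgue_integral_def
        proof (rule Bochner_Integration.integral_cong)
          fix x
          show "indicat_real \<Omega> x *\<^sub>R (J x $ i * \<phi> k x) = \<phi> k x * (indicat_real (cbox c d) x *\<^sub>R J x $ i)"
          proof (cases "x \<in> cbox c d")
            case True
            then have "x \<in> \<Omega>" using sub by blast
            then show ?thesis using True by simp
          next
            case False
            then have "\<phi> k x = 0" using \<phi>(4) box_subset_cbox by blast
            then show ?thesis by simp
          qed
        qed simp
        have int': "integrable lebesgue (\<lambda>x. \<phi> k x * (indicator (cbox c d) x *\<^sub>R J x $ i))"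
          if "set_integrable lebesgue (cbox c d) (\<lambda>x. J x $ i)" for J :: "real ^ 'n \<Rightarrow> real ^ 'n"
        proof (rule Bochner_Integration.integrable_bound[OF that[unfolded set_integrable_def]])
          have "(\<lambda>x. indicat_real (cbox c d) x *\<^sub>R J x $ i) \<in> borel_measurable lebesgue"
            using that unfolding set_integrable_def by (rule borel_measurable_integrable)
          then show "(\<lambda>x. \<phi> k x * indicat_real (cbox c d) x *\<^sub>R J x $ i) \<in> borel_measurable lebesgue"
            by (intro borel_measurable_times) simp_all
          show "AE x in lebesgue. norm (\<phi> k x * indicat_real (cbox c d) x *\<^sub>R J x $ i)
              \<le> norm (indicat_real (cbox c d) x *\<^sub>R J x $ i)"
            using \<phi>(2,3)[where k = k] by (intro AE_I2) (simp add: abs_mult mult_left_le_one_le)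
        qed
        have "(LINT x|lebesgue. \<phi> k x * u x)
            = (LINT x|lebesgue. \<phi> k x * (indicator (cbox c d) x *\<^sub>R G x $ i) - \<phi> k x * (indicator (cbox c d) x *\<^sub>R H x $ i))"
          by (rule Bochner_Integration.integral_cong) (auto simp: u_def algebra_simps)
        also have "\<dots> = (LINT x|lebesgue. \<phi> k x * (indicator (cbox c d) x *\<^sub>R G x $ i))
            - (LINT x|lebesgue. \<phi> k x * (indicator (cbox c d) x *\<^sub>R H x $ i))"
          by (intro Bochner_Integration.integral_diff int' int(2,3)[OF compact_cbox sub])
        also have "\<dots> = 0" using eq by (simp only: red diff_self)
        finally show ?thesis .
      qed
      have "(\<lambda>k. LINT x|lebesgue. \<phi> k x * u x) \<longlonglongrightarrow> (LINT x|lebesgue. indicator (box c d) x * u x)"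
      proof (rule integral_dominated_convergence[where w = "\<lambda>x. \<bar>u x\<bar>"])
        show "AE x in lebesgue. (\<lambda>k. \<phi> k x * u x) \<longlonglongrightarrow> indicator (box c d) x * u x"
          by (intro AE_I2 tendsto_mult \<phi>(5) tendsto_const)
        show "AE x in lebesgue. norm (\<phi> k x * u x) \<le> \<bar>u x\<bar>" for k
          using \<phi>(2,3) by (intro AE_I2) (auto simp: abs_mult mult_left_le_one_le)
      qed (use u in auto)
      then have "(LINT x|lebesgue. indicator (box c d) x * u x) = 0"
        by (simp add: zero LIMSEQ_const_iff)
      also have "(\<lambda>x. indicator (box c d) x * u x) = (\<lambda>x. indicator (box c d) x *\<^sub>R (G x $ i - H x $ i))"
        using box_subset_cbox[of c d] by (intro ext) (auto simp: u_def indicator_def)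
      finally show ?thesis by (simp add: set_lebesgue_integral_def)
    qed (simp add: set_lebesgue_integral_def)
  qed
  obtain \<D> where \<D>: "countable \<D>" "\<D> \<subseteq> Pow \<Omega>" "\<And>X. X \<in> \<D> \<Longrightarrow> \<exists>a b. X = cbox a b" "\<Union>\<D> = \<Omega>"
    by (rule open_countable_Union_open_cbox[OF op]) (rule that)
  have "AE x in lebesgue. \<forall>X\<in>\<D>. x \<in> X \<longrightarrow> (\<forall>i. G x $ i = H x $ i)"
  proof (subst AE_ball_countable[OF \<D>(1)], intro ballI)
    fix X assume "X \<in> \<D>"
    then obtain a b where X: "X = cbox a b" "cbox a b \<subseteq> \<Omega>" using \<D>(2,3) by blast
    have "AE x in lebesgue. \<forall>i\<in>UNIV. x \<in> box a b \<longrightarrow> G x $ i - H x $ i = 0"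
      by (subst AE_ball_countable) (use box[OF X(2)] in auto)
    moreover have "AE x in lebesgue. x \<notin> cbox a b - box a b"
      using negligible_frontier_interval[of a b] negligible_iff_null_sets AE_not_in by blast
    ultimately show "AE x in lebesgue. x \<in> X \<longrightarrow> (\<forall>i. G x $ i = H x $ i)"
      by eventually_elim (auto simp: X)
  qed
  then show ?thesis by eventually_elim (use \<D>(4) in \<open>auto simp: vec_eq_iff\<close>)
qed

section \<open>A Morrey estimate on cones\<close>

text \<open>The mean value theorem bounds the difference quotients by \<open>w\<close>, so that dominated convergence applies.\<close>

lemma integral_has_derivative_dominated:
  fixes h h' :: "real \<Rightarrow> 'a \<Rightarrow> real"
  assumes S: "convex S" "s \<in> S"
    and int: "\<And>t. t \<in> S \<Longrightarrow> integrable M (h t)"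
    and d: "\<And>t z. t \<in> S \<Longrightarrow> ((\<lambda>t. h t z) has_real_derivative h' t z) (at t within S)"
    and b: "\<And>t z. t \<in> S \<Longrightarrow> \<bar>h' t z\<bar> \<le> w z" and w: "integrable M w"
    and m: "h' s \<in> borel_measurable M"
  shows "((\<lambda>t. LINT z|M. h t z) has_real_derivative (LINT z|M. h' s z)) (at s within S)"
  unfolding has_field_derivative_iff tendsto_at_iff_sequentially
proof (intro allI impI)
  fix X assume X: "\<forall>i. X i \<in> S - {s}" "X \<longlonglongrightarrow> s"
  have "(\<lambda>i. LINT z|M. (h (X i) z - h s z) / (X i - s)) \<longlonglongrightarrow> (LINT z|M. h' s z)"
  proof (rule integral_dominated_convergence[where w = w])
    show "AE z in M. (\<lambda>i. (h (X i) z - h s z) / (X i - s)) \<longlonglongrightarrow> h' s z"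
    proof (rule AE_I2)
      fix z
      have "((\<lambda>y. (h y z - h s z) / (y - s)) \<longlongrightarrow> h' s z) (at s within S)"
        using d[OF S(2), of z] by (simp add: has_field_derivative_iff)
      then show "(\<lambda>i. (h (X i) z - h s z) / (X i - s)) \<longlonglongrightarrow> h' s z"
        using X unfolding tendsto_at_iff_sequentially o_def by blast
    qed
    show "AE z in M. norm ((h (X i) z - h s z) / (X i - s)) \<le> w z" for i
    proof (rule AE_I2)
      fix z
      have "norm (h (X i) z - h s z) \<le> w z * norm (X i - s)"
        by (rule field_differentiable_bound[OF S(1), of "\<lambda>t. h t z" "\<lambda>t. h' t z"])
           (use d b X S in auto)
      moreover have "\<bar>X i - s\<bar> > 0" using X(1) by (auto simp: zero_less_abs_iff)
      ultimately show "norm ((h (X i) z - h s z) / (X i - s)) \<le> w z"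
        by (simp add: abs_divide pos_divide_le_eq)
    qed
    show "(\<lambda>z. (h (X i) z - h s z) / (X i - s)) \<in> borel_measurable M" for i
      using int[of "X i"] int[OF S(2)] X(1) by (intro borel_measurable_divide borel_measurable_diff) auto
  qed (use m w in auto)
  moreover have "(LINT z|M. (h (X i) z - h s z) / (X i - s))
      = ((LINT z|M. h (X i) z) - (LINT z|M. h s z)) / (X i - s)" for i
  proof -
    have "(LINT z|M. h (X i) z - h s z) = (LINT z|M. h (X i) z) - (LINT z|M. h s z)"
      using int[of "X i"] int[OF S(2)] X(1) by (intro Bochner_Integration.integral_diff) auto
    then show ?thesis by simp
  qed
  ultimately show "((\<lambda>y. ((LINT z|M. h y z) - (LINT z|M. h s z)) / (y - s)) \<circ> X) \<longlonglongrightarrow> (LINT z|M. h' s z)"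
    unfolding o_def by (simp only:)
qed

lemma sets_lebesgue_compact: "compact K \<Longrightarrow> (K :: (real ^ 'n) set) \<in> sets lebesgue"
  by (simp add: borel_compact sets_completionI_sets)

lemma integrable_indicator_compact:
  "compact K \<Longrightarrow> integrable lebesgue (indicator K :: real ^ 'n \<Rightarrow> real)"
  using emeasure_compact_finite[of K]
  by (intro integrable_real_indicator) (auto simp: sets_lebesgue_compact borel_compact)

lemma borel_measurable_indicator_mult_continuous:
  fixes F :: "real ^ 'n \<Rightarrow> real"
  assumes "open \<Omega>" "continuous_on \<Omega> F"
  shows "(\<lambda>z. indicator \<Omega> z *\<^sub>R F z) \<in> borel_measurable lebesgue"
  using borel_measurable_continuous_on_indicator[of \<Omega> F] assms
  by (intro measurable_completion) simp

lemma continuous_bounded_on_compact: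
  fixes F :: "'a::topological_space \<Rightarrow> real"
  assumes "compact K" "continuous_on K F"
  obtains B where "B \<ge> 0" "\<And>z. z \<in> K \<Longrightarrow> \<bar>F z\<bar> \<le> B"
proof -
  have "bounded (F ` K)" using assms by (intro compact_imp_bounded compact_continuous_image)
  then obtain B where "\<forall>z\<in>K. \<bar>F z\<bar> \<le> B" by (auto simp: bounded_iff)
  then show ?thesis by (intro that[of "max B 0"]) (auto simp: max.coboundedI1)
qed

lemma set_integrable_mult_compact_support:
  fixes F g :: "real ^ 'n \<Rightarrow> real"
  assumes "open \<Omega>" "continuous_on \<Omega> F" "compact K" "K \<subseteq> \<Omega>" "g \<in> borel_measurable lebesgue"
    and g: "\<And>z. \<bar>g z\<bar> \<le> B * indicator K z"
  shows "set_integrable lebesgue \<Omega> (\<lambda>z. F z * g z)"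
proof -
  obtain D where D: "D \<ge> 0" "\<And>z. z \<in> K \<Longrightarrow> \<bar>F z\<bar> \<le> D"
    using continuous_bounded_on_compact[OF assms(3) continuous_on_subset[OF assms(2,4)]] by metis
  show ?thesis unfolding set_integrable_def
  proof (rule Bochner_Integration.integrable_bound)
    show "integrable lebesgue (\<lambda>z. (D * B) * indicat_real K z)"
      by (intro integrable_mult_right integrable_indicator_compact assms)
    have "(\<lambda>z. (indicator \<Omega> z *\<^sub>R F z) * g z) \<in> borel_measurable lebesgue"
      using borel_measurable_indicator_mult_continuous[OF assms(1,2)] assms(5) by simp
    then show "(\<lambda>z. indicator \<Omega> z *\<^sub>R (F z * g z)) \<in> borel_measurable lebesgue" by (simp add: mult.assoc)
    show "AE z in lebesgue. norm (indicator \<Omega> z *\<^sub>R (F z * g z)) \<le> norm (D * B * indicat_real K z)"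
    proof (rule AE_I2)
      fix z
      show "norm (indicator \<Omega> z *\<^sub>R (F z * g z)) \<le> norm (D * B * indicat_real K z)"
      proof (cases "z \<in> K")
        case True
        then have "\<bar>F z\<bar> * \<bar>g z\<bar> \<le> D * B" using g[of z] D by (intro mult_mono) auto
        moreover have "D * B \<le> \<bar>D * B\<bar>" "z \<in> \<Omega>" using True assms(4) by auto
        ultimately show ?thesis using True by (simp add: abs_mult)
      next
        case False
        then show ?thesis using g[of z] by auto
      qed
    qed
  qed
qed

lemma set_integrable_bounded_mult_compact_support:
  fixes u g :: "real ^ 'n \<Rightarrow> real"
  assumes "set_integrable lebesgue K u" "K \<subseteq> \<Omega>" "g \<in> borel_measurable lebesgue"
    and g: "\<And>z. \<bar>g z\<bar> \<le> B * indicator K z"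
  shows "set_integrable lebesgue \<Omega> (\<lambda>z. u z * g z)"
proof -
  have eq: "indicator \<Omega> z *\<^sub>R (u z * g z) = (indicator K z *\<^sub>R u z) * g z" for z
    using g[of z] assms(2) by (cases "z \<in> K") auto
  show ?thesis unfolding set_integrable_def eq
  proof (rule Bochner_Integration.integrable_bound)
    show "integrable lebesgue (\<lambda>z. B * (indicator K z *\<^sub>R u z))"
      using assms(1) unfolding set_integrable_def by (rule integrable_mult_right)
    show "(\<lambda>z. indicat_real K z *\<^sub>R u z * g z) \<in> borel_measurable lebesgue"
      using assms(1,3) unfolding set_integrable_def by (intro borel_measurable_times) auto
    show "AE z in lebesgue. norm (indicat_real K z *\<^sub>R u z * g z) \<le> norm (B * (indicat_real K z *\<^sub>R u z))"
    proof (rule AE_I2)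
      fix z
      have "\<bar>g z\<bar> \<le> \<bar>B\<bar>" using g[of z] by (cases "z \<in> K") auto
      from mult_right_mono[OF this, of "\<bar>indicat_real K z * u z\<bar>"]
      show "norm (indicat_real K z *\<^sub>R u z * g z) \<le> norm (B * (indicat_real K z *\<^sub>R u z))"
        by (simp add: abs_mult mult.commute mult.left_commute)
    qed
  qed
qed

text \<open>Optimising the parameter in the elementary bound \<open>u \<le> l + l powr (1 - p) * u powr p\<close> is
  all of Hoelder's inequality that is needed below.\<close>

lemma le_add_powr:
  fixes u l p :: real
  assumes "u \<ge> 0" "l > 0" "p > 1"
  shows "u \<le> l + l powr (1 - p) * u powr p"
proof (cases "u \<le> l")
  case False
  then have "l powr (p - 1) \<le> u powr (p - 1)" using assms by (intro powr_mono2) auto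
  then have "u * l powr (p - 1) \<le> u * u powr (p - 1)" using assms by (intro mult_left_mono)
  also have "\<dots> = u powr p" using assms False by (simp add: powr_mult_base)
  finally have "u \<le> l powr (1 - p) * u powr p"
    using assms by (simp add: powr_diff field_simps)
  then show ?thesis using assms by simp
qed (use assms in \<open>simp add: add_increasing2\<close>)

lemma le_powr_of_all_scales:
  fixes a E p X :: real
  assumes "a > 0" "E \<ge> 0" "p > 1" and *: "\<And>l. l > 0 \<Longrightarrow> X \<le> l * a + l powr (1 - p) * E"
  shows "X \<le> 2 * a powr (1 - 1 / p) * E powr (1 / p)"
proof (cases "E = 0")
  case True
  have "X \<le> 0"
  proof (rule field_le_epsilon)
    fix e :: real assume "e > 0"
    then show "X \<le> 0 + e" using *[of "e / a"] assms(1) True by simp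
  qed
  then show ?thesis using True by simp
next
  case False
  with assms have E: "E > 0" by simp
  define l where "l = (E / a) powr (1 / p)"
  have l: "l > 0" using E assms by (simp add: l_def)
  have "l * a = a powr (1 - 1 / p) * E powr (1 / p)"
    using E assms by (simp add: l_def powr_divide powr_diff)
  moreover have "l powr (1 - p) * E = l * a"
  proof -
    have "l powr (1 - p) * E = l * (l powr (- p) * E)"
      using l by (simp add: powr_diff powr_minus field_simps)
    also have "l powr (- p) * E = a"
      using E assms by (simp add: l_def powr_powr powr_minus field_simps)
    finally show ?thesis .
  qed
  ultimately show ?thesis using *[OF l] by (simp add: mult_ac)
qed

text \<open>The bump lives on the cube of half the radius; if \<open>cube a \<rho>\<close> lies in \<open>\<Omega>\<close>, then its support has distance
  at least \<open>\<rho> / 2\<close> to the boundary.\<close>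

definition wmean :: "(real ^ 'n) set \<Rightarrow> (real ^ 'n \<Rightarrow> real) \<Rightarrow> real ^ 'n \<Rightarrow> real \<Rightarrow> real" where
  "wmean \<Omega> F a \<rho> = (LINT z:\<Omega>|lebesgue. F z * bump a (\<rho> / 2) z) / ((\<rho> / 2) ^ CARD('n) * bump_mass TYPE('n))"

lemma abs_bump_le: "s > 0 \<Longrightarrow> \<bar>bump a s z\<bar> \<le> 1 * indicator (cube a s) z"
  by (auto simp: indicator_def mem_cube bump_le_1 bump_nonneg bump_eq_0)

lemma wmean_close:
  fixes F :: "real ^ 'n \<Rightarrow> real"
  assumes op: "open \<Omega>" and F: "continuous_on \<Omega> F" and \<rho>: "\<rho> > 0" and sub: "cube a (\<rho> / 2) \<subseteq> \<Omega>"
    and close: "\<And>z. z \<in> cube a (\<rho> / 2) \<Longrightarrow> \<bar>F z - v\<bar> \<le> e"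
  shows "\<bar>wmean \<Omega> F a \<rho> - v\<bar> \<le> e"
proof -
  let ?b = "bump a (\<rho> / 2)" and ?m = "(\<rho> / 2) ^ CARD('n) * bump_mass TYPE('n)"
  have m: "?m > 0" using \<rho> bump_mass_pos[where 'n = 'n] by simp
  have b: "?b \<in> borel_measurable lebesgue" by (rule smooth_measurable[OF smooth_bump])
  have int: "set_integrable lebesgue \<Omega> (\<lambda>z. H z * ?b z)" if "continuous_on \<Omega> H" for H
    by (rule set_integrable_mult_compact_support[OF op that compact_cube sub b, where B = 1]) (use \<rho> in \<open>simp only: abs_bump_le\<close>)
  have mass: "(LINT z:\<Omega>|lebesgue. k * ?b z) = k * ?m" for k
  proof -
    have "(LINT z:\<Omega>|lebesgue. ?b z) = (LINT z|lebesgue. ?b z)"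
      unfolding set_lebesgue_integral_def
    proof (rule Bochner_Integration.integral_cong)
      fix z show "indicat_real \<Omega> z *\<^sub>R ?b z = ?b z"
      proof (cases "z \<in> \<Omega>")
        case False
        then have "z \<notin> cube a (\<rho> / 2)" using sub by blast
        then show ?thesis using False bump_eq_0[of "\<rho> / 2" z a] \<rho> by (simp add: mem_cube)
      qed simp
    qed simp
    also have "\<dots> = ?m" using \<rho> integral_bump[of "\<rho> / 2" a] by (simp add: integral_completion)
    finally show ?thesis by simp
  qed
  have ub: "(LINT z:\<Omega>|lebesgue. H z * ?b z) \<le> k * ?m"
    if "continuous_on \<Omega> H" "\<And>z. z \<in> cube a (\<rho> / 2) \<Longrightarrow> H z \<le> k" for H k
  proof -
    have "(LINT z:\<Omega>|lebesgue. H z * ?b z) \<le> (LINT z:\<Omega>|lebesgue. k * ?b z)"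
    proof (rule set_integral_mono)
      fix z
      show "H z * ?b z \<le> k * ?b z"
      proof (cases "z \<in> cube a (\<rho> / 2)")
        case True
        then show ?thesis using that(2) bump_nonneg by (intro mult_right_mono) auto
      next
        case False
        then show ?thesis using bump_eq_0[of "\<rho> / 2" z a] \<rho> by (simp add: mem_cube)
      qed
    qed (use that(1) int in auto)
    then show ?thesis by (simp only: mass)
  qed
  have lu: "v - e \<le> F z \<and> F z \<le> v + e" if "z \<in> cube a (\<rho> / 2)" for z
    using close[OF that] by linarith
  have "(LINT z:\<Omega>|lebesgue. F z * ?b z) \<le> (v + e) * ?m"
    by (rule ub[OF F]) (use lu in blast)
  then have 1: "wmean \<Omega> F a \<rho> \<le> v + e" unfolding wmean_def using m by (simp only: pos_divide_le_eq)
  have "(LINT z:\<Omega>|lebesgue. (- F z) * ?b z) \<le> (e - v) * ?m"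
    by (rule ub) (use lu F in \<open>auto intro: continuous_on_minus\<close>, smt (verit) lu)
  then have "(v - e) * ?m \<le> (LINT z:\<Omega>|lebesgue. F z * ?b z)"
    using set_integral_uminus[OF int[OF F]] by (simp add: algebra_simps)
  then have 2: "v - e \<le> wmean \<Omega> F a \<rho>" unfolding wmean_def using m by (simp only: pos_le_divide_eq)
  show ?thesis using 1 2 by linarith
qed

text \<open>The cone has the vertex \<open>x\<close>, which need not belong to \<open>\<Omega>\<close>, and the base \<open>cube c r\<close>. Its slices are
  parametrised by \<open>s \<ge> 1\<close>, with \<open>s = 1\<close> for the base. The energy of the slices may grow like
  \<open>s powr \<kappa>\<close> towards the vertex.\<close>

locale cone =
  fixes \<Omega> :: "(real ^ 'n) set" and F :: "real ^ 'n \<Rightarrow> real" and G :: "real ^ 'n \<Rightarrow> real ^ 'n"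
    and p \<kappa> \<eta> :: real and x c :: "real ^ 'n" and r E :: real
  assumes op: "open \<Omega>" and contF: "continuous_on \<Omega> F" and wg: "weak_gradient \<Omega> F G"
    and \<kappa>: "0 \<le> \<kappa>" "real CARD('n) + \<kappa> < p" and \<eta>: "0 \<le> \<eta>" and r: "r > 0"
    and xc: "infnorm (x - c) \<le> \<eta> * r"
    and vis: "\<And>t. 0 < t \<Longrightarrow> t \<le> 1 \<Longrightarrow> cube (x + t *\<^sub>R (c - x)) (t * r) \<subseteq> \<Omega>"
    and pint: "set_integrable lebesgue \<Omega> (\<lambda>z. infnorm (G z) powr p)"
    and E0: "E \<ge> 0"
    and E: "\<And>s. s \<ge> 1 \<Longrightarrow>
      (LINT z:cube (x + (1 / s) *\<^sub>R (c - x)) (r / (2 * s))|lebesgue. infnorm (G z) powr p) \<le> s powr \<kappa> * E"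
begin

abbreviation ctr :: "real \<Rightarrow> real ^ 'n" where "ctr s \<equiv> x + (1 / s) *\<^sub>R (c - x)"

text \<open>Component \<open>i\<close> of the vector field whose divergence is the derivative of the rescaled bump with respect
  to \<open>s\<close>; it is radial with respect to the vertex.\<close>

definition \<Phi> :: "'n \<Rightarrow> real \<Rightarrow> real ^ 'n \<Rightarrow> real" where
  "\<Phi> i s z = s ^ (CARD('n) - 1) * (z $ i - x $ i) * bump (ctr s) (r / (2 * s)) z"

definition B :: "'n \<Rightarrow> real \<Rightarrow> real ^ 'n \<Rightarrow> real" where
  "B i s z = partial_deriv i (bump 0 1) ((2 / r) *\<^sub>R (s *\<^sub>R (z - x) - (c - x)))"

lemma scaled_arg: "s > 0 \<Longrightarrow> (1 / (r / (2 * s))) *\<^sub>R (z - ctr s) = (2 / r) *\<^sub>R (s *\<^sub>R (z - x) - (c - x))"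
  using r by (simp add: vec_eq_iff field_simps)

lemma N_pos: "CARD('n) > 0" by simp

lemma p_gt_1: "p > 1"
  using \<kappa> N_pos by linarith

lemma partial_deriv_\<Phi>:
  assumes s: "s > 0"
  shows "partial_deriv i (\<Phi> i s) z
    = s ^ (CARD('n) - 1) * (bump (ctr s) (r / (2 * s)) z + (z $ i - x $ i) * (2 * s / r) * B i s z)"
proof -
  have "((\<lambda>z. z $ i - x $ i) has_derivative (\<lambda>h. h $ i)) (at z)"
    using bounded_linear_imp_has_derivative[OF bounded_linear_vec_nth[of i], of "at z"]
    by (auto intro!: derivative_eq_intros)
  moreover have "(bump (ctr s) (r / (2 * s)) has_derivative
      (\<lambda>h. \<Sum>j\<in>UNIV. (h $ j / (r / (2 * s))) * B j s z)) (at z)"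
    using bump_has_derivative[of "r / (2 * s)" "ctr s" z] s r
    by (simp only: B_def scaled_arg[OF s] divide_eq_0_iff) simp
  ultimately have "((\<lambda>z. (z $ i - x $ i) * bump (ctr s) (r / (2 * s)) z) has_derivative
      (\<lambda>h. (z $ i - x $ i) * (\<Sum>j\<in>UNIV. (h $ j / (r / (2 * s))) * B j s z) + h $ i * bump (ctr s) (r / (2 * s)) z)) (at z)"
    by (rule has_derivative_mult)
  from has_derivative_mult_right[OF this, of "s ^ (CARD('n) - 1)"]
  have "partial_deriv i (\<Phi> i s) z = s ^ (CARD('n) - 1) * ((z $ i - x $ i) * (\<Sum>j\<in>UNIV. (axis i 1 $ j / (r / (2 * s))) * B j s z)
      + axis i 1 $ i * bump (ctr s) (r / (2 * s)) z)"
    unfolding \<Phi>_def[abs_def] mult.assoc by (rule partial_deriv_eq)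
  also have "(\<Sum>j\<in>UNIV. (axis i 1 $ j / (r / (2 * s))) * B j s z) = (\<Sum>j\<in>UNIV. if j = i then (2 * s / r) * B i s z else 0)"
    by (rule sum.cong) (use s r in \<open>auto simp: axis_def field_simps\<close>)
  finally show ?thesis by (simp add: algebra_simps)
qed

text \<open>As the cube shrinks towards \<open>x\<close>, the rescaled bump changes by a divergence; this is what lets
  the weak gradient see the change of the mean.\<close>

lemma bump_scaling_derivative:
  assumes s: "s > 0"
  shows "((\<lambda>s. s ^ CARD('n) * bump (ctr s) (r / (2 * s)) z) has_real_derivative
    (\<Sum>i\<in>UNIV. partial_deriv i (\<Phi> i s) z)) (at s)"
proof -
  let ?w = "\<lambda>s. (2 / r) *\<^sub>R (s *\<^sub>R (z - x) - (c - x))"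
  have "(?w has_derivative (\<lambda>h. (2 / r) *\<^sub>R (h *\<^sub>R (z - x)))) (at s)"
    by (auto intro!: derivative_eq_intros)
  from has_derivative_compose[OF this has_derivative_partial_deriv[OF smooth_differentiable[OF smooth_bump]]]
  have "((\<lambda>s. bump 0 1 (?w s)) has_derivative
      (\<lambda>h. \<Sum>i\<in>UNIV. ((2 / r) *\<^sub>R (h *\<^sub>R (z - x))) $ i * B i s z)) (at s)"
    by (simp add: B_def)
  then have 1: "((\<lambda>s. bump 0 1 (?w s)) has_real_derivative
      (\<Sum>i\<in>UNIV. (2 / r) * (z $ i - x $ i) * B i s z)) (at s)"
    unfolding has_field_derivative_def
    by (rule has_derivative_eq_rhs) (auto simp: sum_distrib_left sum_distrib_right mult_ac)
  have 2: "((\<lambda>s. s ^ CARD('n)) has_real_derivative real CARD('n) * s ^ (CARD('n) - 1)) (at s)"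
    using DERIV_pow[of "CARD('n)" s] by simp
  \<comment> \<open>The divergence contains the bump \<open>n\<close> times, from the derivative of the factor \<open>z $ i - x $ i\<close>; this
    matches the derivative of \<open>s ^ n\<close>, and the remaining terms match the chain rule.\<close>
  have "(\<Sum>i\<in>UNIV. partial_deriv i (\<Phi> i s) z)
      = s ^ (CARD('n) - 1) * (\<Sum>i\<in>UNIV. bump 0 1 (?w s) + s * ((2 / r) * (z $ i - x $ i) * B i s z))"
  proof -
    have "bump (ctr s) (r / (2 * s)) z = bump 0 1 (?w s)"
      using s r bump_scale[of "r / (2 * s)" "ctr s" z] unfolding scaled_arg[OF s] by simp
    then show ?thesis
      unfolding sum_distrib_left by (intro sum.cong) (auto simp: partial_deriv_\<Phi>[OF s] mult_ac)
  qed
  also have "k * (\<Sum>i\<in>UNIV. b + s * f i) = real CARD('n) * k * b + (\<Sum>i\<in>UNIV. f i) * (s * k)"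
    for k b and f :: "'n \<Rightarrow> real"
    by (simp add: sum.distrib sum_distrib_left[symmetric] algebra_simps)
  also have "s * s ^ (CARD('n) - 1) = s ^ CARD('n)" using power_minus_mult[OF N_pos, of s] by (simp add: mult.commute)
  finally have "((\<lambda>s. s ^ CARD('n) * bump 0 1 (?w s)) has_real_derivative (\<Sum>i\<in>UNIV. partial_deriv i (\<Phi> i s) z)) (at s)"
    by (intro DERIV_cong[OF DERIV_mult[OF 2 1]]) (rule sym)
  then show ?thesis
  proof (rule has_field_derivative_transform_within_open[where S = "{0<..}"])
    fix u :: real assume "u \<in> {0<..}"
    then show "u ^ CARD('n) * bump 0 1 (?w u) = u ^ CARD('n) * bump (ctr u) (r / (2 * u)) z"
      using r scaled_arg[of u z] bump_scale[of "r / (2 * u)" "ctr u" z] by simp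
  qed (use s in auto)
qed

lemma cube_ctr_subset: "s \<ge> 1 \<Longrightarrow> cube (ctr s) (r / (2 * s)) \<subseteq> \<Omega>"
proof -
  assume s: "s \<ge> 1"
  have "cube (ctr s) (r / (2 * s)) \<subseteq> cube (ctr s) (1 / s * r)"
    using s r by (auto simp: mem_cube field_simps)
  with vis[of "1 / s"] s show ?thesis by auto
qed

lemma cube_ctr_dist: "s \<ge> 1 \<Longrightarrow> z \<in> cube (ctr s) (r / (2 * s)) \<Longrightarrow> infnorm (z - x) \<le> (\<eta> + 1) * r / s"
proof -
  assume s: "s \<ge> 1" and z: "z \<in> cube (ctr s) (r / (2 * s))"
  have "infnorm (z - x) \<le> infnorm (z - ctr s) + infnorm ((1 / s) *\<^sub>R (c - x))"
    using infnorm_triangle_diff[of z x "ctr s"] by simp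
  also have "\<dots> \<le> r / (2 * s) + \<eta> * r / s"
    using z s xc by (intro add_mono) (auto simp: mem_cube infnorm_mul infnorm_sub[of c x] divide_right_mono)
  also have "\<dots> \<le> (\<eta> + 1) * r / s" using s r by (simp add: field_simps)
  finally show ?thesis .
qed

text \<open>A compact subset of \<open>\<Omega>\<close> that contains the supports of the bumps for all \<open>s\<close> between \<open>1\<close> and \<open>S\<close>: it
  provides the dominating function for differentiation under the integral.\<close>

definition trail :: "real \<Rightarrow> (real ^ 'n) set" where
  "trail S = (\<lambda>(t, y). x + t *\<^sub>R (y - x)) ` ({1 / S..1} \<times> cube c (r / 2))"

lemma compact_trail: "compact (trail S)"
  unfolding trail_def
  by (intro compact_continuous_image compact_Times compact_Icc compact_cube)
     (auto simp: case_prod_unfold intro!: continuous_intros)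

lemma trail_mem:
  assumes "1 \<le> s" "s \<le> S" "z \<in> cube (ctr s) (r / (2 * s))" shows "z \<in> trail S"
proof -
  have eq: "x + s *\<^sub>R (z - x) - c = s *\<^sub>R (z - ctr s)"
    using assms by (simp add: algebra_simps)
  have "infnorm (x + s *\<^sub>R (z - x) - c) \<le> r / 2"
    unfolding eq infnorm_mul using assms(1,3) by (simp add: mem_cube field_simps)
  moreover have "z = x + (1 / s) *\<^sub>R ((x + s *\<^sub>R (z - x)) - x)" using assms by simp
  ultimately show ?thesis unfolding trail_def
    using assms by (intro image_eqI[of _ _ "(1 / s, x + s *\<^sub>R (z - x))"]) (auto simp: mem_cube frac_le)
qed

lemma trail_subset: "S \<ge> 1 \<Longrightarrow> trail S \<subseteq> \<Omega>"
proof (safe)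
  fix z assume S: "S \<ge> 1" and "z \<in> trail S"
  then obtain t y where t: "1 / S \<le> t" "t \<le> 1" "infnorm (y - c) \<le> r / 2" "z = x + t *\<^sub>R (y - x)"
    by (auto simp: trail_def mem_cube)
  have t0: "t > 0" using t(1) S by (smt (verit) zero_less_divide_1_iff)
  have "z - (x + t *\<^sub>R (c - x)) = t *\<^sub>R (y - c)" using t(4) by (simp add: algebra_simps)
  then have "z \<in> cube (x + t *\<^sub>R (c - x)) (t * r)" using t t0 r by (simp add: mem_cube infnorm_mul)
  then show "z \<in> \<Omega>" using vis[OF t0 t(2)] by blast
qed

text \<open>The mean at scale \<open>1 / s\<close> up to a factor that does not depend on \<open>s\<close>, see \<open>wmean_eq\<close>.\<close>

definition A :: "real \<Rightarrow> real" where
  "A s = (LINT z:\<Omega>|lebesgue. F z * (s ^ CARD('n) * bump (ctr s) (r / (2 * s)) z))"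

lemma smooth_\<Phi>: "smooth (\<Phi> i s)"
  unfolding \<Phi>_def[abs_def] by (intro smooth_intros smooth_bump)

lemma \<Phi>_eq_0: "s > 0 \<Longrightarrow> z \<notin> cube (ctr s) (r / (2 * s)) \<Longrightarrow> \<Phi> i s z = 0"
  using bump_eq_0[of "r / (2 * s)" z "ctr s"] r by (simp add: \<Phi>_def mem_cube)

lemma partial_deriv_\<Phi>_eq_0:
  assumes "s > 0" "z \<notin> cube (ctr s) (r / (2 * s))"
  shows "partial_deriv i (\<Phi> i s) z = 0"
proof -
  have out: "infnorm (z - ctr s) > r / (2 * s)" using assms by (simp add: mem_cube)
  have "infnorm ((1 / (r / (2 * s))) *\<^sub>R (z - ctr s)) > 1"
    unfolding infnorm_mul using out assms r by (simp add: field_simps)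
  then have "B i s z = 0" unfolding B_def scaled_arg[OF assms(1), symmetric] by (rule bump_partial_deriv_eq_0)
  moreover have "bump (ctr s) (r / (2 * s)) z = 0" using out assms r by (intro bump_eq_0) auto
  ultimately show ?thesis by (simp add: partial_deriv_\<Phi>[OF assms(1)])
qed

lemma partial_deriv_\<Phi>_bound:
  assumes "S \<ge> 1"
  obtains D where "\<And>i s z. 1 \<le> s \<Longrightarrow> s \<le> S \<Longrightarrow> \<bar>partial_deriv i (\<Phi> i s) z\<bar> \<le> D * indicator (trail S) z"
proof -
  obtain M where M: "M \<ge> 0" "\<And>i z. \<bar>partial_deriv i (bump 0 1) (z :: real ^ 'n)\<bar> \<le> M"
    using bump_partial_deriv_bounded by metis
  define D where "D = S ^ (CARD('n) - 1) * (1 + ((\<eta> + 1) * r) * (2 * S / r) * M)"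
  have D0: "D \<ge> 0" using assms M r \<eta> by (simp add: D_def)
  have "\<bar>partial_deriv i (\<Phi> i s) z\<bar> \<le> D * indicator (trail S) z" if s: "1 \<le> s" "s \<le> S" for i s z
  proof (cases "z \<in> cube (ctr s) (r / (2 * s))")
    case True
    have "\<bar>z $ i - x $ i\<bar> \<le> infnorm (z - x)" using component_le_infnorm_cart[of "z - x" i] by simp
    also have "\<dots> \<le> (\<eta> + 1) * r / s" by (rule cube_ctr_dist[OF s(1) True])
    also have "\<dots> \<le> (\<eta> + 1) * r"
      using s r \<eta> mult_left_mono[of 1 s "(\<eta> + 1) * r"] by (simp add: pos_divide_le_eq)
    finally have zx: "\<bar>z $ i - x $ i\<bar> \<le> (\<eta> + 1) * r" .
    have "\<bar>partial_deriv i (\<Phi> i s) z\<bar> = s ^ (CARD('n) - 1) * \<bar>bump (ctr s) (r / (2 * s)) z + (z $ i - x $ i) * (2 * s / r) * B i s z\<bar>"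
      using s by (simp add: partial_deriv_\<Phi> abs_mult)
    also have "\<dots> \<le> s ^ (CARD('n) - 1) * (\<bar>bump (ctr s) (r / (2 * s)) z\<bar> + \<bar>z $ i - x $ i\<bar> * (2 * s / r) * \<bar>B i s z\<bar>)"
      using s r by (intro mult_left_mono order_trans[OF abs_triangle_ineq]) (auto simp: abs_mult)
    also have "\<dots> \<le> D" unfolding D_def
      using s r M zx \<eta> bump_nonneg[of "ctr s" "r / (2 * s)" z] bump_le_1[of "ctr s" "r / (2 * s)" z]
      by (intro mult_mono add_mono power_mono divide_right_mono) (auto simp: B_def)
    finally show ?thesis using trail_mem[OF s True] by simp
  next
    case False
    then show ?thesis using partial_deriv_\<Phi>_eq_0[of s z i] s D0 by simp
  qed
  then show ?thesis by (rule that)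
qed

lemma test_\<Phi>: "s \<ge> 1 \<Longrightarrow> test_function \<Omega> (\<Phi> i s)"
  by (rule test_function_smooth[OF smooth_\<Phi> compact_cube cube_ctr_subset]) (auto intro: \<Phi>_eq_0)

text \<open>Differentiation under the integral turns \<open>A\<close> into the integral of \<open>F\<close> against a divergence; the
  components of the field are test functions, so the derivatives move to \<open>G\<close>.\<close>

lemma A_derivative:
  assumes s: "1 \<le> s" "s \<le> S"
  shows "(A has_real_derivative - (\<Sum>i\<in>UNIV. (LINT z:\<Omega>|lebesgue. G z $ i * \<Phi> i s z))) (at s within {1..S})"
proof -
  have S: "S \<ge> 1" using s by simp
  obtain D where D: "\<And>i s z. 1 \<le> s \<Longrightarrow> s \<le> S \<Longrightarrow> \<bar>partial_deriv i (\<Phi> i s) z\<bar> \<le> D * indicator (trail S) z"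
    using partial_deriv_\<Phi>_bound[OF S] by metis
  obtain BF where BF: "BF \<ge> 0" "\<And>z. z \<in> trail S \<Longrightarrow> \<bar>F z\<bar> \<le> BF"
    using continuous_bounded_on_compact[OF compact_trail continuous_on_subset[OF contF trail_subset[OF S]]] by metis
  have int: "set_integrable lebesgue \<Omega> (\<lambda>z. F z * (t ^ CARD('n) * bump (ctr t) (r / (2 * t)) z))" if t: "1 \<le> t" "t \<le> S" for t
  proof (rule set_integrable_mult_compact_support[OF op contF compact_trail trail_subset[OF S]])
    show "(\<lambda>z. t ^ CARD('n) * bump (ctr t) (r / (2 * t)) z) \<in> borel_measurable lebesgue"
      by (intro smooth_measurable smooth_intros smooth_bump)
    show "\<bar>t ^ CARD('n) * bump (ctr t) (r / (2 * t)) z\<bar> \<le> t ^ CARD('n) * indicat_real (trail S) z" for z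
    proof -
      have "\<bar>bump (ctr t) (r / (2 * t)) z\<bar> \<le> indicat_real (cube (ctr t) (r / (2 * t))) z"
        using abs_bump_le[of "r / (2 * t)" "ctr t" z] t r by simp
      also have "\<dots> \<le> indicat_real (trail S) z"
        using trail_mem[OF t, of z] by (auto simp: indicator_def)
      finally show ?thesis using t by (simp add: abs_mult)
    qed
  qed
  have intp: "set_integrable lebesgue \<Omega> (\<lambda>z. F z * partial_deriv i (\<Phi> i t) z)" if t: "1 \<le> t" "t \<le> S" for i t
    by (rule set_integrable_mult_compact_support[OF op contF compact_trail trail_subset[OF S]
          smooth_measurable[OF smooth_partial_deriv[OF smooth_\<Phi>]] D[OF t]])
  have "((\<lambda>t. LINT z|lebesgue. indicator \<Omega> z *\<^sub>R (F z * (t ^ CARD('n) * bump (ctr t) (r / (2 * t)) z))) has_real_derivative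
      (LINT z|lebesgue. indicator \<Omega> z *\<^sub>R (F z * (\<Sum>i\<in>UNIV. partial_deriv i (\<Phi> i s) z)))) (at s within {1..S})"
  proof (rule integral_has_derivative_dominated[where w = "\<lambda>z. BF * (real CARD('n) * D) * indicator (trail S) z"
        and h' = "\<lambda>s z. indicator \<Omega> z *\<^sub>R (F z * (\<Sum>i\<in>UNIV. partial_deriv i (\<Phi> i s) z))"])
    show "integrable lebesgue (\<lambda>z. BF * (real CARD('n) * D) * indicat_real (trail S) z)"
      by (intro integrable_mult_right integrable_indicator_compact compact_trail)
    fix t assume "t \<in> {1..S}"
    then have t: "1 \<le> t" "t \<le> S" by auto
    show "integrable lebesgue (\<lambda>z. indicator \<Omega> z *\<^sub>R (F z * (t ^ CARD('n) * bump (ctr t) (r / (2 * t)) z)))"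
      using int[OF t] by (simp add: set_integrable_def)
    fix z
    have "((\<lambda>t. (indicator \<Omega> z * F z) * (t ^ CARD('n) * bump (ctr t) (r / (2 * t)) z)) has_real_derivative
        (indicator \<Omega> z * F z) * (\<Sum>i\<in>UNIV. partial_deriv i (\<Phi> i t) z)) (at t)"
      using t by (intro DERIV_cmult bump_scaling_derivative) auto
    then show "((\<lambda>t. indicator \<Omega> z *\<^sub>R (F z * (t ^ CARD('n) * bump (ctr t) (r / (2 * t)) z))) has_real_derivative
        indicator \<Omega> z *\<^sub>R (F z * (\<Sum>i\<in>UNIV. partial_deriv i (\<Phi> i t) z))) (at t within {1..S})"
      by (simp add: mult.assoc has_field_derivative_at_within)
    have "\<bar>\<Sum>i\<in>UNIV. partial_deriv i (\<Phi> i t) z\<bar> \<le> (\<Sum>i\<in>(UNIV :: 'n set). D * indicator (trail S) z)"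
      using D[OF t] by (intro order_trans[OF sum_abs] sum_mono)
    then have sb: "\<bar>\<Sum>i\<in>UNIV. partial_deriv i (\<Phi> i t) z\<bar> \<le> (real CARD('n) * D) * indicator (trail S) z" by simp
    show "\<bar>indicator \<Omega> z *\<^sub>R (F z * (\<Sum>i\<in>UNIV. partial_deriv i (\<Phi> i t) z))\<bar>
        \<le> BF * (real CARD('n) * D) * indicat_real (trail S) z"
    proof (cases "z \<in> trail S")
      case True
      then have "\<bar>F z\<bar> * \<bar>\<Sum>i\<in>UNIV. partial_deriv i (\<Phi> i t) z\<bar> \<le> BF * (real CARD('n) * D)"
        using sb BF by (intro mult_mono) auto
      then show ?thesis using True trail_subset[OF S] by (auto simp: abs_mult)
    next
      case False
      then have "(\<Sum>i\<in>UNIV. partial_deriv i (\<Phi> i t) z) = 0" using sb by simp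
      then show ?thesis using False by simp
    qed
  next
    show "(\<lambda>z. indicator \<Omega> z *\<^sub>R (F z * (\<Sum>i\<in>UNIV. partial_deriv i (\<Phi> i s) z))) \<in> borel_measurable lebesgue"
    proof -
      have "(\<lambda>z. (indicator \<Omega> z *\<^sub>R F z) * (\<Sum>i\<in>UNIV. partial_deriv i (\<Phi> i s) z)) \<in> borel_measurable lebesgue"
        by (intro borel_measurable_times borel_measurable_sum borel_measurable_indicator_mult_continuous op contF
            smooth_measurable smooth_partial_deriv smooth_\<Phi>)
      then show ?thesis by (simp add: mult.assoc)
    qed
  qed (use s in auto)
  moreover have "(LINT z|lebesgue. indicator \<Omega> z *\<^sub>R (F z * (\<Sum>i\<in>UNIV. partial_deriv i (\<Phi> i s) z)))
      = (LINT z|lebesgue. (\<Sum>i\<in>UNIV. indicator \<Omega> z *\<^sub>R (F z * partial_deriv i (\<Phi> i s) z)))"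
    by (rule Bochner_Integration.integral_cong) (auto simp: sum_distrib_left)
  moreover have "\<dots> = (\<Sum>i\<in>UNIV. (LINT z:\<Omega>|lebesgue. F z * partial_deriv i (\<Phi> i s) z))"
    using intp[OF s] unfolding set_lebesgue_integral_def set_integrable_def
    by (intro Bochner_Integration.integral_sum) auto
  moreover have "\<dots> = (\<Sum>i\<in>UNIV. - (LINT z:\<Omega>|lebesgue. G z $ i * \<Phi> i s z))"
    using wg test_\<Phi>[OF s(1)] unfolding weak_gradient_def by (intro sum.cong) blast+
  ultimately show ?thesis
    unfolding A_def[abs_def] set_lebesgue_integral_def by (simp add: sum_negf)
qed

lemma set_integrable_infnorm_grad:
  assumes "compact K" "K \<subseteq> \<Omega>"
  shows "set_integrable lebesgue K (\<lambda>z. infnorm (G z))"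
proof -
  have G: "set_integrable lebesgue K G" using wg assms by (auto simp: weak_gradient_def)
  have eq: "infnorm (indicator K z *\<^sub>R G z) = indicator K z *\<^sub>R infnorm (G z)" for z
    by (auto simp: indicator_def infnorm_0)
  show ?thesis unfolding set_integrable_def
  proof (rule Bochner_Integration.integrable_bound[OF G[unfolded set_integrable_def]])
    have "(\<lambda>z. infnorm (indicator K z *\<^sub>R G z)) \<in> borel_measurable lebesgue"
      using G unfolding set_integrable_def
      by (intro borel_measurable_continuous_on[of infnorm] continuous_intros borel_measurable_integrable)
    then show "(\<lambda>z. indicat_real K z *\<^sub>R infnorm (G z)) \<in> borel_measurable lebesgue" by (simp add: eq)
    show "AE z in lebesgue. norm (indicat_real K z *\<^sub>R infnorm (G z)) \<le> norm (indicat_real K z *\<^sub>R G z)"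
      by (intro AE_I2) (auto simp: indicator_def infnorm_le_norm infnorm_pos_le)
  qed
qed

lemma integral_infnorm_grad_cube:
  assumes s: "s \<ge> 1"
  shows "(LINT z:cube (ctr s) (r / (2 * s))|lebesgue. infnorm (G z))
    \<le> 2 * ((r / s) ^ CARD('n)) powr (1 - 1 / p) * (s powr \<kappa> * E) powr (1 / p)"
proof (rule le_powr_of_all_scales)
  let ?W = "cube (ctr s) (r / (2 * s))"
  show "(r / s) ^ CARD('n) > 0" using s r by simp
  show "s powr \<kappa> * E \<ge> 0" using E0 by simp
  show "p > 1" by (rule p_gt_1)
  fix l :: real assume l: "l > 0"
  have i1: "set_integrable lebesgue ?W (\<lambda>z. infnorm (G z))"
    by (rule set_integrable_infnorm_grad[OF compact_cube cube_ctr_subset[OF s]])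
  have i2: "set_integrable lebesgue ?W (\<lambda>z. infnorm (G z) powr p)"
    by (rule set_integrable_subset[OF pint _ cube_ctr_subset[OF s]]) (simp add: sets_lebesgue_compact compact_cube)
  have i3: "set_integrable lebesgue ?W (\<lambda>z. l)"
    using integrable_mult_right[OF integrable_indicator_compact[OF compact_cube], of l "ctr s" "r / (2 * s)"]
    unfolding set_integrable_def by (simp add: mult.commute)
  have vol: "(LINT z:?W|lebesgue. l) = l * (r / s) ^ CARD('n)"
  proof -
    have "(LINT z:?W|lebesgue. l) = l * measure lebesgue ?W"
      unfolding set_lebesgue_integral_def by (simp add: mult.commute)
    then show ?thesis using s r measure_cube[of "r / (2 * s)" "ctr s"] by (simp add: measure_completion)
  qed
  have "(LINT z:?W|lebesgue. infnorm (G z)) \<le> (LINT z:?W|lebesgue. l + l powr (1 - p) * infnorm (G z) powr p)"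
    using le_add_powr[OF infnorm_pos_le l p_gt_1]
    by (intro set_integral_mono i1 set_integral_add set_integrable_mult_right i2 i3) auto
  also have "\<dots> = (LINT z:?W|lebesgue. l) + (LINT z:?W|lebesgue. l powr (1 - p) * infnorm (G z) powr p)"
    by (intro set_integral_add set_integrable_mult_right i2 i3)
  also have "\<dots> \<le> l * (r / s) ^ CARD('n) + l powr (1 - p) * (s powr \<kappa> * E)"
    using E[OF s] by (simp add: vol mult_left_mono)
  finally show "(LINT z:?W|lebesgue. infnorm (G z)) \<le> l * (r / s) ^ CARD('n) + l powr (1 - p) * (s powr \<kappa> * E)" .
qed

text \<open>The field has size at most \<open>s ^ (n - 1) * (\<eta> + 1) * r / s\<close> and lives on a cube of radius \<open>r / (2 * s)\<close>;
  the integral of \<open>|G|\<close> over that cube is estimated by Hoelder's inequality.\<close>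

lemma A_derivative_bound:
  assumes s: "s \<ge> 1"
  shows "\<bar>\<Sum>i\<in>UNIV. (LINT z:\<Omega>|lebesgue. G z $ i * \<Phi> i s z)\<bar>
    \<le> (2 * real CARD('n) * (\<eta> + 1) * r powr (1 + real CARD('n) - real CARD('n) / p) * E powr (1 / p)) * s powr ((real CARD('n) + \<kappa>) / p - 2)"
proof -
  let ?W = "cube (ctr s) (r / (2 * s))"
  define b where "b = s ^ (CARD('n) - 1) * ((\<eta> + 1) * r / s)"
  have b0: "b \<ge> 0" using s r \<eta> by (simp add: b_def)
  have \<Phi>b: "\<bar>\<Phi> i s z\<bar> \<le> b * indicator ?W z" for i z
  proof (cases "z \<in> ?W")
    case True
    have "\<bar>z $ i - x $ i\<bar> \<le> (\<eta> + 1) * r / s"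
      using cube_ctr_dist[OF s True] component_le_infnorm_cart[of "z - x" i] by simp
    then have "s ^ (CARD('n) - 1) * \<bar>z $ i - x $ i\<bar> * bump (ctr s) (r / (2 * s)) z \<le> s ^ (CARD('n) - 1) * ((\<eta> + 1) * r / s) * 1"
      using s r \<eta> by (intro mult_mono) (auto simp: bump_nonneg bump_le_1)
    then show ?thesis using True s by (simp add: \<Phi>_def b_def abs_mult bump_nonneg)
  next
    case False
    then show ?thesis using \<Phi>_eq_0[of s z i] s by simp
  qed
  have one: "\<bar>LINT z:\<Omega>|lebesgue. G z $ i * \<Phi> i s z\<bar> \<le> b * (LINT z:?W|lebesgue. infnorm (G z))" for i
  proof -
    have "\<bar>LINT z:\<Omega>|lebesgue. G z $ i * \<Phi> i s z\<bar> \<le> (LINT z|lebesgue. b * (indicator ?W z *\<^sub>R infnorm (G z)))"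
      unfolding set_lebesgue_integral_def real_norm_def[symmetric]
    proof (rule Bochner_Integration.integral_norm_bound_integral)
      have "set_integrable lebesgue ?W (\<lambda>z. G z $ i)"
        using wg cube_ctr_subset[OF s] compact_cube
        by (intro set_integrable_component) (auto simp: weak_gradient_def)
      from set_integrable_bounded_mult_compact_support[OF this cube_ctr_subset[OF s] smooth_measurable[OF smooth_\<Phi>] \<Phi>b]
      show "integrable lebesgue (\<lambda>z. indicat_real \<Omega> z *\<^sub>R (G z $ i * \<Phi> i s z))"
        by (simp add: set_integrable_def)
      show "integrable lebesgue (\<lambda>z. b * (indicat_real ?W z *\<^sub>R infnorm (G z)))"
        using set_integrable_infnorm_grad[OF compact_cube cube_ctr_subset[OF s]]
        unfolding set_integrable_def by (rule integrable_mult_right)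
      fix z
      have "\<bar>G z $ i\<bar> * \<bar>\<Phi> i s z\<bar> \<le> infnorm (G z) * (b * indicator ?W z)"
        using \<Phi>b[of i z] by (intro mult_mono component_le_infnorm_cart infnorm_pos_le) auto
      then show "norm (indicat_real \<Omega> z *\<^sub>R (G z $ i * \<Phi> i s z)) \<le> b * (indicat_real ?W z *\<^sub>R infnorm (G z))"
        using b0 by (auto simp: abs_mult indicator_def infnorm_pos_le mult_ac)
    qed
    then show ?thesis by (simp add: set_lebesgue_integral_def)
  qed
  have "\<bar>\<Sum>i\<in>UNIV. (LINT z:\<Omega>|lebesgue. G z $ i * \<Phi> i s z)\<bar> \<le> (\<Sum>i\<in>(UNIV :: 'n set). b * (LINT z:?W|lebesgue. infnorm (G z)))"
    using one by (intro order_trans[OF sum_abs] sum_mono)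
  also have "\<dots> = real CARD('n) * (b * (LINT z:?W|lebesgue. infnorm (G z)))" by simp
  also have "\<dots> \<le> real CARD('n) * (b * (2 * ((r / s) ^ CARD('n)) powr (1 - 1 / p) * (s powr \<kappa> * E) powr (1 / p)))"
    using integral_infnorm_grad_cube[OF s] b0 by (intro mult_left_mono) auto
  also have "\<dots> = (2 * real CARD('n) * (\<eta> + 1) * r powr (1 + real CARD('n) - real CARD('n) / p) * E powr (1 / p)) * s powr ((real CARD('n) + \<kappa>) / p - 2)"
  proof -
    have sN: "s ^ (CARD('n) - 1) = s powr (real CARD('n) - 1)" using s N_pos by (simp add: powr_realpow[symmetric] of_nat_diff)
    have e1: "((r / s) ^ CARD('n)) powr (1 - 1 / p)
        = r powr (real CARD('n) - real CARD('n) / p) * s powr (real CARD('n) / p - real CARD('n))"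
    proof -
      have "((r / s) ^ CARD('n)) powr (1 - 1 / p) = (r / s) powr (real CARD('n) - real CARD('n) / p)"
        using s r by (simp add: powr_realpow[symmetric] powr_powr right_diff_distrib)
      also have "\<dots> = r powr (real CARD('n) - real CARD('n) / p) / s powr (real CARD('n) - real CARD('n) / p)"
        using s r by (simp add: powr_divide)
      also have "\<dots> = r powr (real CARD('n) - real CARD('n) / p) * s powr (- (real CARD('n) - real CARD('n) / p))"
        unfolding powr_minus by (simp add: divide_inverse)
      finally show ?thesis by simp
    qed
    have e2: "(s powr \<kappa> * E) powr (1 / p) = s powr (\<kappa> / p) * E powr (1 / p)"
      using s E0 by (simp add: powr_mult powr_powr)
    have e3: "s powr (real CARD('n) - 1) / s * s powr (real CARD('n) / p - real CARD('n)) * s powr (\<kappa> / p)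
        = s powr ((real CARD('n) + \<kappa>) / p - 2)"
    proof -
      have "s powr (real CARD('n) - 1) / s = s powr (real CARD('n) - 1 - 1)" using s by (subst powr_diff) auto
      then show ?thesis by (simp add: powr_add[symmetric] add_divide_distrib algebra_simps)
    qed
    have e4: "r * r powr (real CARD('n) - real CARD('n) / p) = r powr (1 + real CARD('n) - real CARD('n) / p)"
      using r by (simp add: powr_mult_base algebra_simps)
    have "n * (q * (d * r / s) * (2 * (ra * sb) * (sk * e))) = (2 * n * d * (r * ra) * e) * (q / s * sb * sk)"
      for n q d ra sb sk e :: real
      by (simp add: mult_ac)
    then show ?thesis unfolding b_def sN e1 e2 e3[symmetric] e4[symmetric] .
  qed
  finally show ?thesis .
qed

text \<open>The bound for the derivative is integrable up to \<open>s = \<infinity>\<close> precisely because \<open>p\<close> exceeds the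
  dimension, with room for the exponent \<open>\<kappa>\<close>.\<close>

lemma A_variation:
  assumes S: "S \<ge> 1"
  shows "\<bar>A S - A 1\<bar> \<le> 2 * real CARD('n) * (\<eta> + 1) * r powr (1 + real CARD('n) - real CARD('n) / p) * E powr (1 / p) / (1 - (real CARD('n) + \<kappa>) / p)"
proof (cases "S = 1")
  case False
  define q where "q = (real CARD('n) + \<kappa>) / p"
  have q: "q < 1" using \<kappa> p_gt_1 by (simp add: q_def)
  define K where "K = 2 * real CARD('n) * (\<eta> + 1) * r powr (1 + real CARD('n) - real CARD('n) / p) * E powr (1 / p)"
  have K: "K \<ge> 0" using \<eta> by (simp add: K_def)
  \<comment> \<open>A primitive of the bound for the derivative of \<open>A\<close>, bounded because \<open>q < 1\<close>.\<close>
  define \<phi> where "\<phi> s = - K * s powr (q - 1) / (1 - q)" for s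
  have d\<phi>: "(\<phi> has_vector_derivative K * s powr (q - 2)) (at s)" if "s > 0" for s
  proof -
    have "(\<phi> has_real_derivative - K * ((q - 1) * s powr (q - 1 - 1)) / (1 - q)) (at s)"
      unfolding \<phi>_def by (intro DERIV_cdivide DERIV_cmult has_real_derivative_powr that)
    also have "- K * ((q - 1) * s powr (q - 1 - 1)) / (1 - q) = K * s powr (q - 2)"
      using q by (simp add: divide_eq_eq algebra_simps)
    finally show ?thesis by (simp add: has_real_derivative_iff_has_vector_derivative)
  qed
  have "norm (A S - A 1) \<le> \<phi> S - \<phi> 1"
  proof (rule differentiable_bound_general)
    show "1 < S" using S False by simp
    show "continuous_on {1..S} A"
      unfolding continuous_on_eq_continuous_within
      by (intro ballI DERIV_continuous[OF A_derivative]) auto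
    show "continuous_on {1..S} \<phi>"
      using q unfolding \<phi>_def by (intro continuous_intros) auto
    fix s assume s: "1 < s" "s < S"
    have "at s within {1..S} = at s" by (rule at_within_Icc_at[OF s])
    then show "(A has_vector_derivative - (\<Sum>i\<in>UNIV. (LINT z:\<Omega>|lebesgue. G z $ i * \<Phi> i s z))) (at s)"
      using A_derivative[of s S] s by (simp add: has_real_derivative_iff_has_vector_derivative)
    show "(\<phi> has_vector_derivative K * s powr (q - 2)) (at s)" using d\<phi> s by simp
    show "norm (- (\<Sum>i\<in>UNIV. (LINT z:\<Omega>|lebesgue. G z $ i * \<Phi> i s z))) \<le> K * s powr (q - 2)"
      using A_derivative_bound[of s] s by (simp add: K_def q_def)
  qed
  also have "\<dots> \<le> K / (1 - q)"
    using K q by (simp add: \<phi>_def)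
  finally show ?thesis by (simp add: K_def q_def)
qed (use \<eta> \<kappa> p_gt_1 in \<open>auto intro!: divide_nonneg_nonneg\<close>)

lemma wmean_eq: "s \<ge> 1 \<Longrightarrow> wmean \<Omega> F (ctr s) (r / s) = A s / ((r / 2) ^ CARD('n) * bump_mass TYPE('n))"
proof -
  assume s: "s \<ge> 1"
  have "A s = s ^ CARD('n) * (LINT z:\<Omega>|lebesgue. F z * bump (ctr s) (r / s / 2) z)"
    unfolding A_def by (simp add: mult.left_commute[of _ "s ^ CARD('n)"] mult.commute[of s 2])
  then show ?thesis using s by (simp add: wmean_def power_divide field_simps)
qed

end

text \<open>The factor \<open>2 ^ CARD('n) / bump_mass TYPE('n)\<close> is due to the normalisation of the means.\<close>

definition cone_const :: "('n :: finite) itself \<Rightarrow> real \<Rightarrow> real \<Rightarrow> real \<Rightarrow> real" where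
  "cone_const _ p \<kappa> \<eta> = 2 * real CARD('n) * (\<eta> + 1) / (1 - (real CARD('n) + \<kappa>) / p) * 2 ^ CARD('n) / bump_mass TYPE('n)"

lemma (in cone) wmean_variation:
  assumes "S \<ge> 1"
  shows "\<bar>wmean \<Omega> F (ctr S) (r / S) - wmean \<Omega> F c r\<bar> \<le> cone_const TYPE('n) p \<kappa> \<eta> * r powr (1 - real CARD('n) / p) * E powr (1 / p)"
proof -
  let ?m = "(r / 2) ^ CARD('n) * bump_mass TYPE('n)"
  have m: "?m > 0" using r bump_mass_pos[where 'n = 'n] by simp
  have "\<bar>wmean \<Omega> F (ctr S) (r / S) - wmean \<Omega> F c r\<bar> = \<bar>A S - A 1\<bar> / ?m"
    using wmean_eq[OF assms] wmean_eq[of 1] m by (simp add: diff_divide_distrib[symmetric] abs_divide)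
  also have "\<dots> \<le> 2 * real CARD('n) * (\<eta> + 1) * r powr (1 + real CARD('n) - real CARD('n) / p) * E powr (1 / p) / (1 - (real CARD('n) + \<kappa>) / p) / ?m"
    using A_variation[OF assms] m by (intro divide_right_mono) auto
  also have "r powr (1 + real CARD('n) - real CARD('n) / p) = r powr (1 - real CARD('n) / p) * r ^ CARD('n)"
    using r by (simp add: powr_realpow[symmetric] powr_add[symmetric] algebra_simps)
  also have "2 * real CARD('n) * (\<eta> + 1) * (r powr (1 - real CARD('n) / p) * r ^ CARD('n)) * E powr (1 / p) / (1 - (real CARD('n) + \<kappa>) / p) / ?m
      = cone_const TYPE('n) p \<kappa> \<eta> * r powr (1 - real CARD('n) / p) * E powr (1 / p)"
    using r by (simp add: cone_const_def power_divide)
  finally show ?thesis .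
qed

lemma ex_power_2_ivl:
  fixes x :: real
  assumes "x \<ge> 1"
  obtains k :: nat where "2 ^ k \<le> x" "x < 2 ^ Suc k"
proof -
  obtain m0 where m0: "x < 2 ^ m0" using real_arch_pow[of 2 x] by auto
  define m where "m = (LEAST m. x < 2 ^ m)"
  have m: "x < 2 ^ m" unfolding m_def using m0 by (rule LeastI)
  then have "m \<noteq> 0" using assms by (cases m) auto
  then obtain k where k: "m = Suc k" by (cases m) auto
  have "\<not> x < 2 ^ k" using not_less_Least[of k "\<lambda>m. x < 2 ^ m"] k by (simp add: m_def)
  then show ?thesis using that[of k] m k by simp
qed

text \<open>Of the disjoint cubes whose \<open>\<eta>\<close>-dilations contain a given point only boundedly many have size
  of a given order; so small weights on the large ones have a bounded sum.\<close>

lemma sum_powr_disjoint_cubes_le: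
  fixes c :: "'i \<Rightarrow> real ^ 'n"
  assumes fin: "finite I" and disj: "disjoint_family_on (\<lambda>i. cube (c i) (r i)) I"
    and \<rho>: "\<rho> > 0" "\<And>i. i \<in> I \<Longrightarrow> \<rho> \<le> r i"
    and z: "\<And>i. i \<in> I \<Longrightarrow> infnorm (z - c i) \<le> \<eta> * r i" and \<eta>: "\<eta> \<ge> 0" and \<kappa>: "\<kappa> > 0"
  shows "(\<Sum>i\<in>I. (\<rho> / r i) powr \<kappa>) \<le> (2 * (\<eta> + 1)) ^ CARD('n) / (1 - 2 powr (- \<kappa>))"
proof -
  have "\<exists>k :: nat. 2 ^ k \<le> r i / \<rho> \<and> r i / \<rho> < 2 ^ Suc k" if "i \<in> I" for i
    using ex_power_2_ivl[of "r i / \<rho>"] \<rho>(1) \<rho>(2)[OF that] by (metis le_divide_eq_1_pos)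
  \<comment> \<open>The number \<open>k i\<close> is the dyadic order of magnitude of \<open>r i\<close>.\<close>
  then obtain k where k: "\<And>i. i \<in> I \<Longrightarrow> 2 ^ k i \<le> r i / \<rho> \<and> r i / \<rho> < 2 ^ Suc (k i)" by metis
  let ?M = "(2 * (\<eta> + 1)) ^ CARD('n)" and ?q = "2 powr (- \<kappa>)"
  have q: "0 \<le> ?q" "?q < 1" using \<kappa> by (auto simp: powr_less_one)
  have M: "?M \<ge> 0" using \<eta> by simp
  have term_le: "(\<rho> / r i) powr \<kappa> \<le> ?q ^ k i" if "i \<in> I" for i
  proof -
    have "r i > 0" using \<rho>(1) \<rho>(2)[OF that] by linarith
    then have "\<rho> / r i \<le> 1 / 2 ^ k i" using k[OF that] \<rho>(1) by (simp add: field_simps)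
    then have "(\<rho> / r i) powr \<kappa> \<le> (1 / 2 ^ k i) powr \<kappa>"
      using \<open>r i > 0\<close> \<rho>(1) \<kappa> by (intro powr_mono2) auto
    also have "\<dots> = ?q ^ k i"
      by (simp add: powr_divide powr_minus powr_realpow[symmetric] powr_powr powr_power field_simps)
    finally show ?thesis .
  qed
  have card_le: "real (card {i \<in> I. k i = j}) \<le> ?M" for j
  proof -
    have "real (card {i \<in> I. k i = j}) \<le> (((\<eta> + 1) * (2 ^ Suc j * \<rho>)) / (2 ^ j * \<rho>)) ^ CARD('n)"
    proof (rule card_disjoint_cubes_le[where z = z])
      show "disjoint_family_on (\<lambda>i. cube (c i) (r i)) {i \<in> I. k i = j}"
        using disj by (auto simp: disjoint_family_on_def)
      fix i assume "i \<in> {i \<in> I. k i = j}"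
      then have i: "i \<in> I" "2 ^ j * \<rho> \<le> r i" "r i < 2 ^ Suc j * \<rho>"
        using k[of i] \<rho>(1) by (auto simp: field_simps)
      show "2 ^ j * \<rho> \<le> r i" by fact
      show "cube (c i) (r i) \<subseteq> cube z ((\<eta> + 1) * (2 ^ Suc j * \<rho>))"
      proof
        fix y assume "y \<in> cube (c i) (r i)"
        then have "infnorm (y - z) \<le> r i + \<eta> * r i"
          using z[OF i(1)] infnorm_triangle_diff[of y z "c i"] infnorm_sub[of "c i" z] by (simp add: mem_cube)
        also have "\<dots> = (\<eta> + 1) * r i" by (simp add: algebra_simps)
        also have "\<dots> \<le> (\<eta> + 1) * (2 ^ Suc j * \<rho>)" using i \<eta> by (intro mult_left_mono) auto
        finally show "y \<in> cube z ((\<eta> + 1) * (2 ^ Suc j * \<rho>))" by (simp add: mem_cube)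
      qed
    qed (use fin \<rho> \<eta> in auto)
    also have "((\<eta> + 1) * (2 ^ Suc j * \<rho>)) / (2 ^ j * \<rho>) = 2 * (\<eta> + 1)"
      using \<rho>(1) by (simp add: field_simps)
    finally show ?thesis .
  qed
  have "(\<Sum>i\<in>I. (\<rho> / r i) powr \<kappa>) \<le> (\<Sum>i\<in>I. ?q ^ k i)" by (intro sum_mono term_le)
  also have "\<dots> = (\<Sum>j\<in>k ` I. \<Sum>i\<in>{i \<in> I. k i = j}. ?q ^ k i)"
    by (rule sum.group[symmetric]) (use fin in auto)
  also have "\<dots> = (\<Sum>j\<in>k ` I. real (card {i \<in> I. k i = j}) * ?q ^ j)"
    by (intro sum.cong) auto
  also have "\<dots> \<le> (\<Sum>j\<in>k ` I. ?M * ?q ^ j)"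
    using q by (intro sum_mono mult_right_mono card_le) auto
  also have "\<dots> = ?M * (\<Sum>j\<in>k ` I. ?q ^ j)" by (simp add: sum_distrib_left)
  also have "\<dots> \<le> ?M * (\<Sum>j. ?q ^ j)"
    using q M fin by (intro mult_left_mono sum_le_suminf) (auto intro: summable_geometric)
  also have "(\<Sum>j. ?q ^ j) = 1 / (1 - ?q)" using q by (intro suminf_geometric) auto
  finally show ?thesis by simp
qed

section \<open>Traces at visible points\<close>

lemma infnorm_close:
  fixes F :: "real ^ 'n \<Rightarrow> real"
  assumes "open \<Omega>" "continuous_on \<Omega> F" "y \<in> \<Omega>" "e > 0"
  obtains d where "d > 0" "\<And>z. infnorm (z - y) \<le> d \<Longrightarrow> z \<in> \<Omega> \<and> \<bar>F z - F y\<bar> \<le> e"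
proof -
  have "isCont F y" using assms continuous_on_eq_continuous_at by blast
  then obtain d1 where d1: "d1 > 0" "\<And>z. dist z y < d1 \<Longrightarrow> dist (F z) (F y) < e"
    using assms(4) by (auto simp: continuous_at_eps_delta dist_commute)
  obtain d2 where d2: "d2 > 0" "ball y d2 \<subseteq> \<Omega>" using assms openE by blast
  define d where "d = min d1 d2 / (2 * sqrt (real DIM(real ^ 'n)))"
  have D: "sqrt (real DIM(real ^ 'n)) > 0" by simp
  have "d > 0" using d1 d2 D by (simp add: d_def)
  moreover have "z \<in> \<Omega> \<and> \<bar>F z - F y\<bar> \<le> e" if "infnorm (z - y) \<le> d" for z
  proof -
    have "norm (z - y) \<le> sqrt (real DIM(real ^ 'n)) * infnorm (z - y)" by (rule norm_le_infnorm)
    also have "\<dots> \<le> sqrt (real DIM(real ^ 'n)) * d" using that D by (intro mult_left_mono) auto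
    also have "\<dots> = min d1 d2 / 2" unfolding d_def by simp
    also have "\<dots> < min d1 d2" using d1(1) d2(1) by linarith
    finally have "dist z y < d1" "dist z y < d2" by (auto simp: dist_norm)
    then show ?thesis using d1(2)[of z] d2(2) by (auto simp: dist_real_def mem_ball dist_commute)
  qed
  ultimately show ?thesis by (rule that)
qed

lemma cube_between_subset:
  assumes "y \<in> cube c r" "0 < t" "t \<le> 1"
  shows "cube (y + t *\<^sub>R (c - y)) (t * r) \<subseteq> cube c r"
proof
  fix z assume z: "z \<in> cube (y + t *\<^sub>R (c - y)) (t * r)"
  have "(y + t *\<^sub>R (c - y)) - c = (1 - t) *\<^sub>R (y - c)" by (simp add: algebra_simps)
  then have "infnorm ((y + t *\<^sub>R (c - y)) - c) \<le> (1 - t) * r"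
    using assms by (simp add: infnorm_mul mem_cube mult_left_mono)
  then have "infnorm (z - c) \<le> t * r + (1 - t) * r"
    using z infnorm_triangle_diff[of z c "y + t *\<^sub>R (c - y)"] by (simp add: mem_cube)
  then show "z \<in> cube c r" by (simp add: mem_cube algebra_simps)
qed

lemma set_integral_nonneg_powr: "(LINT z:A|M. f z powr p) \<ge> (0 :: real)"
  unfolding set_lebesgue_integral_def by (intro integral_nonneg_AE AE_I2) (simp add: indicator_def)

lemma set_integral_powr_mono:
  fixes f :: "'a \<Rightarrow> real"
  assumes "set_integrable M B (\<lambda>z. f z powr p)" "A \<in> sets M" "A \<subseteq> B"
  shows "(LINT z:A|M. f z powr p) \<le> (LINT z:B|M. f z powr p)"
  using assms set_integrable_subset[OF assms]
  unfolding set_lebesgue_integral_def set_integrable_def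
  by (intro integral_mono) (auto simp: indicator_def)

text \<open>Every point \<open>y\<close> of a cube is the vertex of a cone inside the cube, whose slices have at most the energy
  of the cube (\<open>\<kappa> = 0\<close>, \<open>\<eta> = 1\<close>). By continuity the means tend to \<open>F y\<close>.\<close>

lemma morrey_cube:
  fixes F :: "real ^ 'n \<Rightarrow> real"
  assumes op: "open \<Omega>" and F: "continuous_on \<Omega> F" and wg: "weak_gradient \<Omega> F G"
    and pint: "set_integrable lebesgue \<Omega> (\<lambda>z. infnorm (G z) powr p)" and p: "real CARD('n) < p"
    and r: "r > 0" and sub: "cube c r \<subseteq> \<Omega>" and y: "y \<in> cube c r"
  shows "\<bar>F y - wmean \<Omega> F c r\<bar> \<le> cone_const TYPE('n) p 0 1 * r powr (1 - real CARD('n) / p) *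
    (LINT z:cube c r|lebesgue. infnorm (G z) powr p) powr (1 / p)" (is "_ \<le> ?K")
proof (rule field_le_epsilon)
  let ?E = "LINT z:cube c r|lebesgue. infnorm (G z) powr p"
  have inside: "cube (y + t *\<^sub>R (c - y)) (t * r) \<subseteq> cube c r" if "0 < t" "t \<le> 1" for t
    using cube_between_subset[OF y that] .
  have pintc: "set_integrable lebesgue (cube c r) (\<lambda>z. infnorm (G z) powr p)"
    by (rule set_integrable_subset[OF pint _ sub]) (simp add: sets_lebesgue_compact compact_cube)
  interpret cone \<Omega> F G p 0 1 y c r ?E
  proof
    fix s :: real assume s: "s \<ge> 1"
    have "cube (y + (1 / s) *\<^sub>R (c - y)) (r / (2 * s)) \<subseteq> cube (y + (1 / s) *\<^sub>R (c - y)) ((1 / s) * r)"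
      using s r by (auto simp: mem_cube field_simps)
    then have "cube (y + (1 / s) *\<^sub>R (c - y)) (r / (2 * s)) \<subseteq> cube c r"
      using inside[of "1 / s"] s by auto
    then show "(LINT z:cube (y + (1 / s) *\<^sub>R (c - y)) (r / (2 * s))|lebesgue. infnorm (G z) powr p) \<le> s powr 0 * ?E"
      using set_integral_powr_mono[OF pintc, of "cube (y + (1 / s) *\<^sub>R (c - y)) (r / (2 * s))"] s
      by (simp add: sets_lebesgue_compact compact_cube)
  qed (use assms inside set_integral_nonneg_powr in \<open>auto simp: mem_cube\<close>)
  fix e :: real assume e: "e > 0"
  have "y \<in> \<Omega>" using y sub by blast
  then obtain d where d: "d > 0" "\<And>z. infnorm (z - y) \<le> d \<Longrightarrow> z \<in> \<Omega> \<and> \<bar>F z - F y\<bar> \<le> e"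
    using infnorm_close[OF op F _ e] by metis
  \<comment> \<open>At this scale the bump is supported within distance \<open>2 * r / S \<le> d\<close> of \<open>y\<close>.\<close>
  define S where "S = max 1 (2 * r / d)"
  have S: "S \<ge> 1" "2 * r / S \<le> d" using d r by (auto simp: S_def field_simps max_def)
  have near: "infnorm (z - y) \<le> d" if "z \<in> cube (ctr S) (r / S / 2)" for z
  proof -
    have "infnorm (z - y) \<le> (1 + 1) * r / S"
      by (rule cube_ctr_dist[OF S(1)]) (use that in \<open>simp add: mult.commute\<close>)
    then show ?thesis using S by simp
  qed
  have "\<bar>wmean \<Omega> F (ctr S) (r / S) - F y\<bar> \<le> e"
    by (rule wmean_close[OF op F]) (use near d S r in auto)
  with wmean_variation[OF S(1)] show "\<bar>F y - wmean \<Omega> F c r\<bar> \<le> ?K + e" by linarith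
qed

text \<open>At a vertex on the boundary \<open>F\<close> is not continuous, but Morrey's estimate on the slices shows that along
  the axis \<open>F\<close> and its means have the same limit.\<close>

lemma (in cone) vertex_limit:
  assumes lim: "(\<lambda>k. F (x + (1 / 2 ^ k) *\<^sub>R (c - x))) \<longlonglongrightarrow> v"
  shows "\<bar>v - wmean \<Omega> F c r\<bar> \<le> cone_const TYPE('n) p \<kappa> \<eta> * r powr (1 - real CARD('n) / p) * E powr (1 / p)"
proof -
  let ?I = "LINT z:\<Omega>|lebesgue. infnorm (G z) powr p"
  let ?a = "1 - real CARD('n) / p"
  have a: "?a > 0" using \<kappa> p_gt_1 by simp
  have K0: "cone_const TYPE('n) p 0 1 \<ge> 0"
    using \<kappa> p_gt_1 bump_mass_pos[where 'n = 'n] by (simp add: cone_const_def)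
  have diff: "\<bar>F (ctr (2 ^ k)) - wmean \<Omega> F (ctr (2 ^ k)) (r / 2 ^ k)\<bar>
      \<le> cone_const TYPE('n) p 0 1 * (r / 2 ^ k) powr ?a * ?I powr (1 / p)" for k
  proof -
    have sub: "cube (ctr (2 ^ k)) (r / 2 ^ k) \<subseteq> \<Omega>" using vis[of "1 / 2 ^ k"] by simp
    have "\<bar>F (ctr (2 ^ k)) - wmean \<Omega> F (ctr (2 ^ k)) (r / 2 ^ k)\<bar>
      \<le> cone_const TYPE('n) p 0 1 * (r / 2 ^ k) powr ?a *
        (LINT z:cube (ctr (2 ^ k)) (r / 2 ^ k)|lebesgue. infnorm (G z) powr p) powr (1 / p)"
      using \<kappa> r by (intro morrey_cube[OF op contF wg pint _ _ sub] center_in_cube) auto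
    also have "\<dots> \<le> cone_const TYPE('n) p 0 1 * (r / 2 ^ k) powr ?a * ?I powr (1 / p)"
      using K0 p_gt_1
      by (intro mult_left_mono powr_mono2 set_integral_nonneg_powr set_integral_powr_mono[OF pint _ sub])
         (auto simp: sets_lebesgue_compact compact_cube)
    finally show ?thesis .
  qed
  have "(\<lambda>k. r * (1 / 2) ^ k) \<longlonglongrightarrow> r * 0"
    by (intro tendsto_mult tendsto_const LIMSEQ_abs_realpow_zero2) simp
  then have "(\<lambda>k. r / 2 ^ k) \<longlonglongrightarrow> 0" by (simp add: power_divide)
  then have "(\<lambda>k. (r / 2 ^ k) powr ?a) \<longlonglongrightarrow> 0"
    by (rule tendsto_zero_powrI[OF _ tendsto_const _ a]) (use r in auto)
  then have "(\<lambda>k. cone_const TYPE('n) p 0 1 * (r / 2 ^ k) powr ?a * ?I powr (1 / p))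
      \<longlonglongrightarrow> cone_const TYPE('n) p 0 1 * 0 * ?I powr (1 / p)"
    by (intro tendsto_mult tendsto_const)
  then have "(\<lambda>k. cone_const TYPE('n) p 0 1 * (r / 2 ^ k) powr ?a * ?I powr (1 / p)) \<longlonglongrightarrow> 0"
    by (simp only: mult_zero_left mult_zero_right)
  moreover have "\<forall>\<^sub>F k in sequentially. norm (F (ctr (2 ^ k)) - wmean \<Omega> F (ctr (2 ^ k)) (r / 2 ^ k))
      \<le> cone_const TYPE('n) p 0 1 * (r / 2 ^ k) powr ?a * ?I powr (1 / p)"
    unfolding real_norm_def by (intro always_eventually allI diff)
  ultimately have "(\<lambda>k. F (ctr (2 ^ k)) - wmean \<Omega> F (ctr (2 ^ k)) (r / 2 ^ k)) \<longlonglongrightarrow> 0"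
    by (rule Lim_null_comparison[rotated])
  from tendsto_diff[OF lim this] have wl: "(\<lambda>k. wmean \<Omega> F (ctr (2 ^ k)) (r / 2 ^ k)) \<longlonglongrightarrow> v"
    by simp
  have "(\<lambda>k. \<bar>wmean \<Omega> F (ctr (2 ^ k)) (r / 2 ^ k) - wmean \<Omega> F c r\<bar>) \<longlonglongrightarrow> \<bar>v - wmean \<Omega> F c r\<bar>"
    by (intro tendsto_intros wl)
  then show ?thesis
    by (rule LIMSEQ_le_const2) (intro exI[of _ 0] allI impI wmean_variation, simp)
qed

text \<open>Each point of the shrunken cube lies on a segment from \<open>x\<close> to a point of \<open>cube c r\<close>.\<close>

lemma visible_cone:
  assumes vis: "visible \<Omega> (cube c r) x" and t: "0 < t" "t \<le> 1"
  shows "cube (x + t *\<^sub>R (c - x)) (t * r) \<subseteq> \<Omega>"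
proof
  fix z assume z: "z \<in> cube (x + t *\<^sub>R (c - x)) (t * r)"
  define y where "y = x + (1 / t) *\<^sub>R (z - x)"
  have zy: "z = x + t *\<^sub>R (y - x)" using t by (simp add: y_def)
  have "z - (x + t *\<^sub>R (c - x)) = t *\<^sub>R (y - c)" by (subst zy) (simp add: algebra_simps)
  then have y: "y \<in> cube c r" using z t by (simp add: mem_cube infnorm_mul)
  have zy': "z = (1 - t) *\<^sub>R x + t *\<^sub>R y" by (subst zy) (simp add: algebra_simps)
  have "z \<in> insert y (open_segment x y)"
  proof (cases "t = 1 \<or> x = y")
    case True
    then show ?thesis using zy by auto
  next
    case False
    then show ?thesis using t zy' by (auto simp: in_segment)
  qed
  then show "z \<in> \<Omega>" using vis y by (auto simp: visible_def)
qed

context proper_domain begin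

text \<open>This set depends on the cube alone, but contains the supports of the bumps on the cone from any
  visible boundary point in \<open>cube c (\<eta> * r)\<close>.\<close>

definition shadow :: "real \<Rightarrow> real ^ 'n \<Rightarrow> real \<Rightarrow> (real ^ 'n) set" where
  "shadow \<eta> c r = {z \<in> \<Omega>. infnorm (z - c) \<le> \<eta> * r \<and> R z \<le> (\<eta> + 1) * r}"

lemma sets_shadow: "shadow \<eta> c r \<in> sets lebesgue"
proof -
  have "shadow \<eta> c r = \<Omega> \<inter> ({z. infnorm (z - c) \<le> \<eta> * r} \<inter> {z. R z \<le> (\<eta> + 1) * r})"
    by (auto simp: shadow_def)
  also have "\<dots> \<in> sets borel"
    by (intro sets.Int borel_open op borel_closed closed_Collect_le continuous_intros continuous_on_R)
  finally show ?thesis by (simp add: sets_completionI_sets)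
qed

text \<open>On the cone from a visible point the distance to the boundary is comparable to the distance from
  the vertex, so the weight costs at most \<open>s powr \<kappa>\<close> on the cube at scale \<open>1 / s\<close>.\<close>

lemma visible_estimate:
  assumes F: "continuous_on \<Omega> F" and wg: "weak_gradient \<Omega> F G"
    and pint: "set_integrable lebesgue \<Omega> (\<lambda>z. infnorm (G z) powr p)"
    and \<kappa>: "0 < \<kappa>" "real CARD('n) + \<kappa> < p" and \<eta>: "\<eta> \<ge> 1"
    and r: "r > 0" and vis: "visible \<Omega> (cube c r) x" and x: "x \<in> frontier \<Omega>" "x \<in> cube c (\<eta> * r)"
    and lim: "(\<lambda>k. F (x + (1 / 2 ^ k) *\<^sub>R (c - x))) \<longlonglongrightarrow> v"
  shows "set_integrable lebesgue (shadow \<eta> c r) (\<lambda>z. infnorm (G z) powr p * (2 * R z / r) powr \<kappa>)"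
    "\<bar>v - wmean \<Omega> F c r\<bar> \<le> cone_const TYPE('n) p \<kappa> \<eta> * r powr (1 - real CARD('n) / p) *
      (LINT z:shadow \<eta> c r|lebesgue. infnorm (G z) powr p * (2 * R z / r) powr \<kappa>) powr (1 / p)"
proof -
  let ?g = "\<lambda>z. infnorm (G z) powr p"
  let ?E = "LINT z:shadow \<eta> c r|lebesgue. ?g z * (2 * R z / r) powr \<kappa>"
  have w_meas: "(\<lambda>z. (2 * R z / r) powr \<kappa>) \<in> borel_measurable lebesgue"
  proof -
    have "continuous_on UNIV (\<lambda>z. (2 * R z / r) powr \<kappa>)"
      using R_nonneg r \<kappa> by (intro continuous_on_powr' continuous_intros continuous_on_R) auto
    then show ?thesis by (intro measurable_completion) (simp add: borel_measurable_continuous_onI)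
  qed
  show int: "set_integrable lebesgue (shadow \<eta> c r) (\<lambda>z. ?g z * (2 * R z / r) powr \<kappa>)"
    unfolding set_integrable_def
  proof (rule Bochner_Integration.integrable_bound)
    have "set_integrable lebesgue (shadow \<eta> c r) ?g"
      by (rule set_integrable_subset[OF pint sets_shadow]) (auto simp: shadow_def)
    then show i: "integrable lebesgue (\<lambda>z. (2 * (\<eta> + 1)) powr \<kappa> * (indicator (shadow \<eta> c r) z *\<^sub>R ?g z))"
      unfolding set_integrable_def by (rule integrable_mult_right)
    have "(\<lambda>z. (indicator (shadow \<eta> c r) z *\<^sub>R ?g z) * (2 * R z / r) powr \<kappa>) \<in> borel_measurable lebesgue"
      using \<open>set_integrable lebesgue (shadow \<eta> c r) ?g\<close> unfolding set_integrable_def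
      by (intro borel_measurable_times w_meas) (rule borel_measurable_integrable)
    then show "(\<lambda>z. indicator (shadow \<eta> c r) z *\<^sub>R (?g z * (2 * R z / r) powr \<kappa>)) \<in> borel_measurable lebesgue"
      by (simp add: mult.assoc)
    show "AE z in lebesgue. norm (indicator (shadow \<eta> c r) z *\<^sub>R (?g z * (2 * R z / r) powr \<kappa>))
        \<le> norm ((2 * (\<eta> + 1)) powr \<kappa> * (indicator (shadow \<eta> c r) z *\<^sub>R ?g z))"
    proof (rule AE_I2)
      fix z
      have "(2 * R z / r) powr \<kappa> \<le> (2 * (\<eta> + 1)) powr \<kappa>" if "z \<in> shadow \<eta> c r"
        using that r R_nonneg[of z] \<kappa> by (intro powr_mono2) (auto simp: shadow_def field_simps)
      then show "norm (indicator (shadow \<eta> c r) z *\<^sub>R (?g z * (2 * R z / r) powr \<kappa>))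
        \<le> norm ((2 * (\<eta> + 1)) powr \<kappa> * (indicator (shadow \<eta> c r) z *\<^sub>R ?g z))"
        by (auto simp: indicator_def abs_mult mult.commute intro!: mult_left_mono)
    qed
  qed
  have E0: "?E \<ge> 0" unfolding set_lebesgue_integral_def
    by (intro integral_nonneg_AE AE_I2) (simp add: indicator_def)
  have E: "(LINT z:cube (x + (1 / s) *\<^sub>R (c - x)) (r / (2 * s))|lebesgue. ?g z) \<le> s powr \<kappa> * ?E"
    if s: "s \<ge> 1" for s
  proof -
    let ?W = "cube (x + (1 / s) *\<^sub>R (c - x)) (r / (2 * s))"
    have big: "cube (x + (1 / s) *\<^sub>R (c - x)) ((1 / s) * r) \<subseteq> \<Omega>"
      using visible_cone[OF vis, of "1 / s"] s by simp
    \<comment> \<open>The slice lies in the shadow, and the weight is at least \<open>(1 / s) powr \<kappa>\<close> on it.\<close>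
    have W: "z \<in> \<Omega> \<and> z \<in> shadow \<eta> c r \<and> 1 / s \<le> 2 * R z / r" if z: "z \<in> ?W" for z
    proof -
      have "cube z (r / (2 * s)) \<subseteq> cube (x + (1 / s) *\<^sub>R (c - x)) ((1 / s) * r)"
      proof
        fix y assume "y \<in> cube z (r / (2 * s))"
        then have "infnorm (y - (x + (1 / s) *\<^sub>R (c - x))) \<le> r / (2 * s) + r / (2 * s)"
          using z infnorm_triangle_diff[of y "x + (1 / s) *\<^sub>R (c - x)" z] by (simp add: mem_cube)
        then show "y \<in> cube (x + (1 / s) *\<^sub>R (c - x)) ((1 / s) * r)"
          using s by (simp add: mem_cube field_simps)
      qed
      then have zsub: "cube z (r / (2 * s)) \<subseteq> \<Omega>" using big by blast
      then have "z \<in> \<Omega>" using center_in_cube[of "r / (2 * s)" z] r s by auto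
      moreover have "r / (2 * s) \<le> R z" by (rule R_ge_of_cube[OF zsub])
      moreover have "infnorm (z - x) \<le> (\<eta> + 1) * r / s"
      proof -
        have "infnorm (z - x) \<le> infnorm (z - (x + (1 / s) *\<^sub>R (c - x))) + infnorm ((1 / s) *\<^sub>R (c - x))"
          using infnorm_triangle_diff[of z x "x + (1 / s) *\<^sub>R (c - x)"] by simp
        also have "\<dots> \<le> r / (2 * s) + \<eta> * r / s"
          using z s x(2) by (intro add_mono) (auto simp: mem_cube infnorm_mul infnorm_sub[of c x] divide_right_mono)
        also have "\<dots> \<le> (\<eta> + 1) * r / s" using s r by (simp add: field_simps)
        finally show ?thesis .
      qed
      moreover have "(\<eta> + 1) * r / s \<le> (\<eta> + 1) * r"
        using s r \<eta> mult_left_mono[of 1 s "(\<eta> + 1) * r"] by (simp add: pos_divide_le_eq)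
      moreover have "R z \<le> infnorm (z - x)" by (rule udist_le[OF x(1)])
      moreover have "infnorm (z - c) \<le> \<eta> * r"
      proof -
        have "(x + (1 / s) *\<^sub>R (c - x)) - c = (1 - 1 / s) *\<^sub>R (x - c)" by (simp add: algebra_simps)
        then have "infnorm ((x + (1 / s) *\<^sub>R (c - x)) - c) \<le> (1 - 1 / s) * (\<eta> * r)"
          using x(2) s by (simp add: mem_cube infnorm_mul mult_left_mono)
        then have "infnorm (z - c) \<le> r / (2 * s) + (1 - 1 / s) * (\<eta> * r)"
          using z infnorm_triangle_diff[of z c "x + (1 / s) *\<^sub>R (c - x)"] by (simp add: mem_cube)
        also have "\<dots> \<le> \<eta> * r / s + (1 - 1 / s) * (\<eta> * r)"
          using s r \<eta> by (simp add: field_simps)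
        also have "\<dots> = \<eta> * r" by (simp add: algebra_simps)
        finally show ?thesis .
      qed
      moreover have "1 / s \<le> 2 * R z / r" using calculation(2) r s by (simp add: field_simps)
      ultimately show ?thesis by (auto simp: shadow_def)
    qed
    have "(LINT z:?W|lebesgue. ?g z) \<le> (LINT z:shadow \<eta> c r|lebesgue. s powr \<kappa> * (?g z * (2 * R z / r) powr \<kappa>))"
      unfolding set_lebesgue_integral_def
    proof (rule integral_mono)
      show "integrable lebesgue (\<lambda>z. indicat_real ?W z *\<^sub>R ?g z)"
      proof -
        have "set_integrable lebesgue ?W ?g"
          by (rule set_integrable_subset[OF pint]) (use W in \<open>auto simp: sets_lebesgue_compact compact_cube\<close>)
        then show ?thesis by (simp add: set_integrable_def)
      qed
      show "integrable lebesgue (\<lambda>z. indicat_real (shadow \<eta> c r) z *\<^sub>R (s powr \<kappa> * (?g z * (2 * R z / r) powr \<kappa>)))"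
        using set_integrable_mult_right[OF int, of "s powr \<kappa>"] by (simp add: set_integrable_def)
      fix z
      show "indicat_real ?W z *\<^sub>R ?g z \<le> indicat_real (shadow \<eta> c r) z *\<^sub>R (s powr \<kappa> * (?g z * (2 * R z / r) powr \<kappa>))"
      proof (cases "z \<in> ?W")
        case True
        note Wz = W[OF True]
        have "1 = s powr \<kappa> * (1 / s) powr \<kappa>" using s by (simp add: powr_divide)
        also have "\<dots> \<le> s powr \<kappa> * (2 * R z / r) powr \<kappa>"
          using Wz s \<kappa> by (intro mult_left_mono powr_mono2) auto
        finally have "?g z * 1 \<le> ?g z * (s powr \<kappa> * (2 * R z / r) powr \<kappa>)"
          by (intro mult_left_mono) auto
        then show ?thesis using True Wz by (simp add: mult_ac)
      qed (simp add: indicator_def)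
    qed
    then show ?thesis by simp
  qed
  interpret cone \<Omega> F G p \<kappa> \<eta> x c r ?E
    by unfold_locales
       (use op F wg pint \<kappa> \<eta> r x visible_cone[OF vis] E0 E in \<open>auto simp: mem_cube\<close>)
  show "\<bar>v - wmean \<Omega> F c r\<bar> \<le> cone_const TYPE('n) p \<kappa> \<eta> * r powr (1 - real CARD('n) / p) * ?E powr (1 / p)"
    by (rule vertex_limit[OF lim])
qed

end

text \<open>The first factor comes from the cone estimates at two points, the second one from the sum of the
  weights in \<open>weighted_sum_bound\<close>.\<close>

definition visible_const :: "('n :: finite) itself \<Rightarrow> real \<Rightarrow> real \<Rightarrow> real \<Rightarrow> real" where
  "visible_const T p \<kappa> \<eta> = (2 * cone_const T p \<kappa> \<eta>) powr p *
     ((2 * (\<eta> + 1)) powr \<kappa> * ((2 * (\<eta> + 1)) ^ CARD('n) / (1 - 2 powr (- \<kappa>))))"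

context proper_domain begin

text \<open>If \<open>z\<close> lies in the shadow of a cube, then the radius of the cube is at least \<open>R z / (\<eta> + 1)\<close> and its
  \<open>\<eta>\<close>-dilation contains \<open>z\<close>; so the sum of the weights is bounded at every point.\<close>

lemma weighted_sum_bound:
  assumes pint: "set_integrable lebesgue \<Omega> (\<lambda>z. infnorm (G z) powr p)" and \<kappa>: "0 < \<kappa>" and \<eta>: "\<eta> \<ge> 1"
    and fin: "finite I" and r: "\<And>i. i \<in> I \<Longrightarrow> r i > 0"
    and disj: "disjoint_family_on (\<lambda>i. cube (c i) (r i)) I"
    and int: "\<And>i. i \<in> I \<Longrightarrow> set_integrable lebesgue (shadow \<eta> (c i) (r i)) (\<lambda>z. infnorm (G z) powr p * (2 * R z / r i) powr \<kappa>)"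
  shows "(\<Sum>i\<in>I. LINT z:shadow \<eta> (c i) (r i)|lebesgue. infnorm (G z) powr p * (2 * R z / r i) powr \<kappa>)
    \<le> ((2 * (\<eta> + 1)) powr \<kappa> * ((2 * (\<eta> + 1)) ^ CARD('n) / (1 - 2 powr (- \<kappa>))))
      * (LINT z:\<Omega>|lebesgue. infnorm (G z) powr p)"
proof -
  let ?g = "\<lambda>z. infnorm (G z) powr p"
  let ?C = "(2 * (\<eta> + 1)) powr \<kappa> * ((2 * (\<eta> + 1)) ^ CARD('n) / (1 - 2 powr (- \<kappa>)))"
  let ?t = "\<lambda>i z. indicat_real (shadow \<eta> (c i) (r i)) z *\<^sub>R (?g z * (2 * R z / r i) powr \<kappa>)"
  have C0: "?C \<ge> 0" using \<eta> \<kappa> by (intro mult_nonneg_nonneg divide_nonneg_nonneg) (auto simp: powr_less_one less_imp_le)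
  have pw: "(\<Sum>i\<in>I. ?t i z) \<le> indicator \<Omega> z *\<^sub>R (?C * ?g z)" for z
  proof (cases "z \<in> \<Omega>")
    case True
    define J where "J = {i \<in> I. z \<in> shadow \<eta> (c i) (r i)}"
    have J: "J \<subseteq> I" "finite J" using fin by (auto simp: J_def)
    define \<rho> where "\<rho> = R z / (\<eta> + 1)"
    have \<rho>: "\<rho> > 0" using R_pos[OF True] \<eta> by (simp add: \<rho>_def)
    have "(\<Sum>i\<in>I. ?t i z) = (\<Sum>i\<in>J. ?t i z)"
      using fin by (intro sum.mono_neutral_right) (auto simp: J_def)
    also have "\<dots> = (\<Sum>i\<in>J. ?g z * (2 * (\<eta> + 1)) powr \<kappa> * (\<rho> / r i) powr \<kappa>)"
    proof (rule sum.cong)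
      fix i assume i: "i \<in> J"
      have "2 * R z / r i = (2 * (\<eta> + 1)) * (\<rho> / r i)"
      proof -
        have "R z = (\<eta> + 1) * \<rho>" using \<eta> by (simp add: \<rho>_def)
        then show ?thesis by simp
      qed
      then have "(2 * R z / r i) powr \<kappa> = (2 * (\<eta> + 1)) powr \<kappa> * (\<rho> / r i) powr \<kappa>"
        using \<eta> \<rho> r[of i] i J by (metis powr_mult)
      then show "?t i z = ?g z * (2 * (\<eta> + 1)) powr \<kappa> * (\<rho> / r i) powr \<kappa>"
        using i by (simp add: J_def)
    qed simp
    also have "\<dots> = ?g z * (2 * (\<eta> + 1)) powr \<kappa> * (\<Sum>i\<in>J. (\<rho> / r i) powr \<kappa>)"
      by (simp only: sum_distrib_left)
    also have "\<dots> \<le> ?g z * (2 * (\<eta> + 1)) powr \<kappa> * ((2 * (\<eta> + 1)) ^ CARD('n) / (1 - 2 powr (- \<kappa>)))"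
    proof (intro mult_left_mono sum_powr_disjoint_cubes_le[where z = z])
      show "disjoint_family_on (\<lambda>i. cube (c i) (r i)) J"
        using disj J(1) by (rule disjoint_family_on_mono[rotated])
      show "\<rho> \<le> r i" "infnorm (z - c i) \<le> \<eta> * r i" if "i \<in> J" for i
        using that \<eta> by (auto simp: J_def shadow_def \<rho>_def pos_divide_le_eq mult.commute)
    qed (use J \<rho> \<eta> \<kappa> in auto)
    finally show ?thesis using True by (simp only: indicator_simps scaleR_one mult_ac)
  next
    case False
    then have "?t i z = 0" for i by (auto simp: shadow_def)
    then show ?thesis using False by (simp only: sum.neutral_const) simp
  qed
  have "(\<Sum>i\<in>I. LINT z|lebesgue. ?t i z) = (LINT z|lebesgue. (\<Sum>i\<in>I. ?t i z))"
    using int by (intro Bochner_Integration.integral_sum[symmetric]) (auto simp: set_integrable_def)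
  also have "\<dots> \<le> (LINT z|lebesgue. indicator \<Omega> z *\<^sub>R (?C * ?g z))"
  proof (rule integral_mono)
    show "integrable lebesgue (\<lambda>z. \<Sum>i\<in>I. ?t i z)"
      using int by (intro Bochner_Integration.integrable_sum) (auto simp: set_integrable_def)
    show "integrable lebesgue (\<lambda>z. indicator \<Omega> z *\<^sub>R (?C * ?g z))"
      using set_integrable_mult_right[OF pint, of ?C] by (simp add: set_integrable_def)
  qed (rule pw)
  also have "\<dots> = ?C * (LINT z:\<Omega>|lebesgue. ?g z)"
    using set_integral_mult_right[of lebesgue \<Omega> ?C ?g] by (simp only: set_lebesgue_integral_def)
  finally show ?thesis by (simp only: set_lebesgue_integral_def)
qed

lemma cone_const_nonneg: "0 \<le> \<kappa> \<Longrightarrow> real CARD('n) + \<kappa> < p \<Longrightarrow> \<eta> \<ge> 0 \<Longrightarrow> cone_const TYPE('n) p \<kappa> \<eta> \<ge> 0"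
  using bump_mass_pos[where 'n = 'n] by (auto simp: cone_const_def intro!: divide_nonneg_pos)

lemma visible_const_nonneg: "0 < \<kappa> \<Longrightarrow> \<eta> \<ge> 0 \<Longrightarrow> visible_const TYPE('n) p \<kappa> \<eta> \<ge> 0"
  unfolding visible_const_def
  by (intro mult_nonneg_nonneg divide_nonneg_nonneg) (auto simp: powr_less_one less_imp_le)

text \<open>Both values are compared with the mean over the cube. In the \<open>p\<close>-th power of the cone estimate the
  radius appears with the exponent \<open>p - n\<close> and cancels against the diameter.\<close>

lemma visible_sum_bound:
  assumes F: "continuous_on \<Omega> F" and wg: "weak_gradient \<Omega> F G"
    and pint: "set_integrable lebesgue \<Omega> (\<lambda>z. infnorm (G z) powr p)"
    and \<kappa>: "0 < \<kappa>" "real CARD('n) + \<kappa> < p" and \<eta>: "\<eta> \<ge> 1"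
    and fin: "finite I" and r: "\<And>i. i \<in> I \<Longrightarrow> r i > 0"
    and disj: "disjoint_family_on (\<lambda>i. cube (c i) (r i)) I"
    and x: "\<And>i. i \<in> I \<Longrightarrow> visible \<Omega> (cube (c i) (r i)) (x i) \<and> x i \<in> frontier \<Omega> \<and> x i \<in> cube (c i) (\<eta> * r i)"
    and y: "\<And>i. i \<in> I \<Longrightarrow> visible \<Omega> (cube (c i) (r i)) (y i) \<and> y i \<in> frontier \<Omega> \<and> y i \<in> cube (c i) (\<eta> * r i)"
    and v: "\<And>i. i \<in> I \<Longrightarrow> (\<lambda>k. F (x i + (1 / 2 ^ k) *\<^sub>R (c i - x i))) \<longlonglongrightarrow> v i"
    and w: "\<And>i. i \<in> I \<Longrightarrow> (\<lambda>k. F (y i + (1 / 2 ^ k) *\<^sub>R (c i - y i))) \<longlonglongrightarrow> w i"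
  shows "(\<Sum>i\<in>I. \<bar>v i - w i\<bar> powr p / udiam (cube (c i) (r i)) powr (p - real CARD('n)))
    \<le> visible_const TYPE('n) p \<kappa> \<eta> * (LINT z:\<Omega>|lebesgue. infnorm (G z) powr p)"
proof -
  let ?E = "\<lambda>i. LINT z:shadow \<eta> (c i) (r i)|lebesgue. infnorm (G z) powr p * (2 * R z / r i) powr \<kappa>"
  let ?K = "cone_const TYPE('n) p \<kappa> \<eta>"
  have K: "?K \<ge> 0" using cone_const_nonneg[of \<kappa> p \<eta>] \<kappa> \<eta> by simp
  have p1: "p > 1" using \<kappa> zero_less_card_finite[where 'a = 'n] by linarith
  have est: "\<bar>v i - wmean \<Omega> F (c i) (r i)\<bar> \<le> ?K * r i powr (1 - real CARD('n) / p) * ?E i powr (1 / p)"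
      "\<bar>w i - wmean \<Omega> F (c i) (r i)\<bar> \<le> ?K * r i powr (1 - real CARD('n) / p) * ?E i powr (1 / p)"
      "set_integrable lebesgue (shadow \<eta> (c i) (r i)) (\<lambda>z. infnorm (G z) powr p * (2 * R z / r i) powr \<kappa>)"
    if "i \<in> I" for i
    using visible_estimate[OF F wg pint \<kappa> \<eta> r[OF that] _ _ _ v[OF that]] x[OF that]
      visible_estimate[OF F wg pint \<kappa> \<eta> r[OF that] _ _ _ w[OF that]] y[OF that] by blast+
  have E0: "?E i \<ge> 0" for i unfolding set_lebesgue_integral_def
    by (intro integral_nonneg_AE AE_I2) (simp add: indicator_def)
  have "\<bar>v i - w i\<bar> powr p / udiam (cube (c i) (r i)) powr (p - real CARD('n)) \<le> (2 * ?K) powr p * ?E i"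
    if i: "i \<in> I" for i
  proof -
    have ri: "r i > 0" using r[OF i] .
    have "\<bar>v i - w i\<bar> \<le> 2 * ?K * (r i powr (1 - real CARD('n) / p) * ?E i powr (1 / p))"
      using est(1,2)[OF i] by (simp add: mult.assoc)
    then have "\<bar>v i - w i\<bar> powr p \<le> (2 * ?K * (r i powr (1 - real CARD('n) / p) * ?E i powr (1 / p))) powr p"
      using p1 by (intro powr_mono2) auto
    also have "\<dots> = (2 * ?K) powr p * (r i powr (p - real CARD('n)) * ?E i)"
    proof -
      have "(r i powr (1 - real CARD('n) / p) * ?E i powr (1 / p)) powr p
          = r i powr ((1 - real CARD('n) / p) * p) * ?E i powr (1 / p * p)"
        by (simp only: powr_mult powr_powr powr_ge_zero)
      also have "(1 - real CARD('n) / p) * p = p - real CARD('n)" using p1 by (simp add: left_diff_distrib)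
      also have "?E i powr (1 / p * p) = ?E i" using p1 E0[of i] by simp
      finally show ?thesis using K by (simp add: powr_mult)
    qed
    finally have "\<bar>v i - w i\<bar> powr p / udiam (cube (c i) (r i)) powr (p - real CARD('n))
        \<le> (2 * ?K) powr p * (r i powr (p - real CARD('n)) * ?E i) / (2 * r i) powr (p - real CARD('n))"
      unfolding udiam_cube[OF ri] by (intro divide_right_mono) auto
    also have "\<dots> = (2 * ?K) powr p * ?E i / 2 powr (p - real CARD('n))"
      using ri by (simp add: powr_mult)
    also have "\<dots> \<le> (2 * ?K) powr p * ?E i / 1"
    proof (rule divide_left_mono)
      show "1 \<le> (2 :: real) powr (p - real CARD('n))" using \<kappa> by (intro ge_one_powr_ge_zero) auto
      show "0 \<le> (2 * ?K) powr p * ?E i" by (intro mult_nonneg_nonneg E0) simp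
    qed simp
    finally show ?thesis by simp
  qed
  then have "(\<Sum>i\<in>I. \<bar>v i - w i\<bar> powr p / udiam (cube (c i) (r i)) powr (p - real CARD('n)))
      \<le> (\<Sum>i\<in>I. (2 * ?K) powr p * ?E i)" by (rule sum_mono)
  also have "\<dots> = (2 * ?K) powr p * (\<Sum>i\<in>I. ?E i)" by (simp only: sum_distrib_left)
  also have "\<dots> \<le> (2 * ?K) powr p * (((2 * (\<eta> + 1)) powr \<kappa> * ((2 * (\<eta> + 1)) ^ CARD('n) / (1 - 2 powr (- \<kappa>))))
      * (LINT z:\<Omega>|lebesgue. infnorm (G z) powr p))"
    by (intro mult_left_mono weighted_sum_bound[OF pint \<kappa>(1) \<eta> fin r disj est(3)]) auto
  finally show ?thesis by (simp only: visible_const_def mult.assoc)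
qed

end

section \<open>Variation and arc length\<close>

text \<open>Variation over intervals that need not start at \<open>0\<close>, as required for additivity.\<close>

definition vsums :: "(real \<Rightarrow> real ^ 'n) \<Rightarrow> real \<Rightarrow> real \<Rightarrow> real set" where
  "vsums g a b = {\<Sum>i<k. infnorm (g (t (Suc i)) - g (t i)) | (k :: nat) t.
     t 0 = a \<and> t k = b \<and> (\<forall>i<k. t i \<le> t (Suc i))}"

definition Var :: "(real \<Rightarrow> real ^ 'n) \<Rightarrow> real \<Rightarrow> real \<Rightarrow> real" where
  "Var g a b = Sup (vsums g a b)"

lemma variation_sums_eq: "variation_sums g s = vsums g 0 s"
  by (simp add: variation_sums_def vsums_def)

lemma curve_length_eq: "curve_length g s = Var g 0 s"
  by (simp add: curve_length_def Var_def variation_sums_eq)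

lemma vsumsI:
  "t 0 = a \<Longrightarrow> t k = b \<Longrightarrow> (\<And>i. i < k \<Longrightarrow> t i \<le> t (Suc i)) \<Longrightarrow>
    (\<Sum>i<k. infnorm (g (t (Suc i)) - g (t i))) \<in> vsums g a b"
  unfolding vsums_def by blast

text \<open>Monotone maps send partitions to partitions. Clamping to a subinterval is the case of interest, since
  it restricts a partition without a search for the position of its end points.\<close>

lemma vsums_mono_map:
  assumes "t 0 = a" "t k = b" "\<And>i. i < k \<Longrightarrow> t i \<le> t (Suc i)" "mono \<phi>" "\<phi> a = a'" "\<phi> b = b'"
  shows "(\<Sum>i<k. infnorm (g (\<phi> (t (Suc i))) - g (\<phi> (t i)))) \<in> vsums g a' b'"
  using vsumsI[of "\<lambda>i. \<phi> (t i)" a' k b' g] assms by (auto dest: monoD)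

lemma mono_min_max: "mono (\<lambda>s. min s b)" "mono (\<lambda>s. max s b)" for b :: real
  by (rule monoI, arith)+

lemma partition_mono:
  fixes t :: "nat \<Rightarrow> real"
  assumes "\<And>i. i < k \<Longrightarrow> t i \<le> t (Suc i)" "i \<le> j" "j \<le> k"
  shows "t i \<le> t j"
  using assms(2,3)
proof (induction j)
  case (Suc j)
  then show ?case using assms(1)[of j] by (cases "i = Suc j") auto
qed simp

lemma vsums_chord: "a \<le> b \<Longrightarrow> infnorm (g b - g a) \<in> vsums g a b"
  using vsumsI[of "\<lambda>i. if i = 0 then a else b" a 1 b g] by simp

lemma vsums_cong:
  assumes "\<And>s. a \<le> s \<Longrightarrow> s \<le> b \<Longrightarrow> g s = h s"
  shows "vsums g a b = vsums h a b"
proof -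
  have "vsums g a b \<subseteq> vsums h a b" if "\<And>s. a \<le> s \<Longrightarrow> s \<le> b \<Longrightarrow> g s = h s" for g h
  proof
    fix x assume "x \<in> vsums g a b"
    then obtain k t where t: "x = (\<Sum>i<k. infnorm (g (t (Suc i)) - g (t i)))" "t 0 = a" "t k = b" "\<And>i. i < k \<Longrightarrow> t i \<le> t (Suc i)"
      by (auto simp: vsums_def)
    have "a \<le> t i" "t i \<le> b" if "i \<le> k" for i
      using partition_mono[of k t 0 i] partition_mono[of k t i k] t that by auto
    then have "x = (\<Sum>i<k. infnorm (h (t (Suc i)) - h (t i)))"
      unfolding t(1) using that by (intro sum.cong) auto
    then show "x \<in> vsums h a b" using vsumsI[OF t(2-4)] by simp
  qed
  from this[of g h] this[of h g] show ?thesis using assms by auto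
qed

lemma sum_lessThan_add: "(\<Sum>i<k + l. f i) = (\<Sum>i<k. f i) + (\<Sum>i<l. f (k + i :: nat))"
  by (induction l) (auto simp: add.assoc)

lemma vsums_concat:
  assumes "x \<in> vsums g a b" "y \<in> vsums g b c"
  shows "x + y \<in> vsums g a c"
proof -
  obtain k t where t: "x = (\<Sum>i<k. infnorm (g (t (Suc i)) - g (t i)))" "t 0 = a" "t k = b" "\<And>i. i < k \<Longrightarrow> t i \<le> t (Suc i)"
    using assms(1) by (auto simp: vsums_def)
  obtain l u where u: "y = (\<Sum>i<l. infnorm (g (u (Suc i)) - g (u i)))" "u 0 = b" "u l = c" "\<And>i. i < l \<Longrightarrow> u i \<le> u (Suc i)"
    using assms(2) by (auto simp: vsums_def)
  define s where "s i = (if i \<le> k then t i else u (i - k))" for i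
  have "(\<Sum>i<k + l. infnorm (g (s (Suc i)) - g (s i))) = x + y"
  proof -
    have "(\<Sum>i<k + l. infnorm (g (s (Suc i)) - g (s i)))
        = (\<Sum>i<k. infnorm (g (s (Suc i)) - g (s i))) + (\<Sum>i<l. infnorm (g (s (Suc (k + i))) - g (s (k + i))))"
      by (rule sum_lessThan_add)
    also have "(\<Sum>i<k. infnorm (g (s (Suc i)) - g (s i))) = x"
      unfolding t(1) by (intro sum.cong) (auto simp: s_def)
    also have "(\<Sum>i<l. infnorm (g (s (Suc (k + i))) - g (s (k + i)))) = y"
      unfolding u(1) by (intro sum.cong) (auto simp: s_def t(3) u(2))
    finally show ?thesis .
  qed
  moreover have "s i \<le> s (Suc i)" if "i < k + l" for i
  proof -
    consider "i < k" | "i = k" | "i > k" by linarith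
    then show ?thesis
    proof cases
      case 2
      then show ?thesis using u(2) u(4)[of 0] t(3) that by (auto simp: s_def)
    next
      case 3
      then show ?thesis using u(4)[of "i - k"] that by (auto simp: s_def Suc_diff_le)
    qed (use t(4) in \<open>auto simp: s_def\<close>)
  qed
  ultimately show ?thesis
    using vsumsI[of s a "k + l" c g] t(2,3) u(2,3) by (auto simp: s_def)
qed

text \<open>Clamping a partition to \<open>{a..b}\<close> and to \<open>{b..c}\<close> replaces the insertion of \<open>b\<close>: the repeated points
  contribute nothing, and only the step across \<open>b\<close> needs the triangle inequality.\<close>

lemma vsums_split:
  assumes "x \<in> vsums g a c" "a \<le> b" "b \<le> c"
  obtains y z where "y \<in> vsums g a b" "z \<in> vsums g b c" "x \<le> y + z"
proof -
  obtain k t where t: "x = (\<Sum>i<k. infnorm (g (t (Suc i)) - g (t i)))" "t 0 = a" "t k = c" "\<And>i. i < k \<Longrightarrow> t i \<le> t (Suc i)"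
    using assms(1) by (auto simp: vsums_def)
  let ?y = "\<Sum>i<k. infnorm (g (min (t (Suc i)) b) - g (min (t i) b))"
  let ?z = "\<Sum>i<k. infnorm (g (max (t (Suc i)) b) - g (max (t i) b))"
  have "infnorm (g (t (Suc i)) - g (t i))
      \<le> infnorm (g (min (t (Suc i)) b) - g (min (t i) b)) + infnorm (g (max (t (Suc i)) b) - g (max (t i) b))"
    if "i < k" for i
  proof -
    consider "t (Suc i) \<le> b" | "b \<le> t i" | "t i \<le> b" "b \<le> t (Suc i)" by linarith
    then show ?thesis
    proof cases
      case 1
      then show ?thesis using t(4)[OF that] by (simp add: infnorm_pos_le)
    next
      case 2
      then show ?thesis using t(4)[OF that] by (simp add: infnorm_pos_le)
    next
      case 3
      then show ?thesis using infnorm_triangle_diff[of "g (t (Suc i))" "g (t i)" "g b"] by simp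
    qed
  qed
  then have "x \<le> ?y + ?z" unfolding t(1) sum.distrib[symmetric] by (intro sum_mono) auto
  moreover have "?y \<in> vsums g a b"
    by (rule vsums_mono_map[OF t(2-4) mono_min_max(1)]) (use assms in auto)
  moreover have "?z \<in> vsums g b c"
    by (rule vsums_mono_map[OF t(2-4) mono_min_max(2)]) (use assms in auto)
  ultimately show ?thesis using that by blast
qed

lemma bdd_above_vsums_sub:
  assumes bdd: "bdd_above (vsums g a d)" and "a \<le> b" "b \<le> c" "c \<le> d"
  shows "bdd_above (vsums g b c)"
proof -
  obtain B where B: "\<And>x. x \<in> vsums g a d \<Longrightarrow> x \<le> B" using bdd by (auto simp: bdd_above_def)
  show ?thesis
  proof (rule bdd_aboveI)
    fix x assume "x \<in> vsums g b c"
    then have "infnorm (g b - g a) + (x + infnorm (g d - g c)) \<in> vsums g a d"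
      using assms by (intro vsums_concat[OF vsums_chord vsums_concat[OF _ vsums_chord]])
    from B[OF this] show "x \<le> B" using infnorm_pos_le[of "g b - g a"] infnorm_pos_le[of "g d - g c"] by linarith
  qed
qed

lemma Var_nonneg: "bdd_above (vsums g a b) \<Longrightarrow> a \<le> b \<Longrightarrow> Var g a b \<ge> 0"
  unfolding Var_def by (rule cSup_upper2[OF vsums_chord]) (auto simp: infnorm_pos_le)

lemma Var_chord: "bdd_above (vsums g a b) \<Longrightarrow> a \<le> b \<Longrightarrow> infnorm (g b - g a) \<le> Var g a b"
  unfolding Var_def by (rule cSup_upper[OF vsums_chord])

lemma Var_additive:
  assumes bdd: "bdd_above (vsums g a c)" and "a \<le> b" "b \<le> c"
  shows "Var g a c = Var g a b + Var g b c"
proof (rule antisym)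
  have bb: "bdd_above (vsums g a b)" "bdd_above (vsums g b c)"
    using bdd_above_vsums_sub[OF bdd] assms by auto
  have ne: "vsums g a b \<noteq> {}" "vsums g b c \<noteq> {}" "vsums g a c \<noteq> {}"
    using vsums_chord[of a b g] vsums_chord[of b c g] vsums_chord[of a c g] assms by auto
  show "Var g a c \<le> Var g a b + Var g b c"
    unfolding Var_def[of g a c]
  proof (rule cSup_least[OF ne(3)])
    fix x assume "x \<in> vsums g a c"
    then obtain y z where "y \<in> vsums g a b" "z \<in> vsums g b c" "x \<le> y + z"
      using vsums_split assms by metis
    then show "x \<le> Var g a b + Var g b c"
      unfolding Var_def using cSup_upper[OF _ bb(1)] cSup_upper[OF _ bb(2)] by (meson add_mono order_trans)
  qed
  have "y + z \<le> Var g a c" if "y \<in> vsums g a b" "z \<in> vsums g b c" for y z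
    unfolding Var_def using vsums_concat[OF that] bdd by (rule cSup_upper)
  then have "y \<le> Var g a c - z" if "y \<in> vsums g a b" "z \<in> vsums g b c" for y z
    using that by (simp add: le_diff_eq)
  then have "Var g a b \<le> Var g a c - z" if "z \<in> vsums g b c" for z
    unfolding Var_def[of g a b] using that by (intro cSup_least[OF ne(1)])
  then have "z \<le> Var g a c - Var g a b" if "z \<in> vsums g b c" for z using that by fastforce
  then have "Var g b c \<le> Var g a c - Var g a b"
    unfolding Var_def[of g b c] by (intro cSup_least[OF ne(2)])
  then show "Var g a b + Var g b c \<le> Var g a c" by simp
qed

lemma vsums_affine:
  assumes "m > 0"
  shows "vsums (\<lambda>s. g (m * s + q)) a b = vsums g (m * a + q) (m * b + q)"
proof -
  have sub: "vsums (\<lambda>s. g (m * s + q)) a b \<subseteq> vsums g (m * a + q) (m * b + q)"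
    if "m > 0" for g :: "real \<Rightarrow> real ^ 'n" and m q a b
  proof
    fix x assume "x \<in> vsums (\<lambda>s. g (m * s + q)) a b"
    then obtain k t where t: "x = (\<Sum>i<k. infnorm (g (m * t (Suc i) + q) - g (m * t i + q)))" "t 0 = a" "t k = b" "\<And>i. i < k \<Longrightarrow> t i \<le> t (Suc i)"
      by (auto simp: vsums_def)
    then show "x \<in> vsums g (m * a + q) (m * b + q)"
      using vsumsI[of "\<lambda>i. m * t i + q" _ k _ g] that by simp
  qed
  have "vsums g (m * a + q) (m * b + q) = vsums (\<lambda>s. g (m * (s / m - q / m) + q)) (m * a + q) (m * b + q)"
    using assms by (simp add: algebra_simps)
  also have "\<dots> \<subseteq> vsums (\<lambda>s. g (m * s + q)) ((1 / m) * (m * a + q) + (- q / m)) ((1 / m) * (m * b + q) + (- q / m))"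
    using sub[of "1 / m" "\<lambda>s. g (m * s + q)" "- q / m" "m * a + q" "m * b + q"] assms by simp
  also have "\<dots> = vsums (\<lambda>s. g (m * s + q)) a b" using assms by (simp add: field_simps)
  finally show ?thesis using sub[OF assms] by blast
qed

lemma vsums_reverse: "vsums (\<lambda>s. g (1 - s)) a b = vsums g (1 - b) (1 - a)"
proof -
  have sub: "vsums (\<lambda>s. g (1 - s)) a b \<subseteq> vsums g (1 - b) (1 - a)" for g :: "real \<Rightarrow> real ^ 'n" and a b
  proof
    fix x assume "x \<in> vsums (\<lambda>s. g (1 - s)) a b"
    then obtain k t where t: "x = (\<Sum>i<k. infnorm (g (1 - t (Suc i)) - g (1 - t i)))" "t 0 = a" "t k = b" "\<And>i. i < k \<Longrightarrow> t i \<le> t (Suc i)"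
      by (auto simp: vsums_def)
    define u where "u i = 1 - t (k - i)" for i
    have "(\<Sum>i<k. infnorm (g (u (Suc i)) - g (u i))) = (\<Sum>i<k. infnorm (g (1 - t (k - Suc i)) - g (1 - t (Suc (k - Suc i)))))"
      by (intro sum.cong) (auto simp: u_def Suc_diff_Suc)
    also have "\<dots> = (\<Sum>i<k. infnorm (g (1 - t i) - g (1 - t (Suc i))))"
      by (rule sum.nat_diff_reindex)
    also have "\<dots> = x" unfolding t(1) by (intro sum.cong) (auto simp: infnorm_sub)
    finally have "x = (\<Sum>i<k. infnorm (g (u (Suc i)) - g (u i)))" by simp
    moreover have "u i \<le> u (Suc i)" if "i < k" for i
      using t(4)[of "k - Suc i"] that by (simp add: u_def Suc_diff_Suc)
    ultimately show "x \<in> vsums g (1 - b) (1 - a)"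
      using vsumsI[of u "1 - b" k "1 - a" g] t by (simp add: u_def)
  qed
  from sub[of g a b] sub[of "\<lambda>s. g (1 - s)" "1 - b" "1 - a"] show ?thesis by auto
qed

definition len :: "(real \<Rightarrow> real ^ 'n) \<Rightarrow> real \<Rightarrow> real" where
  "len g s = Var g 0 (max 0 (min 1 s))"

lemma curve_integral_eq:
  "curve_integral g w = (\<integral>\<^sup>+ t\<in>{0..1}. ennreal (w (g t)) \<partial>interval_measure (len g))"
  unfolding curve_integral_def len_def[abs_def] curve_length_eq ..

lemma rectifiableD:
  assumes "rectifiable g"
  shows "path g" "bdd_above (vsums g 0 1)"
    "0 \<le> a \<Longrightarrow> a \<le> b \<Longrightarrow> b \<le> 1 \<Longrightarrow> bdd_above (vsums g a b)"
proof -
  show 1: "path g" "bdd_above (vsums g 0 1)" using assms by (auto simp: rectifiable_def variation_sums_eq)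
  show "0 \<le> a \<Longrightarrow> a \<le> b \<Longrightarrow> b \<le> 1 \<Longrightarrow> bdd_above (vsums g a b)"
    by (rule bdd_above_vsums_sub[OF 1(2)])
qed

lemma len_diff:
  assumes "rectifiable g" "0 \<le> u" "u \<le> v" "v \<le> 1"
  shows "len g v - len g u = Var g u v"
  using Var_additive[OF rectifiableD(3)[OF assms(1)], of 0 v u] assms by (simp add: len_def)

lemma len_mono:
  assumes "rectifiable g" "u \<le> v"
  shows "len g u \<le> len g v"
proof -
  let ?c = "\<lambda>s. max 0 (min 1 s) :: real"
  have "len g (?c v) - len g (?c u) = Var g (?c u) (?c v)"
    using assms by (intro len_diff) auto
  also have "\<dots> \<ge> 0" using assms by (intro Var_nonneg rectifiableD(3)) auto
  finally show ?thesis by (simp add: len_def)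
qed

text \<open>Take a partition whose sum is within \<open>e / 2\<close> of the total variation. Clamped to a short interval
  \<open>{u..v}\<close> it has a sum of at most \<open>e / 2\<close>, by uniform continuity; clamped to the two complementary
  intervals it has at most the variation there. By additivity the variation over \<open>{u..v}\<close> is at most \<open>e\<close>.\<close>

lemma len_continuous:
  assumes g: "rectifiable g"
  shows "continuous_on UNIV (len g)"
proof -
  have unif: "\<exists>d>0. \<forall>u v. 0 \<le> u \<and> u \<le> v \<and> v \<le> 1 \<and> v - u < d \<longrightarrow> Var g u v \<le> e" if e: "e > 0" for e
  proof -
    let ?V = "Var g 0 1"
    have "\<exists>x\<in>vsums g 0 1. ?V - e / 2 < x"
      using less_cSup_iff[of "vsums g 0 1" "?V - e / 2"] vsums_chord[of 0 1 g] rectifiableD(2)[OF g] e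
      unfolding Var_def by auto
    then obtain k t where t: "?V - e / 2 < (\<Sum>i<k. infnorm (g (t (Suc i)) - g (t i)))" "t 0 = 0" "t k = 1" "\<And>i. i < k \<Longrightarrow> t i \<le> t (Suc i)"
      by (auto simp: vsums_def)
    have "uniformly_continuous_on {0..1} g"
      using rectifiableD(1)[OF g] by (intro compact_uniformly_continuous) (auto simp: path_def)
    moreover have "e / (2 * (real k + 1)) > 0" using e by simp
    ultimately have "\<exists>d>0. \<forall>a\<in>{0..1}. \<forall>b\<in>{0..1}. dist b a < d \<longrightarrow> dist (g b) (g a) < e / (2 * (real k + 1))"
      unfolding uniformly_continuous_on_def by blast
    then obtain d where d: "d > 0" "\<And>a b. a \<in> {0..1} \<Longrightarrow> b \<in> {0..1} \<Longrightarrow> dist b a < d \<Longrightarrow> dist (g b) (g a) < e / (2 * (real k + 1))"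
      by blast
    have "Var g u v \<le> e" if uv: "0 \<le> u" "u \<le> v" "v \<le> 1" "v - u < d" for u v
    proof -
      \<comment> \<open>Clamping to \<open>{u..v}\<close>; clamped partition points are less than \<open>d\<close> apart.\<close>
      define c where "c s = max u (min v s)" for s
      have c: "c s \<in> {0..1}" "dist (c s) (c s') < d" for s s'
        using uv by (auto simp: c_def dist_real_def)
      let ?x = "\<Sum>i<k. infnorm (g (min (t (Suc i)) u) - g (min (t i) u))"
      let ?y = "\<Sum>i<k. infnorm (g (c (t (Suc i))) - g (c (t i)))"
      let ?z = "\<Sum>i<k. infnorm (g (max (t (Suc i)) v) - g (max (t i) v))"
      have "infnorm (g (t (Suc i)) - g (t i)) \<le> infnorm (g (min (t (Suc i)) u) - g (min (t i) u))
          + infnorm (g (c (t (Suc i))) - g (c (t i))) + infnorm (g (max (t (Suc i)) v) - g (max (t i) v))"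
        if i: "i < k" for i
      proof -
        define s s' where "s = t i" and "s' = t (Suc i)"
        have ss: "s \<le> s'" using t(4)[OF i] by (simp add: s_def s'_def)
        have step: "infnorm (g b - g a) \<le> infnorm (g (min b m) - g (min a m)) + infnorm (g (max b m) - g (max a m))"
          if "a \<le> b" for a b m
        proof -
          consider "b \<le> m" | "m \<le> a" | "a \<le> m" "m \<le> b" by linarith
          then show ?thesis
            using that infnorm_triangle_diff[of "g b" "g a" "g m"] by cases (simp_all add: infnorm_pos_le)
        qed
        have "infnorm (g s' - g s) \<le> infnorm (g (min s' u) - g (min s u)) + infnorm (g (max s' u) - g (max s u))"
          by (rule step[OF ss])
        also have "infnorm (g (max s' u) - g (max s u)) \<le> infnorm (g (min (max s' u) v) - g (min (max s u) v))
            + infnorm (g (max (max s' u) v) - g (max (max s u) v))"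
          by (rule step) (use ss in auto)
        also have "infnorm (g (min (max s' u) v) - g (min (max s u) v)) + infnorm (g (max (max s' u) v) - g (max (max s u) v))
            = infnorm (g (c s') - g (c s)) + infnorm (g (max s' v) - g (max s v))"
        proof -
          have "min (max s' u) v = c s'" "min (max s u) v = c s" "max (max s' u) v = max s' v" "max (max s u) v = max s v"
            using uv by (auto simp: c_def max_def min_def)
          then show ?thesis by simp
        qed
        finally show ?thesis by (simp only: s_def s'_def add.assoc)
      qed
      then have "(\<Sum>i<k. infnorm (g (t (Suc i)) - g (t i))) \<le> ?x + ?y + ?z"
        unfolding sum.distrib[symmetric] by (intro sum_mono) auto
      moreover have "?x \<le> Var g 0 u" unfolding Var_def
        by (rule cSup_upper[OF vsums_mono_map[OF t(2-4) mono_min_max(1)]])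
           (use uv rectifiableD(3)[OF g, of 0 u] in auto)
      moreover have "?z \<le> Var g v 1" unfolding Var_def
        by (rule cSup_upper[OF vsums_mono_map[OF t(2-4) mono_min_max(2)]])
           (use uv rectifiableD(3)[OF g, of v 1] in auto)
      moreover have "?y \<le> (\<Sum>i<k. e / (2 * (real k + 1)))"
      proof (rule sum_mono)
        fix i
        have "infnorm (g (c (t (Suc i))) - g (c (t i))) \<le> dist (g (c (t (Suc i)))) (g (c (t i)))"
          by (simp add: dist_norm infnorm_le_norm)
        also have "\<dots> < e / (2 * (real k + 1))" by (rule d(2)[OF c(1) c(1) c(2)])
        finally show "infnorm (g (c (t (Suc i))) - g (c (t i))) \<le> e / (2 * (real k + 1))" by simp
      qed
      moreover have "(\<Sum>i<k. e / (2 * (real k + 1))) \<le> e / 2" using e by (simp add: field_simps)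
      moreover have "?V = Var g 0 u + Var g u v + Var g v 1"
        using Var_additive[OF rectifiableD(2)[OF g], of u] Var_additive[OF rectifiableD(3)[OF g], of u 1 v] uv by simp
      ultimately show ?thesis using t(1) by linarith
    qed
    then show ?thesis using d(1) by blast
  qed
  show ?thesis
  proof (rule continuous_onI)
    fix x e :: real assume "e > 0"
    from unif[OF this] obtain d where d: "d > 0"
        "\<forall>u v. 0 \<le> u \<and> u \<le> v \<and> v \<le> 1 \<and> v - u < d \<longrightarrow> Var g u v \<le> e" by blast
    let ?c = "\<lambda>s. max 0 (min 1 s) :: real"
    have close: "\<bar>len g y - len g z\<bar> \<le> e" if "\<bar>y - z\<bar> < d" "y \<le> z" for y z
    proof -
      have "len g (?c z) - len g (?c y) = Var g (?c y) (?c z)" using that g by (intro len_diff) auto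
      also have "\<dots> \<le> e" using that by (intro d(2)[rule_format]) (auto simp: max_def min_def)
      finally show ?thesis using len_mono[OF g that(2)] by (simp add: len_def)
    qed
    have "dist (len g y) (len g x) \<le> e" if "dist y x < d" for y
      using close[of y x] close[of x y] that by (cases "y \<le> x") (auto simp: dist_real_def abs_minus_commute)
    then show "\<exists>d>0. \<forall>x'\<in>UNIV. dist x' x < d \<longrightarrow> dist (len g x') (len g x) \<le> e"
      by (intro exI[of _ d] conjI ballI impI d(1))
  qed
qed

lemma emeasure_len_Icc:
  assumes "rectifiable g" "u \<le> v"
  shows "emeasure (interval_measure (len g)) {u..v} = ennreal (len g v - len g u)"
  using emeasure_interval_measure_Icc[OF assms(2) len_mono[OF assms(1)] len_continuous[OF assms(1)]] by simp

section \<open>Integrals along curves\<close>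

lemma measure_eqI_Icc:
  fixes M N :: "real measure"
  assumes sets: "sets M = sets borel" "sets N = sets borel"
    and eq: "\<And>u v. u \<le> v \<Longrightarrow> emeasure M {u..v} = emeasure N {u..v}"
    and fin: "\<And>u v. u \<le> v \<Longrightarrow> emeasure M {u..v} \<noteq> \<infinity>"
  shows "M = N"
proof (rule measure_eqI_generator_eq[where E = "range (\<lambda>(a, b). {a..b :: real})" and \<Omega> = UNIV and A = "\<lambda>i. {- real i..real i}"])
  have sb: "sets (borel :: real measure) = sigma_sets UNIV (range (\<lambda>(a, b). {a..b :: real}))"
    by (subst borel_eq_atLeastAtMost) simp
  show "Int_stable (range (\<lambda>(a, b). {a..b :: real}))"
    by (auto simp: Int_stable_def)
  show "emeasure M X = emeasure N X" if X: "X \<in> range (\<lambda>(a, b). {a..b :: real})" for X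
  proof -
    obtain a b where "X = {a..b}" using X by auto
    then show ?thesis using eq[of a b] by (cases "a \<le> b") auto
  qed
  show "sets M = sigma_sets UNIV (range (\<lambda>(a, b). {a..b :: real}))"
    "sets N = sigma_sets UNIV (range (\<lambda>(a, b). {a..b :: real}))"
    using sets sb by auto
  show "(\<Union>i. {- real i..real i}) = UNIV"
  proof (intro equalityI subsetI)
    fix x :: real
    obtain i where "\<bar>x\<bar> \<le> real i" using real_arch_simple by blast
    then show "x \<in> (\<Union>i. {- real i..real i})" by (intro UN_I[of i]) auto
  qed simp
  show "emeasure M {- real i..real i} \<noteq> \<infinity>" for i by (intro fin) simp
qed auto

lemma image_affine_Icc:
  fixes a b m q :: real
  assumes "a \<le> b" "m \<noteq> 0"
  shows "(\<lambda>s. m * s + q) ` {a..b} = {min (m * a + q) (m * b + q)..max (m * a + q) (m * b + q)}"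
proof (cases "m > 0")
  case True
  then have "m * a \<le> m * b" using assms by simp
  then show ?thesis using True assms by (simp add: image_affinity_atLeastAtMost)
next
  case False
  then have "m * b \<le> m * a" using assms by (intro mult_left_mono_neg) auto
  then show ?thesis using False assms by (simp add: image_affinity_atLeastAtMost)
qed

text \<open>This covers the two halves of a joined path as well as reversal, where \<open>m\<close> is negative; hence the
  absolute value in the hypothesis on increments.\<close>

lemma nn_integral_interval_measure_affine:
  fixes F H :: "real \<Rightarrow> real"
  assumes F: "\<And>x y. x \<le> y \<Longrightarrow> F x \<le> F y" "continuous_on UNIV F"
    and H: "\<And>x y. x \<le> y \<Longrightarrow> H x \<le> H y" "continuous_on UNIV H"
    and m: "m \<noteq> 0" and ab: "a \<le> b"
    and diff: "\<And>u v. a \<le> u \<Longrightarrow> u \<le> v \<Longrightarrow> v \<le> b \<Longrightarrow> F v - F u = \<bar>H (m * v + q) - H (m * u + q)\<bar>"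
    and f: "f \<in> borel_measurable borel"
  shows "(\<integral>\<^sup>+ s\<in>{a..b}. f (m * s + q) \<partial>interval_measure F)
    = (\<integral>\<^sup>+ u\<in>(\<lambda>s. m * s + q) ` {a..b}. f u \<partial>interval_measure H)"
proof -
  let ?\<phi> = "\<lambda>s. m * s + q"
  let ?I = "?\<phi> ` {a..b}"
  let ?M = "density (interval_measure F) (indicator {a..b})"
  let ?N = "density (interval_measure H) (indicator ?I)"
  note [measurable] = f
  have I: "?I = {min (?\<phi> a) (?\<phi> b)..max (?\<phi> a) (?\<phi> b)}"
    by (rule image_affine_Icc[OF ab m])
  have [measurable]: "?I \<in> sets borel" unfolding I by simp
  have eq: "emeasure (distr ?M borel ?\<phi>) {u..v} = emeasure ?N {u..v} \<and> emeasure ?N {u..v} \<noteq> \<infinity>"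
    if uv: "u \<le> v" for u v
  proof -
    have [measurable]: "?\<phi> -` {u..v} \<in> sets borel"
      by (rule measurable_sets_borel[where M = borel]) auto
    have N: "emeasure ?N {u..v} = emeasure (interval_measure H) (?I \<inter> {u..v})"
      by (subst emeasure_density) (auto simp: indicator_inter_arith[symmetric] simp flip: nn_integral_indicator)
    have M: "emeasure (distr ?M borel ?\<phi>) {u..v} = emeasure (interval_measure F) ({a..b} \<inter> ?\<phi> -` {u..v})"
      by (subst emeasure_distr, simp, simp, subst emeasure_density)
         (auto simp: indicator_inter_arith[symmetric] simp flip: nn_integral_indicator)
    define a' b' where "a' = max a (min ((u - q) / m) ((v - q) / m))" and "b' = min b (max ((u - q) / m) ((v - q) / m))"
    have pre: "{a..b} \<inter> ?\<phi> -` {u..v} = {a'..b'}"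
    proof -
      have "?\<phi> -` {u..v} = {min ((u - q) / m) ((v - q) / m)..max ((u - q) / m) ((v - q) / m)}"
      proof (cases "m > 0")
        case True
        then have "(u - q) / m \<le> (v - q) / m" using uv by (simp add: divide_right_mono)
        then show ?thesis using True by (auto simp: pos_divide_le_eq pos_le_divide_eq mult.commute)
      next
        case False
        then have "m < 0" using m by simp
        then have "(v - q) / m \<le> (u - q) / m" using uv by (simp add: divide_right_mono_neg)
        then show ?thesis using \<open>m < 0\<close> by (auto simp: neg_divide_le_eq neg_le_divide_eq mult.commute)
      qed
      then show ?thesis by (simp add: a'_def b'_def)
    qed
    have img: "?I \<inter> {u..v} = ?\<phi> ` {a'..b'}" unfolding pre[symmetric] by auto
    show ?thesis
    proof (cases "a' \<le> b'")
      case True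
      have "a \<le> a'" "b' \<le> b" by (auto simp: a'_def b'_def)
      then have d: "F b' - F a' = \<bar>H (?\<phi> b') - H (?\<phi> a')\<bar>" using True by (intro diff)
      have "?\<phi> ` {a'..b'} = {min (?\<phi> a') (?\<phi> b')..max (?\<phi> a') (?\<phi> b')}"
        by (rule image_affine_Icc[OF True m])
      then have "emeasure (interval_measure H) (?\<phi> ` {a'..b'}) = ennreal \<bar>H (?\<phi> b') - H (?\<phi> a')\<bar>"
        using emeasure_interval_measure_Icc[OF _ H, of "min (?\<phi> a') (?\<phi> b')" "max (?\<phi> a') (?\<phi> b')"]
          H(1)[of "?\<phi> a'" "?\<phi> b'"] H(1)[of "?\<phi> b'" "?\<phi> a'"] by (auto simp: min_def max_def)
      moreover have "emeasure (interval_measure F) {a'..b'} = ennreal (F b' - F a')"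
        by (rule emeasure_interval_measure_Icc[OF True F])
      ultimately show ?thesis unfolding M N pre img d by simp
    qed (simp add: M N pre img)
  qed
  have MN: "distr ?M borel ?\<phi> = ?N"
    by (rule measure_eqI_Icc) (use eq in \<open>auto\<close>)
  have "(\<integral>\<^sup>+ s\<in>{a..b}. f (?\<phi> s) \<partial>interval_measure F) = (\<integral>\<^sup>+ s. f (?\<phi> s) \<partial>?M)"
    by (subst nn_integral_density) (auto intro!: nn_integral_cong simp: indicator_def)
  also have "\<dots> = (\<integral>\<^sup>+ u. f u \<partial>distr ?M borel ?\<phi>)"
    by (subst nn_integral_distr) auto
  also have "\<dots> = (\<integral>\<^sup>+ u\<in>?I. f u \<partial>interval_measure H)"
    unfolding MN by (subst nn_integral_density) (auto intro!: nn_integral_cong simp: indicator_def)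
  finally show ?thesis .
qed

lemma borel_measurable_along_path:
  assumes "path g" "continuous_on (path_image g) w"
  shows "(\<lambda>u. indicator {0..1} u * ennreal (w (g u))) \<in> borel_measurable borel"
proof -
  have "continuous_on {0..1} (\<lambda>u. w (g u))"
    by (rule continuous_on_compose2[OF assms(2) assms(1)[unfolded path_def]]) (auto simp: path_image_def)
  then have "(\<lambda>u. indicator {0..1} u *\<^sub>R w (g u)) \<in> borel_measurable borel"
    by (rule borel_measurable_continuous_on_indicator[rotated]) simp
  then have "(\<lambda>u. ennreal (indicator {0..1} u *\<^sub>R w (g u))) \<in> borel_measurable borel" by simp
  also have "(\<lambda>u. ennreal (indicator {0..1} u *\<^sub>R w (g u))) = (\<lambda>u. indicator {0..1} u * ennreal (w (g u)))"
    by (auto simp: indicator_def)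
  finally show ?thesis .
qed

lemma rectifiable_reversepath:
  assumes g: "rectifiable g"
  shows "rectifiable (reversepath g)"
  using rectifiableD[OF g] vsums_reverse[of g 0 1]
  unfolding rectifiable_def variation_sums_eq reversepath_def[abs_def] path_def
  by (auto intro!: continuous_on_compose2[of "{0..1}" g] continuous_intros)

lemma curve_integral_reversepath:
  assumes g: "rectifiable g" and w: "continuous_on (path_image g) w"
  shows "curve_integral (reversepath g) w = curve_integral g w"
proof -
  define f where "f u = indicator {0..1} u * ennreal (w (g u))" for u
  have f: "f \<in> borel_measurable borel"
    unfolding f_def[abs_def] by (rule borel_measurable_along_path[OF rectifiableD(1)[OF g] w])
  let ?h = "reversepath g"
  have h: "rectifiable ?h" by (rule rectifiable_reversepath[OF g])
  have "curve_integral ?h w = (\<integral>\<^sup>+ s\<in>{0..1}. f (- 1 * s + 1) \<partial>interval_measure (len ?h))"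
    unfolding curve_integral_eq
    by (intro nn_integral_cong) (auto simp: f_def reversepath_def indicator_def)
  also have "\<dots> = (\<integral>\<^sup>+ u\<in>(\<lambda>s. - 1 * s + 1) ` {0..1}. f u \<partial>interval_measure (len g))"
  proof (rule nn_integral_interval_measure_affine[OF len_mono[OF h] len_continuous[OF h] len_mono[OF g] len_continuous[OF g] _ _ _ f])
    fix u v :: real assume uv: "0 \<le> u" "u \<le> v" "v \<le> 1"
    have "len ?h v - len ?h u = Var g (1 - v) (1 - u)"
      using len_diff[OF h uv] vsums_reverse[of g u v] by (simp add: Var_def reversepath_def[abs_def])
    also have "\<dots> = len g (1 - u) - len g (1 - v)" using len_diff[OF g, of "1 - v" "1 - u"] uv by simp
    finally show "len ?h v - len ?h u = \<bar>len g (- 1 * v + 1) - len g (- 1 * u + 1)\<bar>"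
      using len_mono[OF g, of "1 - v" "1 - u"] uv by simp
  qed auto
  also have "(\<lambda>s. - 1 * s + 1) ` {0..1 :: real} = {0..1}"
    by (auto simp: image_iff intro!: bexI[of _ "1 - _"])
  also have "(\<integral>\<^sup>+ u\<in>{0..1}. f u \<partial>interval_measure (len g)) = curve_integral g w"
    unfolding curve_integral_eq by (intro nn_integral_cong) (auto simp: f_def indicator_def)
  finally show ?thesis .
qed

lemma joinpaths_right:
  "pathfinish g1 = pathstart g2 \<Longrightarrow> 1 / 2 \<le> s \<Longrightarrow> (g1 +++ g2) s = g2 (2 * s - 1)"
proof (cases "s = 1 / 2")
  case True
  assume "pathfinish g1 = pathstart g2"
  then show ?thesis unfolding True by (simp add: joinpaths_def pathfinish_def pathstart_def)
qed (auto simp: joinpaths_def)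

lemma vsums_joinpaths:
  assumes "pathfinish g1 = pathstart g2"
  shows "v \<le> 1 / 2 \<Longrightarrow> vsums (g1 +++ g2) u v = vsums g1 (2 * u) (2 * v)"
    "1 / 2 \<le> u \<Longrightarrow> vsums (g1 +++ g2) u v = vsums g2 (2 * u - 1) (2 * v - 1)"
proof -
  assume "v \<le> 1 / 2"
  then have "vsums (g1 +++ g2) u v = vsums (\<lambda>s. g1 (2 * s + 0)) u v"
    by (intro vsums_cong) (auto simp: joinpaths_def)
  then show "vsums (g1 +++ g2) u v = vsums g1 (2 * u) (2 * v)" using vsums_affine[of 2 g1 0 u v] by simp
next
  assume "1 / 2 \<le> u"
  then have "vsums (g1 +++ g2) u v = vsums (\<lambda>s. g2 (2 * s + (- 1))) u v"
    by (intro vsums_cong) (use joinpaths_right[OF assms] in auto)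
  then show "vsums (g1 +++ g2) u v = vsums g2 (2 * u - 1) (2 * v - 1)" using vsums_affine[of 2 g2 "- 1" u v] by simp
qed

lemma rectifiable_joinpaths:
  assumes g: "rectifiable g1" "rectifiable g2" and j: "pathfinish g1 = pathstart g2"
  shows "rectifiable (g1 +++ g2)"
proof -
  obtain B1 where B1: "\<And>x. x \<in> vsums g1 0 1 \<Longrightarrow> x \<le> B1"
    using rectifiableD(2)[OF g(1)] by (auto simp: bdd_above_def)
  obtain B2 where B2: "\<And>x. x \<in> vsums g2 0 1 \<Longrightarrow> x \<le> B2"
    using rectifiableD(2)[OF g(2)] by (auto simp: bdd_above_def)
  have "bdd_above (vsums (g1 +++ g2) 0 1)"
  proof (rule bdd_aboveI)
    fix x assume "x \<in> vsums (g1 +++ g2) 0 1"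
    then obtain y z where yz: "y \<in> vsums (g1 +++ g2) 0 (1 / 2)" "z \<in> vsums (g1 +++ g2) (1 / 2) 1" "x \<le> y + z"
      by (rule vsums_split[of _ _ _ _ "1 / 2"]) auto
    then have "y \<le> B1" "z \<le> B2"
      using vsums_joinpaths(1)[OF j, of "1 / 2" 0] vsums_joinpaths(2)[OF j, of "1 / 2" 1] B1 B2 by auto
    then show "x \<le> B1 + B2" using yz(3) by simp
  qed
  then show ?thesis using rectifiableD(1)[OF g(1)] rectifiableD(1)[OF g(2)] j
    by (simp add: rectifiable_def variation_sums_eq path_join)
qed

text \<open>The two halves of the parameter interval share a point, which is harmless for an upper bound.\<close>

lemma curve_integral_joinpaths_le:
  assumes g: "rectifiable g1" "rectifiable g2" and j: "pathfinish g1 = pathstart g2"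
    and w: "continuous_on (path_image g1) w" "continuous_on (path_image g2) w"
  shows "curve_integral (g1 +++ g2) w \<le> curve_integral g1 w + curve_integral g2 w"
proof -
  let ?h = "g1 +++ g2"
  have h: "rectifiable ?h" by (rule rectifiable_joinpaths[OF g j])
  define f1 where "f1 u = indicator {0..1} u * ennreal (w (g1 u))" for u
  define f2 where "f2 u = indicator {0..1} u * ennreal (w (g2 u))" for u
  have f: "f1 \<in> borel_measurable borel" "f2 \<in> borel_measurable borel"
    unfolding f1_def[abs_def] f2_def[abs_def]
    using borel_measurable_along_path[OF rectifiableD(1)[OF g(1)] w(1)]
      borel_measurable_along_path[OF rectifiableD(1)[OF g(2)] w(2)] by auto
  have wh: "continuous_on (path_image ?h) w"
  proof -
    have "closed (path_image g1)" "closed (path_image g2)"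
      using g by (auto intro!: compact_imp_closed compact_path_image rectifiableD(1))
    then show ?thesis using w j by (simp add: path_image_join continuous_on_closed_Un)
  qed
  define f where "f u = indicator {0..1} u * ennreal (w (?h u))" for u
  have fm: "f \<in> borel_measurable borel" unfolding f_def[abs_def]
    by (rule borel_measurable_along_path[OF rectifiableD(1)[OF h] wh])
  note [measurable] = fm f
  have "curve_integral ?h w \<le> (\<integral>\<^sup>+ s. f s * indicator {0..1/2} s + f s * indicator {1/2..1} s \<partial>interval_measure (len ?h))"
    unfolding curve_integral_eq by (intro nn_integral_mono) (auto simp: f_def indicator_def)
  also have "\<dots> = (\<integral>\<^sup>+ s\<in>{0..1/2}. f s \<partial>interval_measure (len ?h)) + (\<integral>\<^sup>+ s\<in>{1/2..1}. f s \<partial>interval_measure (len ?h))"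
    by (intro nn_integral_add) auto
  also have "(\<integral>\<^sup>+ s\<in>{0..1/2}. f s \<partial>interval_measure (len ?h)) = (\<integral>\<^sup>+ s\<in>{0..1/2}. f1 (2 * s + 0) \<partial>interval_measure (len ?h))"
    by (intro nn_integral_cong) (auto simp: f_def f1_def joinpaths_def indicator_def)
  also have "\<dots> = (\<integral>\<^sup>+ u\<in>(\<lambda>s. 2 * s + 0) ` {0..1/2}. f1 u \<partial>interval_measure (len g1))"
  proof (rule nn_integral_interval_measure_affine[OF len_mono[OF h] len_continuous[OF h] len_mono[OF g(1)] len_continuous[OF g(1)] _ _ _ f(1)])
    fix u v :: real assume uv: "0 \<le> u" "u \<le> v" "v \<le> 1 / 2"
    have "len ?h v - len ?h u = len g1 (2 * v) - len g1 (2 * u)"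
      using len_diff[OF h, of u v] len_diff[OF g(1), of "2 * u" "2 * v"] vsums_joinpaths(1)[OF j, of v u] uv by (simp add: Var_def)
    then show "len ?h v - len ?h u = \<bar>len g1 (2 * v + 0) - len g1 (2 * u + 0)\<bar>"
      using len_mono[OF g(1), of "2 * u" "2 * v"] uv by simp
  qed auto
  also have "(\<lambda>s. 2 * s + 0) ` {0..1/2 :: real} = {0..1}"
    using image_affine_Icc[of 0 "1 / 2" 2 0] by simp
  also have "(\<integral>\<^sup>+ u\<in>{0..1}. f1 u \<partial>interval_measure (len g1)) = curve_integral g1 w"
    unfolding curve_integral_eq by (intro nn_integral_cong) (auto simp: f1_def indicator_def)
  also have "(\<integral>\<^sup>+ s\<in>{1/2..1}. f s \<partial>interval_measure (len ?h)) = (\<integral>\<^sup>+ s\<in>{1/2..1}. f2 (2 * s + (- 1)) \<partial>interval_measure (len ?h))"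
    by (intro nn_integral_cong) (auto simp: f_def f2_def joinpaths_right[OF j] indicator_def)
  also have "\<dots> = (\<integral>\<^sup>+ u\<in>(\<lambda>s. 2 * s + (- 1)) ` {1/2..1}. f2 u \<partial>interval_measure (len g2))"
  proof (rule nn_integral_interval_measure_affine[OF len_mono[OF h] len_continuous[OF h] len_mono[OF g(2)] len_continuous[OF g(2)] _ _ _ f(2)])
    fix u v :: real assume uv: "1 / 2 \<le> u" "u \<le> v" "v \<le> 1"
    have "len ?h v - len ?h u = len g2 (2 * v - 1) - len g2 (2 * u - 1)"
      using len_diff[OF h, of u v] len_diff[OF g(2), of "2 * u - 1" "2 * v - 1"] vsums_joinpaths(2)[OF j, of u v] uv by (simp add: Var_def)
    then show "len ?h v - len ?h u = \<bar>len g2 (2 * v + - 1) - len g2 (2 * u + - 1)\<bar>"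
      using len_mono[OF g(2), of "2 * u - 1" "2 * v - 1"] uv by simp
  qed auto
  also have "(\<lambda>s. 2 * s + (- 1)) ` {1/2..1 :: real} = {0..1}"
    using image_affine_Icc[of "1 / 2" 1 2 "- 1"] by simp
  also have "(\<integral>\<^sup>+ u\<in>{0..1}. f2 u \<partial>interval_measure (len g2)) = curve_integral g2 w"
    unfolding curve_integral_eq by (intro nn_integral_cong) (auto simp: f2_def indicator_def)
  finally show ?thesis .
qed

lemma curve_integral_le_length:
  assumes g: "rectifiable g" and w: "\<And>z. z \<in> path_image g \<Longrightarrow> w z \<le> B" and "B \<ge> 0"
  shows "curve_integral g w \<le> ennreal (B * Var g 0 1)"
proof -
  have "curve_integral g w \<le> (\<integral>\<^sup>+ t. ennreal B * indicator {0..1} t \<partial>interval_measure (len g))"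
    unfolding curve_integral_eq
    using w by (intro nn_integral_mono) (auto simp: indicator_def path_image_def intro!: ennreal_leI)
  also have "\<dots> = ennreal B * ennreal (len g 1 - len g 0)"
    by (simp add: nn_integral_cmult_indicator emeasure_len_Icc[OF g])
  also have "\<dots> = ennreal (B * Var g 0 1)" using \<open>B \<ge> 0\<close> len_diff[OF g, of 0 1] by (simp add: ennreal_mult')
  finally show ?thesis .
qed

lemma rectifiable_linepath:
  fixes a b :: "real ^ 'n"
  shows "rectifiable (linepath a b)" "Var (linepath a b) 0 1 \<le> infnorm (b - a)"
proof -
  have sums: "x = infnorm (b - a)" if x: "x \<in> vsums (linepath a b) 0 1" for x
  proof -
    obtain k t where t: "x = (\<Sum>i<k. infnorm (linepath a b (t (Suc i)) - linepath a b (t i)))" "t 0 = (0 :: real)" "t k = 1" "\<And>i. i < k \<Longrightarrow> t i \<le> t (Suc i)"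
      using x by (auto simp: vsums_def)
    have "x = (\<Sum>i<k. (t (Suc i) - t i) * infnorm (b - a))"
      unfolding t(1)
    proof (rule sum.cong)
      fix i assume "i \<in> {..<k}"
      then have "t i \<le> t (Suc i)" using t(4) by simp
      moreover have "linepath a b (t (Suc i)) - linepath a b (t i) = (t (Suc i) - t i) *\<^sub>R (b - a)"
        by (simp add: linepath_def algebra_simps)
      ultimately show "infnorm (linepath a b (t (Suc i)) - linepath a b (t i)) = (t (Suc i) - t i) * infnorm (b - a)"
        by (simp add: infnorm_mul)
    qed simp
    also have "\<dots> = (t k - t 0) * infnorm (b - a)"
      by (simp add: sum_distrib_right[symmetric] sum_lessThan_telescope)
    finally show ?thesis using t by simp
  qed
  then have bdd: "bdd_above (vsums (linepath a b) 0 1)" by (intro bdd_aboveI[of _ "infnorm (b - a)"]) auto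
  then show "rectifiable (linepath a b)" by (simp add: rectifiable_def variation_sums_eq)
  show "Var (linepath a b) 0 1 \<le> infnorm (b - a)"
    unfolding Var_def
  proof (rule cSup_least)
    show "vsums (linepath a b) 0 1 \<noteq> {}" using vsums_chord[of 0 1 "linepath a b"] by auto
  qed (use sums in simp)
qed

text \<open>On each piece of the curve the integral is at least a lower bound for the weight times the length
  of the piece, hence times that of the chord.\<close>

lemma curve_integral_ge_chords:
  assumes g: "rectifiable g" and fin: "finite I"
    and uv: "\<And>i. i \<in> I \<Longrightarrow> 0 \<le> u i \<and> u i \<le> v i \<and> v i \<le> 1"
    and disj: "disjoint_family_on (\<lambda>i. {u i..v i}) I"
    and b: "\<And>i t. i \<in> I \<Longrightarrow> u i \<le> t \<Longrightarrow> t \<le> v i \<Longrightarrow> 0 \<le> b i \<and> b i \<le> w (g t)"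
  shows "ennreal (\<Sum>i\<in>I. b i * infnorm (g (v i) - g (u i))) \<le> curve_integral g w"
proof -
  let ?M = "interval_measure (len g)"
  have b0: "b i \<ge> 0" if "i \<in> I" for i using b[OF that order_refl] uv[OF that] by auto
  have "ennreal (\<Sum>i\<in>I. b i * infnorm (g (v i) - g (u i))) = (\<Sum>i\<in>I. ennreal (b i * infnorm (g (v i) - g (u i))))"
    by (intro sum_ennreal[symmetric] mult_nonneg_nonneg b0 infnorm_pos_le)
  also have "\<dots> \<le> (\<Sum>i\<in>I. ennreal (b i) * emeasure ?M {u i..v i})"
  proof (rule sum_mono)
    fix i assume i: "i \<in> I"
    have "infnorm (g (v i) - g (u i)) \<le> Var g (u i) (v i)"
      using uv[OF i] by (intro Var_chord rectifiableD(3)[OF g]) auto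
    also have "\<dots> = len g (v i) - len g (u i)" using uv[OF i] len_diff[OF g] by simp
    finally show "ennreal (b i * infnorm (g (v i) - g (u i))) \<le> ennreal (b i) * emeasure ?M {u i..v i}"
      using b0[OF i] uv[OF i] by (simp add: emeasure_len_Icc[OF g] ennreal_mult'[symmetric] ennreal_leI mult_left_mono)
  qed
  also have "\<dots> = (\<integral>\<^sup>+ t. (\<Sum>i\<in>I. ennreal (b i) * indicator {u i..v i} t) \<partial>?M)"
    by (subst nn_integral_sum) (auto simp: nn_integral_cmult_indicator)
  also have "\<dots> \<le> curve_integral g w"
    unfolding curve_integral_eq
  proof (rule nn_integral_mono)
    fix t
    show "(\<Sum>i\<in>I. ennreal (b i) * indicator {u i..v i} t) \<le> ennreal (w (g t)) * indicator {0..1} t"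
    proof (cases "\<exists>i\<in>I. t \<in> {u i..v i}")
      case True
      then obtain i where i: "i \<in> I" "t \<in> {u i..v i}" by blast
      have "(\<Sum>j\<in>I. ennreal (b j) * indicator {u j..v j} t) = (\<Sum>j\<in>{i}. ennreal (b j) * indicator {u j..v j} t)"
      proof (rule sum.mono_neutral_right[OF fin])
        show "\<forall>j\<in>I - {i}. ennreal (b j) * indicator {u j..v j} t = 0"
        proof
          fix j assume "j \<in> I - {i}"
          then have "{u j..v j} \<inter> {u i..v i} = {}" using disj i by (auto simp: disjoint_family_on_def)
          then show "ennreal (b j) * indicator {u j..v j} t = 0" using i by (auto simp: indicator_def)
        qed
      qed (use i in auto)
      also have "\<dots> \<le> ennreal (w (g t)) * indicator {0..1} t"
        using i b[OF i(1)] uv[OF i(1)] by (auto simp: ennreal_leI)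
      finally show ?thesis .
    next
      case False
      then have "(\<Sum>i\<in>I. ennreal (b i) * indicator {u i..v i} t) = 0" by (intro sum.neutral) auto
      then show ?thesis by simp
    qed
  qed
  finally show ?thesis .
qed

section \<open>The metric and its completion\<close>

lemma powr_add_le:
  fixes a b \<alpha> :: real
  assumes "a \<ge> 0" "b \<ge> 0" "0 < \<alpha>" "\<alpha> \<le> 1"
  shows "(a + b) powr \<alpha> \<le> a powr \<alpha> + b powr \<alpha>"
proof (cases "a + b = 0")
  case False
  then have s: "a + b > 0" using assms by linarith
  have part: "u / (a + b) * (a + b) powr \<alpha> \<le> u powr \<alpha>" if u: "0 \<le> u" "u \<le> a + b" for u
  proof -
    have "u / (a + b) \<le> (u / (a + b)) powr \<alpha>"
    proof (cases "u = 0")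
      case False
      then have "(u / (a + b)) powr 1 \<le> (u / (a + b)) powr \<alpha>"
        using u s assms by (intro powr_mono') auto
      then show ?thesis using u s by simp
    qed simp
    then have "u / (a + b) * (a + b) powr \<alpha> \<le> (u / (a + b)) powr \<alpha> * (a + b) powr \<alpha>"
      by (intro mult_right_mono) auto
    also have "\<dots> = u powr \<alpha>" using u s by (simp add: powr_divide)
    finally show ?thesis .
  qed
  have "(a + b) powr \<alpha> = a / (a + b) * (a + b) powr \<alpha> + b / (a + b) * (a + b) powr \<alpha>"
    using s by (simp add: add_divide_distrib[symmetric] distrib_right[symmetric])
  also have "\<dots> \<le> a powr \<alpha> + b powr \<alpha>" using part[of a] part[of b] assms by (intro add_mono) auto
  finally show ?thesis .
qed (use assms in auto)

locale metric_domain = proper_domain \<Omega> for \<Omega> :: "(real ^ 'n) set" +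
  fixes \<alpha> :: real
  assumes \<alpha>: "0 < \<alpha>" "\<alpha> \<le> 1"
begin

abbreviation wt :: "real ^ 'n \<Rightarrow> real" where "wt z \<equiv> R z powr (\<alpha> - 1)"

abbreviation d :: "real ^ 'n \<Rightarrow> real ^ 'n \<Rightarrow> real" where "d \<equiv> d_metric \<alpha> \<Omega>"

abbreviation rho :: "real ^ 'n \<Rightarrow> real ^ 'n \<Rightarrow> real" where "rho \<equiv> rho_metric \<alpha> \<Omega>"

definition curves :: "real ^ 'n \<Rightarrow> real ^ 'n \<Rightarrow> (real \<Rightarrow> real ^ 'n) set" where
  "curves x y = {g. rectifiable g \<and> path_image g \<subseteq> \<Omega> \<and> pathstart g = x \<and> pathfinish g = y}"

lemma d_eq: "d x y = enn2real (INF g\<in>curves x y. curve_integral g wt)"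
  by (simp add: d_metric_def curves_def)

lemma continuous_on_wt: "continuous_on \<Omega> wt"
  using R_pos by (intro continuous_on_powr continuous_on_R continuous_on_const) force

text \<open>The weight is bounded on the compact image of a path in \<open>\<Omega>\<close>.\<close>

lemma curve_integral_finite:
  assumes "g \<in> curves x y"
  shows "curve_integral g wt < top"
proof -
  have g: "rectifiable g" "path_image g \<subseteq> \<Omega>" using assms by (auto simp: curves_def)
  have "compact (wt ` path_image g)"
    by (intro compact_continuous_image continuous_on_subset[OF continuous_on_wt g(2)] compact_path_image rectifiableD(1)[OF g(1)])
  then obtain B where B: "\<And>z. z \<in> path_image g \<Longrightarrow> wt z \<le> B"
    by (fastforce dest!: compact_imp_bounded simp: bounded_iff)
  have "curve_integral g wt \<le> ennreal (max B 0 * Var g 0 1)"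
    by (rule curve_integral_le_length[OF g(1)]) (use B in \<open>auto simp: max.coboundedI1\<close>)
  then show ?thesis using ennreal_less_top order.strict_trans1 by blast
qed

lemma linepath_curves: "closed_segment x y \<subseteq> \<Omega> \<Longrightarrow> linepath x y \<in> curves x y"
  by (simp add: curves_def rectifiable_linepath)

lemma join_curves: "g \<in> curves x y \<Longrightarrow> h \<in> curves y z \<Longrightarrow> g +++ h \<in> curves x z"
  by (auto simp: curves_def rectifiable_joinpaths path_image_join)

lemma reverse_curves: "g \<in> curves x y \<Longrightarrow> reversepath g \<in> curves y x"
  by (auto simp: curves_def rectifiable_reversepath)

lemma curves_nonempty:
  assumes "x \<in> \<Omega>" "y \<in> \<Omega>"
  shows "curves x y \<noteq> {}"
proof (rule connected_equivalence_relation[OF conn assms, where R = "\<lambda>x y. curves x y \<noteq> {}"])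
  show "\<exists>T. openin (top_of_set \<Omega>) T \<and> a \<in> T \<and> (\<forall>x\<in>T. curves a x \<noteq> {})" if a: "a \<in> \<Omega>" for a
  proof -
    obtain e where e: "e > 0" "ball a e \<subseteq> \<Omega>" using op a openE by blast
    have "curves a x \<noteq> {}" if "x \<in> ball a e" for x
    proof -
      have "closed_segment a x \<subseteq> ball a e"
        using that e by (intro closed_segment_subset convex_ball) auto
      then show ?thesis using e linepath_curves by blast
    qed
    moreover have "openin (top_of_set \<Omega>) (ball a e)" using e op by (simp add: openin_open_eq)
    ultimately show ?thesis using e by (intro exI[of _ "ball a e"]) auto
  qed
qed (use reverse_curves join_curves in blast)+

lemma d_nonneg: "d x y \<ge> 0" by (simp add: d_eq)

lemma d_le: "g \<in> curves x y \<Longrightarrow> curve_integral g wt \<le> ennreal b \<Longrightarrow> 0 \<le> b \<Longrightarrow> d x y \<le> b"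
  unfolding d_eq by (intro enn2real_leI INF_lower2)

lemma d_approx:
  assumes "x \<in> \<Omega>" "y \<in> \<Omega>" "e > 0"
  obtains g where "g \<in> curves x y" "curve_integral g wt \<le> ennreal (d x y + e)"
proof -
  let ?I = "INF g\<in>curves x y. curve_integral g wt"
  obtain g0 where "g0 \<in> curves x y" using curves_nonempty[OF assms(1,2)] by blast
  then have "?I < top" using curve_integral_finite[of g0 x y] by (meson INF_lower order.strict_trans1)
  then have "?I = ennreal (d x y)" by (simp add: d_eq)
  also have "\<dots> < ennreal (d x y + e)" using assms(3) d_nonneg[of x y] by (intro ennreal_lessI) auto
  finally obtain g where "g \<in> curves x y" "curve_integral g wt < ennreal (d x y + e)"
    by (auto simp: INF_less_iff)
  then show ?thesis by (intro that) auto
qed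

lemma curve_wt: "g \<in> curves x y \<Longrightarrow> continuous_on (path_image g) wt"
  using continuous_on_subset[OF continuous_on_wt] by (auto simp: curves_def)

lemma d_triangle:
  assumes "x \<in> \<Omega>" "y \<in> \<Omega>" "z \<in> \<Omega>"
  shows "d x z \<le> d x y + d y z"
proof (rule field_le_epsilon)
  fix e :: real assume "e > 0"
  then obtain g h where g: "g \<in> curves x y" "curve_integral g wt \<le> ennreal (d x y + e / 2)"
    and h: "h \<in> curves y z" "curve_integral h wt \<le> ennreal (d y z + e / 2)"
    using d_approx[OF assms(1,2), of "e / 2"] d_approx[OF assms(2,3), of "e / 2"] by (metis half_gt_zero)
  have "curve_integral (g +++ h) wt \<le> curve_integral g wt + curve_integral h wt"
    using g(1) h(1) curve_wt[OF g(1)] curve_wt[OF h(1)] by (intro curve_integral_joinpaths_le) (auto simp: curves_def)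
  also have "\<dots> \<le> ennreal (d x y + e / 2) + ennreal (d y z + e / 2)" by (intro add_mono g h)
  also have "\<dots> = ennreal (d x y + d y z + e)"
    using d_nonneg[of x y] d_nonneg[of y z] \<open>e > 0\<close> by (simp flip: ennreal_plus)
  finally show "d x z \<le> d x y + d y z + e"
    using d_nonneg[of x y] d_nonneg[of y z] \<open>e > 0\<close> by (intro d_le[OF join_curves[OF g(1) h(1)]]) auto
qed

lemma d_sym:
  assumes "x \<in> \<Omega>" "y \<in> \<Omega>"
  shows "d x y = d y x"
proof -
  have "d y x \<le> d x y" if xy: "x \<in> \<Omega>" "y \<in> \<Omega>" for x y
  proof (rule field_le_epsilon)
    fix e :: real assume e: "e > 0"
    obtain g where g: "g \<in> curves x y" "curve_integral g wt \<le> ennreal (d x y + e)"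
      using d_approx[OF xy e] by blast
    then have "curve_integral (reversepath g) wt \<le> ennreal (d x y + e)"
      using curve_integral_reversepath[OF _ curve_wt[OF g(1)]] by (auto simp: curves_def)
    then show "d y x \<le> d x y + e" using d_nonneg[of x y] e by (intro d_le[OF reverse_curves[OF g(1)]]) auto
  qed
  from this[OF assms] this[OF assms(2,1)] show ?thesis by simp
qed

lemma d_segment:
  assumes "closed_segment x y \<subseteq> \<Omega>" "\<And>z. z \<in> closed_segment x y \<Longrightarrow> l \<le> R z" "l > 0"
  shows "d x y \<le> l powr (\<alpha> - 1) * infnorm (y - x)"
proof (rule d_le[OF linepath_curves[OF assms(1)]])
  have "curve_integral (linepath x y) wt \<le> ennreal (l powr (\<alpha> - 1) * Var (linepath x y) 0 1)"
    by (rule curve_integral_le_length[OF rectifiable_linepath(1)])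
       (use assms \<alpha> in \<open>auto intro!: powr_mono2'\<close>)
  also have "\<dots> \<le> ennreal (l powr (\<alpha> - 1) * infnorm (y - x))"
    by (intro ennreal_leI mult_left_mono rectifiable_linepath(2)) simp
  finally show "curve_integral (linepath x y) wt \<le> ennreal (l powr (\<alpha> - 1) * infnorm (y - x))" .
qed (simp add: infnorm_pos_le)

text \<open>On the segment from \<open>x\<close> to \<open>y\<close> the distance to the boundary is at least half of that of \<open>x\<close>.\<close>

lemma d_local:
  assumes x: "x \<in> \<Omega>" and y: "infnorm (y - x) \<le> R x / 2"
  shows "y \<in> \<Omega>" "d x y \<le> 2 * R x powr (\<alpha> - 1) * infnorm (y - x)"
proof -
  have near: "z \<in> \<Omega> \<and> R x / 2 \<le> R z" if z: "z \<in> closed_segment x y" for z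
  proof -
    obtain u where u: "0 \<le> u" "u \<le> 1" "z = (1 - u) *\<^sub>R x + u *\<^sub>R y" using z by (auto simp: in_segment)
    have "z - x = u *\<^sub>R (y - x)" by (simp add: u(3) algebra_simps)
    then have "infnorm (z - x) \<le> infnorm (y - x)"
      using u by (simp add: infnorm_mul mult_left_le_one_le infnorm_pos_le)
    then show ?thesis using y R_Lipschitz[of z x] R_pos[OF x] by (auto intro!: open_cube_subset[OF x])
  qed
  show "y \<in> \<Omega>" using near[of y] by simp
  have "(R x / 2) powr (\<alpha> - 1) = 2 powr (1 - \<alpha>) * R x powr (\<alpha> - 1)"
    using R_pos[OF x] by (simp add: powr_divide powr_diff field_simps)
  also have "\<dots> \<le> 2 * R x powr (\<alpha> - 1)"
    using \<alpha> powr_mono[of "1 - \<alpha>" 1 "2 :: real"] by (intro mult_right_mono) auto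
  finally have c: "(R x / 2) powr (\<alpha> - 1) \<le> 2 * R x powr (\<alpha> - 1)" .
  have "d x y \<le> (R x / 2) powr (\<alpha> - 1) * infnorm (y - x)"
    using near R_pos[OF x] by (intro d_segment) auto
  also have "\<dots> \<le> 2 * R x powr (\<alpha> - 1) * infnorm (y - x)"
    by (rule mult_right_mono[OF c infnorm_pos_le])
  finally show "d x y \<le> 2 * R x powr (\<alpha> - 1) * infnorm (y - x)" .
qed

lemma d_refl: "x \<in> \<Omega> \<Longrightarrow> d x x = 0"
  using d_local(2)[of x x] d_nonneg[of x x] R_pos[of x] by (simp add: infnorm_0)

lemma rho_nonneg: "rho x y \<ge> 0"
  by (simp add: rho_metric_def d_nonneg)

lemma d_le_rho: "d x y \<le> rho x y"
  by (simp add: rho_metric_def)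

lemma rho_sym: "x \<in> \<Omega> \<Longrightarrow> y \<in> \<Omega> \<Longrightarrow> rho x y = rho y x"
  by (simp add: rho_metric_def d_sym[of x y] infnorm_sub[of x y])

lemma rho_triangle:
  assumes "x \<in> \<Omega>" "y \<in> \<Omega>" "z \<in> \<Omega>"
  shows "rho x z \<le> rho x y + rho y z"
proof -
  have "infnorm (x - z) powr \<alpha> \<le> (infnorm (x - y) + infnorm (y - z)) powr \<alpha>"
    using \<alpha> by (intro powr_mono2 infnorm_triangle_diff infnorm_pos_le) auto
  also have "\<dots> \<le> infnorm (x - y) powr \<alpha> + infnorm (y - z) powr \<alpha>"
    using \<alpha> by (intro powr_add_le infnorm_pos_le) auto
  finally show ?thesis using d_triangle[OF assms] by (simp add: rho_metric_def)
qed

lemma rho_refl: "x \<in> \<Omega> \<Longrightarrow> rho x x = 0"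
  using \<alpha> by (simp add: rho_metric_def d_refl infnorm_0)

lemma rho_Cauchy_mem: "x \<in> rho_Cauchy \<alpha> \<Omega> \<Longrightarrow> x i \<in> \<Omega>"
  by (auto simp: rho_Cauchy_def)

lemma infnorm_le_rho: "infnorm (x - y) \<le> rho x y powr (1 / \<alpha>)"
proof -
  have "infnorm (x - y) = (infnorm (x - y) powr \<alpha>) powr (1 / \<alpha>)"
    using \<alpha> infnorm_pos_le[of "x - y"] by (simp add: powr_powr)
  also have "\<dots> \<le> rho x y powr (1 / \<alpha>)"
    using \<alpha> d_nonneg[of x y] by (intro powr_mono2) (auto simp: rho_metric_def)
  finally show ?thesis .
qed

lemma infnorm_less_of_rho:
  assumes "e > 0" "rho x y < e powr \<alpha>"
  shows "infnorm (x - y) < e"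
proof -
  have "infnorm (x - y) powr \<alpha> < e powr \<alpha>" using assms(2) d_nonneg[of x y] by (simp add: rho_metric_def)
  then show ?thesis using \<alpha> assms(1) by (metis infnorm_pos_le less_eq_real_def not_less powr_mono2)
qed

lemma norm_tendsto_0_of_infnorm:
  fixes f :: "nat \<Rightarrow> real ^ 'n"
  assumes "(\<lambda>i. infnorm (f i)) \<longlonglongrightarrow> 0"
  shows "f \<longlonglongrightarrow> 0"
proof (rule Lim_null_comparison)
  show "\<forall>\<^sub>F i in sequentially. norm (f i) \<le> sqrt (real DIM(real ^ 'n)) * infnorm (f i)"
    by (intro always_eventually allI norm_le_infnorm)
  show "(\<lambda>i. sqrt (real DIM(real ^ 'n)) * infnorm (f i)) \<longlonglongrightarrow> 0"
    using tendsto_mult[OF tendsto_const assms] by simp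
qed

lemma rho_Cauchy_convergent:
  assumes x: "x \<in> rho_Cauchy \<alpha> \<Omega>"
  obtains z where "x \<longlonglongrightarrow> z"
proof -
  have "Cauchy x"
  proof (rule metric_CauchyI)
    fix e :: real assume e: "e > 0"
    define e' where "e' = e / (2 * sqrt (real DIM(real ^ 'n)))"
    have e': "e' > 0" using e by (simp add: e'_def)
    then have "e' powr \<alpha> > 0" by simp
    then obtain M where M: "\<forall>i\<ge>M. \<forall>j\<ge>M. rho (x i) (x j) < e' powr \<alpha>"
      using x unfolding rho_Cauchy_def by blast
    have "dist (x m) (x n) < e" if "m \<ge> M" "n \<ge> M" for m n
    proof -
      have i: "infnorm (x m - x n) < e'" using M that by (intro infnorm_less_of_rho[OF e']) auto
      have "dist (x m) (x n) \<le> sqrt (real DIM(real ^ 'n)) * infnorm (x m - x n)"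
        unfolding dist_norm by (rule norm_le_infnorm)
      also have "\<dots> \<le> sqrt (real DIM(real ^ 'n)) * e'" using i by (intro mult_left_mono) auto
      also have "\<dots> = e / 2" by (simp add: e'_def)
      finally show ?thesis using e by simp
    qed
    then show "\<exists>M. \<forall>m\<ge>M. \<forall>n\<ge>M. dist (x m) (x n) < e" by blast
  qed
  then show ?thesis using that by (meson Cauchy_convergent_iff convergent_def)
qed

lemma rho_equivD:
  assumes "(x, y) \<in> rho_equiv \<alpha> \<Omega>"
  shows "x \<in> rho_Cauchy \<alpha> \<Omega>" "y \<in> rho_Cauchy \<alpha> \<Omega>" "(\<lambda>i. rho (x i) (y i)) \<longlonglongrightarrow> 0"
    "(\<lambda>i. d (x i) (y i)) \<longlonglongrightarrow> 0" "(\<lambda>i. x i - y i) \<longlonglongrightarrow> 0"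
proof -
  show 1: "x \<in> rho_Cauchy \<alpha> \<Omega>" "y \<in> rho_Cauchy \<alpha> \<Omega>" "(\<lambda>i. rho (x i) (y i)) \<longlonglongrightarrow> 0"
    using assms by (auto simp: rho_equiv_def)
  show "(\<lambda>i. d (x i) (y i)) \<longlonglongrightarrow> 0"
    by (rule tendsto_sandwich[OF _ _ tendsto_const 1(3)]) (auto simp: d_nonneg d_le_rho)
  have lim: "(\<lambda>i. rho (x i) (y i) powr (1 / \<alpha>)) \<longlonglongrightarrow> 0"
    by (rule tendsto_zero_powrI[OF 1(3) tendsto_const]) (use \<alpha> rho_nonneg in auto)
  have "(\<lambda>i. infnorm (x i - y i)) \<longlonglongrightarrow> 0"
    by (rule tendsto_sandwich[OF _ _ tendsto_const lim]) (auto simp: infnorm_pos_le infnorm_le_rho)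
  then show "(\<lambda>i. x i - y i) \<longlonglongrightarrow> 0" by (rule norm_tendsto_0_of_infnorm)
qed

lemma equiv_rho: "equiv (rho_Cauchy \<alpha> \<Omega>) (rho_equiv \<alpha> \<Omega>)"
proof (rule equivI)
  show "rho_equiv \<alpha> \<Omega> \<subseteq> rho_Cauchy \<alpha> \<Omega> \<times> rho_Cauchy \<alpha> \<Omega>" by (auto simp: rho_equiv_def)
  show "refl_on (rho_Cauchy \<alpha> \<Omega>) (rho_equiv \<alpha> \<Omega>)"
    by (rule refl_onI) (auto simp: rho_equiv_def rho_refl rho_Cauchy_mem)
  show "sym (rho_equiv \<alpha> \<Omega>)"
    by (rule symI) (auto simp: rho_equiv_def rho_sym[OF rho_Cauchy_mem rho_Cauchy_mem])
  show "trans (rho_equiv \<alpha> \<Omega>)"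
  proof (rule transI)
    fix x y z assume xy: "(x, y) \<in> rho_equiv \<alpha> \<Omega>" and yz: "(y, z) \<in> rho_equiv \<alpha> \<Omega>"
    note m = rho_Cauchy_mem[OF rho_equivD(1)[OF xy]] rho_Cauchy_mem[OF rho_equivD(2)[OF xy]] rho_Cauchy_mem[OF rho_equivD(2)[OF yz]]
    have lim: "(\<lambda>i. rho (x i) (y i) + rho (y i) (z i)) \<longlonglongrightarrow> 0"
      using tendsto_add[OF rho_equivD(3)[OF xy] rho_equivD(3)[OF yz]] by simp
    have "(\<lambda>i. rho (x i) (z i)) \<longlonglongrightarrow> 0"
      by (rule tendsto_sandwich[OF _ _ tendsto_const lim]) (auto simp: rho_nonneg intro!: always_eventually rho_triangle m)
    then show "(x, z) \<in> rho_equiv \<alpha> \<Omega>" using rho_equivD[OF xy] rho_equivD[OF yz] by (simp add: rho_equiv_def)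
  qed
qed

lemma completion_nonempty: "\<omega> \<in> completion \<alpha> \<Omega> \<Longrightarrow> \<exists>x. x \<in> \<omega>"
  unfolding completion_def using in_quotient_imp_non_empty[OF equiv_rho] by blast

lemma completion_equiv: "\<omega> \<in> completion \<alpha> \<Omega> \<Longrightarrow> x \<in> \<omega> \<Longrightarrow> y \<in> \<omega> \<Longrightarrow> (x, y) \<in> rho_equiv \<alpha> \<Omega>"
  unfolding completion_def by (rule quotient_eq_iff[OF equiv_rho, THEN iffD1]) auto

lemma completion_Cauchy: "\<omega> \<in> completion \<alpha> \<Omega> \<Longrightarrow> x \<in> \<omega> \<Longrightarrow> x \<in> rho_Cauchy \<alpha> \<Omega>"
  using completion_equiv rho_equivD(1) by blast

lemma tendsto_ell:
  assumes \<omega>: "\<omega> \<in> completion \<alpha> \<Omega>" and x: "x \<in> \<omega>"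
  shows "x \<longlonglongrightarrow> ell \<omega>"
proof -
  obtain z where z: "x \<longlonglongrightarrow> z" using rho_Cauchy_convergent[OF completion_Cauchy[OF \<omega> x]] .
  have "y \<longlonglongrightarrow> z" if "y \<in> \<omega>" for y
    using tendsto_diff[OF z rho_equivD(5)[OF completion_equiv[OF \<omega> x that]]] by simp
  then have "\<forall>x\<in>\<omega>. x \<longlonglongrightarrow> ell \<omega>"
    unfolding ell_def by (rule_tac theI[of _ z]) (use x LIMSEQ_unique in blast)+
  then show ?thesis using x by blast
qed

lemma ell_closure: "\<omega> \<in> completion \<alpha> \<Omega> \<Longrightarrow> ell \<omega> \<in> closure \<Omega>"
  using completion_nonempty[of \<omega>] completion_Cauchy[of \<omega>] rho_Cauchy_mem tendsto_ell[of \<omega>]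
  by (metis closure_sequential)

lemma boundary_completion: "\<omega> \<in> alpha_boundary \<alpha> \<Omega> \<Longrightarrow> \<omega> \<in> completion \<alpha> \<Omega>"
  by (simp add: alpha_boundary_def)

lemma const_Cauchy: "z \<in> \<Omega> \<Longrightarrow> (\<lambda>_. z) \<in> rho_Cauchy \<alpha> \<Omega>"
  by (auto simp: rho_Cauchy_def rho_refl)

text \<open>Near a point of \<open>\<Omega>\<close> the metric is dominated by powers of the norm, so a Cauchy sequence with a limit
  \<open>z\<close> in \<open>\<Omega>\<close> is equivalent to the constant sequence \<open>z\<close>.\<close>

lemma ell_frontier:
  assumes "\<omega> \<in> alpha_boundary \<alpha> \<Omega>"
  shows "ell \<omega> \<in> frontier \<Omega>"
proof (rule ccontr)
  have \<omega>: "\<omega> \<in> completion \<alpha> \<Omega>" using boundary_completion[OF assms] .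
  let ?z = "ell \<omega>"
  assume "?z \<notin> frontier \<Omega>"
  then have z: "?z \<in> \<Omega>" using ell_closure[OF \<omega>] op by (simp add: frontier_def interior_open)
  obtain x where x: "x \<in> \<omega>" using completion_nonempty[OF \<omega>] by blast
  have lim: "x \<longlonglongrightarrow> ?z" by (rule tendsto_ell[OF \<omega> x])
  have "(\<lambda>i. infnorm (x i - ?z)) \<longlonglongrightarrow> infnorm (?z - ?z)" by (intro tendsto_intros lim)
  then have inf0: "(\<lambda>i. infnorm (x i - ?z)) \<longlonglongrightarrow> 0" by (simp add: infnorm_0)
  have up: "(\<lambda>i. 2 * R ?z powr (\<alpha> - 1) * infnorm (x i - ?z) + infnorm (x i - ?z) powr \<alpha>) \<longlonglongrightarrow> 0"
  proof -
    have "(\<lambda>i. infnorm (x i - ?z) powr \<alpha>) \<longlonglongrightarrow> 0"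
      by (rule tendsto_zero_powrI[OF inf0 tendsto_const]) (use \<alpha> in \<open>auto intro!: always_eventually simp: infnorm_pos_le\<close>)
    from tendsto_add[OF tendsto_mult[OF tendsto_const inf0] this] show ?thesis by simp
  qed
  have "\<forall>\<^sub>F i in sequentially. infnorm (x i - ?z) < R ?z / 2"
    using order_tendstoD(2)[OF inf0, of "R ?z / 2"] R_pos[OF z] by simp
  then have "\<forall>\<^sub>F i in sequentially. rho ?z (x i) \<le> 2 * R ?z powr (\<alpha> - 1) * infnorm (x i - ?z) + infnorm (x i - ?z) powr \<alpha>"
    by eventually_elim (use d_local(2)[OF z] in \<open>auto simp: rho_metric_def infnorm_sub[of ?z]\<close>)
  then have "(\<lambda>i. rho ?z (x i)) \<longlonglongrightarrow> 0"
    by (rule tendsto_sandwich[OF _ _ tendsto_const up, rotated]) (simp add: rho_nonneg)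
  then have "((\<lambda>_. ?z), x) \<in> rho_equiv \<alpha> \<Omega>"
    using completion_Cauchy[OF \<omega> x] const_Cauchy[OF z] by (simp add: rho_equiv_def)
  then have "rho_equiv \<alpha> \<Omega> `` {\<lambda>_. ?z} = rho_equiv \<alpha> \<Omega> `` {x}"
    by (rule equiv_class_eq[OF equiv_rho])
  also have "\<dots> = \<omega>"
  proof -
    obtain a where a: "\<omega> = rho_equiv \<alpha> \<Omega> `` {a}"
      using \<omega> unfolding completion_def by (auto elim: quotientE)
    then have "(a, x) \<in> rho_equiv \<alpha> \<Omega>" using x by simp
    from equiv_class_eq[OF equiv_rho this] show ?thesis using a by simp
  qed
  finally show False using assms z unfolding alpha_boundary_def by blast
qed

lemma boundaryI:
  assumes \<omega>: "\<omega> \<in> completion \<alpha> \<Omega>" "ell \<omega> \<in> frontier \<Omega>"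
  shows "\<omega> \<in> alpha_boundary \<alpha> \<Omega>"
proof -
  have "\<omega> \<noteq> rho_equiv \<alpha> \<Omega> `` {\<lambda>_. z}" if z: "z \<in> \<Omega>" for z
  proof
    assume "\<omega> = rho_equiv \<alpha> \<Omega> `` {\<lambda>_. z}"
    then have "(\<lambda>_. z) \<in> \<omega>" using equiv_class_self[OF equiv_rho const_Cauchy[OF z]] by simp
    from tendsto_ell[OF \<omega>(1) this] have "ell \<omega> = z" by (simp add: LIMSEQ_const_iff)
    then show False using \<omega>(2) z frontier_disjoint by blast
  qed
  then show ?thesis using \<omega>(1) by (auto simp: alpha_boundary_def)
qed

text \<open>The image of a boundary element is an accessible point, to which \<open>condition_A\<close> applies.\<close>

lemma boundary_unique:
  assumes A: "condition_A \<alpha> \<Omega>" and "\<omega> \<in> alpha_boundary \<alpha> \<Omega>" "\<omega>' \<in> alpha_boundary \<alpha> \<Omega>" "ell \<omega> = ell \<omega>'"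
  shows "\<omega> = \<omega>'"
proof -
  have "ell \<omega> \<in> frontier \<Omega> - inaccessible \<alpha> \<Omega>"
    using ell_frontier[OF assms(2)] boundary_completion[OF assms(2)] by (auto simp: inaccessible_def)
  then have "\<exists>!\<omega>'. \<omega>' \<in> completion \<alpha> \<Omega> \<and> ell \<omega>' = ell \<omega>" using A unfolding condition_A_def by blast
  then show ?thesis using boundary_completion assms by metis
qed

lemma tendsto_d_completion:
  assumes \<omega>: "\<omega> \<in> completion \<alpha> \<Omega>" "\<omega>' \<in> completion \<alpha> \<Omega>" and x: "x \<in> \<omega>" and y: "y \<in> \<omega>'"
  shows "(\<lambda>i. d (x i) (y i)) \<longlonglongrightarrow> d_completion \<alpha> \<Omega> \<omega> \<omega>'"
proof -
  have mem: "a i \<in> \<Omega>" "b i \<in> \<Omega>" if "a \<in> \<omega>" "b \<in> \<omega>'" for a b i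
    using that \<omega> completion_Cauchy rho_Cauchy_mem by blast+
  have quad: "\<bar>d a b - d a' b'\<bar> \<le> d a a' + d b b'" if "a \<in> \<Omega>" "b \<in> \<Omega>" "a' \<in> \<Omega>" "b' \<in> \<Omega>" for a b a' b'
    using d_triangle[of a a' b] d_triangle[of a' b' b] d_triangle[of a' a b'] d_triangle[of a b b']
      d_sym[of a a'] d_sym[of b b'] that by linarith
  have "Cauchy (\<lambda>i. d (x i) (y i))"
  proof (rule CauchyI)
    fix e :: real assume "e > 0"
    then have e: "e / 2 > 0" by simp
    obtain M where M: "\<forall>i\<ge>M. \<forall>j\<ge>M. rho (x i) (x j) < e / 2"
      using completion_Cauchy[OF \<omega>(1) x] e unfolding rho_Cauchy_def by blast
    obtain M' where M': "\<forall>i\<ge>M'. \<forall>j\<ge>M'. rho (y i) (y j) < e / 2"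
      using completion_Cauchy[OF \<omega>(2) y] e unfolding rho_Cauchy_def by blast
    have "norm (d (x i) (y i) - d (x j) (y j)) < e" if "i \<ge> max M M'" "j \<ge> max M M'" for i j
    proof -
      have "\<bar>d (x i) (y i) - d (x j) (y j)\<bar> \<le> d (x i) (x j) + d (y i) (y j)"
        by (intro quad mem[OF x y])
      also have "\<dots> \<le> rho (x i) (x j) + rho (y i) (y j)" by (intro add_mono d_le_rho)
      also have "\<dots> < e / 2 + e / 2" using M M' that by (intro add_strict_mono) auto
      finally show ?thesis by simp
    qed
    then show "\<exists>M. \<forall>m\<ge>M. \<forall>n\<ge>M. norm (d (x m) (y m) - d (x n) (y n)) < e" by blast
  qed
  then obtain L where L: "(\<lambda>i. d (x i) (y i)) \<longlonglongrightarrow> L" by (auto simp: Cauchy_convergent_iff convergent_def)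
  have all: "(\<lambda>i. d (a i) (b i)) \<longlonglongrightarrow> L" if a: "a \<in> \<omega>" and b: "b \<in> \<omega>'" for a b
  proof -
    have "(\<lambda>i. d (x i) (a i) + d (y i) (b i)) \<longlonglongrightarrow> 0"
      using tendsto_add[OF rho_equivD(4)[OF completion_equiv[OF \<omega>(1) x a]] rho_equivD(4)[OF completion_equiv[OF \<omega>(2) y b]]] by simp
    then have "(\<lambda>i. d (x i) (y i) - d (a i) (b i)) \<longlonglongrightarrow> 0"
      by (rule Lim_null_comparison[rotated]) (intro always_eventually allI, unfold real_norm_def, intro quad mem[OF x y] mem[OF a b])
    from tendsto_diff[OF L this] show ?thesis by simp
  qed
  have "\<forall>x\<in>\<omega>. \<forall>y\<in>\<omega>'. (\<lambda>i. d (x i) (y i)) \<longlonglongrightarrow> d_completion \<alpha> \<Omega> \<omega> \<omega>'"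
    unfolding d_completion_def
    by (rule theI[of _ L]) (use all x y LIMSEQ_unique in blast)+
  then show ?thesis using x y by blast
qed

abbreviation dyadic :: "real ^ 'n \<Rightarrow> real ^ 'n \<Rightarrow> nat \<Rightarrow> real ^ 'n" where
  "dyadic c x k \<equiv> x + (1 / 2 ^ k) *\<^sub>R (c - x)"

text \<open>This sums the geometric series of the lengths of the dyadic pieces of the axis.\<close>

definition access_const :: "real \<Rightarrow> real" where "access_const \<eta> = \<eta> / (1 - 2 powr (- \<alpha>))"

text \<open>Along the axis of the cone the distance to the boundary is at least proportional to the distance
  from the vertex, so the dyadic pieces have geometrically decreasing length in the metric.\<close>

lemma d_dyadic:
  assumes r: "r > 0" and vis: "visible \<Omega> (cube c r) x" and \<eta>: "infnorm (x - c) \<le> \<eta> * r"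
  shows "dyadic c x k \<in> \<Omega>" "k \<le> m \<Longrightarrow> d (dyadic c x k) (dyadic c x m) \<le> access_const \<eta> * r powr \<alpha> * (2 powr (- \<alpha>)) ^ k"
proof -
  let ?q = "2 powr (- \<alpha>)"
  have q: "0 < ?q" "?q < 1" using \<alpha> by (auto simp: powr_less_one)
  have \<eta>0: "\<eta> \<ge> 0" using \<eta> r infnorm_pos_le[of "x - c"] by (metis linorder_not_less mult_neg_pos order_trans)
  have pt: "x + t *\<^sub>R (c - x) \<in> \<Omega> \<and> t * r \<le> R (x + t *\<^sub>R (c - x))" if t: "0 < t" "t \<le> 1" for t
  proof -
    have "cube (x + t *\<^sub>R (c - x)) (t * r) \<subseteq> \<Omega>" by (rule visible_cone[OF vis t])
    then show ?thesis using R_ge_of_cube center_in_cube[of "t * r"] t r by fastforce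
  qed
  show mem: "dyadic c x k \<in> \<Omega>" for k using pt[of "1 / 2 ^ k"] by simp
  have step: "d (dyadic c x k) (dyadic c x (Suc k)) \<le> \<eta> * r powr \<alpha> * ?q ^ k" for k
  proof -
    let ?s = "1 / 2 ^ Suc k :: real"
    have seg: "\<exists>t. ?s \<le> t \<and> t \<le> 1 \<and> z = x + t *\<^sub>R (c - x)"
      if z: "z \<in> closed_segment (dyadic c x k) (dyadic c x (Suc k))" for z
    proof -
      obtain u where u: "0 \<le> u" "u \<le> 1" "z = (1 - u) *\<^sub>R dyadic c x k + u *\<^sub>R dyadic c x (Suc k)"
        using z by (auto simp: in_segment)
      have "z = x + ((1 - u) / 2 ^ k + u / 2 ^ Suc k) *\<^sub>R (c - x)"
      proof -
        have "(1 - u) *\<^sub>R (x + a *\<^sub>R v) + u *\<^sub>R (x + b *\<^sub>R v) = x + ((1 - u) * a + u * b) *\<^sub>R v" for a b v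
          by (simp add: algebra_simps)
        from this[of "1 / 2 ^ k" "c - x" "1 / 2 ^ Suc k"] show ?thesis unfolding u(3) by simp
      qed
      moreover have "(1 - u) / 2 ^ k + u / 2 ^ Suc k = (2 - u) * ?s" by (simp add: field_simps)
      ultimately have zt: "z = x + ((2 - u) * ?s) *\<^sub>R (c - x)" by simp
      have "1 * ?s \<le> (2 - u) * ?s" using u by (intro mult_right_mono) auto
      then have lo: "?s \<le> (2 - u) * ?s" by simp
      have "(2 - u) * ?s \<le> 2 * ?s" using u by (intro mult_right_mono) auto
      also have "2 * ?s \<le> 1" by simp
      finally have hi: "(2 - u) * ?s \<le> 1" .
      show ?thesis using zt lo hi by blast
    qed
    have s0: "?s > 0" by simp
    have pz: "z \<in> \<Omega> \<and> ?s * r \<le> R z" if z: "z \<in> closed_segment (dyadic c x k) (dyadic c x (Suc k))" for z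
    proof -
      obtain t where t: "?s \<le> t" "t \<le> 1" "z = x + t *\<^sub>R (c - x)" using seg[OF z] by blast
      have "t > 0" using s0 t(1) by linarith
      moreover have "?s * r \<le> t * r" using t r by (intro mult_right_mono) auto
      ultimately show ?thesis using pt[of t] t by fastforce
    qed
    have "(x + b *\<^sub>R v) - (x + a *\<^sub>R v) = (b - a) *\<^sub>R v" for a b v by (simp add: algebra_simps)
    then have e1: "dyadic c x (Suc k) - dyadic c x k = (?s - 1 / 2 ^ k) *\<^sub>R (c - x)" .
    have e2: "?s - 1 / 2 ^ k = - ?s" by simp
    have "infnorm (dyadic c x (Suc k) - dyadic c x k) = ?s * infnorm (x - c)"
      unfolding e1 e2 infnorm_mul infnorm_sub[of c x] by simp
    also have "\<dots> \<le> ?s * (\<eta> * r)" using \<eta> by (intro mult_left_mono) auto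
    finally have len: "infnorm (dyadic c x (Suc k) - dyadic c x k) \<le> ?s * (\<eta> * r)" .
    have "d (dyadic c x k) (dyadic c x (Suc k)) \<le> (?s * r) powr (\<alpha> - 1) * infnorm (dyadic c x (Suc k) - dyadic c x k)"
      using pz r by (intro d_segment) auto
    also have "\<dots> \<le> (?s * r) powr (\<alpha> - 1) * (?s * (\<eta> * r))" using len by (intro mult_left_mono) auto
    also have "(?s * r) powr (\<alpha> - 1) * (?s * (\<eta> * r)) = \<eta> * ((?s * r) * (?s * r) powr (\<alpha> - 1))" by simp
    also have "(?s * r) * (?s * r) powr (\<alpha> - 1) = (?s * r) powr \<alpha>" using r by (subst powr_mult_base) auto
    also have "\<dots> = r powr \<alpha> * ?q ^ Suc k"
    proof -
      have "?q ^ Suc k = ?s powr \<alpha>"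
        by (simp add: powr_divide powr_minus powr_realpow[symmetric] powr_powr field_simps powr_power del: power_Suc)
      then show ?thesis unfolding powr_mult by (simp only: mult.commute)
    qed
    also have "\<eta> * (r powr \<alpha> * ?q ^ Suc k) \<le> \<eta> * (r powr \<alpha> * ?q ^ k)"
      using \<eta>0 q by (intro mult_left_mono) (auto simp: mult_left_le_one_le)
    finally show ?thesis by (simp only: mult.assoc)
  qed
  show "d (dyadic c x k) (dyadic c x m) \<le> access_const \<eta> * r powr \<alpha> * ?q ^ k" if "k \<le> m"
  proof -
    have "d (dyadic c x k) (dyadic c x m) \<le> (\<Sum>j=k..<m. \<eta> * r powr \<alpha> * ?q ^ j)"
      using that
    proof (induction m rule: dec_induct)
      case base
      then show ?case using d_refl[OF mem] by simp
    next
      case (step m)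
      then show ?case using d_triangle[OF mem[of k] mem[of m] mem[of "Suc m"]] \<open>\<And>k. d (dyadic c x k) (dyadic c x (Suc k)) \<le> _\<close>[of m]
        by simp
    qed
    also have "\<dots> = \<eta> * r powr \<alpha> * (\<Sum>j=k..<m. ?q ^ j)" by (simp add: sum_distrib_left)
    also have "(\<Sum>j=k..<m. ?q ^ j) = (?q ^ k - ?q ^ m) / (1 - ?q)"
      using that
    proof (induction m rule: dec_induct)
      case (step m)
      have "b + (a - b) / (1 - t) = (a - t * b) / (1 - t)" if "t < 1" for a b t :: real
        using that by (simp add: field_simps)
      from this[OF q(2), of "?q ^ m" "?q ^ k"] show ?case using step by simp
    qed simp
    also have "\<eta> * r powr \<alpha> * ((?q ^ k - ?q ^ m) / (1 - ?q)) \<le> \<eta> * r powr \<alpha> * (?q ^ k / (1 - ?q))"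
      using \<eta>0 q by (intro mult_left_mono divide_right_mono) auto
    finally show ?thesis by (simp add: access_const_def)
  qed
qed

text \<open>The dyadic points on the axis form a Cauchy sequence, so that visible boundary points are accessible.\<close>

lemma visible_class:
  assumes r: "r > 0" and vis: "visible \<Omega> (cube c r) x" and x: "x \<in> frontier \<Omega>"
  obtains \<omega> where "\<omega> \<in> alpha_boundary \<alpha> \<Omega>" "ell \<omega> = x" "dyadic c x \<in> \<omega>"
proof -
  define \<eta> where "\<eta> = infnorm (x - c) / r"
  have \<eta>: "infnorm (x - c) \<le> \<eta> * r" using r by (simp add: \<eta>_def)
  let ?q = "2 powr (- \<alpha>)" and ?K = "access_const \<eta> * r powr \<alpha>"
  have q: "0 < ?q" "?q < 1" using \<alpha> by (auto simp: powr_less_one)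
  have lim: "dyadic c x \<longlonglongrightarrow> x"
  proof -
    have "(\<lambda>k. x + ((1 / 2) ^ k) *\<^sub>R (c - x)) \<longlonglongrightarrow> x + 0 *\<^sub>R (c - x)"
      by (intro tendsto_intros LIMSEQ_abs_realpow_zero2) simp
    then show ?thesis by (simp add: power_divide)
  qed
  have mem: "dyadic c x k \<in> \<Omega>" for k by (rule d_dyadic(1)[OF r vis \<eta>])
  have rho_bd: "rho (dyadic c x k) (dyadic c x m) \<le> ?K * ?q ^ k + (\<eta> * r) powr \<alpha> * ?q ^ k" if "k \<le> m" for k m
  proof -
    have "dyadic c x k - dyadic c x m = (1 / 2 ^ k - 1 / 2 ^ m) *\<^sub>R (c - x)" by (simp add: algebra_simps)
    moreover have "\<bar>1 / 2 ^ k - 1 / 2 ^ m\<bar> \<le> (1 / 2 ^ k :: real)"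
      using that by (auto simp: abs_le_iff field_simps power_increasing)
    ultimately have "infnorm (dyadic c x k - dyadic c x m) \<le> (1 / 2 ^ k) * (\<eta> * r)"
      using \<eta> by (simp only: infnorm_mul infnorm_sub[of c x]) (intro mult_mono, auto simp: infnorm_pos_le)
    then have "infnorm (dyadic c x k - dyadic c x m) powr \<alpha> \<le> ((1 / 2 ^ k) * (\<eta> * r)) powr \<alpha>"
      using \<alpha> by (intro powr_mono2 infnorm_pos_le) auto
    also have "\<dots> = (\<eta> * r) powr \<alpha> * ?q ^ k"
    proof -
      have "?q ^ k = (1 / 2 ^ k) powr \<alpha>"
        by (simp add: powr_divide powr_minus powr_realpow[symmetric] powr_powr field_simps powr_power)
      moreover have "\<eta> * r \<ge> 0" using \<eta> infnorm_pos_le[of "x - c"] by linarith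
      ultimately show ?thesis by (metis mult.commute powr_mult)
    qed
    finally show ?thesis using d_dyadic(2)[OF r vis \<eta> that] by (simp add: rho_metric_def)
  qed
  have C: "dyadic c x \<in> rho_Cauchy \<alpha> \<Omega>"
    unfolding rho_Cauchy_def
  proof (intro CollectI conjI allI impI)
    show "range (dyadic c x) \<subseteq> \<Omega>" using mem by auto
    fix e :: real assume e: "e > 0"
    have "(\<lambda>k. ?K * ?q ^ k + (\<eta> * r) powr \<alpha> * ?q ^ k) \<longlonglongrightarrow> ?K * 0 + (\<eta> * r) powr \<alpha> * 0"
      using q by (intro tendsto_intros LIMSEQ_abs_realpow_zero2) auto
    then have "\<forall>\<^sub>F k in sequentially. ?K * ?q ^ k + (\<eta> * r) powr \<alpha> * ?q ^ k < e"
      using e by (intro order_tendstoD(2)) auto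
    then obtain M where M: "\<And>k. k \<ge> M \<Longrightarrow> ?K * ?q ^ k + (\<eta> * r) powr \<alpha> * ?q ^ k < e"
      by (auto simp: eventually_sequentially)
    have "rho (dyadic c x i) (dyadic c x j) < e" if "i \<ge> M" "j \<ge> M" for i j
    proof (cases "i \<le> j")
      case True
      then show ?thesis using rho_bd[OF True] M[OF that(1)] by linarith
    next
      case False
      then show ?thesis using rho_bd[of j i] M[OF that(2)] rho_sym[OF mem mem, of i j] by simp
    qed
    then show "\<exists>N. \<forall>i\<ge>N. \<forall>j\<ge>N. rho (dyadic c x i) (dyadic c x j) < e" by blast
  qed
  let ?\<omega> = "rho_equiv \<alpha> \<Omega> `` {dyadic c x}"
  have 1: "?\<omega> \<in> completion \<alpha> \<Omega>" unfolding completion_def using C by (rule quotientI)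
  have 2: "dyadic c x \<in> ?\<omega>" using equiv_class_self[OF equiv_rho C] .
  have 3: "ell ?\<omega> = x" using LIMSEQ_unique[OF tendsto_ell[OF 1 2] lim] .
  show ?thesis using that[of ?\<omega>] boundaryI[OF 1] 2 3 x by simp
qed

end

section \<open>Traces satisfy the criterion\<close>

text \<open>In a shortest chain there is no shortcut: members that are not neighbours are unrelated.\<close>

lemma shortest_chain:
  assumes "k 0 = a" "k m = b" "\<And>i. i \<le> m \<Longrightarrow> k i \<in> V" "\<And>i. i < m \<Longrightarrow> E (k i) (k (Suc i))"
  obtains m' k' where "k' 0 = a" "k' m' = b" "\<And>i. i \<le> m' \<Longrightarrow> k' i \<in> V"
    "\<And>i. i < m' \<Longrightarrow> E (k' i) (k' (Suc i))" "\<And>i j :: nat. i + 2 \<le> j \<Longrightarrow> j \<le> m' \<Longrightarrow> \<not> E (k' i) (k' j)"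
proof -
  define P where "P m \<longleftrightarrow> (\<exists>k. k 0 = a \<and> k m = b \<and> (\<forall>i\<le>m. k i \<in> V) \<and> (\<forall>i<m. E (k i) (k (Suc i))))" for m :: nat
  have "P m" unfolding P_def using assms by blast
  define M where "M = (LEAST m. P m)"
  have "P M" unfolding M_def using \<open>P m\<close> by (rule LeastI)
  then obtain k where k: "k 0 = a" "k M = b" "\<And>i. i \<le> M \<Longrightarrow> k i \<in> V" "\<And>i. i < M \<Longrightarrow> E (k i) (k (Suc i))"
    unfolding P_def by blast
  have "\<not> E (k i) (k j)" if ij: "i + 2 \<le> j" "j \<le> M" for i j
  proof
    assume e: "E (k i) (k j)"
    define s where "s = j - i - 1"
    \<comment> \<open>The chain without its members strictly between the positions \<open>i\<close> and \<open>j\<close>.\<close>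
    define k' where "k' l = (if l \<le> i then k l else k (l + s))" for l
    have "P (M - s)" unfolding P_def
    proof (intro exI[of _ k'] conjI allI impI)
      show "k' 0 = a" using k(1) by (simp add: k'_def)
      show "k' (M - s) = b" using k(2) ij by (auto simp: k'_def s_def)
      show "k' l \<in> V" if "l \<le> M - s" for l using that ij by (auto simp: k'_def s_def intro!: k(3))
      show "E (k' l) (k' (Suc l))" if l: "l < M - s" for l
      proof -
        consider "Suc l \<le> i" | "l = i" | "i < l" by linarith
        then show ?thesis
        proof cases
          case 1
          then show ?thesis using k(4)[of l] ij by (simp add: k'_def)
        next
          case 2
          then show ?thesis using e ij by (simp add: k'_def s_def)
        next
          case 3
          then show ?thesis using k(4)[of "l + s"] l by (simp add: k'_def)
        qed
      qed
    qed
    then have "M \<le> M - s" unfolding M_def by (rule Least_le)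
    then show False using ij by (simp add: s_def)
  qed
  with k that show ?thesis by blast
qed

text \<open>Young's inequality without its constants.\<close>

lemma mult_le_powr_add:
  fixes a b p q :: real
  assumes "a \<ge> 0" "b \<ge> 0" "p > 1" "q = p / (p - 1)"
  shows "a * b \<le> a powr q + b powr p"
proof (cases "a = 0 \<or> b = 0")
  case False
  then have ab: "a > 0" "b > 0" using assms by auto
  show ?thesis
  proof (cases "b \<le> a powr (q - 1)")
    case True
    then have "a * b \<le> a * a powr (q - 1)" using ab by simp
    also have "\<dots> = a powr q" using ab by (simp add: powr_mult_base)
    finally show ?thesis using ab by (simp add: add_increasing2)
  next
    case False
    have qp: "(q - 1) * (p - 1) = 1" using assms by (simp add: field_simps)
    have "a = (a powr (q - 1)) powr (p - 1)" using ab by (simp add: powr_powr qp)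
    also have "\<dots> \<le> b powr (p - 1)" using False assms by (intro powr_mono2) auto
    finally have "a * b \<le> b powr (p - 1) * b" using ab by simp
    also have "\<dots> = b powr p" using ab powr_mult_base[of b "p - 1"] by (simp add: mult.commute)
    finally show ?thesis using ab by (simp add: add_increasing)
  qed
qed auto

locale trace_domain = metric_domain \<Omega> \<alpha> for \<Omega> :: "(real ^ 'n) set" and \<alpha> :: real +
  fixes p :: real
  assumes p: "real CARD('n) < p" and \<alpha>_eq: "\<alpha> = (p - real CARD('n)) / (p - 1)"
    and A: "condition_A \<alpha> \<Omega>"
begin

lemma p_gt_1: "p > 1"
proof -
  have "real CARD('n) \<ge> 1" using zero_less_card_finite[where 'a = 'n] by linarith
  then show ?thesis using p by linarith
qed

lemma has_traceD:
  "has_trace \<alpha> \<Omega> F f \<Longrightarrow> \<omega> \<in> alpha_boundary \<alpha> \<Omega> \<Longrightarrow> y \<in> \<omega> \<Longrightarrow> (\<lambda>i. F (y i)) \<longlonglongrightarrow> f \<omega>"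
  by (simp add: has_trace_def)

text \<open>By \<open>condition_A\<close> the given boundary element is the class of the dyadic points on the axis, so the trace
  can be computed along them.\<close>

lemma has_trace_dyadic:
  assumes tr: "has_trace \<alpha> \<Omega> F f" and \<omega>: "\<omega> \<in> alpha_boundary \<alpha> \<Omega>"
    and r: "r > 0" and vis: "visible \<Omega> (cube c r) (ell \<omega>)"
  shows "(\<lambda>k. F (ell \<omega> + (1 / 2 ^ k) *\<^sub>R (c - ell \<omega>))) \<longlonglongrightarrow> f \<omega>"
proof -
  obtain \<omega>' where \<omega>': "\<omega>' \<in> alpha_boundary \<alpha> \<Omega>" "ell \<omega>' = ell \<omega>" "dyadic c (ell \<omega>) \<in> \<omega>'"
    using visible_class[OF r vis ell_frontier[OF \<omega>]] by blast
  have "\<omega>' = \<omega>" by (rule boundary_unique[OF A \<omega>'(1) \<omega> \<omega>'(2)])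
  with \<omega>'(3) have "dyadic c (ell \<omega>) \<in> \<omega>" by simp
  from has_traceD[OF tr \<omega> this] show ?thesis .
qed

text \<open>Any \<open>\<kappa>\<close> strictly between \<open>0\<close> and \<open>p - n\<close> serves the purpose; the constant is stated for the midpoint.\<close>

lemma trace_visible_bound:
  assumes F: "continuous_on \<Omega> F" and tr: "has_trace \<alpha> \<Omega> F f" and wg: "weak_gradient \<Omega> F G"
    and pint: "set_integrable lebesgue \<Omega> (\<lambda>z. infnorm (G z) powr p)" and \<eta>: "\<eta> \<ge> 1"
  shows "visible_bound p \<alpha> \<eta> \<Omega> f
    (visible_const TYPE('n) p ((p - real CARD('n)) / 2) \<eta> * (LINT z:\<Omega>|lebesgue. infnorm (G z) powr p))"
  unfolding visible_bound_def
proof (intro allI impI, elim conjE)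
  fix m :: nat and c r x y
  assume *: "\<forall>i\<in>{1..m}. r i > 0 \<and> cube (c i) (r i) \<subseteq> \<Omega>"
    and disj: "disjoint_family_on (\<lambda>i. cube (c i) (r i)) {1..m}"
    and xy: "\<forall>i\<in>{1..m}. \<forall>\<omega>\<in>{x i, y i}. \<omega> \<in> alpha_boundary \<alpha> \<Omega> \<and> ell \<omega> \<in> cube (c i) (\<eta> * r i)
        \<and> visible \<Omega> (cube (c i) (r i)) (ell \<omega>)"
  show "(\<Sum>i = 1..m. \<bar>f (x i) - f (y i)\<bar> powr p / udiam (cube (c i) (r i)) powr (p - real CARD('n)))
    \<le> visible_const TYPE('n) p ((p - real CARD('n)) / 2) \<eta> * (LINT z:\<Omega>|lebesgue. infnorm (G z) powr p)"
  proof (rule visible_sum_bound[OF F wg pint _ _ \<eta> _ _ disj, where x = "\<lambda>i. ell (x i)" and y = "\<lambda>i. ell (y i)"])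
    show "0 < (p - real CARD('n)) / 2" "real CARD('n) + (p - real CARD('n)) / 2 < p" using p by (auto simp: field_simps)
    fix i assume i: "i \<in> {1..m}"
    show "r i > 0" using * i by blast
    show "visible \<Omega> (cube (c i) (r i)) (ell (x i)) \<and> ell (x i) \<in> frontier \<Omega> \<and> ell (x i) \<in> cube (c i) (\<eta> * r i)"
      "visible \<Omega> (cube (c i) (r i)) (ell (y i)) \<and> ell (y i) \<in> frontier \<Omega> \<and> ell (y i) \<in> cube (c i) (\<eta> * r i)"
      using xy i ell_frontier by blast+
    show "(\<lambda>k. F (ell (x i) + (1 / 2 ^ k) *\<^sub>R (c i - ell (x i)))) \<longlonglongrightarrow> f (x i)"
      "(\<lambda>k. F (ell (y i) + (1 / 2 ^ k) *\<^sub>R (c i - ell (y i)))) \<longlonglongrightarrow> f (y i)"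
      by (rule has_trace_dyadic[OF tr]; use * xy i in blast)+
  qed simp
qed

text \<open>Leaving the cube \<open>cube z (R z / 4)\<close> costs at least a fixed multiple of \<open>R z powr \<alpha>\<close>. The last
  summand accounts for a cube that is not left because it contains the end of the curve.\<close>

lemma sum_powr_le_curve_integral:
  assumes g: "g \<in> curves x y" and D: "curve_integral g wt \<le> ennreal D" "D \<ge> 0"
    and fin: "finite I" and s: "\<And>i. i \<in> I \<Longrightarrow> s i \<in> {0..1}"
    and disj: "disjoint_family_on (\<lambda>i. cube (g (s i)) (R (g (s i)) / 4)) I"
  shows "(\<Sum>i\<in>I. R (g (s i)) powr \<alpha>) \<le> 5 * D + 2 * R y powr \<alpha>"
proof -
  let ?Q = "\<lambda>i. cube (g (s i)) (R (g (s i)) / 4)"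
  have gr: "rectifiable g" "path_image g \<subseteq> \<Omega>" "g 1 = y" using g by (auto simp: curves_def pathfinish_def)
  have g\<Omega>: "g t \<in> \<Omega>" if "t \<in> {0..1}" for t using gr(2) that by (auto simp: path_image_def)
  have Rpos: "R (g (s i)) > 0" if "i \<in> I" for i using R_pos g\<Omega> s that by blast
  have y\<Omega>: "y \<in> \<Omega>" using g\<Omega>[of 1] gr(3) by simp
  define J where "J = {i \<in> I. y \<notin> ?Q i}"
  have J: "J \<subseteq> I" "finite J" using fin by (auto simp: J_def)
  \<comment> \<open>If the end of the curve is outside the cube, then there is a first exit from it.\<close>
  have "\<exists>v. s i \<le> v \<and> v \<le> 1 \<and> infnorm (g v - g (s i)) = R (g (s i)) / 4 \<and> (\<forall>t. s i \<le> t \<and> t \<le> v \<longrightarrow> g t \<in> ?Q i)"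
    if i: "i \<in> J" for i
  proof -
    let ?\<rho> = "R (g (s i)) / 4"
    let ?h = "\<lambda>t. infnorm (g t - g (s i))"
    have si: "0 \<le> s i" "s i \<le> 1" using s i J by auto
    have gc: "continuous_on {s i..1} g"
      by (rule continuous_on_subset[OF rectifiableD(1)[OF gr(1), unfolded path_def]]) (use si in auto)
    have cont: "continuous_on {s i..1} ?h"
      by (intro continuous_on_infnorm continuous_on_diff gc continuous_on_const)
    define S where "S = {t \<in> {s i..1}. ?\<rho> \<le> ?h t}"
    have "closed ({s i..1} \<inter> ?h -` {?\<rho>..})"
      by (rule continuous_closed_preimage[OF cont]) auto
    also have "{s i..1} \<inter> ?h -` {?\<rho>..} = S" by (auto simp: S_def)
    finally have "compact ({s i..1} \<inter> S)" by (intro compact_Int_closed) auto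
    moreover have "{s i..1} \<inter> S = S" by (auto simp: S_def)
    ultimately have "compact S" by simp
    moreover have "1 \<in> S" using i si gr(3) by (auto simp: S_def J_def mem_cube)
    ultimately obtain v where v: "v \<in> S" "\<And>t. t \<in> S \<Longrightarrow> v \<le> t"
      using compact_attains_inf[of S] by blast
    have v01: "s i \<le> v" "v \<le> 1" "?\<rho> \<le> ?h v" using v(1) by (auto simp: S_def)
    have "?h v = ?\<rho>"
    proof (rule ccontr)
      assume "?h v \<noteq> ?\<rho>"
      then have gt: "?\<rho> < ?h v" using v01 by simp
      have c: "continuous_on {s i..v} ?h" using cont v01 by (auto intro: continuous_on_subset)
      have "?h (s i) \<le> ?\<rho>" using Rpos i J by (auto simp: infnorm_0 less_imp_le)
      then obtain t where t: "s i \<le> t" "t \<le> v" "?h t = ?\<rho>"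
        using IVT'[of ?h "s i" ?\<rho> v] gt v01 c by auto
      then have "t \<in> S" using v01 by (auto simp: S_def)
      then have "t = v" using v(2) t by fastforce
      then show False using t gt by simp
    qed
    moreover have "g t \<in> ?Q i" if t: "s i \<le> t" "t \<le> v" for t
    proof (rule ccontr)
      assume "g t \<notin> ?Q i"
      then have "?\<rho> < ?h t" by (simp add: mem_cube)
      moreover from this have "t \<in> S" using t v01 by (auto simp: S_def)
      ultimately show False using v(2)[of t] t \<open>?h v = ?\<rho>\<close> by fastforce
    qed
    ultimately show ?thesis using v01 by blast
  qed
  then obtain v where v: "\<And>i. i \<in> J \<Longrightarrow> s i \<le> v i \<and> v i \<le> 1 \<and> infnorm (g (v i) - g (s i)) = R (g (s i)) / 4
      \<and> (\<forall>t. s i \<le> t \<and> t \<le> v i \<longrightarrow> g t \<in> ?Q i)" by metis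
  \<comment> \<open>A lower bound for the weight on the cube, as \<open>\<alpha> - 1 \<le> 0\<close>.\<close>
  let ?b = "\<lambda>i. (5 / 4 * R (g (s i))) powr (\<alpha> - 1)"
  have "ennreal (\<Sum>i\<in>J. ?b i * infnorm (g (v i) - g (s i))) \<le> curve_integral g wt"
  proof (rule curve_integral_ge_chords[OF gr(1) J(2)])
    show "0 \<le> s i \<and> s i \<le> v i \<and> v i \<le> 1" if "i \<in> J" for i using v[OF that] s[of i] that J by auto
    show "disjoint_family_on (\<lambda>i. {s i..v i}) J"
      unfolding disjoint_family_on_def
    proof (intro ballI impI)
      fix i j assume ij: "i \<in> J" "j \<in> J" "i \<noteq> j"
      then have "?Q i \<inter> ?Q j = {}" using disj J by (auto simp: disjoint_family_on_def)
      then show "{s i..v i} \<inter> {s j..v j} = {}" using v[OF ij(1)] v[OF ij(2)] by fastforce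
    qed
    show "0 \<le> ?b i \<and> ?b i \<le> wt (g t)" if i: "i \<in> J" and t: "s i \<le> t" "t \<le> v i" for i t
    proof -
      have "g t \<in> ?Q i" "0 \<le> t" "t \<le> 1" using v[OF i] s[of i] i J t by auto
      then have "R (g t) \<le> 5 / 4 * R (g (s i))" "R (g t) > 0"
        using R_Lipschitz[of "g t" "g (s i)"] R_pos[OF g\<Omega>, of t] by (auto simp: mem_cube)
      then show ?thesis using \<alpha> by (auto intro!: powr_mono2')
    qed
  qed
  with D have sumD: "(\<Sum>i\<in>J. ?b i * infnorm (g (v i) - g (s i))) \<le> D"
    by (meson ennreal_le_iff order_trans)
  have "(\<Sum>i\<in>J. R (g (s i)) powr \<alpha> / 5) \<le> (\<Sum>i\<in>J. ?b i * infnorm (g (v i) - g (s i)))"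
  proof (rule sum_mono)
    fix i assume i: "i \<in> J"
    have Ri: "R (g (s i)) > 0" using Rpos i J by blast
    have "4 / 5 = (5 / 4 :: real) powr (- 1)" by (simp add: powr_minus)
    also have "\<dots> \<le> (5 / 4) powr (\<alpha> - 1)" using \<alpha> by (intro powr_mono) auto
    finally have "(4 / 5) * R (g (s i)) powr \<alpha> \<le> (5 / 4) powr (\<alpha> - 1) * (R (g (s i)) * R (g (s i)) powr (\<alpha> - 1))"
      using Ri by (simp add: powr_mult_base mult_right_mono)
    moreover have "?b i * infnorm (g (v i) - g (s i)) = ((5 / 4) powr (\<alpha> - 1) * (R (g (s i)) * R (g (s i)) powr (\<alpha> - 1))) / 4"
      using v[OF i] unfolding powr_mult by simp
    ultimately show "R (g (s i)) powr \<alpha> / 5 \<le> ?b i * infnorm (g (v i) - g (s i))" by linarith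
  qed
  then have part1: "(\<Sum>i\<in>J. R (g (s i)) powr \<alpha>) \<le> 5 * D"
    using sumD by (simp add: sum_divide_distrib[symmetric])
  \<comment> \<open>At most one of the disjoint cubes contains the end \<open>y\<close> of the curve.\<close>
  have part2: "(\<Sum>i\<in>I - J. R (g (s i)) powr \<alpha>) \<le> 2 * R y powr \<alpha>"
  proof (cases "I - J = {}")
    case True
    then show ?thesis by (simp only: True sum.empty) simp
  next
    case False
    then obtain i where i: "i \<in> I" "y \<in> ?Q i" by (auto simp: J_def)
    have IJ: "I - J = {i}"
    proof (intro equalityI subsetI)
      fix j assume "j \<in> I - J"
      then have "j \<in> I" "y \<in> ?Q j" by (auto simp: J_def)
      then show "j \<in> {i}" using disj i by (fastforce simp: disjoint_family_on_def)
    qed (use i in \<open>auto simp: J_def\<close>)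
    have "R (g (s i)) \<le> 4 / 3 * R y"
      using i(2) R_Lipschitz[of y "g (s i)"] by (auto simp: mem_cube abs_le_iff)
    then have "R (g (s i)) powr \<alpha> \<le> (2 * R y) powr \<alpha>"
      using \<alpha> R_nonneg[of y] R_nonneg[of "g (s i)"] by (intro powr_mono2) auto
    also have "\<dots> = 2 powr \<alpha> * R y powr \<alpha>" by (rule powr_mult)
    also have "\<dots> \<le> 2 * R y powr \<alpha>" using \<alpha> powr_mono[of \<alpha> 1 "2 :: real"] by (intro mult_right_mono) auto
    finally show ?thesis by (simp add: IJ)
  qed
  have "(\<Sum>i\<in>I. R (g (s i)) powr \<alpha>) = (\<Sum>i\<in>I - J. R (g (s i)) powr \<alpha>) + (\<Sum>i\<in>J. R (g (s i)) powr \<alpha>)"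
    by (rule sum.subset_diff[OF J(1) fin])
  then show ?thesis using part1 part2 by linarith
qed

lemma sum_cube_integrals_le:
  assumes pint: "set_integrable lebesgue \<Omega> (\<lambda>z. infnorm (G z) powr p)" and fin: "finite I"
    and sub: "\<And>i. i \<in> I \<Longrightarrow> cube (c i) (r i) \<subseteq> \<Omega>" and disj: "disjoint_family_on (\<lambda>i. cube (c i) (r i)) I"
  shows "(\<Sum>i\<in>I. LINT z:cube (c i) (r i)|lebesgue. infnorm (G z) powr p) \<le> (LINT z:\<Omega>|lebesgue. infnorm (G z) powr p)"
proof -
  have m: "cube (c i) (r i) \<in> sets lebesgue" for i by (simp add: sets_lebesgue_compact compact_cube)
  have "(\<Sum>i\<in>I. LINT z:cube (c i) (r i)|lebesgue. infnorm (G z) powr p)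
      = (LINT z:(\<Union>i\<in>I. cube (c i) (r i))|lebesgue. infnorm (G z) powr p)"
    using fin disj m set_integrable_subset[OF pint m sub]
    by (intro set_integral_finite_Union[symmetric]) auto
  also have "\<dots> \<le> (LINT z:\<Omega>|lebesgue. infnorm (G z) powr p)"
    by (rule set_integral_powr_mono[OF pint sets.finite_UN[OF fin m] UN_least[OF sub]])
  finally show ?thesis .
qed

text \<open>The parameter \<open>l\<close> balances the length of the curve against the energy. The first term counts the cubes
  of a chain along the curve by \<open>sum_powr_le_curve_integral\<close>, the second one sums their energies.\<close>

lemma curve_estimate:
  assumes F: "continuous_on \<Omega> F" and wg: "weak_gradient \<Omega> F G"
    and pint: "set_integrable lebesgue \<Omega> (\<lambda>z. infnorm (G z) powr p)"
    and g: "g \<in> curves x y" and D: "curve_integral g wt \<le> ennreal D" "D \<ge> 0" and l: "l > 0"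
  shows "\<bar>F x - F y\<bar> \<le> 4 * cone_const TYPE('n) p 0 1 *
    (l powr (p / (p - 1)) * (5 * D + 2 * R y powr \<alpha>) + l powr (- p) * (LINT z:\<Omega>|lebesgue. infnorm (G z) powr p))"
proof -
  let ?K = "cone_const TYPE('n) p 0 1" and ?q = "p / (p - 1)"
  let ?Q = "\<lambda>t. cube (g t) (R (g t) / 4)"
  let ?e = "\<lambda>t. LINT z:?Q t|lebesgue. infnorm (G z) powr p"
  let ?I = "LINT z:\<Omega>|lebesgue. infnorm (G z) powr p"
  have K: "?K \<ge> 0" using cone_const_nonneg[of 0 p 1] p by simp
  have gr: "rectifiable g" "path_image g \<subseteq> \<Omega>" "g 0 = x" "g 1 = y"
    using g by (auto simp: curves_def pathfinish_def pathstart_def)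
  have g\<Omega>: "g t \<in> \<Omega>" if "t \<in> {0..1}" for t using gr(2) that by (auto simp: path_image_def)
  have Q\<Omega>: "?Q t \<subseteq> \<Omega>" if "t \<in> {0..1}" for t
    using R_pos[OF g\<Omega>[OF that]] by (intro cube_subset g\<Omega> that) auto
  have osc: "\<bar>F u - F v\<bar> \<le> 2 * ?K * (l powr ?q * R (g t) powr \<alpha> + l powr (- p) * ?e t)"
    if t: "t \<in> {0..1}" and uv: "u \<in> ?Q t" "v \<in> ?Q t" for t u v
  proof -
    let ?\<rho> = "R (g t) / 4"
    have \<rho>: "?\<rho> > 0" using R_pos[OF g\<Omega>[OF t]] by simp
    have e0: "?e t \<ge> 0" by (rule set_integral_nonneg_powr)
    define a where "a = ?\<rho> powr (1 - real CARD('n) / p)"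
    define b where "b = ?e t powr (1 / p)"
    have "\<bar>F u - wmean \<Omega> F (g t) ?\<rho>\<bar> \<le> ?K * a * b" "\<bar>F v - wmean \<Omega> F (g t) ?\<rho>\<bar> \<le> ?K * a * b"
      unfolding a_def b_def using morrey_cube[OF op F wg pint p \<rho> Q\<Omega>[OF t]] uv by blast+
    then have "\<bar>F u - F v\<bar> \<le> 2 * ?K * (a * b)" by (simp add: mult.assoc)
    also have "\<dots> \<le> 2 * ?K * (l powr ?q * R (g t) powr \<alpha> + l powr (- p) * ?e t)"
    proof (rule mult_left_mono)
      \<comment> \<open>Young's inequality with the parameter \<open>l\<close>; the exponent of \<open>R (g t)\<close> becomes \<open>\<alpha>\<close>.\<close>
      have "a * b = (l * a) * (b / l)" using l by simp
      also have "\<dots> \<le> (l * a) powr ?q + (b / l) powr p"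
        using l p_gt_1 by (intro mult_le_powr_add) (auto simp: a_def b_def)
      also have "(l * a) powr ?q = l powr ?q * ?\<rho> powr \<alpha>"
      proof -
        have "(1 - real CARD('n) / p) * ?q = \<alpha>"
          using p_gt_1 by (simp add: \<alpha>_eq field_simps)
        then show ?thesis by (simp only: powr_mult a_def powr_powr)
      qed
      also have "(b / l) powr p = l powr (- p) * ?e t"
      proof -
        have "b powr p = ?e t" using e0 p_gt_1 unfolding b_def powr_powr by simp
        moreover have "(b / l) powr p = b powr p / l powr p" by (rule powr_divide)
        ultimately show ?thesis unfolding powr_minus by (simp only: divide_inverse mult.commute)
      qed
      also have "l powr ?q * ?\<rho> powr \<alpha> + l powr (- p) * ?e t \<le> l powr ?q * R (g t) powr \<alpha> + l powr (- p) * ?e t"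
        using \<rho> \<alpha> by (intro add_right_mono mult_left_mono powr_mono2) auto
      finally show "a * b \<le> l powr ?q * R (g t) powr \<alpha> + l powr (- p) * ?e t" .
    qed (use K in simp)
    finally show ?thesis .
  qed
  \<comment> \<open>The distance to the boundary has a positive minimum on the curve, so for a fine partition of the
    parameter interval consecutive cubes meet.\<close>
  have "compact (path_image g)" by (rule compact_path_image[OF rectifiableD(1)[OF gr(1)]])
  moreover have "path_image g \<noteq> {}" by (rule path_image_nonempty)
  ultimately obtain z0 where z0: "z0 \<in> path_image g" "\<And>z. z \<in> path_image g \<Longrightarrow> R z0 \<le> R z"
    using continuous_attains_inf[of "path_image g" R] continuous_on_R by blast
  have \<mu>: "R z0 > 0" using R_pos z0(1) gr(2) by blast
  have "uniformly_continuous_on {0..1} g"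
    using rectifiableD(1)[OF gr(1)] by (intro compact_uniformly_continuous) (auto simp: path_def)
  moreover have "R z0 / 4 > 0" using \<mu> by simp
  ultimately have "\<exists>\<delta>>0. \<forall>a\<in>{0..1}. \<forall>b\<in>{0..1}. dist b a < \<delta> \<longrightarrow> dist (g b) (g a) < R z0 / 4"
    unfolding uniformly_continuous_on_def by blast
  then obtain \<delta> where \<delta>: "\<delta> > 0" "\<And>a b. a \<in> {0..1} \<Longrightarrow> b \<in> {0..1} \<Longrightarrow> dist b a < \<delta> \<Longrightarrow> dist (g b) (g a) < R z0 / 4"
    by blast
  obtain M :: nat where M: "M > 0" "1 / real M < \<delta>"
    using \<delta>(1) reals_Archimedean[of \<delta>] by (metis inverse_eq_divide zero_less_Suc)
  have start: "?Q (real i / real M) \<inter> ?Q (real (Suc i) / real M) \<noteq> {}" if i: "i < M" for i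
  proof -
    have t: "real i / real M \<in> {0..1}" "real (Suc i) / real M \<in> {0..1}" using i M(1) by auto
    have "dist (real (Suc i) / real M) (real i / real M) < \<delta>"
      using M by (simp add: dist_real_def diff_divide_distrib[symmetric])
    from \<delta>(2)[OF t this] have "infnorm (g (real (Suc i) / real M) - g (real i / real M)) < R z0 / 4"
      using infnorm_le_norm by (metis dist_norm order.strict_trans1)
    also have "\<dots> \<le> R (g (real i / real M)) / 4" using z0(2)[of "g (real i / real M)"] t(1) by (simp add: path_image_def)
    finally have "g (real (Suc i) / real M) \<in> ?Q (real i / real M)" by (simp add: mem_cube)
    moreover have "g (real (Suc i) / real M) \<in> ?Q (real (Suc i) / real M)" by (intro center_in_cube) (simp add: R_nonneg)
    ultimately show ?thesis by blast
  qed
  obtain m k where k: "k 0 = (0 :: real)" "k m = 1" "\<And>i. i \<le> m \<Longrightarrow> k i \<in> {0..1}"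
      "\<And>i. i < m \<Longrightarrow> ?Q (k i) \<inter> ?Q (k (Suc i)) \<noteq> {}"
      "\<And>i j :: nat. i + 2 \<le> j \<Longrightarrow> j \<le> m \<Longrightarrow> \<not> ?Q (k i) \<inter> ?Q (k j) \<noteq> {}"
    by (rule shortest_chain[of "\<lambda>i. real i / real M" 0 M 1 "{0..1}" "\<lambda>a b. ?Q a \<inter> ?Q b \<noteq> {}"])
       (use M start in \<open>auto\<close>)
  let ?t = "\<lambda>i. l powr ?q * R (g (k i)) powr \<alpha> + l powr (- p) * ?e (k i)"
  have chain: "\<bar>F x - F u\<bar> \<le> (\<Sum>i\<le>j. 2 * ?K * ?t i)" if "j \<le> m" "u \<in> ?Q (k j)" for j u
    using that
  proof (induction j arbitrary: u)
    case 0
    have "x \<in> ?Q (k 0)" using k(1) gr(3) by (simp add: center_in_cube R_nonneg)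
    then show ?case using osc[OF k(3)[of 0], of x u] 0 by simp
  next
    case (Suc j)
    then obtain w where w: "w \<in> ?Q (k j)" "w \<in> ?Q (k (Suc j))" using k(4)[of j] by auto
    have "\<bar>F x - F w\<bar> \<le> (\<Sum>i\<le>j. 2 * ?K * ?t i)" using Suc w(1) by simp
    moreover have "\<bar>F w - F u\<bar> \<le> 2 * ?K * ?t (Suc j)" using osc[OF k(3)[OF Suc.prems(1)] w(2) Suc.prems(2)] .
    ultimately show ?case by simp
  qed
  \<comment> \<open>Cubes whose positions in the chain differ by at least two are disjoint.\<close>
  have half: "(\<Sum>i\<in>J. ?t i) \<le> l powr ?q * (5 * D + 2 * R y powr \<alpha>) + l powr (- p) * ?I"
    if J: "J \<subseteq> {..m}" and sep: "\<And>i j. i \<in> J \<Longrightarrow> j \<in> J \<Longrightarrow> i < j \<Longrightarrow> i + 2 \<le> j" for J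
  proof -
    have fin: "finite J" using J finite_subset by blast
    have disj: "disjoint_family_on (\<lambda>i. ?Q (k i)) J"
      unfolding disjoint_family_on_def
    proof (intro ballI impI)
      fix i j assume ij: "i \<in> J" "j \<in> J" "i \<noteq> j"
      then consider "i < j" | "j < i" by linarith
      then show "?Q (k i) \<inter> ?Q (k j) = {}"
      proof cases
        case 1
        then show ?thesis using k(5)[OF sep[OF ij(1,2)]] ij J by auto
      next
        case 2
        then show ?thesis using k(5)[OF sep[OF ij(2,1)]] ij J by auto
      qed
    qed
    have "(\<Sum>i\<in>J. R (g (k i)) powr \<alpha>) \<le> 5 * D + 2 * R y powr \<alpha>"
      by (rule sum_powr_le_curve_integral[OF g D fin _ disj]) (use k(3) J in auto)
    moreover have "(\<Sum>i\<in>J. ?e (k i)) \<le> ?I"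
      by (rule sum_cube_integrals_le[OF pint fin _ disj]) (use Q\<Omega>[OF k(3)] J in blast)
    ultimately show ?thesis
      unfolding sum.distrib sum_distrib_left[symmetric] by (intro add_mono mult_left_mono) auto
  qed
  have "\<bar>F x - F y\<bar> \<le> (\<Sum>i\<le>m. 2 * ?K * ?t i)"
    by (rule chain) (use k(2) gr(4) in \<open>auto simp: center_in_cube R_nonneg\<close>)
  also have "\<dots> = 2 * ?K * (\<Sum>i\<le>m. ?t i)" by (simp only: sum_distrib_left)
  also have "(\<Sum>i\<le>m. ?t i) = (\<Sum>i\<in>{i. i \<le> m \<and> even i}. ?t i) + (\<Sum>i\<in>{i. i \<le> m \<and> odd i}. ?t i)"
    by (subst sum.union_disjoint[symmetric]) (auto intro!: sum.cong)
  also have "2 * ?K * \<dots> \<le> 2 * ?K * ((l powr ?q * (5 * D + 2 * R y powr \<alpha>) + l powr (- p) * ?I) + (l powr ?q * (5 * D + 2 * R y powr \<alpha>) + l powr (- p) * ?I))"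
  proof -
    have sep: "i + 2 \<le> j" if "i < j" "even i = even j" for i j :: nat
      using that by presburger
    have "(\<Sum>i\<in>{i. i \<le> m \<and> even i}. ?t i) \<le> l powr ?q * (5 * D + 2 * R y powr \<alpha>) + l powr (- p) * ?I"
      by (rule half) (blast, rule sep, auto)
    moreover have "(\<Sum>i\<in>{i. i \<le> m \<and> odd i}. ?t i) \<le> l powr ?q * (5 * D + 2 * R y powr \<alpha>) + l powr (- p) * ?I"
      by (rule half) (blast, rule sep, auto)
    ultimately show ?thesis using K by (intro mult_left_mono add_mono) auto
  qed
  finally show ?thesis by (simp add: algebra_simps)
qed

text \<open>Apply \<open>curve_estimate\<close> to nearly shortest curves between sequences that represent two boundary elements:
  in the limit the distance to the boundary at the end point disappears from the estimate.\<close>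

lemma trace_d_continuous:
  assumes F: "continuous_on \<Omega> F" and tr: "has_trace \<alpha> \<Omega> F f" and wg: "weak_gradient \<Omega> F G"
    and pint: "set_integrable lebesgue \<Omega> (\<lambda>z. infnorm (G z) powr p)"
  shows "d_continuous \<alpha> \<Omega> f"
  unfolding d_continuous_def
proof (intro ballI allI impI)
  fix \<omega> e assume \<omega>: "\<omega> \<in> alpha_boundary \<alpha> \<Omega>" and e: "(e :: real) > 0"
  let ?K = "cone_const TYPE('n) p 0 1" and ?q = "p / (p - 1)"
  let ?I = "LINT z:\<Omega>|lebesgue. infnorm (G z) powr p"
  have K: "?K \<ge> 0" using cone_const_nonneg[of 0 p 1] p by simp
  have I: "?I \<ge> 0" by (rule set_integral_nonneg_powr)
  have est: "\<bar>f \<omega> - f \<omega>'\<bar> \<le> 4 * ?K * (l powr ?q * (5 * d_completion \<alpha> \<Omega> \<omega> \<omega>') + l powr (- p) * ?I)"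
    if \<omega>': "\<omega>' \<in> alpha_boundary \<alpha> \<Omega>" and l: "l > 0" for \<omega>' l
  proof -
    obtain x where x: "x \<in> \<omega>" using completion_nonempty[OF boundary_completion[OF \<omega>]] ..
    obtain y where y: "y \<in> \<omega>'" using completion_nonempty[OF boundary_completion[OF \<omega>']] ..
    have mem: "x i \<in> \<Omega>" "y i \<in> \<Omega>" for i
      by (rule rho_Cauchy_mem[OF completion_Cauchy[OF boundary_completion[OF \<omega>] x]])
         (rule rho_Cauchy_mem[OF completion_Cauchy[OF boundary_completion[OF \<omega>'] y]])
    have bound: "\<bar>F (x i) - F (y i)\<bar> \<le> 4 * ?K * (l powr ?q * (5 * d (x i) (y i) + 2 * R (y i) powr \<alpha>) + l powr (- p) * ?I)" for i
    proof (rule field_le_epsilon)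
      fix \<epsilon> :: real assume \<epsilon>: "\<epsilon> > 0"
      define \<epsilon>' where "\<epsilon>' = \<epsilon> / (20 * ?K * l powr ?q + 1)"
      have pos: "20 * ?K * l powr ?q + 1 > 0" using K by (simp add: add_nonneg_pos)
      have \<epsilon>': "\<epsilon>' > 0" using \<epsilon> pos by (simp add: \<epsilon>'_def)
      obtain g where g: "g \<in> curves (x i) (y i)" "curve_integral g wt \<le> ennreal (d (x i) (y i) + \<epsilon>')"
        using d_approx[OF mem \<epsilon>'] by blast
      have "\<bar>F (x i) - F (y i)\<bar> \<le> 4 * ?K * (l powr ?q * (5 * (d (x i) (y i) + \<epsilon>') + 2 * R (y i) powr \<alpha>) + l powr (- p) * ?I)"
        by (rule curve_estimate[OF F wg pint g _ l]) (use d_nonneg \<epsilon>' in \<open>auto intro: add_nonneg_nonneg\<close>)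
      also have "\<dots> = 4 * ?K * (l powr ?q * (5 * d (x i) (y i) + 2 * R (y i) powr \<alpha>) + l powr (- p) * ?I) + 20 * ?K * l powr ?q * \<epsilon>'"
        by (simp add: algebra_simps)
      also have "20 * ?K * l powr ?q * \<epsilon>' \<le> \<epsilon>"
      proof -
        have "20 * ?K * l powr ?q * \<epsilon>' \<le> (20 * ?K * l powr ?q + 1) * \<epsilon>'" using \<epsilon>' by (simp add: distrib_right)
        also have "\<dots> = \<epsilon>" using pos by (simp add: \<epsilon>'_def)
        finally show ?thesis .
      qed
      finally show "\<bar>F (x i) - F (y i)\<bar> \<le> 4 * ?K * (l powr ?q * (5 * d (x i) (y i) + 2 * R (y i) powr \<alpha>) + l powr (- p) * ?I) + \<epsilon>"
        by simp
    qed
    have Ry: "(\<lambda>i. R (y i) powr \<alpha>) \<longlonglongrightarrow> 0"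
    proof -
      have "isCont R (ell \<omega>')" using continuous_on_R[of UNIV] by (simp add: continuous_on_eq_continuous_at)
      then have "(\<lambda>i. R (y i)) \<longlonglongrightarrow> R (ell \<omega>')"
        using tendsto_ell[OF boundary_completion[OF \<omega>'] y] by (rule isCont_tendsto_compose)
      moreover have "R (ell \<omega>') = 0"
        using udist_le[OF ell_frontier[OF \<omega>'], of "ell \<omega>'"] R_nonneg[of "ell \<omega>'"] by (simp add: infnorm_0)
      ultimately have "(\<lambda>i. R (y i)) \<longlonglongrightarrow> 0" by simp
      then show ?thesis by (rule tendsto_zero_powrI[OF _ tendsto_const]) (use \<alpha> in \<open>auto intro!: always_eventually simp: R_nonneg\<close>)
    qed
    have up: "(\<lambda>i. 4 * ?K * (l powr ?q * (5 * d (x i) (y i) + 2 * R (y i) powr \<alpha>) + l powr (- p) * ?I))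
        \<longlonglongrightarrow> 4 * ?K * (l powr ?q * (5 * d_completion \<alpha> \<Omega> \<omega> \<omega>' + 2 * 0) + l powr (- p) * ?I)"
      by (intro tendsto_intros Ry tendsto_d_completion boundary_completion \<omega> \<omega>' x y)
    have lo: "(\<lambda>i. \<bar>F (x i) - F (y i)\<bar>) \<longlonglongrightarrow> \<bar>f \<omega> - f \<omega>'\<bar>"
      by (intro tendsto_intros has_traceD[OF tr] \<omega> \<omega>' x y)
    have "\<bar>f \<omega> - f \<omega>'\<bar> \<le> 4 * ?K * (l powr ?q * (5 * d_completion \<alpha> \<Omega> \<omega> \<omega>' + 2 * 0) + l powr (- p) * ?I)"
      by (rule LIMSEQ_le[OF lo up]) (intro exI[of _ 0] allI impI bound)
    then show ?thesis by simp
  qed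
  \<comment> \<open>First \<open>l\<close> makes the energy term less than \<open>e / 2\<close>; then \<open>\<delta>\<close> does the same for the other term. The
    summands \<open>1\<close> exclude division by zero.\<close>
  define l where "l = (8 * ?K * ?I / e + 1) powr (1 / p)"
  have base: "8 * ?K * ?I / e + 1 > 0" using K I e by (simp add: add_nonneg_pos)
  have l: "l > 0" using base by (simp add: l_def)
  have lp: "4 * ?K * (l powr (- p) * ?I) < e / 2"
  proof -
    have "l powr (- p) = 1 / (8 * ?K * ?I / e + 1)"
      using base p_gt_1 by (simp add: l_def powr_powr powr_minus divide_inverse)
    then have "4 * ?K * (l powr (- p) * ?I) = (4 * ?K * ?I) / (8 * ?K * ?I / e + 1)" by simp
    also have "\<dots> < e / 2"
      unfolding pos_divide_less_eq[OF base] using e by (simp add: algebra_simps)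
    finally show ?thesis .
  qed
  define \<delta> where "\<delta> = e / (2 * (20 * ?K * l powr ?q + 1))"
  have pos: "20 * ?K * l powr ?q + 1 > 0" using K by (simp add: add_nonneg_pos)
  have "\<delta> > 0" using e pos by (simp add: \<delta>_def)
  moreover have "\<bar>f \<omega>' - f \<omega>\<bar> < e" if \<omega>': "\<omega>' \<in> alpha_boundary \<alpha> \<Omega>" and dd: "d_completion \<alpha> \<Omega> \<omega> \<omega>' < \<delta>" for \<omega>'
  proof -
    have "20 * ?K * l powr ?q * d_completion \<alpha> \<Omega> \<omega> \<omega>' \<le> 20 * ?K * l powr ?q * \<delta>"
      using dd K by (intro mult_left_mono) auto
    also have "\<dots> \<le> (20 * ?K * l powr ?q + 1) * \<delta>" using \<open>\<delta> > 0\<close> by (simp add: distrib_right)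
    also have "\<dots> = e / 2"
    proof -
      have "w * (e / (2 * w)) = e / 2" if "w > 0" for w :: real using that by simp
      from this[OF pos] show ?thesis unfolding \<delta>_def .
    qed
    finally have "4 * ?K * (l powr ?q * (5 * d_completion \<alpha> \<Omega> \<omega> \<omega>')) \<le> e / 2" by (simp add: algebra_simps)
    then have "4 * ?K * (l powr ?q * (5 * d_completion \<alpha> \<Omega> \<omega> \<omega>') + l powr (- p) * ?I) < e"
      using lp by (simp add: distrib_left)
    then show ?thesis using est[OF \<omega>' l] by (simp add: abs_minus_commute)
  qed
  ultimately show "\<exists>\<delta>>0. \<forall>\<omega>'\<in>alpha_boundary \<alpha> \<Omega>. d_completion \<alpha> \<Omega> \<omega> \<omega>' < \<delta> \<longrightarrow> \<bar>f \<omega>' - f \<omega>\<bar> < e" by blast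
qed

end

section \<open>Continuously differentiable functions are weakly differentiable\<close>

lemma lborel_integral_translate:
  fixes u :: "real ^ 'n \<Rightarrow> real"
  assumes "u \<in> borel_measurable borel"
  shows "(LINT x|lborel. u (x + a)) = (LINT x|lborel. u x)"
proof -
  have "(LINT x|lborel. u x) = (LINT x|distr lborel borel ((+) a). u x)"
    by (simp add: lborel_distr_plus)
  also have "\<dots> = (LINT x|lborel. u (a + x))" using assms by (intro integral_distr) auto
  finally show ?thesis by (simp add: add.commute)
qed

text \<open>The integral of \<open>u (x + t e\<^sub>i)\<close> over \<open>x\<close> does not depend on \<open>t\<close>, and its derivative at \<open>t = 0\<close> is the
  integral in question.\<close>

lemma integral_partial_deriv_eq_0:
  fixes u :: "real ^ 'n \<Rightarrow> real"
  assumes diff: "\<And>x. u differentiable (at x)" and K: "compact K" and out: "\<And>x. x \<notin> K \<Longrightarrow> u x = 0"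
    and bd: "\<And>x. \<bar>partial_deriv i u x\<bar> \<le> B" and meas: "partial_deriv i u \<in> borel_measurable lebesgue"
  shows "(LINT x|lebesgue. partial_deriv i u x) = 0"
proof -
  have cont: "continuous_on UNIV u"
    using diff by (simp add: continuous_on_eq_continuous_at differentiable_imp_continuous_within)
  then have um: "u \<in> borel_measurable borel" by (rule borel_measurable_continuous_onI)
  obtain b where b: "b \<ge> 0" "K \<subseteq> cube 0 b"
  proof -
    obtain b where "\<forall>x\<in>K. norm x \<le> b" using compact_imp_bounded[OF K] by (auto simp: bounded_iff)
    have "infnorm x \<le> max b 0" if "x \<in> K" for x
      using infnorm_le_norm[of x] \<open>\<forall>x\<in>K. norm x \<le> b\<close> that by fastforce
    then have "K \<subseteq> cube 0 (max b 0)" by (auto simp: mem_cube)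
    then show ?thesis using that[of "max b 0"] by simp
  qed
  obtain D where D: "D \<ge> 0" "\<And>x. x \<in> K \<Longrightarrow> \<bar>u x\<bar> \<le> D"
    using continuous_bounded_on_compact[OF K continuous_on_subset[OF cont]] by blast
  let ?e = "axis i 1 :: real ^ 'n"
  have pd0: "partial_deriv i u x = 0" if x: "x \<notin> K" for x
  proof -
    have "(u has_derivative (\<lambda>h. 0)) (at x)"
      by (rule has_derivative_transform_within_open[of "\<lambda>x. 0" _ _ _ "- K"])
         (use x out compact_imp_closed[OF K] in auto)
    then show ?thesis by (rule partial_deriv_eq)
  qed
  have far: "x + t *\<^sub>R ?e \<notin> K" if x: "x \<notin> cube 0 (b + 1)" and t: "\<bar>t\<bar> \<le> 1" for x t
  proof
    assume "x + t *\<^sub>R ?e \<in> K"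
    then have "infnorm (x + t *\<^sub>R ?e) \<le> b" using b by (auto simp: mem_cube)
    moreover have "infnorm (t *\<^sub>R ?e) \<le> 1" using t by (simp add: infnorm_mul)
    moreover have "infnorm x \<le> infnorm (x + t *\<^sub>R ?e) + infnorm (t *\<^sub>R ?e)"
      using infnorm_triangle[of "x + t *\<^sub>R ?e" "- (t *\<^sub>R ?e)"] by (simp add: infnorm_neg)
    ultimately show False using x by (simp add: mem_cube)
  qed
  have "((\<lambda>t. LINT x|lebesgue. u (x + t *\<^sub>R ?e)) has_real_derivative
      (LINT x|lebesgue. partial_deriv i u (x + 0 *\<^sub>R ?e))) (at 0 within {-1..1})"
  proof (rule integral_has_derivative_dominated[where w = "\<lambda>x. B * indicator (cube 0 (b + 1)) x"
        and h = "\<lambda>t x. u (x + t *\<^sub>R ?e)" and h' = "\<lambda>t x. partial_deriv i u (x + t *\<^sub>R ?e)"])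
    fix t :: real assume "t \<in> {-1..1}"
    then have t: "\<bar>t\<bar> \<le> 1" by auto
    show "integrable lebesgue (\<lambda>x. u (x + t *\<^sub>R ?e))"
    proof (rule Bochner_Integration.integrable_bound)
      show "integrable lebesgue (\<lambda>x. D * indicat_real (cube (0 :: real ^ 'n) (b + 1)) x)"
        by (intro integrable_mult_right integrable_indicator_compact compact_cube)
      have "continuous_on UNIV (\<lambda>x. u (x + t *\<^sub>R ?e))"
        by (rule continuous_on_compose2[OF cont]) (auto intro!: continuous_intros)
      then show "(\<lambda>x. u (x + t *\<^sub>R ?e)) \<in> borel_measurable lebesgue"
        by (intro measurable_completion) (simp add: borel_measurable_continuous_onI)
      show "AE x in lebesgue. norm (u (x + t *\<^sub>R ?e)) \<le> norm (D * indicat_real (cube 0 (b + 1)) x)"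
      proof (rule AE_I2)
        fix x
        show "norm (u (x + t *\<^sub>R ?e)) \<le> norm (D * indicat_real (cube 0 (b + 1)) x)"
        proof (cases "x \<in> cube 0 (b + 1)")
          case True
          then show ?thesis using D out[of "x + t *\<^sub>R ?e"] by (cases "x + t *\<^sub>R ?e \<in> K") auto
        next
          case False
          then show ?thesis using out[OF far[OF False t]] by simp
        qed
      qed
    qed
    fix x
    have "((\<lambda>t. x + t *\<^sub>R ?e) has_derivative (\<lambda>h. h *\<^sub>R ?e)) (at t)"
      by (auto intro!: derivative_eq_intros)
    from has_derivative_compose[OF this has_derivative_partial_deriv[OF diff]]
    have "((\<lambda>t. u (x + t *\<^sub>R ?e)) has_derivative
        (\<lambda>h. \<Sum>j\<in>UNIV. (h *\<^sub>R ?e) $ j * partial_deriv j u (x + t *\<^sub>R ?e))) (at t)" .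
    moreover have "(\<Sum>j\<in>UNIV. (h *\<^sub>R ?e) $ j * partial_deriv j u y) = partial_deriv i u y * h" for h y
    proof -
      have "(h *\<^sub>R ?e) $ j * partial_deriv j u y = (if j = i then partial_deriv i u y * h else 0)" for j
        by (auto simp: axis_def)
      then show ?thesis by simp
    qed
    ultimately have "((\<lambda>t. u (x + t *\<^sub>R ?e)) has_real_derivative partial_deriv i u (x + t *\<^sub>R ?e)) (at t)"
      by (simp add: has_field_derivative_def)
    then show "((\<lambda>t. u (x + t *\<^sub>R ?e)) has_real_derivative partial_deriv i u (x + t *\<^sub>R ?e)) (at t within {-1..1})"
      by (rule has_field_derivative_at_within)
    show "\<bar>partial_deriv i u (x + t *\<^sub>R ?e)\<bar> \<le> B * indicat_real (cube 0 (b + 1)) x"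
    proof (cases "x \<in> cube 0 (b + 1)")
      case True
      then show ?thesis using bd by simp
    next
      case False
      then show ?thesis using pd0[OF far[OF False t]] by simp
    qed
  next
    show "integrable lebesgue (\<lambda>x. B * indicat_real (cube (0 :: real ^ 'n) (b + 1)) x)"
      by (intro integrable_mult_right integrable_indicator_compact compact_cube)
  qed (use meas in auto)
  moreover have "(\<lambda>t. LINT x|lebesgue. u (x + t *\<^sub>R ?e)) = (\<lambda>t. LINT x|lborel. u x)"
  proof
    fix t
    have "(\<lambda>x. u (x + t *\<^sub>R ?e)) \<in> borel_measurable lborel"
      using measurable_compose[OF _ um, of "\<lambda>x. x + t *\<^sub>R ?e" lborel] by simp
    then show "(LINT x|lebesgue. u (x + t *\<^sub>R ?e)) = (LINT x|lborel. u x)"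
      by (simp add: integral_completion lborel_integral_translate[OF um])
  qed
  ultimately have "((\<lambda>t. LINT x|lborel. u x) has_real_derivative (LINT x|lebesgue. partial_deriv i u x)) (at 0 within {-1..1})"
    by simp
  then have "((\<lambda>t. LINT x|lborel. u x) has_real_derivative (LINT x|lebesgue. partial_deriv i u x)) (at 0)"
    by (simp add: at_within_Icc_at)
  then show ?thesis using DERIV_unique[OF _ DERIV_const] by blast
qed

lemma set_integrable_continuous_compact:
  fixes f :: "real ^ 'n \<Rightarrow> 'b :: {banach, second_countable_topology}"
  assumes "compact K" "continuous_on K f"
  shows "set_integrable lebesgue K f"
  using borel_integrable_compact[OF assms] unfolding set_integrable_def
  by (simp add: integrable_completion borel_measurable_integrable)

text \<open>The product of \<open>F\<close> with a test function, continued by zero, is differentiable on the whole space.\<close>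

lemma weak_gradient_C1:
  fixes F :: "real ^ 'n \<Rightarrow> real"
  assumes op: "open \<Omega>" and diff: "\<And>x. x \<in> \<Omega> \<Longrightarrow> F differentiable (at x)"
    and cont: "\<And>i. continuous_on \<Omega> (partial_deriv i F)"
  shows "weak_gradient \<Omega> F (\<lambda>x. \<chi> i. partial_deriv i F x)"
  unfolding weak_gradient_def
proof (intro conjI allI impI)
  have Fc: "continuous_on \<Omega> F"
    using diff by (simp add: continuous_at_imp_continuous_on differentiable_imp_continuous_within)
  show "set_integrable lebesgue K F" if "compact K \<and> K \<subseteq> \<Omega>" for K
    using that Fc by (intro set_integrable_continuous_compact) (auto intro: continuous_on_subset)
  show "set_integrable lebesgue K (\<lambda>x. \<chi> i. partial_deriv i F x)" if "compact K \<and> K \<subseteq> \<Omega>" for K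
    using that cont by (intro set_integrable_continuous_compact continuous_on_vec_lambda) (auto intro: continuous_on_subset)
  fix \<phi> i assume "test_function \<Omega> \<phi>"
  then obtain K where C: "\<And>k. C_class k \<phi>" and K: "compact K" "K \<subseteq> \<Omega>" and out: "\<And>x. x \<notin> K \<Longrightarrow> \<phi> x = 0"
    unfolding test_function_def by blast
  have \<phi>d: "\<phi> differentiable (at x)" for x using C[of "Suc 0"] by simp
  have \<phi>c: "continuous_on A \<phi>" for A using C[of 0] continuous_on_subset by auto
  have \<phi>pc: "continuous_on A (partial_deriv i \<phi>)" for A using C[of "Suc 0"] by (auto intro: continuous_on_subset[of UNIV])
  have \<phi>p0: "partial_deriv i \<phi> x = 0" if x: "x \<notin> K" for x
  proof -
    have "(\<phi> has_derivative (\<lambda>h. 0)) (at x)"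
      by (rule has_derivative_transform_within_open[of "\<lambda>x. 0" _ _ _ "- K"])
         (use x out compact_imp_closed[OF K(1)] in auto)
    then show ?thesis by (rule partial_deriv_eq)
  qed
  \<comment> \<open>Nothing is known about \<open>F\<close> outside \<open>\<Omega>\<close>, hence the case distinction.\<close>
  define u where "u x = (if x \<in> \<Omega> then F x * \<phi> x else 0)" for x
  define u' where "u' x = indicator \<Omega> x *\<^sub>R (F x * partial_deriv i \<phi> x + partial_deriv i F x * \<phi> x)" for x
  have u_der: "u differentiable (at x) \<and> partial_deriv i u x = u' x" for x
  proof (cases "x \<in> \<Omega>")
    case True
    have "((\<lambda>x. F x * \<phi> x) has_derivative (\<lambda>h. F x * frechet_derivative \<phi> (at x) h + frechet_derivative F (at x) h * \<phi> x)) (at x)"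
      by (rule has_derivative_mult) (use diff[OF True] \<phi>d[of x] in \<open>simp_all add: frechet_derivative_works[symmetric]\<close>)
    then have "(u has_derivative (\<lambda>h. F x * frechet_derivative \<phi> (at x) h + frechet_derivative F (at x) h * \<phi> x)) (at x)"
      by (rule has_derivative_transform_within_open[OF _ op True]) (simp add: u_def)
    from this partial_deriv_eq[OF this, of i] show ?thesis
      using True by (auto simp: differentiable_def u'_def partial_deriv_def)
  next
    case False
    then have "x \<in> - K" using K by auto
    have "(u has_derivative (\<lambda>h. 0)) (at x)"
      by (rule has_derivative_transform_within_open[of "\<lambda>x. 0" _ _ _ "- K"])
         (use \<open>x \<in> - K\<close> out compact_imp_closed[OF K(1)] in \<open>auto simp: u_def\<close>)
    from this partial_deriv_eq[OF this, of i] show ?thesis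
      using False by (auto simp: differentiable_def u'_def)
  qed
  have b: "\<bar>\<phi> x\<bar> \<le> B * indicator K x" if "\<And>x. x \<in> K \<Longrightarrow> \<bar>\<phi> x\<bar> \<le> B" "\<And>x. x \<notin> K \<Longrightarrow> \<phi> x = 0" for \<phi> :: "real ^ 'n \<Rightarrow> real" and B x
    using that by (cases "x \<in> K") auto
  have int: "set_integrable lebesgue \<Omega> (\<lambda>x. f x * g x)" and bnd: "\<exists>B. \<forall>x. \<bar>indicator \<Omega> x *\<^sub>R (f x * g x)\<bar> \<le> B"
    if f: "continuous_on \<Omega> f" and g: "continuous_on UNIV g" "\<And>x. x \<notin> K \<Longrightarrow> g x = 0" for f g :: "real ^ 'n \<Rightarrow> real"
  proof -
    obtain B where B: "B \<ge> 0" "\<And>x. x \<in> K \<Longrightarrow> \<bar>g x\<bar> \<le> B"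
      using continuous_bounded_on_compact[OF K(1) continuous_on_subset[OF g(1)]] by blast
    obtain D where D: "D \<ge> 0" "\<And>x. x \<in> K \<Longrightarrow> \<bar>f x\<bar> \<le> D"
      using continuous_bounded_on_compact[OF K(1) continuous_on_subset[OF f K(2)]] by blast
    show "set_integrable lebesgue \<Omega> (\<lambda>x. f x * g x)"
    proof (rule set_integrable_mult_compact_support[OF op f K])
      show "g \<in> borel_measurable lebesgue"
        by (intro measurable_completion) (simp add: borel_measurable_continuous_onI g(1))
      show "\<bar>g z\<bar> \<le> B * indicat_real K z" for z by (rule b[OF B(2) g(2)])
    qed
    have "\<bar>indicator \<Omega> x *\<^sub>R (f x * g x)\<bar> \<le> D * B" for x
    proof (cases "x \<in> K")
      case True
      then have "\<bar>f x\<bar> * \<bar>g x\<bar> \<le> D * B" using B D by (intro mult_mono) auto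
      then show ?thesis using B D by (simp add: abs_mult indicator_def)
    qed (use g B D in simp)
    then show "\<exists>B. \<forall>x. \<bar>indicator \<Omega> x *\<^sub>R (f x * g x)\<bar> \<le> B" by blast
  qed
  have i1: "set_integrable lebesgue \<Omega> (\<lambda>x. F x * partial_deriv i \<phi> x)"
    by (rule int(1)[OF Fc \<phi>pc \<phi>p0])
  have i2: "set_integrable lebesgue \<Omega> (\<lambda>x. partial_deriv i F x * \<phi> x)"
    by (rule int(1)[OF cont \<phi>c out])
  obtain B1 where B1: "\<And>x. \<bar>indicator \<Omega> x *\<^sub>R (F x * partial_deriv i \<phi> x)\<bar> \<le> B1"
    using bnd[OF Fc \<phi>pc \<phi>p0] by blast
  obtain B2 where B2: "\<And>x. \<bar>indicator \<Omega> x *\<^sub>R (partial_deriv i F x * \<phi> x)\<bar> \<le> B2"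
    using bnd[OF cont \<phi>c out] by blast
  have u'_split: "u' x = indicator \<Omega> x *\<^sub>R (F x * partial_deriv i \<phi> x) + indicator \<Omega> x *\<^sub>R (partial_deriv i F x * \<phi> x)" for x
    by (simp add: u'_def algebra_simps)
  have "(LINT x|lebesgue. partial_deriv i u x) = 0"
  proof (rule integral_partial_deriv_eq_0[OF _ K(1)])
    show "u differentiable (at x)" for x using u_der by blast
    show "u x = 0" if "x \<notin> K" for x using out[OF that] by (simp add: u_def)
    show "\<bar>partial_deriv i u x\<bar> \<le> B1 + B2" for x
      using u_der[of x] B1[of x] B2[of x] abs_triangle_ineq[of "indicator \<Omega> x *\<^sub>R (F x * partial_deriv i \<phi> x)" "indicator \<Omega> x *\<^sub>R (partial_deriv i F x * \<phi> x)"]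
      by (simp only: u'_split)
    have "u' \<in> borel_measurable lebesgue"
      unfolding u'_split[abs_def] using i1 i2 unfolding set_integrable_def
      by (intro borel_measurable_add) (auto dest: borel_measurable_integrable)
    moreover have "partial_deriv i u = u'" using u_der by blast
    ultimately show "partial_deriv i u \<in> borel_measurable lebesgue" by simp
  qed
  also have "(LINT x|lebesgue. partial_deriv i u x) = (LINT x|lebesgue. u' x)"
    using u_der by simp
  also have "\<dots> = (LINT x:\<Omega>|lebesgue. F x * partial_deriv i \<phi> x) + (LINT x:\<Omega>|lebesgue. partial_deriv i F x * \<phi> x)"
    unfolding u'_split set_lebesgue_integral_def
    using i1 i2 unfolding set_integrable_def by (intro Bochner_Integration.integral_add)
  finally show "(LINT x:\<Omega>|lebesgue. F x * partial_deriv i \<phi> x) = - (LINT x:\<Omega>|lebesgue. (\<chi> i. partial_deriv i F x) $ i * \<phi> x)"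
    by simp
qed

section \<open>The Sobolev seminorm and the trace norm\<close>

context proper_domain begin

text \<open>A weak gradient is integrable over compact subsets only; these exhaust \<open>\<Omega>\<close>.\<close>

lemma weak_gradient_measurable:
  assumes wg: "weak_gradient \<Omega> F H"
  shows "(\<lambda>z. indicator \<Omega> z *\<^sub>R H z) \<in> borel_measurable lebesgue"
proof (rule borel_measurable_LIMSEQ_metric)
  define K where "K k = closure \<Omega> \<inter> {x. 1 / real (Suc k) \<le> R x} \<inter> cube 0 (real k)" for k
  have K: "compact (K k)" for k
    unfolding K_def
    by (intro closed_Int_compact closed_Int closed_closure closed_Collect_le continuous_intros continuous_on_R compact_cube)
  have K\<Omega>: "K k \<subseteq> \<Omega>" for k
  proof
    fix x assume x: "x \<in> K k"
    have "0 < 1 / real (Suc k)" by simp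
    also have "\<dots> \<le> R x" using x by (simp add: K_def)
    finally have "R x > 0" .
    then have "x \<notin> frontier \<Omega>" using udist_le[of x "frontier \<Omega>" x] by (auto simp: infnorm_0)
    then show "x \<in> \<Omega>" using x op by (simp add: K_def frontier_def interior_open)
  qed
  show "(\<lambda>z. indicator (K k) z *\<^sub>R H z) \<in> borel_measurable lebesgue" for k
    using wg K K\<Omega> by (auto simp: weak_gradient_def set_integrable_def intro: borel_measurable_integrable)
  fix z
  show "(\<lambda>k. indicat_real (K k) z *\<^sub>R H z) \<longlonglongrightarrow> indicat_real \<Omega> z *\<^sub>R H z"
  proof (cases "z \<in> \<Omega>")
    case True
    obtain k1 :: nat where k1: "1 / R z < real k1" using reals_Archimedean2 by blast
    obtain k2 :: nat where k2: "infnorm z < real k2" using reals_Archimedean2 by blast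
    have "z \<in> K k" if "k \<ge> max k1 k2" for k
    proof -
      have "1 / R z \<le> real (Suc k)" using k1 that by simp
      then have "1 / real (Suc k) \<le> R z" using R_pos[OF True] by (simp add: field_simps)
      then show ?thesis using k2 that closure_subset True by (auto simp: K_def mem_cube)
    qed
    then have "\<forall>\<^sub>F k in sequentially. indicat_real (K k) z *\<^sub>R H z = indicat_real \<Omega> z *\<^sub>R H z"
      unfolding eventually_sequentially using True by (intro exI[of _ "max k1 k2"]) auto
    then show ?thesis by (rule tendsto_eventually)
  next
    case False
    then have "z \<notin> K k" for k using K\<Omega> by blast
    then show ?thesis using False by simp
  qed
qed

text \<open>By uniqueness up to null sets, any weak gradient computes the seminorm.\<close>

lemma L1p_norm_eq:
  assumes wg: "weak_gradient \<Omega> F G" and pint: "set_integrable lebesgue \<Omega> (\<lambda>z. infnorm (G z) powr p)"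
  shows "L1p_norm p \<Omega> F = (LINT z:\<Omega>|lebesgue. infnorm (G z) powr p) powr (1 / p)"
proof -
  define H where "H = (SOME G. weak_gradient \<Omega> F G)"
  have H: "weak_gradient \<Omega> F H" unfolding H_def by (rule someI[of "weak_gradient \<Omega> F", OF wg])
  have ae: "AE x in lebesgue. x \<in> \<Omega> \<longrightarrow> H x = G x" by (rule weak_gradient_unique[OF op H wg])
  have "(LINT z|lebesgue. indicator \<Omega> z *\<^sub>R (infnorm (H z) powr p)) = (LINT z|lebesgue. indicator \<Omega> z *\<^sub>R (infnorm (G z) powr p))"
  proof (rule integral_cong_AE)
    show "(\<lambda>z. indicat_real \<Omega> z *\<^sub>R (infnorm (G z) powr p)) \<in> borel_measurable lebesgue"
      using pint unfolding set_integrable_def by (rule borel_measurable_integrable)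
    have "(\<lambda>z. infnorm (indicator \<Omega> z *\<^sub>R H z)) \<in> borel_measurable lebesgue"
      by (intro borel_measurable_continuous_on[of infnorm] continuous_intros weak_gradient_measurable[OF H])
    then have "(\<lambda>z. infnorm (indicator \<Omega> z *\<^sub>R H z) powr p) \<in> borel_measurable lebesgue" by measurable
    also have "(\<lambda>z. infnorm (indicat_real \<Omega> z *\<^sub>R H z) powr p) = (\<lambda>z. indicat_real \<Omega> z *\<^sub>R (infnorm (H z) powr p))"
      by (auto simp: indicator_def infnorm_0)
    finally show "(\<lambda>z. indicat_real \<Omega> z *\<^sub>R (infnorm (H z) powr p)) \<in> borel_measurable lebesgue" .
    show "AE z in lebesgue. indicat_real \<Omega> z *\<^sub>R (infnorm (H z) powr p) = indicat_real \<Omega> z *\<^sub>R (infnorm (G z) powr p)"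
      by (rule eventually_mono[OF ae]) (simp add: indicator_def)
  qed
  then show ?thesis by (simp add: L1p_norm_def H_def set_lebesgue_integral_def)
qed

end

lemma L1p_norm_nonneg: "L1p_norm p \<Omega> F \<ge> 0"
  by (simp add: L1p_norm_def)

lemma trace_norm_le:
  assumes "F \<in> trace_extensions p \<alpha> \<Omega> f"
  shows "trace_norm p \<alpha> \<Omega> f \<le> L1p_norm p \<Omega> F"
  unfolding trace_norm_def using assms
  by (intro cINF_lower bdd_belowI[of _ 0]) (auto simp: L1p_norm_nonneg)

section \<open>Extension by a partition of unity\<close>

text \<open>The choice fixes a bound that depends on the dimension only.\<close>

definition bump_lip :: "('n :: finite) itself \<Rightarrow> real" where
  "bump_lip _ = (SOME M. M \<ge> 0 \<and> (\<forall>i (z :: real ^ 'n). \<bar>partial_deriv i (bump 0 1) z\<bar> \<le> M))"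

lemma bump_lip: "bump_lip TYPE('n :: finite) \<ge> 0" "\<bar>partial_deriv i (bump 0 1) (z :: real ^ 'n)\<bar> \<le> bump_lip TYPE('n)"
proof -
  obtain M where "M \<ge> 0 \<and> (\<forall>i (z :: real ^ 'n). \<bar>partial_deriv i (bump 0 1) z\<bar> \<le> M)"
    using bump_partial_deriv_bounded by metis
  then have "bump_lip TYPE('n) \<ge> 0 \<and> (\<forall>i (z :: real ^ 'n). \<bar>partial_deriv i (bump 0 1) z\<bar> \<le> bump_lip TYPE('n))"
    unfolding bump_lip_def by (rule someI)
  then show "bump_lip TYPE('n) \<ge> 0" "\<bar>partial_deriv i (bump 0 1) (z :: real ^ 'n)\<bar> \<le> bump_lip TYPE('n)" by auto
qed

text \<open>Every point of \<open>\<Omega>\<close> is within \<open>2 / 19 * R c\<close> of a centre \<open>c\<close>, which is \<open>18 / 19\<close> of the radius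
  \<open>R c / 9\<close> of its bump; so this is a lower bound for the sum of the bumps.\<close>

definition net_low :: "('n :: finite) itself \<Rightarrow> real" where
  "net_low _ = flat 1 (1 - 18 / 19) ^ (2 * CARD('n))"

lemma net_low_pos: "net_low T > 0"
  by (simp add: net_low_def flat_1_pos_iff)

text \<open>The numerator of the derivative of a quotient consists of two products of sums with at most \<open>5 ^ n\<close>
  terms, in which the derivatives of the bumps are at most \<open>12 * bump_lip T / R j\<close>; the denominator is the
  square of the sum of the bumps.\<close>

definition grad_const :: "('n :: finite) itself \<Rightarrow> real" where
  "grad_const T = 24 * 25 ^ CARD('n) * bump_lip T / (net_low T * net_low T)"

lemma grad_const_nonneg: "grad_const TYPE('n :: finite) \<ge> 0"
  by (simp add: grad_const_def bump_lip)

lemma partial_deriv_linear_combination: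
  fixes \<psi> :: "'c \<Rightarrow> real ^ 'n \<Rightarrow> real"
  assumes "\<And>c. \<psi> c differentiable (at x)"
  shows "partial_deriv i (\<lambda>y. \<Sum>c\<in>T. k c * \<psi> c y) x = (\<Sum>c\<in>T. k c * partial_deriv i (\<psi> c) x)"
proof -
  have "((\<lambda>y. \<Sum>c\<in>T. k c * \<psi> c y) has_derivative (\<lambda>h. \<Sum>c\<in>T. k c * frechet_derivative (\<psi> c) (at x) h)) (at x)"
    by (intro has_derivative_sum has_derivative_mult_right) (use assms in \<open>simp add: frechet_derivative_works[symmetric]\<close>)
  from partial_deriv_eq[OF this, of i] show ?thesis by (simp add: partial_deriv_def)
qed

context proper_domain begin

definition separated :: "(real ^ 'n) set \<Rightarrow> bool" where
  "separated I \<longleftrightarrow> I \<subseteq> \<Omega> \<and> disjoint_family_on (\<lambda>c. cube c (R c / 20)) I"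

text \<open>Separation passes to unions of chains, so Zorn's lemma applies.\<close>

lemma ex_maximal_separated:
  "\<exists>I. separated I \<and> (\<forall>x\<in>\<Omega>. \<exists>c\<in>I. cube x (R x / 20) \<inter> cube c (R c / 20) \<noteq> {})"
proof -
  have "\<exists>M\<in>{I. separated I}. \<forall>X\<in>{I. separated I}. M \<subseteq> X \<longrightarrow> X = M"
  proof (rule subset_Zorn')
    fix C assume C: "subset.chain {I. separated I} C"
    have "cube c (R c / 20) \<inter> cube c' (R c' / 20) = {}" if cc: "c \<in> \<Union>C" "c' \<in> \<Union>C" "c \<noteq> c'" for c c'
    proof -
      obtain X Y where XY: "X \<in> C" "Y \<in> C" "c \<in> X" "c' \<in> Y" using cc by blast
      have "X \<subseteq> Y \<or> Y \<subseteq> X" using C XY by (auto simp: subset_chain_def)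
      then obtain Z where Z: "Z \<in> C" "c \<in> Z" "c' \<in> Z" using XY by blast
      then have "separated Z" using C by (auto simp: subset_chain_def)
      then show ?thesis using Z cc(3) by (auto simp: separated_def disjoint_family_on_def)
    qed
    moreover have "\<Union>C \<subseteq> \<Omega>" using C by (fastforce simp: subset_chain_def separated_def)
    ultimately show "\<Union>C \<in> {I. separated I}" by (simp add: separated_def disjoint_family_on_def)
  qed
  then obtain M where M: "separated M" "\<And>X. separated X \<Longrightarrow> M \<subseteq> X \<Longrightarrow> X = M" by blast
  have "\<exists>c\<in>M. cube x (R x / 20) \<inter> cube c (R c / 20) \<noteq> {}" if x: "x \<in> \<Omega>" for x
  proof (rule ccontr)
    assume no: "\<not> (\<exists>c\<in>M. cube x (R x / 20) \<inter> cube c (R c / 20) \<noteq> {})"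
    have xx: "x \<in> cube x (R x / 20)" by (rule center_in_cube) (simp add: R_nonneg)
    have "separated (insert x M)"
      using M(1) no x by (auto simp: separated_def disjoint_family_on_def)
    then have "x \<in> M" using M(2)[of "insert x M"] by blast
    then show False using no xx by blast
  qed
  then show ?thesis using M(1) by blast
qed

text \<open>The open cube with centre \<open>c\<close> and radius \<open>R c\<close> is convex and lies in \<open>\<Omega>\<close>; a segment from \<open>a\<close>, on its
  surface, into its interior leaves the surface at once.\<close>

lemma nearest_visible:
  assumes c: "c \<in> \<Omega>" and a: "a \<in> frontier \<Omega>" "infnorm (c - a) = R c" and Q: "infnorm (z - c) + s < R c"
  shows "visible \<Omega> (cube z s) a"
  unfolding visible_def
proof (intro conjI ballI subsetI)
  show "a \<in> closure \<Omega>" using a(1) by (simp add: frontier_def)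
  fix y w assume y: "y \<in> cube z s" and w: "w \<in> insert y (open_segment a y)"
  have yc: "infnorm (y - c) < R c" using y Q infnorm_triangle_diff[of y c z] by (simp add: mem_cube)
  obtain u where u: "0 < u" "u \<le> 1" "w = (1 - u) *\<^sub>R a + u *\<^sub>R y"
  proof (cases "w = y")
    case True
    then show ?thesis using that[of 1] by simp
  next
    case False
    then have "w \<in> open_segment a y" using w by simp
    then obtain u where "0 < u" "u < 1" "w = (1 - u) *\<^sub>R a + u *\<^sub>R y" by (auto simp: in_segment)
    then show ?thesis using that[of u] by simp
  qed
  have "w - c = (1 - u) *\<^sub>R (a - c) + u *\<^sub>R (y - c)" by (simp add: u(3) algebra_simps)
  then have "infnorm (w - c) \<le> (1 - u) * infnorm (a - c) + u * infnorm (y - c)"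
    using u infnorm_triangle[of "(1 - u) *\<^sub>R (a - c)" "u *\<^sub>R (y - c)"] by (simp add: infnorm_mul)
  also have "\<dots> < (1 - u) * R c + u * R c"
    using u yc a(2) infnorm_sub[of a c] by (intro add_le_less_mono mult_strict_left_mono) auto
  also have "\<dots> = R c" by (simp add: algebra_simps)
  finally show "w \<in> \<Omega>" by (rule open_cube_subset[OF c])
qed

end

text \<open>The values \<open>val\<close> at the centres are to be interpolated. The radius \<open>R c / 20\<close> is so small that by
  maximality bumps of radius \<open>R c / 9\<close>, far from the boundary, cover \<open>\<Omega>\<close>; yet the \<open>41\<close>-fold dilation of
  the cube around a centre contains the points of the boundary nearest to its neighbours.\<close>

locale net = proper_domain \<Omega> for \<Omega> :: "(real ^ 'n) set" +
  fixes I :: "(real ^ 'n) set" and val :: "real ^ 'n \<Rightarrow> real"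
  assumes sep: "separated I"
    and maximal: "\<And>x. x \<in> \<Omega> \<Longrightarrow> \<exists>c\<in>I. cube x (R x / 20) \<inter> cube c (R c / 20) \<noteq> {}"
begin

lemma I_\<Omega>: "c \<in> I \<Longrightarrow> c \<in> \<Omega>"
  using sep by (auto simp: separated_def)

lemma I_pos: "c \<in> I \<Longrightarrow> R c > 0"
  using I_\<Omega> R_pos by blast

text \<open>The constant \<open>2 / 19\<close> is the solution of \<open>t = (1 + t) / 20 + 1 / 20\<close>.\<close>

lemma cover:
  assumes "x \<in> \<Omega>"
  obtains c where "c \<in> I" "infnorm (x - c) \<le> 2 / 19 * R c"
proof -
  obtain c z where c: "c \<in> I" "z \<in> cube x (R x / 20)" "z \<in> cube c (R c / 20)" using maximal[OF assms] by blast
  then have "infnorm (x - c) \<le> R x / 20 + R c / 20"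
    using infnorm_triangle_diff[of x c z] infnorm_sub[of x z] by (simp add: mem_cube)
  moreover have "R x \<le> R c + infnorm (x - c)" using R_Lipschitz[of x c] by (simp add: abs_le_iff)
  ultimately have "infnorm (x - c) \<le> 2 / 19 * R c" by simp
  then show ?thesis using that c(1) by blast
qed

text \<open>These are the centres whose bumps may differ from zero at \<open>x\<close>. The radius \<open>R c / 9\<close> exceeds the
  \<open>2 / 19 * R c\<close> of \<open>cover\<close>, so there is always one that is not small.\<close>

definition idx :: "real ^ 'n \<Rightarrow> (real ^ 'n) set" where
  "idx x = {c \<in> I. infnorm (x - c) \<le> R c / 9}"

text \<open>A slightly larger set, which contains \<open>idx y\<close> for all \<open>y\<close> in a neighbourhood of \<open>x\<close>, see \<open>idx_patch\<close>.
  The bumps around it represent the extension in that whole neighbourhood.\<close>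

definition near :: "real ^ 'n \<Rightarrow> (real ^ 'n) set" where
  "near x = {c \<in> I. infnorm (x - c) \<le> R c / 8}"

text \<open>The centres whose bumps overlap with that of \<open>j\<close>.\<close>

definition nbrs :: "real ^ 'n \<Rightarrow> (real ^ 'n) set" where
  "nbrs j = {c \<in> I. \<exists>z. infnorm (z - j) \<le> R j / 9 \<and> infnorm (z - c) \<le> R c / 9}"

lemma idx_near: "idx x \<subseteq> near x"
  using I_pos by (fastforce simp: idx_def near_def)

lemma near_R:
  assumes "infnorm (x - c) \<le> R c / 8"
  shows "R x \<le> 9 / 8 * R c" "7 / 8 * R c \<le> R x"
  using R_Lipschitz[of x c] assms by (auto simp: abs_le_iff)

text \<open>The volume bound holds for all finite subsets of \<open>J\<close>, which makes \<open>J\<close> itself finite.\<close>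

lemma crowd:
  assumes J: "J \<subseteq> I" and a: "a > 0" "\<And>c. c \<in> J \<Longrightarrow> a \<le> R c / 20"
    and b: "b \<ge> 0" "\<And>c. c \<in> J \<Longrightarrow> infnorm (c - z) + R c / 20 \<le> b" and M: "b / a \<le> real M"
  shows "finite J \<and> card J \<le> M ^ CARD('n)"
proof (rule finite_if_finite_subsets_card_bdd)
  fix G assume G: "G \<subseteq> J" "finite G"
  have "real (card G) \<le> (b / a) ^ CARD('n)"
  proof (rule card_disjoint_cubes_le[where c = "\<lambda>c. c" and r = "\<lambda>c. R c / 20" and z = z])
    show "disjoint_family_on (\<lambda>c. cube c (R c / 20)) G"
      by (rule disjoint_family_on_mono[OF subset_trans[OF G(1) J]]) (use sep in \<open>simp add: separated_def\<close>)
    fix c assume "c \<in> G"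
    then have c: "c \<in> J" using G by blast
    show "a \<le> R c / 20" by (rule a(2)[OF c])
    show "cube c (R c / 20) \<subseteq> cube z b"
    proof
      fix y assume "y \<in> cube c (R c / 20)"
      then show "y \<in> cube z b"
        using b(2)[OF c] infnorm_triangle_diff[of y z c] by (simp add: mem_cube)
    qed
  qed (use G a b in auto)
  also have "\<dots> \<le> real M ^ CARD('n)" using M a b by (intro power_mono) auto
  finally show "card G \<le> M ^ CARD('n)" by (metis of_nat_le_iff of_nat_power)
qed

text \<open>All centres near \<open>x\<close> have \<open>8 / 9 * R x \<le> R c \<le> 8 / 7 * R x\<close>. Hence their cubes have radius at least
  \<open>2 / 45 * R x\<close> and lie in \<open>cube x (R x / 5)\<close>, because \<open>1 / 8 + 1 / 20 = 7 / 40\<close>.\<close>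

lemma near_card:
  assumes x: "x \<in> \<Omega>"
  shows "finite (near x)" "card (near x) \<le> 5 ^ CARD('n)"
proof -
  have "finite (near x) \<and> card (near x) \<le> 5 ^ CARD('n)"
  proof (rule crowd[where a = "2 / 45 * R x" and b = "R x / 5" and z = x])
    show "near x \<subseteq> I" by (auto simp: near_def)
    show "2 / 45 * R x > 0" "R x / 5 \<ge> 0" "(R x / 5) / (2 / 45 * R x) \<le> real 5" using R_pos[OF x] by auto
    fix c assume "c \<in> near x"
    then have c: "infnorm (x - c) \<le> R c / 8" by (simp add: near_def)
    show "2 / 45 * R x \<le> R c / 20" using near_R[OF c] by simp
    show "infnorm (c - x) + R c / 20 \<le> R x / 5" using near_R[OF c] c infnorm_sub[of c x] by simp
  qed
  then show "finite (near x)" "card (near x) \<le> 5 ^ CARD('n)" by auto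
qed

lemma nbrs_close:
  assumes j: "j \<in> I" and c: "c \<in> nbrs j"
  shows "R c \<le> 5 / 4 * R j" "4 / 5 * R j \<le> R c" "infnorm (c - j) \<le> R j / 4"
proof -
  obtain z where z: "infnorm (z - j) \<le> R j / 9" "infnorm (z - c) \<le> R c / 9" using c by (auto simp: nbrs_def)
  have le: "infnorm (c - j) \<le> R c / 9 + R j / 9"
    using z infnorm_triangle_diff[of c j z] infnorm_sub[of c z] by simp
  then show "R c \<le> 5 / 4 * R j" "4 / 5 * R j \<le> R c" using R_Lipschitz[of c j] by (auto simp: abs_le_iff)
  then show "infnorm (c - j) \<le> R j / 4" using le by simp
qed

text \<open>The constant \<open>5 / 16\<close> is \<open>1 / 4 + (5 / 4) / 20\<close>, by \<open>nbrs_close\<close>.\<close>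

lemma nbrs_finite:
  assumes j: "j \<in> I"
  shows "finite (nbrs j)"
proof -
  have "finite (nbrs j) \<and> card (nbrs j) \<le> 8 ^ CARD('n)"
  proof (rule crowd[where a = "R j / 25" and b = "5 / 16 * R j" and z = j])
    show "nbrs j \<subseteq> I" by (auto simp: nbrs_def)
    show "R j / 25 > 0" "5 / 16 * R j \<ge> 0" "(5 / 16 * R j) / (R j / 25) \<le> real 8" using I_pos[OF j] by auto
    fix c assume c: "c \<in> nbrs j"
    show "R j / 25 \<le> R c / 20" using nbrs_close[OF j c] by simp
    show "infnorm (c - j) + R c / 20 \<le> 5 / 16 * R j" using nbrs_close[OF j c] by simp
  qed
  then show ?thesis by simp
qed

definition \<psi> :: "real ^ 'n \<Rightarrow> real ^ 'n \<Rightarrow> real" where "\<psi> c = bump c (R c / 9)"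

lemma \<psi>_bounds: "0 \<le> \<psi> c x" "\<psi> c x \<le> 1"
  by (auto simp: \<psi>_def bump_nonneg bump_le_1)

lemma \<psi>_smooth: "smooth (\<psi> c)"
  by (simp add: \<psi>_def smooth_bump)

lemma \<psi>_eq_0: "c \<in> I \<Longrightarrow> c \<notin> idx x \<Longrightarrow> \<psi> c x = 0"
  using I_pos[of c] by (auto simp: idx_def \<psi>_def intro!: bump_eq_0)

lemma partial_deriv_\<psi>_eq_0:
  assumes "c \<in> I" "c \<notin> idx x"
  shows "partial_deriv i (\<psi> c) x = 0"
proof -
  have "infnorm ((1 / (R c / 9)) *\<^sub>R (x - c)) > 1"
    unfolding infnorm_mul using assms I_pos[OF assms(1)] by (simp add: idx_def field_simps)
  from bump_partial_deriv_eq_0[OF this, of i] have "partial_deriv i (bump 0 1) ((1 / (R c / 9)) *\<^sub>R (x - c)) / (R c / 9) = 0"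
    by (simp only: div_0)
  moreover have nz: "R c / 9 \<noteq> 0" using I_pos[OF assms(1)] by simp
  ultimately show ?thesis unfolding \<psi>_def partial_deriv_bump[OF nz] by simp
qed

lemma partial_deriv_\<psi>_bound:
  assumes "c \<in> I"
  shows "\<bar>partial_deriv i (\<psi> c) x\<bar> \<le> 9 * bump_lip TYPE('n) / R c"
proof -
  have gen: "\<bar>q / (r / 9)\<bar> \<le> 9 * M / r" if "\<bar>q\<bar> \<le> M" "r > 0" for q r M :: real
  proof -
    have "\<bar>q / (r / 9)\<bar> = 9 * \<bar>q\<bar> / r" using that(2) by (simp add: abs_divide)
    also have "\<dots> \<le> 9 * M / r" using that by (intro divide_right_mono mult_left_mono) auto
    finally show ?thesis .
  qed
  have nz: "R c / 9 \<noteq> 0" using I_pos[OF assms] by simp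
  show ?thesis unfolding \<psi>_def partial_deriv_bump[OF nz] by (rule gen[OF bump_lip(2) I_pos[OF assms]])
qed

definition comb :: "(real ^ 'n) set \<Rightarrow> (real ^ 'n \<Rightarrow> real) \<Rightarrow> real ^ 'n \<Rightarrow> real" where
  "comb T k x = (\<Sum>c\<in>T. k c * \<psi> c x)"

definition ext :: "real ^ 'n \<Rightarrow> real" where
  "ext x = comb (idx x) val x / comb (idx x) (\<lambda>_. 1) x"

lemma comb_eq: "finite T \<Longrightarrow> idx x \<subseteq> T \<Longrightarrow> T \<subseteq> I \<Longrightarrow> comb (idx x) k x = comb T k x"
  unfolding comb_def by (intro sum.mono_neutral_left) (auto simp: \<psi>_eq_0)

lemma near_I: "near x \<subseteq> I"
  by (auto simp: near_def)

lemma idx_finite: "x \<in> \<Omega> \<Longrightarrow> finite (idx x)"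
  using idx_near near_card(1) finite_subset by blast

lemma comb_1_ge:
  assumes "x \<in> \<Omega>"
  shows "comb (idx x) (\<lambda>_. 1) x \<ge> net_low TYPE('n)"
proof -
  obtain c where c: "c \<in> I" "infnorm (x - c) \<le> 2 / 19 * R c" using cover[OF assms] .
  have Rc: "R c > 0" by (rule I_pos[OF c(1)])
  have "net_low TYPE('n) \<le> \<psi> c x"
    unfolding net_low_def \<psi>_def by (rule bump_lower) (use c Rc in auto)
  also have "\<dots> \<le> (\<Sum>c\<in>idx x. \<psi> c x)"
    by (rule member_le_sum) (use c Rc idx_finite[OF assms] in \<open>auto simp: idx_def \<psi>_bounds\<close>)
  finally show ?thesis by (simp add: comb_def)
qed

text \<open>At each point the extension is a weighted mean of the values at the centres in \<open>idx x\<close>.\<close>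

lemma ext_close:
  assumes x: "x \<in> \<Omega>" and e: "\<And>c. c \<in> idx x \<Longrightarrow> \<bar>val c - t\<bar> \<le> e"
  shows "\<bar>ext x - t\<bar> \<le> e"
proof -
  let ?S = "comb (idx x) (\<lambda>_. 1) x"
  have S: "?S > 0" using comb_1_ge[OF x] net_low_pos[of "TYPE('n)"] by linarith
  have "comb (idx x) val x - t * ?S = (\<Sum>c\<in>idx x. (val c - t) * \<psi> c x)"
    by (simp add: comb_def sum_distrib_left sum_subtractf[symmetric] left_diff_distrib)
  also have "\<bar>\<dots>\<bar> \<le> (\<Sum>c\<in>idx x. e * \<psi> c x)"
    using e by (intro order_trans[OF sum_abs] sum_mono) (auto simp: abs_mult \<psi>_bounds intro!: mult_right_mono)
  also have "\<dots> = e * ?S" by (simp add: comb_def sum_distrib_left)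
  finally have "\<bar>comb (idx x) val x - t * ?S\<bar> / ?S \<le> e" using S by (simp add: pos_divide_le_eq)
  moreover have "ext x - t = (comb (idx x) val x - t * ?S) / ?S" using S by (simp add: ext_def diff_divide_distrib)
  ultimately show ?thesis using S by (simp add: abs_divide)
qed

text \<open>If \<open>c\<close> is in \<open>idx y\<close> for some \<open>y\<close> of this set, then \<open>99 / 100 * R x \<le> 10 / 9 * R c\<close>, whence
  \<open>R x / 100 \<le> R c / 72\<close>; and \<open>1 / 72 = 1 / 8 - 1 / 9\<close>. This gives \<open>idx_patch\<close>.\<close>

definition patch :: "real ^ 'n \<Rightarrow> (real ^ 'n) set" where
  "patch x = {y. infnorm (y - x) < R x / 100}"

lemma open_patch: "open (patch x)"
  unfolding patch_def by (intro open_Collect_less continuous_intros)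

lemma patch_\<Omega>: "x \<in> \<Omega> \<Longrightarrow> patch x \<subseteq> \<Omega>" "x \<in> \<Omega> \<Longrightarrow> x \<in> patch x"
  using R_pos[of x] open_cube_subset[of x] by (auto simp: patch_def infnorm_0)

lemma idx_patch:
  assumes x: "x \<in> \<Omega>" and y: "y \<in> patch x"
  shows "idx y \<subseteq> near x"
proof
  fix c assume c: "c \<in> idx y"
  have yx: "infnorm (y - x) < R x / 100" using y by (simp add: patch_def)
  have yc: "infnorm (y - c) \<le> R c / 9" "c \<in> I" using c by (auto simp: idx_def)
  have "R x \<le> R c + (infnorm (y - c) + infnorm (y - x))"
    using R_Lipschitz[of x c] infnorm_triangle_diff[of x c y] infnorm_sub[of x y] by (simp add: abs_le_iff)
  then have "R x / 100 \<le> R c / 72" using yc yx I_pos[OF yc(2)] by simp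
  moreover have "infnorm (x - c) \<le> infnorm (y - x) + infnorm (y - c)"
    using infnorm_triangle_diff[of x c y] infnorm_sub[of x y] by simp
  ultimately have "infnorm (x - c) \<le> R c / 8" using yx yc by simp
  then show "c \<in> near x" using yc by (simp add: near_def)
qed

lemma comb_smooth: "finite T \<Longrightarrow> smooth (comb T k)"
  unfolding comb_def[abs_def]
  by (induction T rule: finite_induct) (auto intro!: smooth_const smooth_add smooth_mult \<psi>_smooth)

text \<open>On a patch the sets \<open>idx y\<close>, which vary with \<open>y\<close>, can all be replaced by \<open>near x\<close>.\<close>

lemma ext_derivative:
  assumes x: "x \<in> \<Omega>" and y: "y \<in> patch x"
  shows "ext differentiable (at y)"
    "partial_deriv i ext y = (partial_deriv i (comb (near x) val) y * comb (near x) (\<lambda>_. 1) y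
      - comb (near x) val y * partial_deriv i (comb (near x) (\<lambda>_. 1)) y)
      / (comb (near x) (\<lambda>_. 1) y * comb (near x) (\<lambda>_. 1) y)"
proof -
  let ?a = "comb (near x) val" and ?s = "comb (near x) (\<lambda>_. 1)"
  have local: "comb (idx z) k z = comb (near x) k z" if "z \<in> patch x" for z k
    by (rule comb_eq[OF near_card(1)[OF x] idx_patch[OF x that] near_I])
  have s0: "?s z \<noteq> 0" if "z \<in> patch x" for z
    using comb_1_ge[of z] net_low_pos[of "TYPE('n)"] local[OF that] patch_\<Omega>(1)[OF x] that by fastforce
  have da: "(?a has_derivative frechet_derivative ?a (at y)) (at y)"
    and ds: "(?s has_derivative frechet_derivative ?s (at y)) (at y)"
    using smooth_differentiable[OF comb_smooth[OF near_card(1)[OF x]]] by (simp_all add: frechet_derivative_works[symmetric])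
  have "((\<lambda>z. ?a z / ?s z) has_derivative (\<lambda>h. (frechet_derivative ?a (at y) h * ?s y - ?a y * frechet_derivative ?s (at y) h) / (?s y * ?s y))) (at y)"
    by (rule has_derivative_divide'[OF da ds s0[OF y]])
  then have "(ext has_derivative (\<lambda>h. (frechet_derivative ?a (at y) h * ?s y - ?a y * frechet_derivative ?s (at y) h) / (?s y * ?s y))) (at y)"
    by (rule has_derivative_transform_within_open[OF _ open_patch y]) (simp add: ext_def local)
  from this partial_deriv_eq[OF this, of i]
  show "ext differentiable (at y)"
    "partial_deriv i ext y = (partial_deriv i ?a y * ?s y - ?a y * partial_deriv i ?s y) / (?s y * ?s y)"
    by (auto simp: differentiable_def partial_deriv_def)
qed

lemma ext_C1: "continuous_on \<Omega> (partial_deriv i ext)"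
proof (rule continuous_at_imp_continuous_on, rule ballI)
  fix x assume x: "x \<in> \<Omega>"
  let ?a = "comb (near x) val" and ?s = "comb (near x) (\<lambda>_. 1)"
  note fin = near_card(1)[OF x]
  have s0: "?s z \<noteq> 0" if "z \<in> patch x" for z
    using comb_1_ge[of z] net_low_pos[of "TYPE('n)"] comb_eq[OF fin idx_patch[OF x that] near_I, of "\<lambda>_. 1"]
      patch_\<Omega>(1)[OF x] that by fastforce
  have "continuous_on (patch x) (\<lambda>y. (partial_deriv i ?a y * ?s y - ?a y * partial_deriv i ?s y) / (?s y * ?s y))"
    using s0 by (intro continuous_on_divide continuous_on_diff continuous_on_mult smooth_continuous
        smooth_partial_deriv comb_smooth fin) auto
  then have "continuous_on (patch x) (partial_deriv i ext)"
    using ext_derivative(2)[OF x] by (subst continuous_on_cong[OF refl]) auto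
  then show "isCont (partial_deriv i ext) x"
    using open_patch patch_\<Omega>(2)[OF x] continuous_on_eq_continuous_at by blast
qed

lemma ext_weak_gradient: "weak_gradient \<Omega> ext (\<lambda>x. \<chi> i. partial_deriv i ext x)"
  by (rule weak_gradient_C1[OF op ext_derivative(1) ext_C1]) (use patch_\<Omega> in blast)+

lemma ext_continuous: "continuous_on \<Omega> ext"
  using ext_derivative(1)[OF _ patch_\<Omega>(2)]
  by (simp add: continuous_at_imp_continuous_on differentiable_imp_continuous_within)

text \<open>Since the bumps are divided by their sum, subtracting the constant \<open>val j\<close> leaves the gradient
  unchanged; only differences of values at neighbouring centres enter.\<close>

lemma ext_gradient_bound:
  assumes j: "j \<in> I" and x: "infnorm (x - j) \<le> 2 / 19 * R j"
    and m: "\<And>c. c \<in> nbrs j \<Longrightarrow> \<bar>val c - val j\<bar> \<le> m"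
  shows "\<bar>partial_deriv i ext x\<bar> \<le> grad_const TYPE('n) * m / R j"
proof -
  let ?n = "CARD('n)" and ?M = "bump_lip TYPE('n)"
  have Rj: "R j > 0" by (rule I_pos[OF j])
  have x\<Omega>: "x \<in> \<Omega>" using x Rj by (intro open_cube_subset[OF I_\<Omega>[OF j]]) simp
  let ?T = "near x"
  note fin = near_card(1)[OF x\<Omega>]
  let ?a = "comb ?T val" and ?s = "comb ?T (\<lambda>_. 1)" and ?b = "comb ?T (\<lambda>c. val c - val j)"
  have jn: "j \<in> nbrs j" using x Rj j by (auto simp: nbrs_def intro!: exI[of _ x])
  have m0: "m \<ge> 0" using m[OF jn] by simp
  have T: "(c \<in> idx x \<and> \<bar>val c - val j\<bar> \<le> m \<and> 4 / 5 * R j \<le> R c) \<or> (\<psi> c x = 0 \<and> partial_deriv i (\<psi> c) x = 0)"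
    if c: "c \<in> ?T" for c
  proof (cases "c \<in> idx x")
    case True
    then have "c \<in> nbrs j" using x Rj by (auto simp: nbrs_def idx_def intro!: exI[of _ x])
    then show ?thesis using True m nbrs_close(2)[OF j] by blast
  next
    case False
    then show ?thesis using \<psi>_eq_0 partial_deriv_\<psi>_eq_0 c near_I by blast
  qed
  have card: "real (card ?T) \<le> 5 ^ ?n" using near_card(2)[OF x\<Omega>] by (metis of_nat_le_iff of_nat_numeral of_nat_power)
  have M0: "?M \<ge> 0" by (rule bump_lip)
  \<comment> \<open>The factor is \<open>9 / (4 / 5) \<le> 12\<close>.\<close>
  have d\<psi>: "\<bar>partial_deriv i (\<psi> c) x\<bar> \<le> 12 * ?M / R j" if c: "c \<in> ?T" for c
  proof (cases "c \<in> idx x")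
    case True
    have cI: "c \<in> I" using c near_I by blast
    have "c \<in> nbrs j" using True x Rj by (auto simp: nbrs_def idx_def intro!: exI[of _ x])
    then have "4 / 5 * R j \<le> R c" using nbrs_close(2)[OF j] by blast
    then have "9 * ?M / R c \<le> 9 * ?M / (4 / 5 * R j)" using Rj M0 by (intro divide_left_mono mult_pos_pos I_pos[OF cI]) auto
    also have "\<dots> \<le> 12 * ?M / R j" using Rj M0 by (simp add: field_simps)
    finally show ?thesis using partial_deriv_\<psi>_bound[OF cI, of i x] by linarith
  next
    case False
    have "c \<in> I" using c near_I by blast
    from partial_deriv_\<psi>_eq_0[OF this False, of i] show ?thesis using Rj M0 by simp
  qed
  have pd: "partial_deriv i (comb ?T k) x = (\<Sum>c\<in>?T. k c * partial_deriv i (\<psi> c) x)" for k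
    unfolding comb_def[abs_def] by (rule partial_deriv_linear_combination) (rule smooth_differentiable[OF \<psi>_smooth])
  have sum_le: "\<bar>\<Sum>c\<in>?T. h c\<bar> \<le> 5 ^ ?n * B" if "\<And>c. c \<in> near x \<Longrightarrow> \<bar>h c\<bar> \<le> B" "B \<ge> 0" for h :: "real ^ 'n \<Rightarrow> real" and B :: real
  proof -
    have "\<bar>\<Sum>c\<in>?T. h c\<bar> \<le> (\<Sum>c\<in>?T. B)" by (rule order_trans[OF sum_abs], rule sum_mono, rule that(1))
    also have "\<dots> = card ?T * B" by simp
    also have "\<dots> \<le> 5 ^ ?n * B" using card that(2) by (intro mult_right_mono)
    finally show ?thesis .
  qed
  have b1: "\<bar>?b x\<bar> \<le> 5 ^ ?n * m" unfolding comb_def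
  proof (rule sum_le[OF _ m0])
    fix c assume c: "c \<in> ?T"
    show "\<bar>(val c - val j) * \<psi> c x\<bar> \<le> m"
      using T[OF c] m0 \<psi>_bounds[of c x] mult_mono[of "\<bar>val c - val j\<bar>" m "\<psi> c x" 1] by (auto simp: abs_mult)
  qed
  have b2: "\<bar>partial_deriv i ?b x\<bar> \<le> 5 ^ ?n * (m * (12 * ?M / R j))" unfolding pd
  proof (rule sum_le)
    fix c assume c: "c \<in> ?T"
    show "\<bar>(val c - val j) * partial_deriv i (\<psi> c) x\<bar> \<le> m * (12 * ?M / R j)"
      using T[OF c] m0 d\<psi>[OF c] M0 Rj mult_mono[of "\<bar>val c - val j\<bar>" m "\<bar>partial_deriv i (\<psi> c) x\<bar>" "12 * ?M / R j"]
      by (auto simp: abs_mult)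
  qed (use m0 M0 Rj in auto)
  have s1: "\<bar>?s x\<bar> \<le> 5 ^ ?n" using sum_le[where h = "\<lambda>c. \<psi> c x" and B = 1] \<psi>_bounds by (simp add: comb_def)
  have s2: "\<bar>partial_deriv i ?s x\<bar> \<le> 5 ^ ?n * (12 * ?M / R j)"
    unfolding pd by (rule sum_le) (use d\<psi> M0 Rj in auto)
  have low: "net_low TYPE('n) \<le> ?s x"
    using comb_1_ge[OF x\<Omega>] comb_eq[OF fin idx_near near_I, of "\<lambda>_. 1"] by simp
  have a_eq: "?a x = ?b x + val j * ?s x"
    by (simp add: comb_def sum_distrib_left sum.distrib[symmetric] left_diff_distrib)
  have da_eq: "partial_deriv i ?a x = partial_deriv i ?b x + val j * partial_deriv i ?s x"
    unfolding pd by (simp add: sum_distrib_left sum.distrib[symmetric] left_diff_distrib)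
  have "partial_deriv i ext x = (partial_deriv i ?b x * ?s x - ?b x * partial_deriv i ?s x) / (?s x * ?s x)"
    unfolding ext_derivative(2)[OF x\<Omega> patch_\<Omega>(2)[OF x\<Omega>]] a_eq da_eq by (simp add: algebra_simps)
  then have "\<bar>partial_deriv i ext x\<bar> = \<bar>partial_deriv i ?b x * ?s x - ?b x * partial_deriv i ?s x\<bar> / (?s x * ?s x)"
    by (simp add: abs_divide abs_mult)
  also have "\<dots> \<le> (2 * (25 ^ ?n * (m * (12 * ?M / R j)))) / (net_low TYPE('n) * net_low TYPE('n))"
  proof (rule frac_le)
    have "\<bar>partial_deriv i ?b x * ?s x\<bar> \<le> (5 ^ ?n * (m * (12 * ?M / R j))) * 5 ^ ?n"
      unfolding abs_mult using b2 s1 m0 M0 Rj by (intro mult_mono) auto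
    moreover have "\<bar>?b x * partial_deriv i ?s x\<bar> \<le> (5 ^ ?n * m) * (5 ^ ?n * (12 * ?M / R j))"
      unfolding abs_mult using b1 s2 m0 M0 Rj by (intro mult_mono) auto
    moreover have "(u * (v * t)) * u = q * (v * t)" "(u * v) * (u * t) = q * (v * t)" if "u * u = q" for u v t q :: real
      unfolding that[symmetric] by (simp_all add: mult_ac)
    from this[of "5 ^ ?n" "25 ^ ?n" m "12 * ?M / R j"]
    have "(5 ^ ?n * (m * (12 * ?M / R j))) * 5 ^ ?n = 25 ^ ?n * (m * (12 * ?M / R j))"
      "(5 ^ ?n * m) * (5 ^ ?n * (12 * ?M / R j)) = 25 ^ ?n * (m * (12 * ?M / R j))"
      by (simp_all add: power_mult_distrib[symmetric])
    ultimately show "\<bar>partial_deriv i ?b x * ?s x - ?b x * partial_deriv i ?s x\<bar> \<le> 2 * (25 ^ ?n * (m * (12 * ?M / R j)))"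
      by linarith
    show "net_low TYPE('n) * net_low TYPE('n) \<le> ?s x * ?s x"
      using low net_low_pos[of "TYPE('n)"] by (intro mult_mono) auto
  qed (use m0 M0 Rj net_low_pos[of "TYPE('n)"] in auto)
  also have "\<dots> = grad_const TYPE('n) * m / R j" by (simp add: grad_const_def mult_ac)
  finally show ?thesis .
qed

text \<open>Each centre is near some point of a countable dense set, and only finitely many centres are near the
  same point.\<close>

lemma I_countable: "countable I"
proof -
  obtain D :: "(real ^ 'n) set" where D: "countable D" "\<And>X. open X \<Longrightarrow> X \<noteq> {} \<Longrightarrow> \<exists>d\<in>D. d \<in> X"
    using countable_dense_exists by metis
  have "I \<subseteq> (\<Union>q\<in>D \<inter> \<Omega>. near q)"
  proof
    fix c assume c: "c \<in> I"
    let ?X = "{y. infnorm (y - c) < R c / 8}"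
    have "open ?X" by (intro open_Collect_less continuous_intros)
    moreover have "c \<in> ?X" using I_pos[OF c] by (simp add: infnorm_0)
    ultimately obtain q where q: "q \<in> D" "infnorm (q - c) < R c / 8" using D(2)[of ?X] by blast
    then have "q \<in> \<Omega>" using I_pos[OF c] by (intro open_cube_subset[OF I_\<Omega>[OF c]]) auto
    then show "c \<in> (\<Union>q\<in>D \<inter> \<Omega>. near q)" using q c by (intro UN_I[of q]) (auto simp: near_def)
  qed
  moreover have "countable (\<Union>q\<in>D \<inter> \<Omega>. near q)"
    using D(1) near_card(1) by (intro countable_UN) (auto intro: countable_finite)
  ultimately show ?thesis by (rule countable_subset)
qed

text \<open>The cubes of \<open>cover\<close> exhaust \<open>\<Omega>\<close>, and on each of them the gradient has a uniform bound. The volume of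
  the cube around \<open>j\<close> is at most \<open>R j ^ n\<close>, which leaves \<open>R j powr (p - n)\<close> in the denominator.\<close>

lemma ext_energy:
  assumes p: "real CARD('n) < p"
    and m: "\<And>j c. j \<in> I \<Longrightarrow> c \<in> nbrs j \<Longrightarrow> \<bar>val c - val j\<bar> \<le> m j"
    and L: "\<And>J. finite J \<Longrightarrow> J \<subseteq> I \<Longrightarrow> (\<Sum>j\<in>J. m j powr p / (R j / 10) powr (p - real CARD('n))) \<le> L"
  shows "set_integrable lebesgue \<Omega> (\<lambda>x. infnorm (\<chi> i. partial_deriv i ext x) powr p)"
    "(LINT x:\<Omega>|lebesgue. infnorm (\<chi> i. partial_deriv i ext x) powr p) \<le> grad_const TYPE('n) powr p * L"
proof -
  let ?n = "real CARD('n)" and ?K = "grad_const TYPE('n)"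
  have K0: "?K \<ge> 0" by (rule grad_const_nonneg)
  have L0: "L \<ge> 0" using L[of "{}"] by simp
  have p0: "p > 0" using p by (meson of_nat_0_le_iff order.strict_trans1)
  define g where "g x = indicator \<Omega> x *\<^sub>R (infnorm (\<chi> i. partial_deriv i ext x) powr p)" for x
  have g0: "g x \<ge> 0" for x by (simp add: g_def)
  have "continuous_on \<Omega> (\<lambda>x. infnorm (\<chi> i. partial_deriv i ext x) powr p)"
    using p0 by (intro continuous_on_powr' continuous_on_infnorm continuous_on_vec_lambda ext_C1 continuous_on_const)
      (auto simp: infnorm_pos_le)
  then have gm: "g \<in> borel_measurable lebesgue"
    unfolding g_def[abs_def] by (rule borel_measurable_indicator_mult_continuous[OF op])
  define \<mu> where "\<mu> = density lebesgue (\<lambda>x. ennreal (g x))"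
  define Q where "Q j = cube j (2 / 19 * R j)" for j
  have Qm: "Q j \<in> sets lebesgue" for j by (simp add: Q_def sets_lebesgue_compact compact_cube)
  have m0: "m j \<ge> 0" if "j \<in> I" for j
  proof -
    have "j \<in> nbrs j" using that I_pos[OF that] by (auto simp: nbrs_def infnorm_0 intro!: exI[of _ j])
    then show ?thesis using m[OF that] by fastforce
  qed
  have piece: "emeasure \<mu> (Q j) \<le> ennreal (?K powr p * (m j powr p / (R j / 10) powr (p - ?n)))" if j: "j \<in> I" for j
  proof -
    have Rj: "R j > 0" by (rule I_pos[OF j])
    have "emeasure \<mu> (Q j) = (\<integral>\<^sup>+ x. ennreal (g x) * indicator (Q j) x \<partial>lebesgue)"
      unfolding \<mu>_def using gm Qm by (intro emeasure_density) auto
    also have "\<dots> \<le> (\<integral>\<^sup>+ x. ennreal ((?K * m j / R j) powr p) * indicator (Q j) x \<partial>lebesgue)"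
    proof (rule nn_integral_mono)
      fix x
      show "ennreal (g x) * indicator (Q j) x \<le> ennreal ((?K * m j / R j) powr p) * indicator (Q j) x"
      proof (cases "x \<in> Q j")
        case True
        then have "infnorm (\<chi> i. partial_deriv i ext x) \<le> ?K * m j / R j"
          unfolding infnorm_le_iff using ext_gradient_bound[OF j _ m[OF j]] by (auto simp: Q_def mem_cube)
        then have "g x \<le> (?K * m j / R j) powr p"
          using p0 by (auto simp: g_def indicator_def intro!: powr_mono2 infnorm_pos_le)
        then show ?thesis using True by (simp add: ennreal_leI)
      qed simp
    qed
    also have "\<dots> = ennreal ((?K * m j / R j) powr p) * emeasure lebesgue (Q j)"
      using Qm by (simp add: nn_integral_cmult_indicator)
    also have "emeasure lebesgue (Q j) = ennreal ((4 / 19 * R j) ^ CARD('n))"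
    proof -
      have "emeasure lborel (Q j) = ennreal (measure lborel (Q j))"
        unfolding Q_def by (intro emeasure_eq_ennreal_measure) simp
      then show ?thesis using Rj measure_cube[of "2 / 19 * R j" j] by (simp add: Q_def)
    qed
    also have "ennreal ((?K * m j / R j) powr p) * ennreal ((4 / 19 * R j) ^ CARD('n))
        = ennreal ((?K * m j / R j) powr p * (4 / 19 * R j) ^ CARD('n))"
      by (simp add: ennreal_mult')
    also have "\<dots> \<le> ennreal (?K powr p * (m j powr p / (R j / 10) powr (p - ?n)))"
    proof (rule ennreal_leI)
      have "(4 / 19 * R j) ^ CARD('n) \<le> R j ^ CARD('n)" using Rj by (intro power_mono) auto
      then have "(?K * m j / R j) powr p * (4 / 19 * R j) ^ CARD('n) \<le> (?K * m j / R j) powr p * R j powr ?n"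
        using Rj by (intro mult_left_mono) (auto simp: powr_realpow)
      also have "\<dots> = ?K powr p * (m j powr p / R j powr (p - ?n))"
        unfolding powr_diff using Rj by (simp add: powr_divide powr_mult)
      also have "\<dots> \<le> ?K powr p * (m j powr p / (R j / 10) powr (p - ?n))"
        using Rj p by (intro mult_left_mono divide_left_mono powr_mono2 mult_pos_pos) auto
      finally show "(?K * m j / R j) powr p * (4 / 19 * R j) ^ CARD('n) \<le> ?K powr p * (m j powr p / (R j / 10) powr (p - ?n))" .
    qed
    finally show ?thesis .
  qed
  \<comment> \<open>An enumeration of the cubes, with empty sets at unused indices.\<close>
  define N where "N = to_nat_on I"
  have N: "inj_on N I" unfolding N_def using I_countable by (rule inj_on_to_nat_on)
  define Af where "Af k = (if k \<in> N ` I then Q (the_inv_into I N k) else {})" for k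
  have AfN: "Af (N j) = Q j" if "j \<in> I" for j using that N by (simp add: Af_def the_inv_into_f_f)
  have "\<Omega> \<subseteq> (\<Union>k. Af k)"
  proof
    fix x assume "x \<in> \<Omega>"
    then obtain c where "c \<in> I" "infnorm (x - c) \<le> 2 / 19 * R c" using cover by metis
    then have "x \<in> Af (N c)" by (simp add: AfN Q_def mem_cube)
    then show "x \<in> (\<Union>k. Af k)" by blast
  qed
  have Afm: "range Af \<subseteq> sets \<mu>" using Qm by (auto simp: Af_def \<mu>_def)
  have "emeasure \<mu> \<Omega> \<le> emeasure \<mu> (\<Union>k. Af k)"
    by (rule emeasure_mono) (use \<open>\<Omega> \<subseteq> (\<Union>k. Af k)\<close> Afm in auto)
  also have "\<dots> \<le> (\<Sum>k. emeasure \<mu> (Af k))" by (rule emeasure_subadditive_countably[OF Afm])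
  also have "\<dots> \<le> ennreal (?K powr p * L)"
  proof (rule suminf_le_const)
    fix n
    define J where "J = {j \<in> I. N j < n}"
    have "N ` J \<subseteq> {..<n}" "inj_on N J" using N by (auto simp: J_def inj_on_def)
    then have fJ: "finite J" using finite_imageD finite_subset by blast
    have "(\<Sum>k<n. emeasure \<mu> (Af k)) = (\<Sum>k\<in>N ` J. emeasure \<mu> (Af k))"
      by (intro sum.mono_neutral_right) (auto simp: J_def Af_def)
    also have "\<dots> = (\<Sum>j\<in>J. emeasure \<mu> (Af (N j)))" using \<open>inj_on N J\<close> by (simp add: sum.reindex)
    also have "\<dots> \<le> (\<Sum>j\<in>J. ennreal (?K powr p * (m j powr p / (R j / 10) powr (p - ?n))))"
      by (intro sum_mono) (use piece AfN in \<open>auto simp: J_def\<close>)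
    also have "\<dots> = ennreal (\<Sum>j\<in>J. ?K powr p * (m j powr p / (R j / 10) powr (p - ?n)))"
      by (intro sum_ennreal mult_nonneg_nonneg divide_nonneg_nonneg) auto
    also have "\<dots> \<le> ennreal (?K powr p * L)"
      unfolding sum_distrib_left[symmetric]
      by (intro ennreal_leI mult_left_mono L fJ) (auto simp: J_def)
    finally show "(\<Sum>k<n. emeasure \<mu> (Af k)) \<le> ennreal (?K powr p * L)" .
  qed simp
  finally have "emeasure \<mu> \<Omega> \<le> ennreal (?K powr p * L)" .
  moreover have "emeasure \<mu> \<Omega> = (\<integral>\<^sup>+ x. ennreal (g x) \<partial>lebesgue)"
  proof -
    have "emeasure \<mu> \<Omega> = (\<integral>\<^sup>+ x. ennreal (g x) * indicator \<Omega> x \<partial>lebesgue)"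
      unfolding \<mu>_def using gm op by (intro emeasure_density) (auto simp: sets_completionI_sets)
    also have "\<dots> = (\<integral>\<^sup>+ x. ennreal (g x) \<partial>lebesgue)"
      by (intro nn_integral_cong) (auto simp: g_def indicator_def)
    finally show ?thesis .
  qed
  ultimately have nn: "(\<integral>\<^sup>+ x. ennreal (g x) \<partial>lebesgue) \<le> ennreal (?K powr p * L)" by simp
  then have "(\<integral>\<^sup>+ x. ennreal (norm (g x)) \<partial>lebesgue) < \<infinity>"
    using g0 by (simp add: order.strict_trans1[OF _ ennreal_less_top])
  then have int: "integrable lebesgue g" using gm by (intro integrableI_bounded)
  then show "set_integrable lebesgue \<Omega> (\<lambda>x. infnorm (\<chi> i. partial_deriv i ext x) powr p)"
    unfolding set_integrable_def g_def[abs_def] .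
  have "(LINT x|lebesgue. g x) \<le> ?K powr p * L"
    using nn nn_integral_eq_integral[OF int] g0 L0 by (simp add: ennreal_le_iff)
  then show "(LINT x:\<Omega>|lebesgue. infnorm (\<chi> i. partial_deriv i ext x) powr p) \<le> ?K powr p * L"
    unfolding set_lebesgue_integral_def g_def[abs_def] .
qed

end

section \<open>The criterion\<close>

context trace_domain begin

text \<open>Each centre \<open>c\<close> receives the value of \<open>f\<close> at the class \<open>\<omega> c\<close> of a nearest boundary point \<open>a c\<close>. In the
  assumed inequality the cube around \<open>j\<close> is combined with \<open>a j\<close> and the nearest point of that neighbour of
  \<open>j\<close> for which the difference of the values is largest.\<close>

lemma extension:
  assumes dc: "d_continuous \<alpha> \<Omega> f" and vb: "visible_bound p \<alpha> \<eta> \<Omega> f L" and \<eta>: "\<eta> \<ge> 41"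
  obtains F G where "continuous_on \<Omega> F" "has_trace \<alpha> \<Omega> F f" "weak_gradient \<Omega> F G"
    "set_integrable lebesgue \<Omega> (\<lambda>x. infnorm (G x) powr p)"
    "(LINT x:\<Omega>|lebesgue. infnorm (G x) powr p) \<le> grad_const TYPE('n) powr p * L"
proof -
  obtain I where I: "separated I" "\<And>x. x \<in> \<Omega> \<Longrightarrow> \<exists>c\<in>I. cube x (R x / 20) \<inter> cube c (R c / 20) \<noteq> {}"
    using ex_maximal_separated by blast
  have "\<exists>a. a \<in> frontier \<Omega> \<and> infnorm (c - a) = R c" for c
    using R_attained[of c] by metis
  then obtain a where a: "\<And>c. a c \<in> frontier \<Omega>" "\<And>c. infnorm (c - a c) = R c" by metis
  have "\<exists>\<omega>. \<omega> \<in> alpha_boundary \<alpha> \<Omega> \<and> ell \<omega> = a c \<and> dyadic c (a c) \<in> \<omega>" if c: "c \<in> \<Omega>" for c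
  proof -
    have "visible \<Omega> (cube c (R c / 20)) (a c)"
      by (rule nearest_visible[OF c a]) (use R_pos[OF c] in \<open>simp add: infnorm_0\<close>)
    then show ?thesis using visible_class[of "R c / 20" c "a c"] R_pos[OF c] a(1) by (metis divide_pos_pos zero_less_numeral)
  qed
  then obtain \<omega> where \<omega>: "\<And>c. c \<in> \<Omega> \<Longrightarrow> \<omega> c \<in> alpha_boundary \<alpha> \<Omega> \<and> ell (\<omega> c) = a c \<and> dyadic c (a c) \<in> \<omega> c"
    by metis
  define val where "val c = f (\<omega> c)" for c
  interpret net \<Omega> I val by unfold_locales (use I in auto)
  have "\<exists>b. b \<in> nbrs j \<and> (\<forall>c\<in>nbrs j. \<bar>val c - val j\<bar> \<le> \<bar>val b - val j\<bar>)" if j: "j \<in> I" for j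
  proof -
    have "j \<in> nbrs j" using j I_pos[OF j] by (auto simp: nbrs_def infnorm_0 intro!: exI[of _ j])
    then have ne: "(\<lambda>c. \<bar>val c - val j\<bar>) ` nbrs j \<noteq> {}" by blast
    have fin: "finite ((\<lambda>c. \<bar>val c - val j\<bar>) ` nbrs j)" using nbrs_finite[OF j] by simp
    obtain b where b: "b \<in> nbrs j" "Max ((\<lambda>c. \<bar>val c - val j\<bar>) ` nbrs j) = \<bar>val b - val j\<bar>"
      using Max_in[OF fin ne] by auto
    have "\<bar>val c - val j\<bar> \<le> \<bar>val b - val j\<bar>" if "c \<in> nbrs j" for c
      using Max_ge[OF fin, of "\<bar>val c - val j\<bar>"] that b(2) by auto
    then show ?thesis using b(1) by blast
  qed
  then obtain nb where nb: "\<And>j. j \<in> I \<Longrightarrow> nb j \<in> nbrs j"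
      "\<And>j c. j \<in> I \<Longrightarrow> c \<in> nbrs j \<Longrightarrow> \<bar>val c - val j\<bar> \<le> \<bar>val (nb j) - val j\<bar>"
    by metis
  have sum_le: "(\<Sum>j\<in>J. \<bar>val (nb j) - val j\<bar> powr p / (R j / 10) powr (p - real CARD('n))) \<le> L"
    if J: "finite J" "J \<subseteq> I" for J
  proof -
    obtain h where h: "bij_betw h {1..card J} J" using ex_bij_betw_nat_finite_1[OF J(1)] by blast
    have hJ: "h i \<in> I" if "i \<in> {1..card J}" for i using h that J(2) by (auto simp: bij_betw_def)
    have "(\<Sum>i=1..card J. \<bar>f (\<omega> (nb (h i))) - f (\<omega> (h i))\<bar> powr p / udiam (cube (h i) (R (h i) / 20)) powr (p - real CARD('n))) \<le> L"
    proof (rule vb[unfolded visible_bound_def, rule_format, where c = h and r = "\<lambda>i. R (h i) / 20"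
          and x = "\<lambda>i. \<omega> (nb (h i))" and y = "\<lambda>i. \<omega> (h i)"], intro conjI ballI)
      fix i assume i: "i \<in> {1..card J}"
      note j = hJ[OF i]
      have pos: "R (h i) > 0" by (rule I_pos[OF j])
      show "0 < R (h i) / 20" using pos by simp
      show "cube (h i) (R (h i) / 20) \<subseteq> \<Omega>" using pos by (intro cube_subset I_\<Omega>[OF j]) simp
      fix \<omega>' assume "\<omega>' \<in> {\<omega> (nb (h i)), \<omega> (h i)}"
      moreover have "h i \<in> nbrs (h i)"
        using j pos by (auto simp: nbrs_def infnorm_0 intro!: exI[of _ "h i"])
      ultimately obtain c where c: "\<omega>' = \<omega> c" "c \<in> nbrs (h i)" using nb(1)[OF j] by blast
      have cI: "c \<in> I" using c(2) by (auto simp: nbrs_def)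
      note close = nbrs_close[OF j c(2)]
      note \<omega>c = \<omega>[OF I_\<Omega>[OF cI]]
      show "\<omega>' \<in> alpha_boundary \<alpha> \<Omega>" using \<omega>c c by simp
      \<comment> \<open>The nearest point of a neighbour is within \<open>5 / 4 + 1 / 4\<close> times the distance to the boundary.\<close>
      have "infnorm (a c - h i) \<le> R c + infnorm (c - h i)"
        using infnorm_triangle_diff[of "a c" "h i" c] a(2)[of c] infnorm_sub[of "a c" c] by simp
      also have "\<dots> \<le> 3 / 2 * R (h i)" using close by simp
      also have "\<dots> \<le> \<eta> * (R (h i) / 20)" using \<eta> pos by simp
      finally show "ell \<omega>' \<in> cube (h i) (\<eta> * (R (h i) / 20))" using \<omega>c c by (simp add: mem_cube)
      have "infnorm (h i - c) + R (h i) / 20 < R c" using close pos infnorm_sub[of c "h i"] by simp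
      then show "visible \<Omega> (cube (h i) (R (h i) / 20)) (ell \<omega>')"
        using nearest_visible[OF I_\<Omega>[OF cI] a] \<omega>c c by simp
    next
      show "disjoint_family_on (\<lambda>i. cube (h i) (R (h i) / 20)) {1..card J}"
        unfolding disjoint_family_on_def
      proof (intro ballI impI)
        fix i i' assume ii: "i \<in> {1..card J}" "i' \<in> {1..card J}" "i \<noteq> i'"
        have "h i \<noteq> h i'" using inj_on_eq_iff[OF bij_betw_imp_inj_on[OF h] ii(1,2)] ii(3) by simp
        moreover have "disjoint_family_on (\<lambda>c. cube c (R c / 20)) I" using sep by (simp add: separated_def)
        ultimately show "cube (h i) (R (h i) / 20) \<inter> cube (h i') (R (h i') / 20) = {}"
          using disjoint_family_onD[OF _ hJ[OF ii(1)] hJ[OF ii(2)]] by blast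
      qed
    qed
    also have "(\<Sum>i=1..card J. \<bar>f (\<omega> (nb (h i))) - f (\<omega> (h i))\<bar> powr p / udiam (cube (h i) (R (h i) / 20)) powr (p - real CARD('n)))
        = (\<Sum>j\<in>J. \<bar>val (nb j) - val j\<bar> powr p / udiam (cube j (R j / 20)) powr (p - real CARD('n)))"
      unfolding val_def by (rule sum.reindex_bij_betw[OF h])
    also have "\<dots> = (\<Sum>j\<in>J. \<bar>val (nb j) - val j\<bar> powr p / (R j / 10) powr (p - real CARD('n)))"
    proof (rule sum.cong)
      fix j assume "j \<in> J"
      then have "R j > 0" using J I_pos by blast
      then have "udiam (cube j (R j / 20)) = R j / 10" using udiam_cube[of "R j / 20" j] by simp
      then show "\<bar>val (nb j) - val j\<bar> powr p / udiam (cube j (R j / 20)) powr (p - real CARD('n))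
          = \<bar>val (nb j) - val j\<bar> powr p / (R j / 10) powr (p - real CARD('n))"
        by (simp only:)
    qed simp
    finally show ?thesis .
  qed
  have tr: "has_trace \<alpha> \<Omega> ext f"
    unfolding has_trace_def
  proof (intro ballI)
    fix \<omega>0 y assume \<omega>0: "\<omega>0 \<in> alpha_boundary \<alpha> \<Omega>" and y: "y \<in> \<omega>0"
    note \<omega>0c = boundary_completion[OF \<omega>0]
    note yC = completion_Cauchy[OF \<omega>0c y]
    have y\<Omega>: "y k \<in> \<Omega>" for k by (rule rho_Cauchy_mem[OF yC])
    show "(\<lambda>k. ext (y k)) \<longlonglongrightarrow> f \<omega>0"
    proof (rule LIMSEQ_I)
      fix e :: real assume e: "e > 0"
      then have "e / 2 > 0" by simp
      then obtain \<delta> where \<delta>: "\<delta> > 0" "\<And>\<omega>'. \<omega>' \<in> alpha_boundary \<alpha> \<Omega> \<Longrightarrow> d_completion \<alpha> \<Omega> \<omega>0 \<omega>' < \<delta> \<Longrightarrow> \<bar>f \<omega>' - f \<omega>0\<bar> < e / 2"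
        using dc \<omega>0 unfolding d_continuous_def by meson
      \<comment> \<open>The metric distance from a point \<open>y k\<close> through a centre \<open>c\<close> around it to the points that represent
        \<open>\<omega> c\<close> is at most \<open>A * R (y k) powr \<alpha>\<close>, which tends to zero.\<close>
      define A where "A = (1 + access_const 20) * (9 / 8) powr \<alpha>"
      have "\<delta> / 3 > 0" using \<delta>(1) by simp
      then obtain M where M: "\<forall>i\<ge>M. \<forall>j\<ge>M. rho (y i) (y j) < \<delta> / 3" using yC unfolding rho_Cauchy_def by blast
      have "(\<lambda>k. A * R (y k) powr \<alpha>) \<longlonglongrightarrow> 0"
      proof -
        have "isCont R (ell \<omega>0)" using continuous_on_R[of UNIV] by (simp add: continuous_on_eq_continuous_at)
        then have "(\<lambda>k. R (y k)) \<longlonglongrightarrow> R (ell \<omega>0)" by (rule isCont_tendsto_compose[OF _ tendsto_ell[OF \<omega>0c y]])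
        moreover have "R (ell \<omega>0) = 0"
          using udist_le[OF ell_frontier[OF \<omega>0], of "ell \<omega>0"] R_nonneg[of "ell \<omega>0"] by (simp add: infnorm_0)
        ultimately have "(\<lambda>k. R (y k)) \<longlonglongrightarrow> 0" by simp
        then have "(\<lambda>k. R (y k) powr \<alpha>) \<longlonglongrightarrow> 0"
          by (rule tendsto_zero_powrI[OF _ tendsto_const]) (use \<alpha> in \<open>auto intro!: always_eventually simp: R_nonneg\<close>)
        then show ?thesis by (rule tendsto_mult_right_zero)
      qed
      then have "\<forall>\<^sub>F k in sequentially. A * R (y k) powr \<alpha> < \<delta> / 3" using \<delta>(1) by (intro order_tendstoD(2)) auto
      then obtain M' where M': "\<And>k. k \<ge> M' \<Longrightarrow> A * R (y k) powr \<alpha> < \<delta> / 3" by (auto simp: eventually_sequentially)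
      have "norm (ext (y k) - f \<omega>0) < e" if k: "k \<ge> max M M'" for k
      proof -
        have "\<bar>val c - f \<omega>0\<bar> \<le> e / 2" if c: "c \<in> idx (y k)" for c
        proof -
          have cI: "c \<in> I" "infnorm (y k - c) \<le> R c / 9" using c by (auto simp: idx_def)
          have c\<Omega>: "c \<in> \<Omega>" by (rule I_\<Omega>[OF cI(1)])
          have Rc: "R c > 0" by (rule I_pos[OF cI(1)])
          note \<omega>c = \<omega>[OF c\<Omega>]
          have d1: "d c (y k) \<le> R c powr \<alpha>"
          proof -
            have "d c (y k) \<le> 2 * R c powr (\<alpha> - 1) * infnorm (y k - c)"
              by (rule d_local(2)[OF c\<Omega>]) (use cI Rc in simp)
            also have "\<dots> \<le> 2 * R c powr (\<alpha> - 1) * (R c / 2)"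
              using cI Rc by (intro mult_left_mono) auto
            also have "\<dots> = R c * R c powr (\<alpha> - 1)" by simp
            also have "\<dots> = R c powr \<alpha>" using Rc by (subst powr_mult_base) auto
            finally show ?thesis .
          qed
          have vis: "visible \<Omega> (cube c (R c / 20)) (a c)"
            by (rule nearest_visible[OF c\<Omega> a]) (use Rc in \<open>simp add: infnorm_0\<close>)
          have d2: "d c (dyadic c (a c) m) \<le> access_const 20 * R c powr \<alpha>" for m
          proof -
            have "infnorm (a c - c) \<le> 20 * (R c / 20)" using a(2)[of c] infnorm_sub[of "a c" c] by simp
            from d_dyadic(2)[OF _ vis this, of 0 m]
            have "d c (dyadic c (a c) m) \<le> access_const 20 * (R c / 20) powr \<alpha>" using Rc by simp
            also have "\<dots> \<le> access_const 20 * R c powr \<alpha>"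
              using Rc \<alpha> by (intro mult_left_mono powr_mono2) (auto simp: access_const_def powr_less_one less_imp_le)
            finally show ?thesis .
          qed
          have Rcy: "R c \<le> 9 / 8 * R (y k)"
            using cI(2) R_Lipschitz[of "y k" c] by (simp add: abs_le_iff)
          have dm: "dyadic c (a c) m \<in> \<Omega>" for m
            by (rule rho_Cauchy_mem[OF completion_Cauchy[OF boundary_completion]]) (use \<omega>c in blast)+
          have "d (y m) (dyadic c (a c) m) \<le> 2 * \<delta> / 3" if m: "m \<ge> M" for m
          proof -
            have "d (y m) (dyadic c (a c) m) \<le> d (y m) (y k) + (d c (y k) + d c (dyadic c (a c) m))"
              using d_triangle[OF y\<Omega>[of m] y\<Omega>[of k] dm[of m]] d_triangle[OF y\<Omega>[of k] c\<Omega> dm[of m]] d_sym[OF y\<Omega>[of k] c\<Omega>] by simp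
            also have "d (y m) (y k) \<le> \<delta> / 3" using M m k d_le_rho[of "y m" "y k"] by fastforce
            also have "d c (y k) + d c (dyadic c (a c) m) \<le> (1 + access_const 20) * R c powr \<alpha>"
              using d1 d2[of m] by (simp add: algebra_simps)
            also have "\<dots> \<le> (1 + access_const 20) * ((9 / 8) powr \<alpha> * R (y k) powr \<alpha>)"
              unfolding powr_mult[symmetric]
              using Rcy Rc \<alpha> by (intro mult_left_mono powr_mono2) (auto simp: access_const_def powr_less_one less_imp_le)
            also have "\<dots> = A * R (y k) powr \<alpha>" by (simp add: A_def)
            also have "\<dots> \<le> \<delta> / 3" using M'[of k] k by simp
            finally show ?thesis by simp
          qed
          then have "d_completion \<alpha> \<Omega> \<omega>0 (\<omega> c) \<le> 2 * \<delta> / 3"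
            using tendsto_d_completion[OF \<omega>0c boundary_completion y, of "\<omega> c" "dyadic c (a c)"] \<omega>c
            by (intro LIMSEQ_le_const2[where X = "\<lambda>m. d (y m) (dyadic c (a c) m)"]) auto
          also have "\<dots> < \<delta>" using \<delta>(1) by simp
          finally have "d_completion \<alpha> \<Omega> \<omega>0 (\<omega> c) < \<delta>" .
          then show ?thesis using \<delta>(2)[of "\<omega> c"] \<omega>c by (simp add: val_def less_imp_le)
        qed
        then have "\<bar>ext (y k) - f \<omega>0\<bar> \<le> e / 2" by (rule ext_close[OF y\<Omega>])
        then show ?thesis using e by simp
      qed
      then show "\<exists>no. \<forall>n\<ge>no. norm (ext (y n) - f \<omega>0) < e" by blast
    qed
  qed
  show ?thesis
    by (rule that[OF ext_continuous tr ext_weak_gradient ext_energy[OF p nb(2) sum_le]])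
qed

text \<open>For the estimate of the trace norm from above \<open>C\<close> has to dominate \<open>grad_const\<close>, for the estimate from
  below the \<open>p\<close>-th root of \<open>visible_const\<close>.\<close>

lemma criterion:
  assumes \<eta>: "\<eta> \<ge> 41"
    and C: "C \<ge> 1" "visible_const TYPE('n) p ((p - real CARD('n)) / 2) \<eta> powr (1 / p) \<le> C" "grad_const TYPE('n) \<le> C"
  shows "(\<exists>F \<in> L1p p \<Omega>. continuous_on \<Omega> F \<and> has_trace \<alpha> \<Omega> F f) \<longleftrightarrow>
      d_continuous \<alpha> \<Omega> f \<and> (\<exists>L>0. visible_bound p \<alpha> \<eta> \<Omega> f L)" (is "?E \<longleftrightarrow> ?V")
    and "\<exists>F \<in> L1p p \<Omega>. continuous_on \<Omega> F \<and> has_trace \<alpha> \<Omega> F f \<Longrightarrow>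
      trace_norm p \<alpha> \<Omega> f / C \<le> Inf {L powr (1 / p) | L. L > 0 \<and> visible_bound p \<alpha> \<eta> \<Omega> f L} \<and>
      Inf {L powr (1 / p) | L. L > 0 \<and> visible_bound p \<alpha> \<eta> \<Omega> f L} \<le> C * trace_norm p \<alpha> \<Omega> f"
proof -
  let ?K = "visible_const TYPE('n) p ((p - real CARD('n)) / 2) \<eta>"
  let ?A = "{L powr (1 / p) | L. L > 0 \<and> visible_bound p \<alpha> \<eta> \<Omega> f L}"
  have K0: "?K \<ge> 0" using visible_const_nonneg[of "(p - real CARD('n)) / 2" \<eta> p] p \<eta> by simp
  have nec: "\<exists>G :: real ^ 'n \<Rightarrow> real ^ 'n. d_continuous \<alpha> \<Omega> f \<and> visible_bound p \<alpha> \<eta> \<Omega> f (?K * (LINT z:\<Omega>|lebesgue. infnorm (G z) powr p))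
      \<and> L1p_norm p \<Omega> F = (LINT z:\<Omega>|lebesgue. infnorm (G z) powr p) powr (1 / p)"
    if F: "F \<in> L1p p \<Omega>" "continuous_on \<Omega> F" "has_trace \<alpha> \<Omega> F f" for F
  proof -
    obtain G where G: "weak_gradient \<Omega> F G" "set_integrable lebesgue \<Omega> (\<lambda>x. infnorm (G x) powr p)"
      using F(1) unfolding L1p_def by blast
    have "\<eta> \<ge> 1" using \<eta> by simp
    show ?thesis
      by (intro exI[of _ G] conjI trace_d_continuous[OF F(2,3) G] trace_visible_bound[OF F(2,3) G \<open>\<eta> \<ge> 1\<close>] L1p_norm_eq[OF G])
  qed
  have mono: "visible_bound p \<alpha> \<eta> \<Omega> f L'" if "visible_bound p \<alpha> \<eta> \<Omega> f L" "L \<le> L'" for L L'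
    unfolding visible_bound_def
  proof (intro allI impI)
    fix m :: nat and c r x y
    assume "(\<forall>i\<in>{1..m}. r i > 0 \<and> cube (c i) (r i) \<subseteq> \<Omega>) \<and> disjoint_family_on (\<lambda>i. cube (c i) (r i)) {1..m} \<and>
        (\<forall>i\<in>{1..m}. \<forall>\<omega> \<in> {x i, y i}. \<omega> \<in> alpha_boundary \<alpha> \<Omega> \<and> ell \<omega> \<in> cube (c i) (\<eta> * r i) \<and>
          visible \<Omega> (cube (c i) (r i)) (ell \<omega>))"
    from that(1)[unfolded visible_bound_def, THEN spec, THEN spec, THEN spec, THEN spec, THEN spec, THEN mp, OF this] that(2)
    show "(\<Sum>i=1..m. \<bar>f (x i) - f (y i)\<bar> powr p / udiam (cube (c i) (r i)) powr (p - real CARD('n))) \<le> L'"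
      by (rule order_trans)
  qed
  have I0: "(LINT z:\<Omega>|lebesgue. infnorm (G z) powr p) \<ge> 0" for G :: "real ^ 'n \<Rightarrow> real ^ 'n"
    by (rule set_integral_nonneg_powr)
  have suff: "\<exists>F \<in> trace_extensions p \<alpha> \<Omega> f. L1p_norm p \<Omega> F \<le> C * L powr (1 / p)"
    if L: "d_continuous \<alpha> \<Omega> f" "visible_bound p \<alpha> \<eta> \<Omega> f L" "L > 0" for L
  proof -
    obtain F G where F: "continuous_on \<Omega> F" "has_trace \<alpha> \<Omega> F f" and G: "weak_gradient \<Omega> F G"
      "set_integrable lebesgue \<Omega> (\<lambda>x. infnorm (G x) powr p)"
      "(LINT x:\<Omega>|lebesgue. infnorm (G x) powr p) \<le> grad_const TYPE('n) powr p * L"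
      by (rule extension[OF L(1,2) \<eta>])
    have "L1p_norm p \<Omega> F \<le> (grad_const TYPE('n) powr p * L) powr (1 / p)"
      unfolding L1p_norm_eq[OF G(1,2)] using I0 G(3) p_gt_1 by (intro powr_mono2) auto
    also have "\<dots> = grad_const TYPE('n) * L powr (1 / p)"
      unfolding powr_mult powr_powr using p_gt_1 grad_const_nonneg[where 'n = 'n] by simp
    also have "\<dots> \<le> C * L powr (1 / p)" using C(3) by (intro mult_right_mono) auto
    finally have "L1p_norm p \<Omega> F \<le> C * L powr (1 / p)" .
    moreover have "F \<in> trace_extensions p \<alpha> \<Omega> f"
      using F G(1,2) unfolding trace_extensions_def L1p_def by blast
    ultimately show ?thesis by blast
  qed
  show eqv: "?E \<longleftrightarrow> ?V"
  proof
    assume ?E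
    then obtain F where "F \<in> L1p p \<Omega>" "continuous_on \<Omega> F" "has_trace \<alpha> \<Omega> F f" by blast
    from nec[OF this] obtain G :: "real ^ 'n \<Rightarrow> real ^ 'n" where G: "d_continuous \<alpha> \<Omega> f"
      "visible_bound p \<alpha> \<eta> \<Omega> f (?K * (LINT z:\<Omega>|lebesgue. infnorm (G z) powr p))" by blast
    have "visible_bound p \<alpha> \<eta> \<Omega> f (?K * (LINT z:\<Omega>|lebesgue. infnorm (G z) powr p) + 1)"
      by (rule mono[OF G(2)]) simp
    moreover have "?K * (LINT z:\<Omega>|lebesgue. infnorm (G z) powr p) + 1 > 0"
      using K0 I0 by (simp add: add_nonneg_pos)
    ultimately show ?V using G(1) by blast
  next
    assume ?V
    then obtain F where "F \<in> trace_extensions p \<alpha> \<Omega> f" using suff by blast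
    then show ?E unfolding trace_extensions_def by blast
  qed
  assume E: ?E
  then have V: ?V using eqv by blast
  have A0: "t \<ge> 0" if "t \<in> ?A" for t using that by auto
  have bdd: "bdd_below ?A" by (rule bdd_belowI[of _ 0]) (rule A0)
  have ne: "?A \<noteq> {}" using V by blast
  have lower: "trace_norm p \<alpha> \<Omega> f / C \<le> Inf ?A"
  proof (rule cInf_greatest[OF ne])
    fix t assume "t \<in> ?A"
    then obtain L where L: "t = L powr (1 / p)" "L > 0" "visible_bound p \<alpha> \<eta> \<Omega> f L" by blast
    obtain F where F: "F \<in> trace_extensions p \<alpha> \<Omega> f" "L1p_norm p \<Omega> F \<le> C * t"
      using suff[OF _ L(3,2)] V L(1) by blast
    have "trace_norm p \<alpha> \<Omega> f \<le> C * t" using trace_norm_le[OF F(1)] F(2) by simp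
    then show "trace_norm p \<alpha> \<Omega> f / C \<le> t" using C(1) by (simp add: pos_divide_le_eq mult.commute)
  qed
  have one: "Inf ?A / C \<le> L1p_norm p \<Omega> F" if F: "F \<in> trace_extensions p \<alpha> \<Omega> f" for F
  proof -
    have "F \<in> L1p p \<Omega>" "continuous_on \<Omega> F" "has_trace \<alpha> \<Omega> F f" using F by (auto simp: trace_extensions_def)
    from nec[OF this] obtain G :: "real ^ 'n \<Rightarrow> real ^ 'n" where G: "visible_bound p \<alpha> \<eta> \<Omega> f (?K * (LINT z:\<Omega>|lebesgue. infnorm (G z) powr p))"
      "L1p_norm p \<Omega> F = (LINT z:\<Omega>|lebesgue. infnorm (G z) powr p) powr (1 / p)" by blast
    define T where "T = ?K * (LINT z:\<Omega>|lebesgue. infnorm (G z) powr p)"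
    have T0: "T \<ge> 0" unfolding T_def by (intro mult_nonneg_nonneg K0 I0)
    \<comment> \<open>The bound \<open>T\<close> itself may be zero, whereas admissible bounds are positive.\<close>
    have "Inf ?A \<le> (T + 1 / real (Suc k)) powr (1 / p)" for k
    proof (rule cInf_lower[OF _ bdd])
      have "visible_bound p \<alpha> \<eta> \<Omega> f (T + 1 / real (Suc k))" by (rule mono[OF G(1)]) (simp add: T_def)
      moreover have "T + 1 / real (Suc k) > 0" using T0 by (simp add: add_nonneg_pos)
      ultimately show "(T + 1 / real (Suc k)) powr (1 / p) \<in> ?A" by blast
    qed
    moreover have "(\<lambda>k. (T + 1 / real (Suc k)) powr (1 / p)) \<longlonglongrightarrow> (T + 0) powr (1 / p)"
    proof (rule tendsto_powr')
      show "(\<lambda>k. T + 1 / real (Suc k)) \<longlonglongrightarrow> T + 0"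
        using LIMSEQ_inverse_real_of_nat by (intro tendsto_add tendsto_const) (simp add: inverse_eq_divide)
      show "T + 0 \<noteq> 0 \<or> 0 < 1 / p \<and> (\<forall>\<^sub>F k in sequentially. 0 \<le> T + 1 / real (Suc k))"
        using T0 p_gt_1 by (auto intro!: always_eventually)
    qed (rule tendsto_const)
    ultimately have "Inf ?A \<le> (T + 0) powr (1 / p)" by (intro LIMSEQ_le_const) auto
    also have "\<dots> = ?K powr (1 / p) * L1p_norm p \<Omega> F" unfolding G(2) T_def by (simp add: powr_mult)
    also have "\<dots> \<le> C * L1p_norm p \<Omega> F" by (intro mult_right_mono C L1p_norm_nonneg)
    finally show ?thesis using C(1) by (simp add: pos_divide_le_eq mult.commute)
  qed
  have "Inf ?A / C \<le> trace_norm p \<alpha> \<Omega> f"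
    unfolding trace_norm_def
  proof (rule cINF_greatest)
    show "trace_extensions p \<alpha> \<Omega> f \<noteq> {}" using E by (auto simp: trace_extensions_def)
  qed (rule one)
  then have "Inf ?A \<le> C * trace_norm p \<alpha> \<Omega> f" using C(1) by (simp add: pos_divide_le_eq mult.commute)
  with lower show "trace_norm p \<alpha> \<Omega> f / C \<le> Inf ?A \<and> Inf ?A \<le> C * trace_norm p \<alpha> \<Omega> f" ..
qed

end

theorem theorem1p8:
  fixes p \<alpha> \<eta> :: real
  assumes "real CARD('n::finite) < p"
    and "\<alpha> = (p - real CARD('n)) / (p - 1)"
    and "\<eta> \<ge> 41"
  shows "\<exists>C\<ge>1. \<forall>(\<Omega> :: (real ^ 'n) set) (f :: (nat \<Rightarrow> real ^ 'n) set \<Rightarrow> real).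
    open \<Omega> \<and> connected \<Omega> \<and> \<Omega> \<noteq> {} \<and> \<Omega> \<noteq> UNIV \<and> condition_A \<alpha> \<Omega> \<longrightarrow>
      ((\<exists>F \<in> L1p p \<Omega>. continuous_on \<Omega> F \<and> has_trace \<alpha> \<Omega> F f) \<longleftrightarrow>
         d_continuous \<alpha> \<Omega> f \<and> (\<exists>L>0. visible_bound p \<alpha> \<eta> \<Omega> f L)) \<and>
      ((\<exists>F \<in> L1p p \<Omega>. continuous_on \<Omega> F \<and> has_trace \<alpha> \<Omega> F f) \<longrightarrow>
         trace_norm p \<alpha> \<Omega> f / C \<le> Inf {L powr (1 / p) | L. L > 0 \<and> visible_bound p \<alpha> \<eta> \<Omega> f L} \<and>
         Inf {L powr (1 / p) | L. L > 0 \<and> visible_bound p \<alpha> \<eta> \<Omega> f L} \<le> C * trace_norm p \<alpha> \<Omega> f)"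
proof -
  define C where "C = max 1 (max (visible_const TYPE('n) p ((p - real CARD('n)) / 2) \<eta> powr (1 / p)) (grad_const TYPE('n)))"
  have C: "C \<ge> 1" "visible_const TYPE('n) p ((p - real CARD('n)) / 2) \<eta> powr (1 / p) \<le> C" "grad_const TYPE('n) \<le> C"
    by (auto simp: C_def)
  have "real CARD('n) \<ge> 1" using zero_less_card_finite[where 'a = 'n] by linarith
  then have p1: "p > 1" "p - real CARD('n) \<le> p - 1" using assms(1) by linarith+
  have "0 < \<alpha>" unfolding assms(2) by (intro divide_pos_pos) (use assms(1) p1 in linarith)+
  moreover have "\<alpha> \<le> 1" unfolding assms(2) using p1 by (simp only: pos_divide_le_eq mult_1 diff_gt_0_iff_gt)
  ultimately have \<alpha>: "0 < \<alpha>" "\<alpha> \<le> 1" by blast+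
  show ?thesis
  proof (intro exI[of _ C] conjI allI impI C(1))
    fix \<Omega> :: "(real ^ 'n) set" and f :: "(nat \<Rightarrow> real ^ 'n) set \<Rightarrow> real"
    assume *: "open \<Omega> \<and> connected \<Omega> \<and> \<Omega> \<noteq> {} \<and> \<Omega> \<noteq> UNIV \<and> condition_A \<alpha> \<Omega>"
    interpret trace_domain \<Omega> \<alpha> p
      by unfold_locales (use * \<alpha> assms in auto)
    note crit = criterion[OF assms(3) C, of f]
    show "(\<exists>F \<in> L1p p \<Omega>. continuous_on \<Omega> F \<and> has_trace \<alpha> \<Omega> F f) \<longleftrightarrow>
         d_continuous \<alpha> \<Omega> f \<and> (\<exists>L>0. visible_bound p \<alpha> \<eta> \<Omega> f L)" by (rule crit(1))
    assume E: "\<exists>F \<in> L1p p \<Omega>. continuous_on \<Omega> F \<and> has_trace \<alpha> \<Omega> F f"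
    from crit(2)[OF E] show "trace_norm p \<alpha> \<Omega> f / C \<le> Inf {L powr (1 / p) | L. L > 0 \<and> visible_bound p \<alpha> \<eta> \<Omega> f L}"
      and "Inf {L powr (1 / p) | L. L > 0 \<and> visible_bound p \<alpha> \<eta> \<Omega> f L} \<le> C * trace_norm p \<alpha> \<Omega> f" by auto
  qed
qed

end
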